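(* Let $\Phi:\mathcal H\to\mathbb R\cup\{+\infty\}$ be convex, lower semicontinuous, with nonempty effective domain and bounded from below; let $\Psi:\mathcal H\to\mathcal H$ be Lipschitz continuous with constant $\mathfrak L>0$; let $u_0\in D(\Phi)$, $f\in L^2_\alpha(0,T;\mathcal H)$, and let $u$ be the unique energy solution of $$D_c^\alpha u(t)+\partial\Phi(u(t))+\Psi(u(t))\ni f(t),\quad t\in(0,T],\qquad u(0)=u_0.$$ Let $\mathcal P$ be a partition of $[0,T]$ whose maximal step size $\tau$ satisfies $\mathfrak L\tau^\alpha<\Gamma(\alpha+1)$, and let $\mathbf U$ be the discrete solution of the perturbed problem on $\mathcal P$ starting from $U_0\in D(\Phi)$. Let $$\mathcal E_{\mathcal P,\mathfrak L}(t)=\langle D_c^\alpha\widehat U_{\mathcal P}(t)+\Psi(\overline U_{\mathcal P}(t))-\overline F_{\mathcal P}(t),\widehat U_{\mathcal P}(t)-\overline U_{\mathcal P}(t)\rangle+\Phi(\widehat U_{\mathcal P}(t))-\Phi(\overline U_{\mathcal P}(t)),$$ and $E=\big(\sup_{t\in[0,T]}\{E_{\mathcal H}^2(t)+E_\sigma^2(t)\}\big)^{1/2}$, where $E_{\mathcal H}(t)=\|u(t)-\widehat U_{\mathcal P}(t)\|$ and $$E_\sigma(t)=\Big(\frac2{\Gamma(\alpha)}\int_0^t(t-s)^{\alpha-1}\big[\sigma(u(s);\widehat U_{\mathcal P}(s))+\sigma(\overline U_{\mathcal P}(s);u(s))\big]ds\Big)^{1/2}.$$ Then $$E\le\Big(\|u_0-U_0\|^2+\frac2{\Gamma(\alpha)}\|\mathcal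 E_{\mathcal P,\mathfrak L}\|_{L^1_\alpha(0,T;\mathbb R)}\Big)^{1/2}\big(E_\alpha(2\mathfrak LT^\alpha)\big)^{1/2}+\frac2{\Gamma(\alpha)}\Big(\|f-\overline F_{\mathcal P}\|_{L^1_\alpha(0,T;\mathcal H)}+\mathfrak L\|\overline U_{\mathcal P}-\widehat U_{\mathcal P}\|_{L^1_\alpha(0,T;\mathcal H)}\Big)E_\alpha(2\mathfrak LT^\alpha),$$ where $E_\alpha$ is the Mittag-Leffler function.
   Context: Setting: $T\in(0,\infty)$, $\alpha\in(0,1)$, $\mathcal H$ is a separable real Hilbert space. $E_\alpha(z)=\sum_{k=0}^\infty z^k/\Gamma(\alpha k+1)$. $D(\Phi)=\{w\in\mathcal H:\Phi(w)<+\infty\}$, $\partial\Phi(w)=\{\xi:\langle\xi,v-w\rangle\le\Phi(v)-\Phi(w)\ \forall v\in\mathcal H\}$, $D(\partial\Phi)=\{w:\partial\Phi(w)\ne\emptyset\}$. Coercivity modulus: for $w_1\in D(\partial\Phi)$ and $w_2\in D(\Phi)$, $\sigma(w_1;w_2)=\Phi(w_2)-\Phi(w_1)-\sup_{\xi\in\partial\Phi(w_1)}\langle\xi,w_2-w_1\rangle\ge0$. For a normed space $X$, $\|w\|_{L^p_\alpha(0,T;X)}=\sup_{t\in[0,T]}\big(\int_0^t(t-s)^{\alpha-1}\|w(s)\|_X^p\,ds\big)^{1/p}$, and $L^p_\alpha(0,T;X)$ is the space of (strongly measurable) functions for which this is finite. Generalized Caputo derivative: for $w\in L^1_{loc}([0,T);\mathcal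 H)$ with initial value $w_0$, $D_c^\alpha w$ is the distributional derivative on $(-\infty,T)$ of the function equal to $\frac1{\Gamma(1-\alpha)}\int_0^t(t-s)^{-\alpha}(w(s)-w_0)\,ds$ for $t\ge0$ and $0$ for $t<0$; if $\lim_{t\downarrow0}\frac1t\int_0^t\|w(s)-w(0)\|ds=0$ for some $w(0)\in\mathcal H$, then $w_0=w(0)$. Energy solution of the perturbed problem: $u\in L^2(0,T;\mathcal H)$ with $\lim_{t\downarrow0}\frac1t\int_0^t\|u(s)-u_0\|^2ds=0$, $D_c^\alpha u\in L^2(0,T;\mathcal H)$, and $D_c^\alpha u(t)+\partial\Phi(u(t))+\Psi(u(t))\ni f(t)$ for a.e. $t\in(0,T)$ (it exists and is unique). Discretization: $\mathcal P=\{0=t_0<t_1<\dots<t_N=T\}$, $\tau_n=t_n-t_{n-1}$, $\tau=\max_n\tau_n$; for $t\in(t_{n-1},t_n]$ put $n(t)=n$. $\mathbf K_{\mathcal P}\in\mathbb R^{N\times N}$ is the (invertible) lower triangular matrix with $\mathbf K_{\mathcal P,ni}=\frac1{\Gamma(\alpha+1)}\big((t_n-t_{i-1})^\alpha-(t_n-t_i)^\alpha\big)$ for $1\le i\le n\le N$ and $0$ for $i>n$. The discrete Caputo derivative of $(W_0,\dots,W_N)$ is $(D^\alpha_{\mathcal P}\mathbf W)_n=\sum_{i=1}^n\mathbf K^{-1}_{\mathcal P,ni}(W_i-W_0)$, where $\mathbf K^{-1}_{\mathcal P,ni}$ are the entries of $\mathbf K_{\mathcal P}^{-1}$. With $F_n=\frac1{\tau_n}\int_{t_{n-1}}^{t_n}f(t)\,dt$,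 the discrete solution $\mathbf U=(U_n)_{n=0}^N$ starting from $U_0$ is defined recursively by $F_n-(D^\alpha_{\mathcal P}\mathbf U)_n-\Psi(U_n)\in\partial\Phi(U_n)$, $n=1,\dots,N$ (well defined when $\mathfrak L\tau^\alpha<\Gamma(\alpha+1)$). Interpolants: $\overline U_{\mathcal P}(t)=U_{n(t)}$, $\overline F_{\mathcal P}(t)=F_{n(t)}$, and $\widehat U_{\mathcal P}(t)=U_0+\frac1{\Gamma(\alpha)}\int_0^t(t-s)^{\alpha-1}(D^\alpha_{\mathcal P}\mathbf U)_{n(s)}\,ds$, so that $D_c^\alpha\widehat U_{\mathcal P}(t)=(D^\alpha_{\mathcal P}\mathbf U)_{n(t)}$. *)

theory Defs
  imports "HOL-Analysis.Analysis" "Jordan_Normal_Form.Gauss_Jordan_Elimination"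
begin

definition eff_dom :: "('h \<Rightarrow> ereal) \<Rightarrow> 'h set" where
  "eff_dom \<Phi> = {w. \<Phi> w < \<infinity>}"

definition convex_ereal :: "('h::real_vector \<Rightarrow> ereal) \<Rightarrow> bool" where
  "convex_ereal \<Phi> \<longleftrightarrow> (\<forall>x y. \<forall>r\<in>{0..1}.
     \<Phi> ((1 - r) *\<^sub>R x + r *\<^sub>R y) \<le> ereal (1 - r) * \<Phi> x + ereal r * \<Phi> y)"

definition lower_semicontinuous :: "('h::topological_space \<Rightarrow> ereal) \<Rightarrow> bool" where
  "lower_semicontinuous \<Phi> \<longleftrightarrow> (\<forall>x. \<Phi> x \<le> Liminf (at x) \<Phi>)"

definition bounded_from_below :: "('h \<Rightarrow> ereal) \<Rightarrow> bool" where
  "bounded_from_below \<Phi> \<longleftrightarrow> (\<exists>c::real. \<forall>w. ereal c \<le> \<Phi> w)"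

definition subdiff :: "('h::real_inner \<Rightarrow> ereal) \<Rightarrow> 'h \<Rightarrow> 'h set" where
  "subdiff \<Phi> w = {\<xi>. \<forall>v. ereal (inner \<xi> (v - w)) \<le> \<Phi> v - \<Phi> w}"

text \<open>The coercivity modulus \<open>\<sigma>(w\<^sub>1; w\<^sub>2)\<close>, meaningful for \<open>w\<^sub>1\<close> in the domain of the
  subdifferential and \<open>w\<^sub>2\<close> in the effective domain.\<close>

definition coercivity_modulus :: "('h::real_inner \<Rightarrow> ereal) \<Rightarrow> 'h \<Rightarrow> 'h \<Rightarrow> ereal" where
  "coercivity_modulus \<Phi> w1 w2 =
     \<Phi> w2 - \<Phi> w1 - (SUP \<xi>\<in>subdiff \<Phi> w1. ereal (inner \<xi> (w2 - w1)))"

definition mittag_leffler :: "real \<Rightarrow> real \<Rightarrow> real" where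
  "mittag_leffler \<alpha> z = (\<Sum>k. z ^ k / Gamma (\<alpha> * real k + 1))"

text \<open>Real powers on the extended nonnegative reals, for positive exponents only.\<close>

definition ennpowr :: "ennreal \<Rightarrow> real \<Rightarrow> ennreal" where
  "ennpowr x p = (if x = \<infinity> then \<infinity> else ennreal (enn2real x powr p))"

text \<open>The weighted norm is a function of the pointwise norm \<open>m\<close> of its argument, so that it
  also makes sense for extended real-valued functions; it is \<open>\<infinity>\<close> when the supremum diverges.\<close>

definition Lp_frac_enorm :: "real \<Rightarrow> real \<Rightarrow> real \<Rightarrow> (real \<Rightarrow> ennreal) \<Rightarrow> ennreal" where
  "Lp_frac_enorm \<alpha> T p m = (SUP t\<in>{0..T}. ennpowr
     (\<integral>\<^sup>+ s\<in>{0..t}. (ennreal ((t - s) powr (\<alpha> - 1)) * ennpowr (m s) p) \<partial>lebesgue) (1 / p))"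

definition Lp_frac_norm ::
    "real \<Rightarrow> real \<Rightarrow> real \<Rightarrow> (real \<Rightarrow> 'h::real_normed_vector) \<Rightarrow> ennreal" where
  "Lp_frac_norm \<alpha> T p w = Lp_frac_enorm \<alpha> T p (\<lambda>s. ennreal (norm (w s)))"

definition Lp_frac ::
    "real \<Rightarrow> real \<Rightarrow> real \<Rightarrow> (real \<Rightarrow> 'h::{banach, second_countable_topology}) set" where
  "Lp_frac \<alpha> T p =
     {w. set_borel_measurable lebesgue {0<..<T} w \<and> Lp_frac_norm \<alpha> T p w < \<infinity>}"

definition L2_Bochner :: "real \<Rightarrow> (real \<Rightarrow> 'h::{banach, second_countable_topology}) set" where
  "L2_Bochner T = {w. set_borel_measurable lebesgue {0<..<T} w \<and>
     set_integrable lebesgue {0<..<T} (\<lambda>t. (norm (w t))\<^sup>2)}"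

definition test_functions :: "real \<Rightarrow> (real \<Rightarrow> real) set" where
  "test_functions T = {\<phi>. (\<forall>k x. (deriv ^^ k) \<phi> differentiable (at x)) \<and>
     (\<exists>a b. b < T \<and> (\<forall>x. x \<notin> {a..b} \<longrightarrow> \<phi> x = 0))}"

text \<open>The distributional derivative of \<open>G\<close> on \<open>(-\<infinity>, T)\<close> is the regular distribution given
  by the locally integrable function \<open>g\<close>.\<close>

definition has_distributional_deriv ::
    "real \<Rightarrow> (real \<Rightarrow> 'h::{banach, second_countable_topology}) \<Rightarrow> (real \<Rightarrow> 'h) \<Rightarrow> bool" where
  "has_distributional_deriv T G g \<longleftrightarrow>
     (\<forall>a b. b < T \<longrightarrow> set_integrable lebesgue {a..b} G \<and> set_integrable lebesgue {a..b} g) \<and>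
     (\<forall>\<phi>\<in>test_functions T.
        (LINT t:{..<T}|lebesgue. deriv \<phi> t *\<^sub>R G t) = - (LINT t:{..<T}|lebesgue. \<phi> t *\<^sub>R g t))"

definition caputo_primitive ::
    "real \<Rightarrow> (real \<Rightarrow> 'h::{banach, second_countable_topology}) \<Rightarrow> 'h \<Rightarrow> real \<Rightarrow> 'h" where
  "caputo_primitive \<alpha> w w0 t = (if t < 0 then 0 else
     (1 / Gamma (1 - \<alpha>)) *\<^sub>R (LINT s:{0..t}|lebesgue. (t - s) powr (- \<alpha>) *\<^sub>R (w s - w0)))"

text \<open>The distribution always vanishes on \<open>(-\<infinity>, 0)\<close>, so only the values of \<open>g\<close> on \<open>(0, T)\<close>
  matter. The test functions do not have to vanish near \<open>0\<close>, which excludes a singular part there.\<close>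

definition has_caputo_deriv ::
    "real \<Rightarrow> real \<Rightarrow> (real \<Rightarrow> 'h::{banach, second_countable_topology}) \<Rightarrow> 'h \<Rightarrow> (real \<Rightarrow> 'h) \<Rightarrow> bool"
  where
  "has_caputo_deriv \<alpha> T w w0 g \<longleftrightarrow>
     (\<forall>c<T. set_integrable lebesgue {0..c} w) \<and>
     has_distributional_deriv T (caputo_primitive \<alpha> w w0) (\<lambda>t. if t < 0 then 0 else g t)"

text \<open>A representative, unique up to null sets in \<open>(0, T)\<close>.\<close>

definition caputo_deriv ::
    "real \<Rightarrow> real \<Rightarrow> (real \<Rightarrow> 'h::{banach, second_countable_topology}) \<Rightarrow> 'h \<Rightarrow> real \<Rightarrow> 'h" where
  "caputo_deriv \<alpha> T w w0 = (SOME g. has_caputo_deriv \<alpha> T w w0 g)"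

text \<open>Invariant under changes of \<open>u\<close> on null sets. Pointwise quantities such as the error below
  refer to the continuous representative of \<open>u\<close> on \<open>[0, T]\<close>.\<close>

definition energy_solution ::
    "real \<Rightarrow> real \<Rightarrow> ('h::{real_inner, banach, second_countable_topology} \<Rightarrow> ereal) \<Rightarrow> ('h \<Rightarrow> 'h) \<Rightarrow>
     (real \<Rightarrow> 'h) \<Rightarrow> 'h \<Rightarrow> (real \<Rightarrow> 'h) \<Rightarrow> bool" where
  "energy_solution \<alpha> T \<Phi> \<Psi> f u0 u \<longleftrightarrow>
     u \<in> L2_Bochner T \<and>
     ((\<lambda>t. (1 / t) * (LINT s:{0..t}|lebesgue. (norm (u s - u0))\<^sup>2)) \<longlongrightarrow> 0) (at_right 0) \<and>
     (\<exists>g. has_caputo_deriv \<alpha> T u u0 g \<and> g \<in> L2_Bochner T \<and>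
        (AE t in lebesgue. t \<in> {0<..<T} \<longrightarrow>
           (\<exists>\<xi>\<in>subdiff \<Phi> (u t). g t + \<xi> + \<Psi> (u t) = f t)))"

definition is_partition :: "real \<Rightarrow> nat \<Rightarrow> (nat \<Rightarrow> real) \<Rightarrow> bool" where
  "is_partition T N P \<longleftrightarrow> P 0 = 0 \<and> P N = T \<and> (\<forall>n<N. P n < P (Suc n))"

definition max_step :: "nat \<Rightarrow> (nat \<Rightarrow> real) \<Rightarrow> real" where
  "max_step N P = Max ((\<lambda>n. P n - P (n - 1)) ` {1..N})"

text \<open>The index \<open>n(t)\<close>, specified for \<open>t \<in> (0, T]\<close> only.\<close>

definition part_index :: "nat \<Rightarrow> (nat \<Rightarrow> real) \<Rightarrow> real \<Rightarrow> nat" where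
  "part_index N P t = (THE n. n \<in> {1..N} \<and> P (n - 1) < t \<and> t \<le> P n)"

text \<open>Matrix indices start at \<open>0\<close>: the entry \<open>(n, i)\<close> of the mathematical matrix, with
  \<open>1 \<le> n, i \<le> N\<close>, is the entry \<open>(n - 1, i - 1)\<close> here.\<close>

definition K_matrix :: "real \<Rightarrow> nat \<Rightarrow> (nat \<Rightarrow> real) \<Rightarrow> real mat" where
  "K_matrix \<alpha> N P = mat N N (\<lambda>(n, i). if i \<le> n
     then ((P (Suc n) - P i) powr \<alpha> - (P (Suc n) - P (Suc i)) powr \<alpha>) / Gamma (\<alpha> + 1)
     else 0)"

definition discrete_caputo ::
    "real \<Rightarrow> nat \<Rightarrow> (nat \<Rightarrow> real) \<Rightarrow> (nat \<Rightarrow> 'h::real_vector) \<Rightarrow> nat \<Rightarrow> 'h" where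
  "discrete_caputo \<alpha> N P W n =
     (\<Sum>i=1..n. (the (mat_inverse (K_matrix \<alpha> N P)) $$ (n - 1, i - 1)) *\<^sub>R (W i - W 0))"

definition cell_average ::
    "(nat \<Rightarrow> real) \<Rightarrow> (real \<Rightarrow> 'h::{banach, second_countable_topology}) \<Rightarrow> nat \<Rightarrow> 'h" where
  "cell_average P f n = (1 / (P n - P (n - 1))) *\<^sub>R (LINT t:{P (n - 1)..P n}|lebesgue. f t)"

definition discrete_solution ::
    "real \<Rightarrow> nat \<Rightarrow> (nat \<Rightarrow> real) \<Rightarrow> ('h::{real_inner, banach, second_countable_topology} \<Rightarrow> ereal) \<Rightarrow>
     ('h \<Rightarrow> 'h) \<Rightarrow> (real \<Rightarrow> 'h) \<Rightarrow> 'h \<Rightarrow> (nat \<Rightarrow> 'h) \<Rightarrow> bool" where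
  "discrete_solution \<alpha> N P \<Phi> \<Psi> f U0 U \<longleftrightarrow> U 0 = U0 \<and>
     (\<forall>n\<in>{1..N}.
        cell_average P f n - discrete_caputo \<alpha> N P U n - \<Psi> (U n) \<in> subdiff \<Phi> (U n))"

definition pc_interpolant :: "nat \<Rightarrow> (nat \<Rightarrow> real) \<Rightarrow> (nat \<Rightarrow> 'h) \<Rightarrow> real \<Rightarrow> 'h" where
  "pc_interpolant N P W t = W (part_index N P t)"

definition frac_interpolant ::
    "real \<Rightarrow> nat \<Rightarrow> (nat \<Rightarrow> real) \<Rightarrow> (nat \<Rightarrow> 'h::{banach, second_countable_topology}) \<Rightarrow> real \<Rightarrow> 'h"
  where
  "frac_interpolant \<alpha> N P W t = W 0 + (1 / Gamma \<alpha>) *\<^sub>R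
     (LINT s:{0..t}|lebesgue. (t - s) powr (\<alpha> - 1) *\<^sub>R
        pc_interpolant N P (discrete_caputo \<alpha> N P W) s)"

definition estimator ::
    "real \<Rightarrow> real \<Rightarrow> nat \<Rightarrow> (nat \<Rightarrow> real) \<Rightarrow>
     ('h::{real_inner, banach, second_countable_topology} \<Rightarrow> ereal) \<Rightarrow> ('h \<Rightarrow> 'h) \<Rightarrow>
     (real \<Rightarrow> 'h) \<Rightarrow> (nat \<Rightarrow> 'h) \<Rightarrow> real \<Rightarrow> ereal" where
  "estimator \<alpha> T N P \<Phi> \<Psi> f U t =
     (let Uhat = frac_interpolant \<alpha> N P U;
          Ubar = pc_interpolant N P U;
          Fbar = pc_interpolant N P (cell_average P f)
      in ereal (inner (caputo_deriv \<alpha> T Uhat (Uhat 0) t + \<Psi> (Ubar t) - Fbar t)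
                      (Uhat t - Ubar t))
         + \<Phi> (Uhat t) - \<Phi> (Ubar t))"

definition error_H ::
    "real \<Rightarrow> nat \<Rightarrow> (nat \<Rightarrow> real) \<Rightarrow> (nat \<Rightarrow> 'h::{banach, second_countable_topology}) \<Rightarrow>
     (real \<Rightarrow> 'h) \<Rightarrow> real \<Rightarrow> ennreal" where
  "error_H \<alpha> N P U u t = ennreal (norm (u t - frac_interpolant \<alpha> N P U t))"

definition error_sigma ::
    "real \<Rightarrow> nat \<Rightarrow> (nat \<Rightarrow> real) \<Rightarrow>
     ('h::{real_inner, banach, second_countable_topology} \<Rightarrow> ereal) \<Rightarrow> (nat \<Rightarrow> 'h) \<Rightarrow>
     (real \<Rightarrow> 'h) \<Rightarrow> real \<Rightarrow> ennreal" where
  "error_sigma \<alpha> N P \<Phi> U u t = ennpowr (ennreal (2 / Gamma \<alpha>) *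
     (\<integral>\<^sup>+ s\<in>{0..t}. (ennreal ((t - s) powr (\<alpha> - 1)) *
        e2ennreal (coercivity_modulus \<Phi> (u s) (frac_interpolant \<alpha> N P U s)
                 + coercivity_modulus \<Phi> (pc_interpolant N P U s) (u s))) \<partial>lebesgue)) (1 / 2)"

definition total_error ::
    "real \<Rightarrow> real \<Rightarrow> nat \<Rightarrow> (nat \<Rightarrow> real) \<Rightarrow>
     ('h::{real_inner, banach, second_countable_topology} \<Rightarrow> ereal) \<Rightarrow> (nat \<Rightarrow> 'h) \<Rightarrow>
     (real \<Rightarrow> 'h) \<Rightarrow> ennreal" where
  "total_error \<alpha> T N P \<Phi> U u =
     ennpowr (SUP t\<in>{0..T}. (error_H \<alpha> N P U u t)\<^sup>2 + (error_sigma \<alpha> N P \<Phi> U u t)\<^sup>2) (1 / 2)"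

end

theory Submission
  imports Defs
begin

text \<open>Write \<open>k\<close> for the fractional kernel. The equation gives \<open>u = u0 + k * g\<close> almost everywhere, \<open>g\<close>
  being the Caputo derivative of \<open>u\<close>, and likewise the interpolant is \<open>U0 + k * V\<close>. The main tool is
  the chain inequality \<open>y - y0 \<le> k * inner \<xi> h\<close> for \<open>w = w0 + k * h\<close> whenever both
  \<open>y t - y s \<le> inner (\<xi> t) (w t - w s)\<close> and \<open>y t - y0 \<le> inner (\<xi> t) (w t - w0)\<close>. It is proved by
  regularizing with \<open>\<delta> - r\<close>, where \<open>r\<close> is a nonnegative kernel of mass at most one.
  For \<open>y = \<Phi> \<circ> u\<close> it yields an energy estimate; hence \<open>k * norm g ^ 2\<close> is bounded and \<open>u\<close> has a
  continuous representative. For \<open>y = norm w ^ 2 / 2\<close>, where \<open>w\<close> is the difference of \<open>u\<close> and the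
  interpolant, the two inclusions bound \<open>inner w h\<close> plus the coercivity moduli by the residual, the
  data errors and \<open>L * norm w ^ 2\<close>, and a fractional Gronwall inequality gives the error estimate.\<close>

section \<open>Convolution with fractional kernels\<close>

text \<open>The obstacle is regularity: \<open>u\<close> is only an L2 class whose Caputo derivative
  is an L2 function, so neither its value at a given time nor a product rule is available, and the
  singular memory kernel destroys the local Leibniz formula. For \<alpha> \<le> 1/2 an L2 bound on
  the derivative does not even make \<open>u\<close> continuous. A bound, uniform in t, on the
  fractional integral of its squared norm does; this is where data in the weighted space enter and
  why an energy estimate has to precede the error estimate. The chain inequality sees subgradients
  only through differences of values, so one argument serves both the functional and the squared
  norm. All convolutions run over the whole line: the data are replaced by Borel functions vanishing
  off (0,T), which makes Fubini arguments over \<open>lborel\<close> available. Convolutions with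
  values in [0,\<infinity>] are kept beside the Bochner ones because they need no integrability. The
  sum of a square root and a linear term in the estimate comes from solving a quadratic inequality
  for the size of the error.\<close>

definition frac_kernel :: "real \<Rightarrow> real \<Rightarrow> real" where
  "frac_kernel a x = (if 0 < x then x powr (a - 1) / Gamma a else 0)"

text \<open>Values in [0,\<infinity>] make Tonelli and associativity unconditional; the Bochner
  convolution below inherits them wherever the corresponding \<open>nconv\<close> of norms is
  finite. Since \<open>frac_kernel\<close> vanishes on the nonpositive half-line, convolving with it
  over the whole line in effect integrates over s < t.\<close>

definition nconv :: "(real \<Rightarrow> ennreal) \<Rightarrow> (real \<Rightarrow> ennreal) \<Rightarrow> real \<Rightarrow> ennreal" where
  "nconv a b t = (\<integral>\<^sup>+s. a (t - s) * b s \<partial>lborel)"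

definition conv :: "(real \<Rightarrow> real) \<Rightarrow> (real \<Rightarrow> 'b::{banach, second_countable_topology}) \<Rightarrow> real \<Rightarrow> 'b"
  where "conv a g t = (LINT s|lborel. a (t - s) *\<^sub>R g s)"

abbreviation enorm :: "('a \<Rightarrow> 'b::real_normed_vector) \<Rightarrow> 'a \<Rightarrow> ennreal" where
  "enorm g \<equiv> (\<lambda>s. ennreal (norm (g s)))"

text \<open>Two causal factors confine the convolution at t to [0,t], which is what makes the
  estimates local in time. Nothing is asked at the point 0, which is discarded as a null set where
  necessary.\<close>

definition causal :: "(real \<Rightarrow> 'b::zero) \<Rightarrow> bool" where
  "causal a \<longleftrightarrow> (\<forall>x<0. a x = 0)"

lemma frac_kernel_measurable [measurable]: "frac_kernel a \<in> borel_measurable borel"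
  unfolding frac_kernel_def[abs_def] by measurable

lemma frac_kernel_nonneg: "0 < a \<Longrightarrow> 0 \<le> frac_kernel a x"
  by (auto simp: frac_kernel_def intro!: divide_nonneg_pos Gamma_real_pos)

lemma causal_frac_kernel [simp]: "causal (frac_kernel a)"
  by (simp add: causal_def frac_kernel_def)

lemma causal_enorm [simp]: "causal g \<Longrightarrow> causal (enorm g)"
  by (simp add: causal_def)

lemma nconv_measurable [measurable]:
  assumes [measurable]: "a \<in> borel_measurable borel" "b \<in> borel_measurable borel"
  shows "nconv a b \<in> borel_measurable borel"
  unfolding nconv_def[abs_def] by measurable

lemma conv_measurable [measurable]:
  assumes [measurable]: "a \<in> borel_measurable borel" "g \<in> borel_measurable borel"
  shows "conv a g \<in> borel_measurable borel"
  unfolding conv_def[abs_def] by measurable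

lemma nconv_commute:
  assumes [measurable]: "a \<in> borel_measurable borel" "b \<in> borel_measurable borel"
  shows "nconv a b t = nconv b a t"
  unfolding nconv_def by (subst nn_integral_real_affine[of _ "-1" t]) (simp_all add: mult.commute)

lemma nconv_assoc:
  assumes [measurable]: "a \<in> borel_measurable borel" "b \<in> borel_measurable borel"
    "c \<in> borel_measurable borel"
  shows "nconv a (nconv b c) t = nconv (nconv a b) c t"
proof -
  have "nconv a (nconv b c) t = (\<integral>\<^sup>+s. \<integral>\<^sup>+x. a (t - s) * (b (s - x) * c x) \<partial>lborel \<partial>lborel)"
    unfolding nconv_def by (simp add: nn_integral_cmult)
  also have "\<dots> = (\<integral>\<^sup>+x. \<integral>\<^sup>+s. a (t - s) * (b (s - x) * c x) \<partial>lborel \<partial>lborel)"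
    by (rule lborel_pair.Fubini') measurable
  also have "\<dots> = (\<integral>\<^sup>+x. (\<integral>\<^sup>+s. a (t - s) * b (s - x) \<partial>lborel) * c x \<partial>lborel)"
    by (subst nn_integral_multc[symmetric]) (simp_all add: mult.assoc)
  also have "\<dots> = (\<integral>\<^sup>+x. nconv a b (t - x) * c x \<partial>lborel)"
  proof (rule nn_integral_cong)
    fix x
    have "(\<integral>\<^sup>+s. a (t - s) * b (s - x) \<partial>lborel) = nconv a b (t - x)"
      unfolding nconv_def
      by (subst nn_integral_real_affine[of _ "1" x]) (simp_all add: algebra_simps)
    then show "(\<integral>\<^sup>+s. a (t - s) * b (s - x) \<partial>lborel) * c x = nconv a b (t - x) * c x" by simp
  qed
  finally show ?thesis by (simp add: nconv_def)
qed

lemma nconv_mono: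
  assumes "\<And>s. s \<le> t \<Longrightarrow> b s \<le> c s" "causal a"
  shows "nconv a b t \<le> nconv a c t"
  unfolding nconv_def
proof (rule nn_integral_mono)
  fix s show "a (t - s) * b s \<le> a (t - s) * c s"
    using assms by (cases "s \<le> t") (auto simp: causal_def intro: mult_left_mono)
qed

lemma nconv_mono_AE:
  assumes "AE s in lborel. s < t \<longrightarrow> b s \<le> c s" "causal a"
  shows "nconv a b t \<le> nconv a c t"
  unfolding nconv_def
proof (rule nn_integral_mono_AE)
  show "AE s in lborel. a (t - s) * b s \<le> a (t - s) * c s"
    using assms(1) AE_lborel_singleton[of t]
  proof eventually_elim
    case (elim s) then show ?case
      using assms by (cases "s < t") (auto simp: causal_def intro: mult_left_mono)
  qed
qed

lemma nconv_cong_AE: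
  assumes "AE s in lborel. s < t \<longrightarrow> b s = c s" "causal a"
  shows "nconv a b t = nconv a c t"
  by (rule antisym; rule nconv_mono_AE) (use assms in auto)

lemma nconv_add:
  assumes [measurable]: "a \<in> borel_measurable borel" "b \<in> borel_measurable borel" "c \<in> borel_measurable borel"
  shows "nconv a (\<lambda>s. b s + c s) t = nconv a b t + nconv a c t"
  unfolding nconv_def by (simp add: distrib_left nn_integral_add)

lemma nconv_cmult:
  assumes [measurable]: "a \<in> borel_measurable borel" "b \<in> borel_measurable borel"
  shows "nconv a (\<lambda>s. c * b s) t = c * nconv a b t"
  unfolding nconv_def by (subst nn_integral_cmult[symmetric]) (simp_all add: ac_simps)

lemma causal_nconv: "causal a \<Longrightarrow> causal b \<Longrightarrow> causal (nconv a b)"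
  unfolding causal_def nconv_def
proof (intro allI impI)
  fix x :: real assume *: "\<forall>x<0. a x = 0" "\<forall>x<0. b x = 0" "x < 0"
  have "(\<integral>\<^sup>+ s. a (x - s) * b s \<partial>lborel) = (\<integral>\<^sup>+ s. 0 \<partial>(lborel::real measure))"
  proof (rule nn_integral_cong)
    fix s show "a (x - s) * b s = 0" using * by (cases "s < 0") auto
  qed
  then show "(\<integral>\<^sup>+ s. a (x - s) * b s \<partial>lborel) = 0" by simp
qed

lemma causal_conv: "causal a \<Longrightarrow> causal b \<Longrightarrow> causal (conv a b)"
  unfolding causal_def conv_def
proof (intro allI impI)
  fix x :: real assume *: "\<forall>x<0. a x = 0" "\<forall>x<0. b x = 0" "x < 0"
  have "(LINT s|lborel. a (x - s) *\<^sub>R b s) = (LINT s|(lborel::real measure). 0)"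
  proof (rule Bochner_Integration.integral_cong)
    fix s show "a (x - s) *\<^sub>R b s = 0" using * by (cases "s < 0") auto
  qed simp
  then show "(LINT s|lborel. a (x - s) *\<^sub>R b s) = 0" by simp
qed

text \<open>Young's inequality in L1, localized to times up to T: if s and x are nonnegative and s +
  x \<le> T, then both are at most T, so causality lets each factor be cut off at T as well. Only
  integrability up to T is then needed, and the fractional kernels have no more than that.\<close>

lemma nn_integral_nconv_le:
  assumes [measurable]: "a \<in> borel_measurable borel" "b \<in> borel_measurable borel"
    and ca: "causal a" and cb: "causal b"
  shows "(\<integral>\<^sup>+t\<in>{..T}. nconv a b t \<partial>lborel) \<le> (\<integral>\<^sup>+t\<in>{..T}. a t \<partial>lborel) * (\<integral>\<^sup>+t\<in>{..T}. b t \<partial>lborel)"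
proof -
  have "(\<integral>\<^sup>+t\<in>{..T}. nconv a b t \<partial>lborel)
      = (\<integral>\<^sup>+t. \<integral>\<^sup>+s. a (t - s) * b s * indicator {..T} t \<partial>lborel \<partial>lborel)"
    unfolding nconv_def by (simp add: nn_integral_multc)
  also have "\<dots> = (\<integral>\<^sup>+s. \<integral>\<^sup>+t. a (t - s) * b s * indicator {..T} t \<partial>lborel \<partial>lborel)"
    by (rule lborel_pair.Fubini') measurable
  also have "\<dots> \<le> (\<integral>\<^sup>+s. (\<integral>\<^sup>+t\<in>{..T}. a t \<partial>lborel) * (b s * indicator {..T} s) \<partial>lborel)"
  proof (rule nn_integral_mono)
    fix s :: real
    have "(\<integral>\<^sup>+t. a (t - s) * b s * indicator {..T} t \<partial>lborel)
        = (\<integral>\<^sup>+x. (a x * indicator {..T} (s + x)) * b s \<partial>lborel)"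
      by (subst nn_integral_real_affine[of _ 1 s]) (simp_all add: ac_simps)
    also have "\<dots> \<le> (\<integral>\<^sup>+x. (a x * indicator {..T} x) * (b s * indicator {..T} s) \<partial>lborel)"
    proof (rule nn_integral_mono)
      fix x show "a x * indicator {..T} (s + x) * b s \<le> a x * indicator {..T} x * (b s * indicator {..T} s)"
        using ca cb unfolding causal_def
        by (cases "s < 0"; cases "x < 0") (auto simp: indicator_def)
    qed
    also have "\<dots> = (\<integral>\<^sup>+t\<in>{..T}. a t \<partial>lborel) * (b s * indicator {..T} s)"
      by (rule nn_integral_multc) measurable
    finally show "(\<integral>\<^sup>+t. a (t - s) * b s * indicator {..T} t \<partial>lborel) \<le> \<dots>" .
  qed
  also have "\<dots> = (\<integral>\<^sup>+t\<in>{..T}. a t \<partial>lborel) * (\<integral>\<^sup>+t\<in>{..T}. b t \<partial>lborel)"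
    by (rule nn_integral_cmult) measurable
  finally show ?thesis .
qed

text \<open>This supplies the conull set of times at which Bochner convolutions converge absolutely
  and may be rearranged.\<close>

lemma nconv_finite_AE:
  assumes [measurable]: "a \<in> borel_measurable borel" "b \<in> borel_measurable borel"
    and ca: "causal a" and cb: "causal b"
    and fa: "(\<integral>\<^sup>+t\<in>{..T}. a t \<partial>lborel) < \<infinity>" and fb: "(\<integral>\<^sup>+t\<in>{..T}. b t \<partial>lborel) < \<infinity>"
  shows "AE t in lborel. t \<le> T \<longrightarrow> nconv a b t < \<infinity>"
proof -
  have "(\<integral>\<^sup>+t\<in>{..T}. nconv a b t \<partial>lborel) \<noteq> \<infinity>"
    using nn_integral_nconv_le[OF assms(1-4), of T] fa fb
    by (metis ennreal_mult_less_top infinity_ennreal_def leD not_less_iff_gr_or_eq top.not_eq_extremum)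
  then have "AE t in lborel. nconv a b t * indicator {..T} t \<noteq> \<infinity>"
    by (intro nn_integral_noteq_infinite) auto
  then show ?thesis
    by eventually_elim (auto simp: less_top)
qed

text \<open>The semigroup law of fractional integration. The substitution s = t x turns the
  convolution into a Beta integral, and Beta(b,a) = Gamma(a) Gamma(b) / Gamma(a + b) produces the
  normalization.\<close>

lemma nconv_frac_kernel:
  assumes a: "0 < a" and b: "0 < b"
  shows "nconv (\<lambda>x. ennreal (frac_kernel a x)) (\<lambda>x. ennreal (frac_kernel b x)) t = ennreal (frac_kernel (a + b) t)"
proof (cases "0 < t")
  case False
  have "ennreal (frac_kernel a (t - s)) * ennreal (frac_kernel b s) = 0" for s
    using False by (cases "0 < s") (auto simp: frac_kernel_def)
  then have "nconv (\<lambda>x. ennreal (frac_kernel a x)) (\<lambda>x. ennreal (frac_kernel b x)) t = 0"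
    unfolding nconv_def by (subst nn_integral_cong[where v = "\<lambda>_. 0"]) auto
  then show ?thesis using False by (simp add: frac_kernel_def)
next
  case t: True
  have G: "Gamma a > 0" "Gamma b > 0" "Gamma (a + b) > 0"
    using a b by (auto intro: Gamma_real_pos)
  have eq: "ennreal (frac_kernel a (t - t * x)) * ennreal (frac_kernel b (t * x))
      = ennreal (t powr (a + b - 2) / (Gamma a * Gamma b)) *
        ennreal (indicator {0..1} x * (x powr (b - 1) * (1 - x) powr (a - 1)))" (is "?l x = ?r x")
    if "x \<noteq> 0" "x \<noteq> 1" for x
  proof (cases "0 < x \<and> x < 1")
    case True
    have e: "t - t * x = t * (1 - x)" by (simp add: algebra_simps)
    have "frac_kernel a (t - t * x) * frac_kernel b (t * x)
      = t powr (a + b - 2) / (Gamma a * Gamma b) * (x powr (b - 1) * (1 - x) powr (a - 1))"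
    proof -
      have p: "t powr (a + b - 2) = t powr (a - 1) * t powr (b - 1)"
        using t by (simp add: powr_add[symmetric])
      show ?thesis unfolding e p using t True
        by (simp add: frac_kernel_def powr_mult)
    qed
    then show ?thesis using True t G
      by (simp add: ennreal_mult[symmetric] frac_kernel_nonneg a b)
  next
    case False
    then have "?l x = 0" using t by (auto simp: frac_kernel_def zero_less_mult_iff)
    moreover have "?r x = 0" using False that by (auto simp: indicator_def)
    ultimately show ?thesis by (simp only:)
  qed
  have "nconv (\<lambda>x. ennreal (frac_kernel a x)) (\<lambda>x. ennreal (frac_kernel b x)) t
     = ennreal t * (\<integral>\<^sup>+x. ennreal (frac_kernel a (t - t * x)) * ennreal (frac_kernel b (t * x)) \<partial>lborel)"
    unfolding nconv_def using t by (subst nn_integral_real_affine[of _ t 0]) simp_all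
  also have "(\<integral>\<^sup>+x. ?l x \<partial>lborel) = (\<integral>\<^sup>+x. ?r x \<partial>lborel)"
  proof (rule nn_integral_cong_AE)
    show "AE x in lborel. ?l x = ?r x"
      using AE_lborel_singleton[of 0] AE_lborel_singleton[of 1]
      by eventually_elim (rule eq)
  qed
  also have "\<dots> = ennreal (t powr (a + b - 2) / (Gamma a * Gamma b)) *
      (\<integral>\<^sup>+x. ennreal (indicator {0..1} x * (x powr (b - 1) * (1 - x) powr (a - 1))) \<partial>lborel)"
    by (rule nn_integral_cmult) measurable
  also have "(\<integral>\<^sup>+x. ennreal (indicator {0..1} x * (x powr (b - 1) * (1 - x) powr (a - 1))) \<partial>lborel)
     = ennreal (Beta b a)"
  proof (rule nn_integral_has_integral_lborel)
    have "((\<lambda>x. if x \<in> {0..1} then x powr (b - 1) * (1 - x) powr (a - 1) else 0) has_integral Beta b a) UNIV"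
      using has_integral_Beta_real[OF b a] by (subst has_integral_restrict_UNIV)
    then show "((\<lambda>x. indicator {0..1} x * (x powr (b - 1) * (1 - x) powr (a - 1))) has_integral Beta b a) UNIV"
      by (rule has_integral_cong[THEN iffD1, rotated]) (auto simp: indicator_def)
  qed auto
  also have "ennreal t * (ennreal (t powr (a + b - 2) / (Gamma a * Gamma b)) * ennreal (Beta b a))
    = ennreal (t * (t powr (a + b - 2) / (Gamma a * Gamma b) * Beta b a))"
    using t G by (simp add: ennreal_mult[symmetric] Beta_def add.commute)
  also have "t * (t powr (a + b - 2) / (Gamma a * Gamma b) * Beta b a) = frac_kernel (a + b) t"
  proof -
    have "t * t powr (a + b - 2) = t powr (a + b - 1)"
      using t by (simp add: powr_mult_base)
    then show ?thesis using t G by (simp add: frac_kernel_def Beta_def field_simps)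
  qed
  finally show ?thesis .
qed

lemma frac_kernel_1: "frac_kernel 1 = indicator {0<..}"
  by (auto simp: frac_kernel_def indicator_def fun_eq_iff)

lemma nconv_frac_kernel_1:
  "nconv (\<lambda>x. ennreal (frac_kernel 1 x)) b t = (\<integral>\<^sup>+s\<in>{..<t}. b s \<partial>lborel)"
  unfolding nconv_def frac_kernel_1 by (intro nn_integral_cong) (auto simp: indicator_def)

text \<open>Integration is convolution with the Heaviside function \<open>frac_kernel 1\<close>, so
  the primitive is a case of the semigroup law.\<close>

lemma nn_integral_frac_kernel:
  assumes "0 < a" shows "(\<integral>\<^sup>+t\<in>{..T}. ennreal (frac_kernel a t) \<partial>lborel) = ennreal (frac_kernel (a + 1) T)"
proof -
  have "(\<integral>\<^sup>+t\<in>{..T}. ennreal (frac_kernel a t) \<partial>lborel) = (\<integral>\<^sup>+t\<in>{..<T}. ennreal (frac_kernel a t) \<partial>lborel)"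
    by (rule nn_integral_cong_AE)
       (use AE_lborel_singleton[of T] in \<open>auto simp: indicator_def less_le\<close>)
  also have "\<dots> = nconv (\<lambda>x. ennreal (frac_kernel 1 x)) (\<lambda>x. ennreal (frac_kernel a x)) T"
    by (simp add: nconv_frac_kernel_1)
  also have "\<dots> = ennreal (frac_kernel (a + 1) T)"
    using assms by (subst nconv_frac_kernel) (auto simp: add.commute)
  finally show ?thesis .
qed

lemma conv_integrable:
  fixes g :: "real \<Rightarrow> 'b::{banach, second_countable_topology}"
  assumes [measurable]: "a \<in> borel_measurable borel" "g \<in> borel_measurable borel"
    and "nconv (enorm a) (enorm g) t < \<infinity>"
  shows "integrable lborel (\<lambda>s. a (t - s) *\<^sub>R g s)"
proof (rule integrableI_bounded)
  show "(\<integral>\<^sup>+ s. ennreal (norm (a (t - s) *\<^sub>R g s)) \<partial>lborel) < \<infinity>"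
    using assms(3) by (simp add: nconv_def ennreal_mult)
  show "(\<lambda>s. a (t - s) *\<^sub>R g s) \<in> borel_measurable lborel" by measurable
qed

lemma norm_conv_le:
  assumes [measurable]: "a \<in> borel_measurable borel" "g \<in> borel_measurable borel"
  shows "ennreal (norm (conv a g t)) \<le> nconv (enorm a) (enorm g) t"
proof (cases "nconv (enorm a) (enorm g) t < \<infinity>")
  case True
  have "ennreal (norm (conv a g t)) \<le> (\<integral>\<^sup>+ s. ennreal (norm (a (t - s) *\<^sub>R g s)) \<partial>lborel)"
    unfolding conv_def by (rule integral_norm_bound_ennreal[OF conv_integrable[OF assms True]])
  then show ?thesis by (simp add: nconv_def ennreal_mult)
qed (simp add: less_top[symmetric])

text \<open>Fubini at one time t: finiteness of the double convolution of norms at this t is exactly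
  its hypothesis. The statement is pointwise because for merely integrable functions that finiteness
  can fail at exceptional times.\<close>

lemma conv_assoc:
  fixes g :: "real \<Rightarrow> 'b::{banach, second_countable_topology}"
  assumes [measurable]: "a \<in> borel_measurable borel" "b \<in> borel_measurable borel" "g \<in> borel_measurable borel"
    and fin: "nconv (enorm a) (nconv (enorm b) (enorm g)) t < \<infinity>"
  shows "conv a (conv b g) t = conv (conv a b) g t"
proof -
  have [measurable]: "(\<lambda>(s, x). a (t - s) *\<^sub>R b (s - x) *\<^sub>R g x) \<in> borel_measurable (lborel \<Otimes>\<^sub>M lborel)"
    by measurable
  have "(\<integral>\<^sup>+ s. \<integral>\<^sup>+ x. ennreal (norm (a (t - s) *\<^sub>R b (s - x) *\<^sub>R g x)) \<partial>lborel \<partial>lborel)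
      = nconv (enorm a) (nconv (enorm b) (enorm g)) t"
    unfolding nconv_def
    by (simp add: ennreal_mult abs_mult mult.assoc nn_integral_cmult del: scaleR_scaleR)
  then have int: "integrable (lborel \<Otimes>\<^sub>M lborel) (\<lambda>(s, x). a (t - s) *\<^sub>R b (s - x) *\<^sub>R g x)"
    using fin by (intro integrableI_bounded) (simp_all add: lborel.nn_integral_fst[symmetric] split_beta')
  have "conv a (conv b g) t = (LINT s|lborel. LINT x|lborel. a (t - s) *\<^sub>R b (s - x) *\<^sub>R g x)"
    unfolding conv_def by (simp del: scaleR_scaleR)
  also have "\<dots> = (LINT x|lborel. LINT s|lborel. a (t - s) *\<^sub>R b (s - x) *\<^sub>R g x)"
    by (rule lborel_pair.Fubini_integral[symmetric]) (rule int)
  also have "\<dots> = (LINT x|lborel. conv a b (t - x) *\<^sub>R g x)"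
  proof (rule Bochner_Integration.integral_cong_AE)
    show "AE x in lborel. (LINT s|lborel. a (t - s) *\<^sub>R b (s - x) *\<^sub>R g x) = conv a b (t - x) *\<^sub>R g x"
      using lborel_pair.AE_integrable_snd[OF int]
    proof eventually_elim
      case (elim x)
      have "(LINT s|lborel. a (t - s) *\<^sub>R b (s - x) *\<^sub>R g x) = (LINT s|lborel. (a (t - s) * b (s - x)) *\<^sub>R g x)"
        by simp
      \<comment> \<open>Fubini yields integrability of the product with \<open>g x\<close>. The
        scalar factor alone is integrable only after dividing by \<open>norm (g x)\<close>, so the
        zeros of g are treated apart.\<close>
      also have "\<dots> = (LINT s|lborel. a (t - s) * b (s - x)) *\<^sub>R g x"
      proof (cases "g x = 0")
        case False
        have "integrable lborel (\<lambda>s. norm (a (t - s) *\<^sub>R b (s - x) *\<^sub>R g x))"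
          using elim by (intro integrable_norm) simp
        then have "integrable lborel (\<lambda>s. norm (a (t - s) * b (s - x)) * norm (g x))"
          by (simp add: abs_mult mult.assoc)
        then have "integrable lborel (\<lambda>s. norm (a (t - s) * b (s - x)))"
          using False by (simp only: integrable_mult_right_iff norm_eq_zero simp_thms)
        then have "integrable lborel (\<lambda>s. a (t - s) * b (s - x))"
          by (subst (asm) integrable_norm_iff) simp_all
        then show ?thesis by (rule integral_scaleR_left)
      qed simp
      also have "(LINT s|lborel. a (t - s) * b (s - x)) = conv a b (t - x)"
        unfolding conv_def
        by (subst lborel_integral_real_affine[of 1 _ x]) (simp_all add: algebra_simps)
      finally show ?case .
    qed
  qed measurable
  finally show ?thesis unfolding conv_def .
qed

lemma conv_commute: "conv a b t = conv b a t" for a b :: "real \<Rightarrow> real"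
  unfolding conv_def by (subst lborel_integral_real_affine[of "-1" _ t]) (simp_all add: mult.commute)

lemma conv_eq_nconv:
  assumes [measurable]: "a \<in> borel_measurable borel" "b \<in> borel_measurable borel"
    and "\<And>x. 0 \<le> a x" "\<And>x. 0 \<le> b x"
  shows "conv a b t = enn2real (nconv (\<lambda>x. ennreal (a x)) (\<lambda>x. ennreal (b x)) t)"
  unfolding conv_def nconv_def using assms(3,4)
  by (subst integral_eq_nn_integral) (auto simp: ennreal_mult)

lemma conv_frac_kernel:
  assumes "0 < a" "0 < b" shows "conv (frac_kernel a) (frac_kernel b) t = frac_kernel (a + b) t"
  using assms by (subst conv_eq_nconv) (auto simp: nconv_frac_kernel frac_kernel_nonneg)

lemma conv_cong_AE:
  assumes [measurable]: "a \<in> borel_measurable borel" "g \<in> borel_measurable borel" "h \<in> borel_measurable borel"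
    and "AE s in lborel. s < t \<longrightarrow> g s = h s" "causal a"
  shows "conv a g t = conv a h t"
  unfolding conv_def
proof (rule Bochner_Integration.integral_cong_AE)
  show "AE s in lborel. a (t - s) *\<^sub>R g s = a (t - s) *\<^sub>R h s"
    using assms(4) AE_lborel_singleton[of t]
  proof eventually_elim
    case (elim s) then show ?case
      using assms by (cases "s < t") (auto simp: causal_def)
  qed
qed measurable

text \<open>The exceptional null set lives in the kernel variable and has to be carried over to s;
  the reflection s \<mapsto> t - s preserves Lebesgue measure, hence null sets.\<close>

lemma conv_kernel_cong_AE:
  assumes [measurable]: "a \<in> borel_measurable borel" "g \<in> borel_measurable borel" "b \<in> borel_measurable borel"
    and "AE s in lborel. a s = b s"
  shows "conv a g t = conv b g t"
  unfolding conv_def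
proof (rule Bochner_Integration.integral_cong_AE)
  have "AE s in distr lborel borel (\<lambda>s. t + (-1) * s). a s = b s"
  proof -
    have "AE s in density (distr lborel borel (\<lambda>s. t + (-1) * s)) (\<lambda>_. ennreal \<bar>-1\<bar>). a s = b s"
      using assms(4) by (subst (asm) lborel_real_affine[of "-1" t]) auto
    then show ?thesis by (subst (asm) AE_density) auto
  qed
  then have "AE s in lborel. a (t - s) = b (t - s)"
    by (subst (asm) AE_distr_iff) auto
  then show "AE s in lborel. a (t - s) *\<^sub>R g s = b (t - s) *\<^sub>R g s"
    by eventually_elim simp
qed measurable

lemma conv_diff:
  assumes "integrable lborel (\<lambda>s. a (t - s) *\<^sub>R g s)" "integrable lborel (\<lambda>s. a (t - s) *\<^sub>R h s)"
  shows "conv a (\<lambda>s. g s - h s) t = conv a g t - conv a h t"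
  using assms unfolding conv_def by (simp add: scaleR_diff_right)

lemma conv_frac_kernel_1:
  "conv (frac_kernel 1) g t = (LINT s:{..<t}|lborel. g s)"
  unfolding conv_def set_lebesgue_integral_def frac_kernel_1
  by (intro Bochner_Integration.integral_cong) (auto simp: indicator_def)

section \<open>Passing from almost every time to every time; uniqueness of densities\<close>

lemma AE_imp_seq:
  fixes t :: real
  assumes ae: "AE s in lborel. s \<in> {a<..<b} \<longrightarrow> P s" and "a < b" and t: "t \<in> {a..b}"
  shows "\<exists>X::nat \<Rightarrow> real. (\<forall>n. X n \<in> {a<..<b} \<and> P (X n)) \<and> X \<longlonglongrightarrow> t"
proof -
  \<comment> \<open>A conull subset of an interval meets every nonempty open subinterval, since such
    a subinterval has positive length. Clipping at a and b covers the case that t is an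
    endpoint.\<close>
  have "\<exists>x. x \<in> {a<..<b} \<and> P x \<and> \<bar>x - t\<bar> \<le> 1 / real (Suc n)" for n
  proof (rule ccontr)
    define p q where "p = max a (t - 1 / real (Suc n))" and "q = min b (t + 1 / real (Suc n))"
    assume no: "\<not> ?thesis"
    have "0 < 1 / real (Suc n)" by simp
    then have "p < q" using t \<open>a < b\<close> unfolding p_def q_def by (smt (verit) atLeastAtMost_iff)
    have "AE s in lborel. s \<notin> {p<..<q}"
      using ae
    proof eventually_elim
      case (elim s)
      show ?case
      proof
        assume "s \<in> {p<..<q}"
        then have "s \<in> {a<..<b}" "\<bar>s - t\<bar> \<le> 1 / real (Suc n)" by (auto simp: p_def q_def abs_le_iff)
        with elim no show False by blast
      qed
    qed
    then have "emeasure lborel {p<..<q} = 0"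
      by (subst (asm) AE_iff_measurable[of "{p<..<q}"]) auto
    then show False using \<open>p < q\<close> by simp
  qed
  then obtain X where X: "\<And>n. X n \<in> {a<..<b} \<and> P (X n) \<and> \<bar>X n - t\<bar> \<le> 1 / real (Suc n)"
    by metis
  have "(\<lambda>n. X n - t) \<longlonglongrightarrow> 0"
    by (rule tendsto_rabs_zero_cancel, rule tendsto_sandwich[OF _ _ tendsto_const LIMSEQ_Suc[OF lim_1_over_n]])
       (use X in auto)
  then have "X \<longlonglongrightarrow> t" by (simp add: LIM_zero_iff)
  with X show ?thesis by blast
qed

lemma AE_le_imp_le_on:
  fixes f g :: "real \<Rightarrow> real"
  assumes "AE s in lborel. s \<in> {a<..<b} \<longrightarrow> f s \<le> g s" "a < b" "t \<in> {a..b}"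
    and "continuous_on {a..b} f" "continuous_on {a..b} g"
  shows "f t \<le> g t"
proof -
  obtain X where X: "\<And>n. X n \<in> {a<..<b} \<and> f (X n) \<le> g (X n)" "X \<longlonglongrightarrow> t"
    using AE_imp_seq[OF assms(1-3)] by blast
  have *: "\<forall>\<^sub>F n in sequentially. X n \<in> {a..b}"
    by (rule always_eventually) (use X in \<open>auto simp: less_imp_le\<close>)
  show ?thesis
    by (rule tendsto_le[OF _ continuous_on_tendsto_compose[OF assms(5) X(2) assms(3) *]
          continuous_on_tendsto_compose[OF assms(4) X(2) assms(3) *]]) (use X in auto)
qed

text \<open>Half-lines form an intersection-stable generator of the Borel sets, so the integral of
  the truncated function over every Borel set vanishes, and a function all of whose set integrals
  vanish is zero almost everywhere. The Dynkin argument applies to Banach-valued integrals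
  directly.\<close>

lemma AE_zero_of_integral_lessThan_zero:
  fixes z :: "real \<Rightarrow> 'b::{banach, second_countable_topology}"
  assumes int: "integrable lborel z"
    and 0: "\<And>t. t < T \<Longrightarrow> (LINT s:{..<t}|lborel. z s) = 0"
  shows "AE s in lborel. s < T \<longrightarrow> z s = 0"
proof -
  have [measurable]: "z \<in> borel_measurable borel" using int by auto
  have *: "AE s in lborel. s < T' \<longrightarrow> z s = 0" if "T' < T" for T'
  proof -
    \<comment> \<open>Cutting at T' < T keeps all primitives within the range of the hypothesis and
      makes the total integral vanish, as the complement step of the Dynkin argument
      requires.\<close>
    define y where "y s = indicator {..<T'} s *\<^sub>R z s" for s
    have inty: "integrable lborel y" unfolding y_def
      using int by (intro integrable_mult_indicator) auto
    have siy: "set_integrable lborel A y" if "A \<in> sets borel" for A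
      using inty that unfolding set_integrable_def by (intro integrable_mult_indicator) auto
    have yt: "(LINT s:{..<t}|lborel. y s) = 0" for t
    proof -
      have "(LINT s:{..<t}|lborel. y s) = (LINT s:{..<min t T'}|lborel. z s)"
        unfolding set_lebesgue_integral_def y_def
        by (intro Bochner_Integration.integral_cong) (auto simp: indicator_def)
      then show ?thesis using 0[of "min t T'"] that by simp
    qed
    have tot: "(LINT s|lborel. y s) = 0"
    proof -
      have "(LINT s|lborel. y s) = (LINT s:{..<T'}|lborel. y s)"
        unfolding set_lebesgue_integral_def y_def
        by (intro Bochner_Integration.integral_cong) (auto simp: indicator_def)
      then show ?thesis using yt by simp
    qed
    have sb: "sets borel = sigma_sets UNIV (range (lessThan :: real \<Rightarrow> _))"
      by (subst borel_Iio) simp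
    have "AE s in lborel. y s = 0"
    proof (rule sigma_finite_measure.density_zero[OF lborel.sigma_finite_measure_axioms inty])
      fix A :: "real set" assume "A \<in> sets lborel"
      then have A: "A \<in> sigma_sets UNIV (range lessThan)"
        by (simp add: sb)
      have IS: "Int_stable (range (lessThan :: real \<Rightarrow> _))"
        unfolding Int_stable_def
      proof (intro ballI)
        fix A B :: "real set" assume "A \<in> range lessThan" "B \<in> range lessThan"
        then obtain p q where "A = {..<p}" "B = {..<q}" by auto
        then have "A \<inter> B = {..<min p q}" by auto
        then show "A \<inter> B \<in> range lessThan" by auto
      qed
      from IS subset_UNIV[of "range lessThan", folded Pow_UNIV] A show "set_lebesgue_integral lborel A y = 0"
      proof (induct rule: sigma_sets_induct_disjoint)
        case (basic A) then show ?case using yt by auto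
      next
        case empty then show ?case by (simp add: set_lebesgue_integral_def)
      next
        case (compl A)
        then have "A \<in> sets borel" by (simp add: sb)
        then have "(LINT s:(UNIV - A) \<union> A|lborel. y s) = (LINT s:UNIV - A|lborel. y s) + (LINT s:A|lborel. y s)"
          by (intro set_integral_Un siy) auto
        then show ?case using compl tot by (simp add: set_lebesgue_integral_def)
      next
        case (union A)
        have "(LINT s:(\<Union>i. A i)|lborel. y s) = (\<Sum>i. LINT s:A i|lborel. y s)"
        proof (rule lebesgue_integral_countable_add)
          show m: "\<And>i. A i \<in> sets lborel"
            using union by (auto simp: sb)
          show "\<And>i j. i \<noteq> j \<Longrightarrow> A i \<inter> A j = {}"
            using union by (auto simp: disjoint_family_on_def)
          show "set_integrable lborel (\<Union> (range A)) y"
            using m by (intro siy) auto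
        qed
        then show ?case using union by simp
      qed
    qed
    then show ?thesis by eventually_elim (auto simp: y_def)
  qed
  have "AE s in lborel. \<forall>n::nat. s < T - 1 / real (Suc n) \<longrightarrow> z s = 0"
    by (subst AE_all_countable, intro allI, rule *) simp
  then show ?thesis
  proof eventually_elim
    case (elim s)
    show ?case
    proof
      assume "s < T"
      then obtain n where "1 / real (Suc n) < T - s" using nat_approx_posE[of "T - s"] by auto
      then show "z s = 0" using elim by (auto simp: algebra_simps)
    qed
  qed
qed

lemma isCont_integral_lessThan:
  fixes z :: "real \<Rightarrow> 'b::{banach, second_countable_topology}"
  assumes int: "integrable lborel z"
  shows "isCont (\<lambda>t. LINT s:{..<t}|lborel. z s) t"
  unfolding continuous_at_sequentially
proof (intro allI impI)
  have [measurable]: "z \<in> borel_measurable borel" using int by auto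
  fix X :: "nat \<Rightarrow> real" assume X: "X \<longlonglongrightarrow> t"
  have "(\<lambda>n. LINT s|lborel. indicator {..<X n} s *\<^sub>R z s) \<longlonglongrightarrow> (LINT s|lborel. indicator {..<t} s *\<^sub>R z s)"
  proof (rule integral_dominated_convergence[where w = "\<lambda>s. norm (z s)"])
    show "AE s in lborel. (\<lambda>n. indicator {..<X n} s *\<^sub>R z s) \<longlonglongrightarrow> indicator {..<t} s *\<^sub>R z s"
      using AE_lborel_singleton[of t]
    proof eventually_elim
      case (elim s)
      consider "s < t" | "t < s" using elim by linarith
      then have "\<forall>\<^sub>F n in sequentially. indicator {..<X n} s *\<^sub>R z s = indicator {..<t} s *\<^sub>R z s"
      proof cases
        case 1 show ?thesis using order_tendstoD(1)[OF X 1]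
          by eventually_elim (use 1 in \<open>simp add: indicator_def\<close>)
      next
        case 2 show ?thesis using order_tendstoD(2)[OF X 2]
          by eventually_elim (use 2 in \<open>simp add: indicator_def\<close>)
      qed
      then show ?case by (rule tendsto_eventually)
    qed
  qed (use int in \<open>auto simp: indicator_def\<close>)
  then show "((\<lambda>t. LINT s:{..<t}|lborel. z s) \<circ> X) \<longlonglongrightarrow> (LINT s:{..<t}|lborel. z s)"
    by (simp add: set_lebesgue_integral_def comp_def)
qed

text \<open>Continuity of the primitive turns vanishing at almost every time into vanishing at every
  time. This is the cancellation rule for \<open>frac_kernel 1\<close>.\<close>

lemma AE_zero_of_conv_frac_kernel_1_zero:
  fixes z :: "real \<Rightarrow> 'b::{banach, second_countable_topology}"
  assumes int: "integrable lborel z" and c: "causal z"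
    and 0: "AE t in lborel. t \<in> {0<..<T} \<longrightarrow> conv (frac_kernel 1) z t = 0"
  shows "AE s in lborel. s < T \<longrightarrow> z s = 0"
proof (rule AE_zero_of_integral_lessThan_zero[OF int])
  fix t assume "t < T"
  show "(LINT s:{..<t}|lborel. z s) = 0"
  proof (cases "t \<le> 0")
    case True
    have "(LINT s:{..<t}|lborel. z s) = (LINT s|(lborel::real measure). 0)"
      unfolding set_lebesgue_integral_def
      by (intro Bochner_Integration.integral_cong) (use True c in \<open>auto simp: indicator_def causal_def\<close>)
    then show ?thesis by simp
  next
    case False
    have "AE t in lborel. t \<in> {0<..<T} \<longrightarrow> (LINT s:{..<t}|lborel. z s) = 0"
      using 0 by (simp add: conv_frac_kernel_1)
    from AE_imp_seq[OF this, of t] False \<open>t < T\<close>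
    obtain X where X: "\<And>n. (LINT s:{..<X n}|lborel. z s) = 0" "X \<longlonglongrightarrow> t"
      by (auto simp: less_imp_le)
    have "(\<lambda>n. LINT s:{..<X n}|lborel. z s) \<longlonglongrightarrow> (LINT s:{..<t}|lborel. z s)"
      by (rule isCont_tendsto_compose[OF isCont_integral_lessThan[OF int] X(2)])
    then show ?thesis using X(1) by (simp add: LIMSEQ_const_iff)
  qed
qed

section \<open>The Mittag-Leffler function and the fractional Gronwall inequality\<close>

text \<open>R^s e^(-R) is the integral of R^s e^(-x) over x \<ge> R, and there R^s \<le> x^s bounds
  the integrand by that of Gamma(s + 1). As R is free, this lower bound on Gamma does the work of
  Stirling's formula.\<close>

lemma powr_le_exp_Gamma:
  fixes R s :: real
  assumes "0 \<le> s" "0 < R"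
  shows "R powr s \<le> exp R * Gamma (s + 1)"
proof -
  have 1: "((\<lambda>t. t powr (s + 1 - 1) / exp t) has_integral Gamma (s + 1)) {0..}"
    by (rule Gamma_integral_real) (use assms in simp)
  have "((\<lambda>x. exp (- 1 * x)) has_integral exp (- 1 * R) / 1) {R..}"
    by (rule has_integral_exp_minus_to_infinity) simp
  then have "((\<lambda>x. R powr s * exp (- x)) has_integral R powr s * exp (- R)) {R..}"
    by (intro has_integral_mult_right) simp
  then have "((\<lambda>x. if x \<in> {R..} then R powr s * exp (- x) else 0) has_integral R powr s * exp (- R)) {0..}"
    by (subst has_integral_restrict) (use assms in auto)
  then have "R powr s * exp (- R) \<le> Gamma (s + 1)"
  proof (rule has_integral_le[OF _ 1])
    fix x :: real assume "x \<in> {0..}"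
    show "(if x \<in> {R..} then R powr s * exp (- x) else 0) \<le> x powr (s + 1 - 1) / exp x"
      using assms powr_mono2[of s R x] by (simp add: exp_minus divide_inverse)
  qed
  then have "R powr s / exp R \<le> Gamma (s + 1)"
    by (simp only: exp_minus divide_inverse)
  then show ?thesis
    by (simp add: pos_divide_le_eq mult.commute)
qed

lemma summable_mittag_leffler:
  fixes z :: real
  assumes a: "0 < \<alpha>"
  shows "summable (\<lambda>k. z ^ k / Gamma (\<alpha> * real k + 1))"
proof -
  \<comment> \<open>Chosen such that R^\<alpha> = 2 (|z| + 1); the lower bound on Gamma then makes
    the k-th term at most e^R 2^(-k).\<close>
  define R where "R = (2 * (\<bar>z\<bar> + 1)) powr (1 / \<alpha>)"
  have R: "0 < R" "R powr \<alpha> = 2 * (\<bar>z\<bar> + 1)" using a by (auto simp: R_def powr_powr)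
  have "norm (z ^ k / Gamma (\<alpha> * real k + 1)) \<le> exp R * (1 / 2) ^ k" for k
  proof -
    have G: "Gamma (\<alpha> * real k + 1) > 0" using a by (intro Gamma_real_pos) (simp add: add_nonneg_pos)
    have "R powr (\<alpha> * real k) = (2 * (\<bar>z\<bar> + 1)) ^ k"
      using R by (simp add: powr_powr[symmetric] powr_realpow)
    then have "(2 * (\<bar>z\<bar> + 1)) ^ k \<le> exp R * Gamma (\<alpha> * real k + 1)"
      using powr_le_exp_Gamma[of "\<alpha> * real k" R] a R by simp
    moreover have "\<bar>z\<bar> ^ k * 2 ^ k \<le> (2 * (\<bar>z\<bar> + 1)) ^ k"
      unfolding power_mult_distrib[symmetric] by (rule power_mono) auto
    ultimately have "\<bar>z\<bar> ^ k * 2 ^ k \<le> exp R * Gamma (\<alpha> * real k + 1)" by linarith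
    then have "\<bar>z\<bar> ^ k / Gamma (\<alpha> * real k + 1) \<le> exp R / 2 ^ k" using G by (simp add: divide_le_eq pos_le_divide_eq)
    then show ?thesis using G by (simp add: power_abs power_one_over)
  qed
  then show ?thesis by (intro summable_comparison_test[OF _ summable_mult[OF summable_geometric]]) auto
qed

text \<open>Picard iteration: substituting the hypothesis into itself produces partial sums of the
  series and a remainder, c^m times the convolution of \<open>a\<close> with the m-fold kernel,
  which by the semigroup law is the kernel of order \<alpha> m. Integrability of \<open>a\<close>
  suffices to make the remainder vanish because this kernel is bounded on (0,T] as soon as \<alpha>
  m \<ge> 1.\<close>

lemma frac_gronwall:
  fixes a :: "real \<Rightarrow> ennreal" and b :: ennreal
  assumes [measurable]: "a \<in> borel_measurable borel" and ca: "causal a"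
    and al: "0 < \<alpha>" and c: "0 \<le> c"
    and fin: "(\<integral>\<^sup>+s\<in>{..T}. a s \<partial>lborel) < \<infinity>"
    and le: "\<And>t. t \<in> {0..T} \<Longrightarrow> a t \<le> b + ennreal c * nconv (\<lambda>x. ennreal (frac_kernel \<alpha> x)) a t"
    and t: "t \<in> {0..T}"
  shows "a t \<le> b * ennreal (\<Sum>k. (c * t powr \<alpha>) ^ k / Gamma (\<alpha> * real k + 1))"
proof -
  let ?l = "\<lambda>m x. ennreal (frac_kernel (\<alpha> * real m) x)"
  let ?S = "\<lambda>m t. ennreal (\<Sum>k<m. (c * t powr \<alpha>) ^ k / Gamma (\<alpha> * real k + 1))"
  have Gp: "Gamma (\<alpha> * real k + 1) > 0" for k using al by (intro Gamma_real_pos) (simp add: add_nonneg_pos)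
  have pos: "0 \<le> (c * t powr \<alpha>) ^ k / Gamma (\<alpha> * real k + 1)" for k t
    using c Gp[of k] by simp
  have step: "a t \<le> b * ?S (Suc m) t + ennreal (c ^ Suc m) * nconv (?l (Suc m)) a t" if "t \<in> {0..T}" for m t
    using that
  proof (induction m arbitrary: t)
    case 0
    show ?case using le[OF 0] Gp[of 0] by simp
  next
    case (Suc m)
    have "nconv (?l (Suc m)) a t \<le> nconv (?l (Suc m)) (\<lambda>s. b * ennreal (frac_kernel 1 s) + ennreal c * nconv (\<lambda>x. ennreal (frac_kernel \<alpha> x)) a s) t"
    proof (rule nconv_mono_AE)
      show "AE s in lborel. s < t \<longrightarrow> a s \<le> b * ennreal (frac_kernel 1 s) + ennreal c * nconv (\<lambda>x. ennreal (frac_kernel \<alpha> x)) a s"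
        using AE_lborel_singleton[of 0]
      proof eventually_elim
        case (elim s)
        show ?case
        proof
          assume "s < t"
          show "a s \<le> b * ennreal (frac_kernel 1 s) + ennreal c * nconv (\<lambda>x. ennreal (frac_kernel \<alpha> x)) a s"
          proof (cases "0 < s")
            case True then show ?thesis using le[of s] \<open>s < t\<close> Suc.prems by (simp add: frac_kernel_1)
          next
            case False then show ?thesis using elim ca by (simp add: causal_def)
          qed
        qed
      qed
      show "causal (?l (Suc m))" by (simp add: causal_def frac_kernel_def)
    qed
    also have "\<dots> = b * nconv (?l (Suc m)) (\<lambda>s. ennreal (frac_kernel 1 s)) t
        + ennreal c * nconv (nconv (?l (Suc m)) (\<lambda>x. ennreal (frac_kernel \<alpha> x))) a t"
      by (simp add: nconv_add nconv_cmult nconv_assoc)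
    also have "nconv (?l (Suc m)) (\<lambda>s. ennreal (frac_kernel 1 s)) t = ennreal (frac_kernel (\<alpha> * real (Suc m) + 1) t)"
      using al by (intro nconv_frac_kernel) auto
    also have "nconv (?l (Suc m)) (\<lambda>x. ennreal (frac_kernel \<alpha> x)) = ?l (Suc (Suc m))"
    proof -
      have "\<alpha> * real (Suc m) + \<alpha> = \<alpha> * real (Suc (Suc m))" by (simp add: algebra_simps)
      then show ?thesis using al by (auto simp: fun_eq_iff nconv_frac_kernel simp del: of_nat_Suc)
    qed
    finally have n: "nconv (?l (Suc m)) a t \<le> b * ennreal (frac_kernel (\<alpha> * real (Suc m) + 1) t) + ennreal c * nconv (?l (Suc (Suc m))) a t" .
    have e: "ennreal (c ^ Suc m) * ennreal (frac_kernel (\<alpha> * real (Suc m) + 1) t) = ennreal ((c * t powr \<alpha>) ^ Suc m / Gamma (\<alpha> * real (Suc m) + 1))"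
    proof -
      have "t = 0 \<or> 0 < t" using Suc.prems by auto
      then have "c ^ Suc m * frac_kernel (\<alpha> * real (Suc m) + 1) t = (c * t powr \<alpha>) ^ Suc m / Gamma (\<alpha> * real (Suc m) + 1)"
      proof
        assume "0 < t"
        then have "t powr (\<alpha> * real (Suc m)) = (t powr \<alpha>) ^ Suc m"
          by (subst powr_powr[symmetric], subst powr_realpow) auto
        then show ?thesis using \<open>0 < t\<close> by (simp add: frac_kernel_def power_mult_distrib del: of_nat_Suc power_Suc)
      qed (simp add: frac_kernel_def)
      then show ?thesis using c by (subst ennreal_mult[symmetric]) (auto simp: frac_kernel_def Gp[of "Suc m"] less_imp_le simp del: of_nat_Suc)
    qed
    have "a t \<le> b * ?S (Suc m) t + ennreal (c ^ Suc m) * nconv (?l (Suc m)) a t"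
      by (rule Suc.IH[OF Suc.prems])
    also have "\<dots> \<le> b * ?S (Suc m) t + ennreal (c ^ Suc m) * (b * ennreal (frac_kernel (\<alpha> * real (Suc m) + 1) t) + ennreal c * nconv (?l (Suc (Suc m))) a t)"
      by (intro add_left_mono mult_left_mono n) simp
    also have "\<dots> = b * ?S (Suc m) t + b * (ennreal (c ^ Suc m) * ennreal (frac_kernel (\<alpha> * real (Suc m) + 1) t)) + ennreal c * ennreal (c ^ Suc m) * nconv (?l (Suc (Suc m))) a t"
      by (simp add: distrib_left ac_simps)
    also have "\<dots> = b * (?S (Suc m) t + ennreal ((c * t powr \<alpha>) ^ Suc m / Gamma (\<alpha> * real (Suc m) + 1))) + ennreal (c ^ Suc (Suc m)) * nconv (?l (Suc (Suc m))) a t"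
      unfolding e using c by (simp add: distrib_left ennreal_mult)
    also have "?S (Suc m) t + ennreal ((c * t powr \<alpha>) ^ Suc m / Gamma (\<alpha> * real (Suc m) + 1)) = ?S (Suc (Suc m)) t"
      by (subst ennreal_plus[symmetric], rule sum_nonneg[OF pos], rule pos) (simp only: sum.lessThan_Suc)
    finally show ?case .
  qed
  let ?M = "\<Sum>k. (c * t powr \<alpha>) ^ k / Gamma (\<alpha> * real k + 1)"
  have SM: "?S m t \<le> ennreal ?M" for m
    by (intro ennreal_leI sum_le_suminf summable_mittag_leffler al) (auto intro: pos)
  define A where "A = (\<integral>\<^sup>+s\<in>{..T}. a s \<partial>lborel)"
  show ?thesis
  \<comment> \<open>The case t = 0 is separate because T = 0 is then possible, and the remainder
    bound divides by T.\<close>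
  proof (cases "t = 0")
    case True
    have "nconv (\<lambda>x. ennreal (frac_kernel \<alpha> x)) a 0 = 0"
    proof -
      have "ennreal (frac_kernel \<alpha> (0 - s)) * a s = 0" for s
        using ca by (auto simp: frac_kernel_def causal_def)
      then have "nconv (\<lambda>x. ennreal (frac_kernel \<alpha> x)) a 0 = (\<integral>\<^sup>+s. 0 \<partial>(lborel :: real measure))"
        unfolding nconv_def by (intro nn_integral_cong)
      then show ?thesis by simp
    qed
    then have "a t \<le> b" using le[OF t] True by simp
    also have "b * 1 \<le> b * ennreal ?M"
      using SM[of 1] Gp[of 0] by (intro mult_left_mono) auto
    finally show ?thesis by simp
  next
    case False
    then have t0: "0 < t" "t \<le> T" using t by auto
    then have T: "0 < T" by simp
    \<comment> \<open>The supremum over (0,T] of c^m times the kernel of order \<alpha> m is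
      (\<alpha> m / T) (c T^\<alpha>)^m / Gamma(\<alpha> m + 1). Replacing the factor m by 2^m turns
      it into \<alpha> / T times a term of the Mittag-Leffler series at 2 c T^\<alpha>, hence it
      tends to 0.\<close>
    define r where "r m = 1 / T * (\<alpha> * ((2 * (c * T powr \<alpha>)) ^ m / Gamma (\<alpha> * real m + 1)))" for m
    have r0: "0 \<le> r m" for m using T al c Gp[of m] by (simp add: r_def)
    have K: "ennreal (c ^ m) * nconv (?l m) a t \<le> ennreal (r m) * A"
      if m: "1 \<le> \<alpha> * real m" for m
    proof -
      have m0: "0 < \<alpha> * real m" using m by simp
      have G: "0 < Gamma (\<alpha> * real m)" using m0 by (rule Gamma_real_pos)
      have k: "c ^ m * frac_kernel (\<alpha> * real m) x \<le> r m" if "x \<le> T" for x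
      proof (cases "0 < x")
        case True
        have "frac_kernel (\<alpha> * real m) x \<le> T powr (\<alpha> * real m - 1) / Gamma (\<alpha> * real m)"
          using True that m G by (auto simp: frac_kernel_def intro!: divide_right_mono powr_mono2)
        also have "T powr (\<alpha> * real m - 1) = (T powr \<alpha>) ^ m / T"
          using T by (simp add: powr_diff powr_powr[symmetric] powr_realpow)
        also have "Gamma (\<alpha> * real m) = Gamma (\<alpha> * real m + 1) / (\<alpha> * real m)"
        proof -
          have "\<alpha> * real m \<notin> \<int>\<^sub>\<le>\<^sub>0" using m0 by (metis nonpos_Ints_nonpos not_le)
          then show ?thesis using m0 by (simp add: Gamma_plus1)
        qed
        finally have "frac_kernel (\<alpha> * real m) x \<le> (T powr \<alpha>) ^ m / T * (\<alpha> * real m) / Gamma (\<alpha> * real m + 1)"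
          by simp
        also have "\<dots> \<le> (T powr \<alpha>) ^ m / T * (\<alpha> * 2 ^ m) / Gamma (\<alpha> * real m + 1)"
          using T al Gp[of m] of_nat_less_two_power[of m, where 'a=real]
          by (intro divide_right_mono mult_left_mono) auto
        finally have "c ^ m * frac_kernel (\<alpha> * real m) x \<le> c ^ m * ((T powr \<alpha>) ^ m / T * (\<alpha> * 2 ^ m) / Gamma (\<alpha> * real m + 1))"
          using c by (intro mult_left_mono) auto
        also have "\<dots> = r m" by (simp add: r_def power_mult_distrib)
        finally show ?thesis .
      qed (use r0 in \<open>simp add: frac_kernel_def\<close>)
      have "ennreal (c ^ m) * nconv (?l m) a t = (\<integral>\<^sup>+s. ennreal (c ^ m) * (?l m (t - s) * a s) \<partial>lborel)"
        unfolding nconv_def by (rule nn_integral_cmult[symmetric]) measurable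
      also have "\<dots> \<le> (\<integral>\<^sup>+s. ennreal (r m) * (a s * indicator {..T} s) \<partial>lborel)"
      proof (rule nn_integral_mono)
        fix s
        show "ennreal (c ^ m) * (?l m (t - s) * a s) \<le> ennreal (r m) * (a s * indicator {..T} s)"
        proof (cases "0 \<le> s \<and> s < t")
          case True
          have "ennreal (c ^ m) * ?l m (t - s) = ennreal (c ^ m * frac_kernel (\<alpha> * real m) (t - s))"
            using c m0 by (simp add: ennreal_mult frac_kernel_nonneg)
          also have "\<dots> \<le> ennreal (r m)" using True t0 by (intro ennreal_leI k) auto
          finally show ?thesis using True t0 by (simp add: mult.assoc[symmetric] mult_right_mono)
        next
          case False
          then have "?l m (t - s) * a s = 0" using ca by (auto simp: causal_def frac_kernel_def)
          then show ?thesis by (simp only: mult_zero_right)  simp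
        qed
      qed
      also have "\<dots> = ennreal (r m) * A"
        unfolding A_def by (rule nn_integral_cmult) measurable
      finally show ?thesis .
    qed
    have "(\<lambda>m. (2 * (c * T powr \<alpha>)) ^ m / Gamma (\<alpha> * real m + 1)) \<longlonglongrightarrow> 0"
      by (rule summable_LIMSEQ_zero[OF summable_mittag_leffler[OF al]])
    then have "r \<longlonglongrightarrow> 0"
      unfolding r_def[abs_def] by (intro tendsto_mult_right_zero)
    then have "(\<lambda>m. r m * enn2real A) \<longlonglongrightarrow> 0" by (rule tendsto_mult_left_zero)
    then have R: "(\<lambda>m. ennreal (r m * enn2real A)) \<longlonglongrightarrow> 0" by (simp flip: ennreal_0)
    have A: "A = ennreal (enn2real A)" using fin by (simp add: A_def)
    obtain m0 where m0: "1 / \<alpha> < real m0" using reals_Archimedean2 by blast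
    have "\<forall>\<^sub>F m in sequentially. a t \<le> b * ennreal ?M + ennreal (r (Suc m) * enn2real A)"
      using eventually_ge_at_top[of m0]
    proof eventually_elim
      case (elim m)
      then have "1 / \<alpha> \<le> real (Suc m)" using m0 by simp
      then have m: "1 \<le> \<alpha> * real (Suc m)" using al by (simp add: field_simps)
      have "a t \<le> b * ?S (Suc m) t + ennreal (c ^ Suc m) * nconv (?l (Suc m)) a t"
        by (rule step[OF t])
      also have "\<dots> \<le> b * ennreal ?M + ennreal (r (Suc m)) * A"
        by (intro add_mono mult_left_mono SM K m) auto
      also have "ennreal (r (Suc m)) * A = ennreal (r (Suc m) * enn2real A)"
        using r0[of "Suc m"] by (subst A, subst ennreal_mult[symmetric]) auto
      finally show ?case .
    qed
    moreover have "(\<lambda>m. b * ennreal ?M + ennreal (r (Suc m) * enn2real A)) \<longlonglongrightarrow> b * ennreal ?M + 0"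
      by (intro tendsto_add tendsto_const LIMSEQ_Suc[OF R])
    ultimately have "a t \<le> b * ennreal ?M + 0"
      by (intro tendsto_lowerbound) auto
    then show ?thesis by simp
  qed
qed

section \<open>Semicontinuity and continuity of fractional integrals\<close>

lemma frac_kernel_tendsto:
  assumes "X \<longlonglongrightarrow> x" "x \<noteq> 0"
  shows "(\<lambda>n. frac_kernel a (X n)) \<longlonglongrightarrow> frac_kernel a x"
proof (cases "0 < x")
  case True
  then have "(\<lambda>n. X n powr (a - 1) / Gamma a) \<longlonglongrightarrow> x powr (a - 1) / Gamma a"
    using assms(1) unfolding divide_inverse by (intro tendsto_mult tendsto_const tendsto_powr) auto
  moreover have "\<forall>\<^sub>F n in sequentially. X n powr (a - 1) / Gamma a = frac_kernel a (X n)"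
    using order_tendstoD(1)[OF assms(1) True] by eventually_elim (simp add: frac_kernel_def)
  ultimately show ?thesis using True by (auto simp: frac_kernel_def[of a x] elim: Lim_transform_eventually)
next
  case False
  then have "x < 0" using assms by simp
  have "\<forall>\<^sub>F n in sequentially. frac_kernel a (X n) = frac_kernel a x"
    using order_tendstoD(2)[OF assms(1) \<open>x < 0\<close>] by eventually_elim (use \<open>x < 0\<close> in \<open>simp add: frac_kernel_def\<close>)
  then show ?thesis by (rule tendsto_eventually)
qed

text \<open>By Fatou's lemma, \<open>nconv (frac_kernel \<alpha>) h\<close> is lower semicontinuous.\<close>

lemma nconv_frac_kernel_bound_everywhere:
  fixes h :: "real \<Rightarrow> real"
  assumes [measurable]: "h \<in> borel_measurable borel"
    and T: "0 < T"
    and ae: "AE t in lborel. t \<in> {0<..<T} \<longrightarrow> nconv (\<lambda>x. ennreal (frac_kernel \<alpha> x)) (\<lambda>s. ennreal (h s)) t \<le> C"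
    and t: "t \<in> {0..T}"
  shows "nconv (\<lambda>x. ennreal (frac_kernel \<alpha> x)) (\<lambda>s. ennreal (h s)) t \<le> C"
proof -
  obtain X where X: "\<And>n. nconv (\<lambda>x. ennreal (frac_kernel \<alpha> x)) (\<lambda>s. ennreal (h s)) (X n) \<le> C" "X \<longlonglongrightarrow> t"
    using AE_imp_seq[OF ae T t] by blast
  \<comment> \<open>The kernel can be discontinuous only at 0, so along the sequence the integrands
    converge for every s other than t.\<close>
  have "nconv (\<lambda>x. ennreal (frac_kernel \<alpha> x)) (\<lambda>s. ennreal (h s)) t
     = (\<integral>\<^sup>+s. liminf (\<lambda>n. ennreal (frac_kernel \<alpha> (X n - s)) * ennreal (h s)) \<partial>lborel)"
    unfolding nconv_def
  proof (rule nn_integral_cong_AE)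
    show "AE s in lborel. ennreal (frac_kernel \<alpha> (t - s)) * ennreal (h s) = liminf (\<lambda>n. ennreal (frac_kernel \<alpha> (X n - s)) * ennreal (h s))"
      using AE_lborel_singleton[of t]
    proof eventually_elim
      case (elim s)
      have "(\<lambda>n. frac_kernel \<alpha> (X n - s)) \<longlonglongrightarrow> frac_kernel \<alpha> (t - s)"
        by (rule frac_kernel_tendsto) (use X elim in \<open>auto intro!: tendsto_intros\<close>)
      then have "(\<lambda>n. ennreal (frac_kernel \<alpha> (X n - s)) * ennreal (h s)) \<longlonglongrightarrow> ennreal (frac_kernel \<alpha> (t - s)) * ennreal (h s)"
        by (intro tendsto_mult_ennreal tendsto_ennrealI tendsto_const) auto
      then show ?case by (intro lim_imp_Liminf[symmetric]) auto
    qed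
  qed
  also have "\<dots> \<le> liminf (\<lambda>n. nconv (\<lambda>x. ennreal (frac_kernel \<alpha> x)) (\<lambda>s. ennreal (h s)) (X n))"
    unfolding nconv_def by (rule nn_integral_liminf) measurable
  also have "\<dots> \<le> liminf (\<lambda>n::nat. C)"
    by (rule Liminf_mono) (use X in auto)
  finally show ?thesis by (simp add: Liminf_const)
qed

text \<open>For \<alpha> \<le> 1 the kernel decreases on the positive axis, so the absolute value
  resolves into the t1-kernel minus the t2-kernel before t1 and the t2-kernel alone after t1. With K
  the kernel of order \<alpha> + 1 the integral is 2 K(t2 - t1) + K(t1) - K(t2), and K(t1) \<le>
  K(t2).\<close>

lemma nn_integral_abs_frac_kernel_diff_le:
  assumes a: "0 < \<alpha>" "\<alpha> \<le> 1" and t: "0 \<le> t1" "t1 \<le> t2"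
  shows "(\<integral>\<^sup>+s\<in>{0..}. ennreal \<bar>frac_kernel \<alpha> (t2 - s) - frac_kernel \<alpha> (t1 - s)\<bar> \<partial>lborel)
     \<le> ennreal (2 * frac_kernel (\<alpha> + 1) (t2 - t1))"
proof -
  let ?D = "\<lambda>s. \<bar>frac_kernel \<alpha> (t2 - s) - frac_kernel \<alpha> (t1 - s)\<bar>"
  have k0: "0 \<le> frac_kernel \<alpha> x" for x using a by (simp add: frac_kernel_nonneg)
  have I: "(\<integral>\<^sup>+s. ennreal (frac_kernel \<alpha> (t - s)) * indicator {r..} s \<partial>lborel) = ennreal (frac_kernel (\<alpha> + 1) (t - r))"
    for t r
  proof -
    have "(\<integral>\<^sup>+s. ennreal (frac_kernel \<alpha> (t - s)) * indicator {r..} s \<partial>lborel)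
      = (\<integral>\<^sup>+s. ennreal (frac_kernel \<alpha> s) * indicator {..t - r} s \<partial>lborel)"
      by (subst nn_integral_real_affine[of _ "-1" t]) (auto intro!: nn_integral_cong simp: indicator_def)
    then show ?thesis using nn_integral_frac_kernel[OF a(1)] by simp
  qed
  \<comment> \<open>The integral of the t2-kernel is added on both sides so that no subtraction of
    extended values occurs; being finite, it cancels at the end.\<close>
  have "(\<integral>\<^sup>+s\<in>{0..}. ennreal (?D s) \<partial>lborel) + ennreal (frac_kernel (\<alpha> + 1) t2)
     = (\<integral>\<^sup>+s. ennreal (?D s) * indicator {0..} s + ennreal (frac_kernel \<alpha> (t2 - s)) * indicator {0..} s \<partial>lborel)"
    by (subst nn_integral_add) (auto simp: I)
  also have "\<dots> = (\<integral>\<^sup>+s. ennreal (frac_kernel \<alpha> (t1 - s)) * indicator {0..} s + 2 * (ennreal (frac_kernel \<alpha> (t2 - s)) * indicator {t1..} s) \<partial>lborel)"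
  proof (rule nn_integral_cong_AE)
    show "AE s in lborel. ennreal (?D s) * indicator {0..} s + ennreal (frac_kernel \<alpha> (t2 - s)) * indicator {0..} s
      = ennreal (frac_kernel \<alpha> (t1 - s)) * indicator {0..} s + 2 * (ennreal (frac_kernel \<alpha> (t2 - s)) * indicator {t1..} s)"
      using AE_lborel_singleton[of t1]
    proof eventually_elim
      case (elim s)
      consider "s < 0" | "0 \<le> s" "s < t1" | "0 \<le> s" "t1 < s" using elim by linarith
      then show ?case
      proof cases
        case 1 then show ?thesis using t by (simp add: indicator_def)
      next
        case 2
        have "frac_kernel \<alpha> (t2 - s) \<le> frac_kernel \<alpha> (t1 - s)"
          using 2 t a Gamma_real_pos[of \<alpha>] by (auto simp: frac_kernel_def intro!: divide_right_mono powr_mono2')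
        then show ?thesis using 2 k0 by (simp add: indicator_def ennreal_plus[symmetric] del: ennreal_plus)
      next
        case 3
        then have "frac_kernel \<alpha> (t1 - s) = 0" by (simp add: frac_kernel_def)
        then show ?thesis using 3 k0 by (simp add: indicator_def mult_2)
      qed
    qed
  qed
  also have "\<dots> = ennreal (frac_kernel (\<alpha> + 1) t1) + 2 * ennreal (frac_kernel (\<alpha> + 1) (t2 - t1))"
    using I[of t1 0] I[of t2 t1] by (subst nn_integral_add) (auto simp: nn_integral_cmult)
  also have "\<dots> \<le> ennreal (2 * frac_kernel (\<alpha> + 1) (t2 - t1)) + ennreal (frac_kernel (\<alpha> + 1) t2)"
  proof -
    have "frac_kernel (\<alpha> + 1) t1 \<le> frac_kernel (\<alpha> + 1) t2"
      using t a Gamma_real_pos[of "\<alpha> + 1"] by (auto simp: frac_kernel_def intro!: divide_right_mono powr_mono2)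
    then show ?thesis using a
      by (simp add: ennreal_mult frac_kernel_nonneg add.commute ennreal_leI add_left_mono)
  qed
  finally show ?thesis by (simp add: ennreal_add_left_cancel_le add.commute[of _ "ennreal (frac_kernel (\<alpha> + 1) t2)"])
qed

text \<open>Square integrability of h alone does not give continuity when \<alpha> \<le> 1/2. The
  weighted bound does: in |h| \<le> e |h|^2 + 1/e the first term contributes at most 2 C e to an
  increment, uniformly in the two times, and the second is controlled by the L1 modulus of
  continuity of the kernel.\<close>

lemma continuous_on_conv_frac_kernel:
  fixes h :: "real \<Rightarrow> 'b::{banach, second_countable_topology}"
  assumes [measurable]: "h \<in> borel_measurable borel" and c: "causal h"
    and a: "0 < \<alpha>" "\<alpha> \<le> 1"
    and C: "\<And>t. t \<in> {0..T} \<Longrightarrow> nconv (\<lambda>x. ennreal (frac_kernel \<alpha> x)) (\<lambda>s. ennreal ((norm (h s))\<^sup>2)) t \<le> ennreal C"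
  shows "continuous_on {0..T} (conv (frac_kernel \<alpha>) h)"
    and "\<And>t. t \<in> {0..T} \<Longrightarrow> nconv (\<lambda>x. ennreal (frac_kernel \<alpha> x)) (enorm h) t < \<infinity>"
proof -
  have k0: "0 \<le> frac_kernel \<alpha> x" for x using a by (simp add: frac_kernel_nonneg)
  have amgm: "x \<le> e * x\<^sup>2 + 1 / e" if "0 < e" for e x :: real
  proof -
    have "0 \<le> (e * x - 1)\<^sup>2 + e * x" if "0 \<le> x" using that \<open>0 < e\<close> by auto
    then have "e * x \<le> e * (e * x\<^sup>2 + 1 / e)" if "0 \<le> x" using that \<open>0 < e\<close>
      by (simp add: power2_eq_square algebra_simps)
    moreover have "0 \<le> e * x\<^sup>2 + 1 / e" using that by simp
    ultimately show ?thesis using that by (cases "0 \<le> x") (simp add: mult_le_cancel_left, linarith)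
  qed
  show fin: "nconv (\<lambda>x. ennreal (frac_kernel \<alpha> x)) (enorm h) t < \<infinity>" if t: "t \<in> {0..T}" for t
  proof -
    have "nconv (\<lambda>x. ennreal (frac_kernel \<alpha> x)) (enorm h) t
      \<le> nconv (\<lambda>x. ennreal (frac_kernel \<alpha> x)) (\<lambda>s. ennreal ((norm (h s))\<^sup>2) + ennreal (frac_kernel 1 s)) t"
    proof (rule nconv_mono_AE)
      show "AE s in lborel. s < t \<longrightarrow> enorm h s \<le> ennreal ((norm (h s))\<^sup>2) + ennreal (frac_kernel 1 s)"
        using AE_lborel_singleton[of 0]
        by eventually_elim
           (use c amgm[of 1] in \<open>auto simp: causal_def frac_kernel_1 indicator_def ennreal_leI simp flip: ennreal_1 ennreal_plus\<close>)
    qed (simp add: causal_def frac_kernel_def)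
    also have "\<dots> \<le> ennreal C + ennreal (frac_kernel (\<alpha> + 1) t)"
      using a C[OF t] by (simp add: nconv_add nconv_frac_kernel add_right_mono)
    also have "\<dots> < \<infinity>" by (simp add: less_top[symmetric])
    finally show ?thesis .
  qed
  \<comment> \<open>C is an arbitrary real number and \<open>ennreal\<close> sends negative values
    to 0, so \<open>max C 0\<close> gives the same bound.\<close>
  have C0: "0 \<le> max C 0" and C': "t \<in> {0..T} \<Longrightarrow> nconv (\<lambda>x. ennreal (frac_kernel \<alpha> x)) (\<lambda>s. ennreal ((norm (h s))\<^sup>2)) t \<le> ennreal (max C 0)" for t
    using C[of t] by (auto simp: max_def ennreal_neg split: if_splits)
  have E: "ennreal (e * (p * n) + e * (q * n) + 1 / e * d)
      = ennreal e * (ennreal p * ennreal n) + ennreal e * (ennreal q * ennreal n) + ennreal (1 / e) * ennreal d"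
    if "0 < e" "0 \<le> p" "0 \<le> q" "0 \<le> n" "0 \<le> d" for e p q n d
    using that by (simp add: ennreal_plus[symmetric] ennreal_mult[symmetric] del: ennreal_plus)
  have main: "norm (conv (frac_kernel \<alpha>) h t2 - conv (frac_kernel \<alpha>) h t1) \<le> 2 * max C 0 * e + 2 * frac_kernel (\<alpha> + 1) (t2 - t1) / e"
    if t: "0 \<le> t1" "t1 \<le> t2" "t2 \<le> T" and e: "0 < e" for t1 t2 e
  proof -
    let ?D = "\<lambda>s. \<bar>frac_kernel \<alpha> (t2 - s) - frac_kernel \<alpha> (t1 - s)\<bar>"
    have int: "integrable lborel (\<lambda>s. frac_kernel \<alpha> (t - s) *\<^sub>R h s)" if "t \<in> {0..T}" for t
      using fin[OF that] k0 by (intro conv_integrable) auto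
    have i1: "integrable lborel (\<lambda>s. frac_kernel \<alpha> (t1 - s) *\<^sub>R h s)" and i2: "integrable lborel (\<lambda>s. frac_kernel \<alpha> (t2 - s) *\<^sub>R h s)"
      using t by (auto intro!: int)
    have "ennreal (norm (conv (frac_kernel \<alpha>) h t2 - conv (frac_kernel \<alpha>) h t1))
      = ennreal (norm (LINT s|lborel. (frac_kernel \<alpha> (t2 - s) - frac_kernel \<alpha> (t1 - s)) *\<^sub>R h s))"
      unfolding conv_def using i1 i2 by (simp add: scaleR_diff_left)
    also have "\<dots> \<le> (\<integral>\<^sup>+s. ennreal (norm ((frac_kernel \<alpha> (t2 - s) - frac_kernel \<alpha> (t1 - s)) *\<^sub>R h s)) \<partial>lborel)"
      by (rule integral_norm_bound_ennreal) (use i1 i2 in \<open>auto simp: scaleR_diff_left\<close>)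
    also have "\<dots> \<le> (\<integral>\<^sup>+s. ennreal e * (ennreal (frac_kernel \<alpha> (t2 - s)) * ennreal ((norm (h s))\<^sup>2)) + ennreal e * (ennreal (frac_kernel \<alpha> (t1 - s)) * ennreal ((norm (h s))\<^sup>2)) + ennreal (1 / e) * (ennreal (?D s) * indicator {0..} s) \<partial>lborel)"
    proof (rule nn_integral_mono)
      fix s
      show "ennreal (norm ((frac_kernel \<alpha> (t2 - s) - frac_kernel \<alpha> (t1 - s)) *\<^sub>R h s))
        \<le> ennreal e * (ennreal (frac_kernel \<alpha> (t2 - s)) * ennreal ((norm (h s))\<^sup>2)) + ennreal e * (ennreal (frac_kernel \<alpha> (t1 - s)) * ennreal ((norm (h s))\<^sup>2)) + ennreal (1 / e) * (ennreal (?D s) * indicator {0..} s)"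
      proof (cases "0 \<le> s")
        case True
        have "?D s * norm (h s) \<le> ?D s * (e * (norm (h s))\<^sup>2 + 1 / e)"
          by (intro mult_left_mono amgm e) simp
        also have "\<dots> = e * (?D s * (norm (h s))\<^sup>2) + 1 / e * ?D s" by (simp add: algebra_simps)
        also have "\<dots> \<le> e * ((frac_kernel \<alpha> (t2 - s) + frac_kernel \<alpha> (t1 - s)) * (norm (h s))\<^sup>2) + 1 / e * ?D s"
          using k0[of "t2 - s"] k0[of "t1 - s"] e
          by (intro add_right_mono mult_left_mono mult_right_mono) auto
        finally have "?D s * norm (h s) \<le> e * (frac_kernel \<alpha> (t2 - s) * (norm (h s))\<^sup>2) + e * (frac_kernel \<alpha> (t1 - s) * (norm (h s))\<^sup>2) + 1 / e * ?D s"
          by (simp add: algebra_simps)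
        then have "ennreal (?D s * norm (h s)) \<le> ennreal (e * (frac_kernel \<alpha> (t2 - s) * (norm (h s))\<^sup>2) + e * (frac_kernel \<alpha> (t1 - s) * (norm (h s))\<^sup>2) + 1 / e * ?D s)"
          by (rule ennreal_leI)
        also have "\<dots> = ennreal e * (ennreal (frac_kernel \<alpha> (t2 - s)) * ennreal ((norm (h s))\<^sup>2)) + ennreal e * (ennreal (frac_kernel \<alpha> (t1 - s)) * ennreal ((norm (h s))\<^sup>2)) + ennreal (1 / e) * (ennreal (?D s) * indicator {0..} s)"
          using e k0 True by (subst E) auto
        finally show ?thesis by simp
      qed (use c in \<open>simp add: causal_def\<close>)
    qed
    also have "\<dots> = ennreal e * nconv (\<lambda>x. ennreal (frac_kernel \<alpha> x)) (\<lambda>s. ennreal ((norm (h s))\<^sup>2)) t2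
       + ennreal e * nconv (\<lambda>x. ennreal (frac_kernel \<alpha> x)) (\<lambda>s. ennreal ((norm (h s))\<^sup>2)) t1
       + ennreal (1 / e) * (\<integral>\<^sup>+s\<in>{0..}. ennreal (?D s) \<partial>lborel)"
      unfolding nconv_def by (simp add: nn_integral_add nn_integral_cmult)
    also have "\<dots> \<le> ennreal e * ennreal (max C 0) + ennreal e * ennreal (max C 0) + ennreal (1 / e) * ennreal (2 * frac_kernel (\<alpha> + 1) (t2 - t1))"
      by (intro add_mono mult_left_mono C' nn_integral_abs_frac_kernel_diff_le) (use t a in auto)
    also have "\<dots> = ennreal (2 * max C 0 * e + 2 * frac_kernel (\<alpha> + 1) (t2 - t1) / e)"
      using e C0 a frac_kernel_nonneg[of "\<alpha> + 1" "t2 - t1"]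
      by (simp add: ennreal_mult[symmetric] ennreal_plus[symmetric] algebra_simps del: ennreal_plus)
    finally show ?thesis
      using e C0 a frac_kernel_nonneg[of "\<alpha> + 1" "t2 - t1"] by (subst (asm) ennreal_le_iff) auto
  qed
  show "continuous_on {0..T} (conv (frac_kernel \<alpha>) h)"
  proof (rule uniformly_continuous_imp_continuous, unfold uniformly_continuous_on_def, intro allI impI)
    fix r :: real assume r: "0 < r"
    \<comment> \<open>This e makes the first part of the increment at most r/2. The d below solves 2
      d^\<alpha> / (Gamma(\<alpha> + 1) e) = r/4, which leaves room for a strict inequality.\<close>
    define e where "e = r / (4 * (max C 0 + 1))"
    have e: "0 < e" "2 * max C 0 * e < r / 2 \<or> 2 * max C 0 * e \<le> r / 2" using r C0 by (auto simp: e_def field_simps)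
    define G where "G = Gamma (\<alpha> + 1)"
    have G: "0 < G" using a by (auto simp: G_def intro: Gamma_real_pos)
    define d where "d = (r * e * G / 8) powr (1 / \<alpha>)"
    have d: "0 < d" using r e G by (simp add: d_def)
    have F: "2 * frac_kernel (\<alpha> + 1) x / e < r / 2" if "0 \<le> x" "x < d" for x
    proof (cases "0 < x")
      case True
      have "x powr \<alpha> < d powr \<alpha>" using True that a by (intro powr_less_mono2) auto
      also have "d powr \<alpha> = r * e * G / 8" using r e G a by (simp add: d_def powr_powr)
      finally have "x powr \<alpha> / G < r * e / 8" using G by (simp add: field_simps)
      moreover have "frac_kernel (\<alpha> + 1) x = x powr \<alpha> / G" using True by (simp add: frac_kernel_def G_def)
      moreover have "0 < r * e" using r e by simp
      ultimately have "2 * frac_kernel (\<alpha> + 1) x < r / 2 * e" by linarith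
      then show ?thesis using e by (simp add: pos_divide_less_eq)
    qed (use r in \<open>simp add: frac_kernel_def\<close>)
    show "\<exists>d>0. \<forall>x\<in>{0..T}. \<forall>x'\<in>{0..T}. dist x' x < d \<longrightarrow> dist (conv (frac_kernel \<alpha>) h x') (conv (frac_kernel \<alpha>) h x) < r"
    proof (intro exI conjI ballI impI)
      fix x x' assume x: "x \<in> {0..T}" "x' \<in> {0..T}" "dist x' x < d"
      have *: "norm (conv (frac_kernel \<alpha>) h t2 - conv (frac_kernel \<alpha>) h t1) < r" if "0 \<le> t1" "t1 \<le> t2" "t2 \<le> T" "t2 - t1 < d" for t1 t2
        using main[OF that(1-3) e(1)] F[of "t2 - t1"] that e(2) by linarith
      show "dist (conv (frac_kernel \<alpha>) h x') (conv (frac_kernel \<alpha>) h x) < r"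
        using *[of x x'] *[of x' x] x by (cases "x \<le> x'") (auto simp: dist_norm norm_minus_commute)
    qed (rule d)
  qed
qed

section \<open>Regularization of the fractional kernel\<close>

text \<open>Kernels are compared through their primitives, where the semigroup law is available.
  Finiteness of the primitives lets the extended values be replaced by real ones on each half-line
  below n.\<close>

lemma AE_eq_of_nn_integral_lessThan_eq:
  fixes a b :: "real \<Rightarrow> ennreal"
  assumes [measurable]: "a \<in> borel_measurable borel" "b \<in> borel_measurable borel"
    and eq: "\<And>t. (\<integral>\<^sup>+s\<in>{..<t}. a s \<partial>lborel) = (\<integral>\<^sup>+s\<in>{..<t}. b s \<partial>lborel)"
    and fin: "\<And>t. (\<integral>\<^sup>+s\<in>{..<t}. a s \<partial>lborel) < \<infinity>"
  shows "AE s in lborel. a s = b s"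
proof -
  have *: "AE s in lborel. s < real n \<longrightarrow> a s = b s" for n :: nat
  proof -
    define z where "z c s = enn2real (c s * indicator {..<real n} s)" for c :: "real \<Rightarrow> ennreal" and s
    have [measurable]: "z c \<in> borel_measurable borel" if "c \<in> borel_measurable borel" for c
      using that unfolding z_def[abs_def] by measurable
    have f: "AE s in lborel. c s * indicator {..<real n} s < \<infinity>" 
      if "c \<in> borel_measurable borel" "(\<integral>\<^sup>+s\<in>{..<real n}. c s \<partial>lborel) < \<infinity>" for c
      using nn_integral_noteq_infinite[of "\<lambda>s. c s * indicator {..<real n} s" lborel] that
      by (auto simp: less_top)
    have zz: "integrable lborel (z c)" "(LINT s:{..<t}|lborel. z c s) = enn2real (\<integral>\<^sup>+s\<in>{..<min t (real n)}. c s \<partial>lborel)"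
      if c[measurable]: "c \<in> borel_measurable borel" and cf: "(\<integral>\<^sup>+s\<in>{..<real n}. c s \<partial>lborel) < \<infinity>" for c t
    proof -
      have e: "(\<integral>\<^sup>+s. ennreal (z c s) \<partial>lborel) = (\<integral>\<^sup>+s\<in>{..<real n}. c s \<partial>lborel)"
        by (rule nn_integral_cong_AE) (use f[OF c cf] in eventually_elim, simp add: z_def)
      show "integrable lborel (z c)"
        by (rule integrableI_nonneg) (use cf e in \<open>auto simp: z_def\<close>)
      have "(LINT s:{..<t}|lborel. z c s) = enn2real (\<integral>\<^sup>+s. ennreal (indicator {..<t} s *\<^sub>R z c s) \<partial>lborel)"
        unfolding set_lebesgue_integral_def
        by (rule integral_eq_nn_integral) (auto simp: z_def)
      also have "(\<integral>\<^sup>+s. ennreal (indicator {..<t} s *\<^sub>R z c s) \<partial>lborel) = (\<integral>\<^sup>+s\<in>{..<min t (real n)}. c s \<partial>lborel)"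
        by (rule nn_integral_cong_AE)
           (use f[OF c cf] in eventually_elim, auto simp: z_def indicator_def)
      finally show "(LINT s:{..<t}|lborel. z c s) = enn2real (\<integral>\<^sup>+s\<in>{..<min t (real n)}. c s \<partial>lborel)" .
    qed
    have fb: "(\<integral>\<^sup>+s\<in>{..<t}. b s \<partial>lborel) < \<infinity>" for t using fin eq by simp
    have si: "set_integrable lborel {..<t} (z c)" if "integrable lborel (z c)" for c t
      using that unfolding set_integrable_def by (intro integrable_mult_indicator) auto
    have "AE s in lborel. s < real n \<longrightarrow> z a s - z b s = 0"
    proof (rule AE_zero_of_integral_lessThan_zero)
      show "integrable lborel (\<lambda>s. z a s - z b s)" using zz(1) fin fb by auto
      fix t assume "t < real n"
      show "(LINT s:{..<t}|lborel. z a s - z b s) = 0"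
        by (subst set_integral_diff(2)) (use zz fin fb eq in \<open>auto intro!: si\<close>)
    qed
    then show ?thesis using f[OF assms(1) fin] f[OF assms(2) fb]
    proof eventually_elim
      case (elim s)
      show ?case
      proof
        assume "s < real n"
        then have "enn2real (a s) = enn2real (b s)" "a s < top_class.top" "b s < top_class.top" using elim by (auto simp: z_def)
        then show "a s = b s" by (metis ennreal_enn2real)
      qed
    qed
  qed
  have "AE s in lborel. \<forall>n::nat. s < real n \<longrightarrow> a s = b s"
    by (subst AE_all_countable) (use * in blast)
  then show ?thesis by eventually_elim (use reals_Archimedean2 in blast)
qed

text \<open>In terms of Laplace transforms, \<open>r\<close> is determined by \<open>1 - R(z) = (z / (z + n)) powr \<alpha>\<close>.
  Its explicit form is a mixture of exponential densities with a Beta-distributed rate, which makes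
  positivity evident.\<close>

lemma frac_kernel_regularization:
  assumes \<alpha>: "0 < \<alpha>" "\<alpha> < 1" and n: "0 < n"
  obtains r :: "real \<Rightarrow> real" where "r \<in> borel_measurable borel" "causal r" "\<And>x. 0 \<le> r x"
    "\<And>t. (\<integral>\<^sup>+s\<in>{..t}. ennreal (r s) \<partial>lborel) \<le> 1"
    "AE x in lborel. ennreal (frac_kernel \<alpha> x)
       = nconv (\<lambda>x. ennreal (frac_kernel \<alpha> x)) (\<lambda>x. ennreal (r x)) x + ennreal (exp (- n * x) * frac_kernel \<alpha> x)"
proof -
  \<comment> \<open>This is the density of the Beta(\<alpha>, 1 - \<alpha>) distribution on (0,1),
    and \<open>q\<close> averages the exponential densities of rate n x against it. \<open>e\<close>
    is the exponentially tempered kernel; the goal is that the fractional kernel minus its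
    convolution with r equals \<open>e\<close>.\<close>
  define b where "b x = frac_kernel (1 - \<alpha>) (1 - x) * frac_kernel \<alpha> x" for x
  define e where "e x = exp (- n * x) * frac_kernel \<alpha> x" for x
  define q where "q t = (\<integral>\<^sup>+x. ennreal (n * x * exp (- n * t * x)) * ennreal (b x) \<partial>lborel)" for t
  define r where "r t = (if 0 < t then enn2real (q t) else 0)" for t
  let ?l = "\<lambda>x. ennreal (frac_kernel \<alpha> x)" and ?p = "\<lambda>x. ennreal (frac_kernel 1 x)"
    and ?k = "\<lambda>x. ennreal (frac_kernel (1 - \<alpha>) x)" and ?e = "\<lambda>x. ennreal (e x)" and ?r = "\<lambda>x. ennreal (r x)"
  have k0: "0 \<le> frac_kernel \<alpha> x" "0 \<le> frac_kernel (1 - \<alpha>) x" for x using \<alpha> by (auto simp: frac_kernel_nonneg)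
  have b0: "0 \<le> b x" for x using k0 by (simp add: b_def)
  have bz: "b x = 0" if "x \<le> 0 \<or> 1 \<le> x" for x using that by (auto simp: b_def frac_kernel_def)
  have [measurable]: "b \<in> borel_measurable borel" "e \<in> borel_measurable borel"
    unfolding b_def[abs_def] e_def[abs_def] by measurable
  have [measurable]: "q \<in> borel_measurable borel" unfolding q_def[abs_def] by measurable
  have [measurable]: "r \<in> borel_measurable borel" unfolding r_def[abs_def] by measurable
  have ib: "(\<integral>\<^sup>+x. ennreal (b x) \<partial>lborel) = 1"
  proof -
    have "(\<integral>\<^sup>+x. ennreal (b x) \<partial>lborel) = nconv ?k ?l 1"
      unfolding nconv_def b_def using k0 by (simp add: ennreal_mult)
    then show ?thesis using \<alpha> by (simp add: nconv_frac_kernel frac_kernel_1)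
  qed
  \<comment> \<open>The rates n x stay below n since \<open>b\<close> lives on (0,1); this finite
    bound allows passing from \<open>q\<close> to the real-valued \<open>r\<close>.\<close>
  have qn: "q t \<le> ennreal n" if "0 < t" for t
  proof -
    have "q t \<le> (\<integral>\<^sup>+x. ennreal n * ennreal (b x) \<partial>lborel)"
      unfolding q_def
    proof (rule nn_integral_mono)
      fix x show "ennreal (n * x * exp (- n * t * x)) * ennreal (b x) \<le> ennreal n * ennreal (b x)"
      proof (cases "0 < x \<and> x < 1")
        case True
        have "x * exp (- n * t * x) \<le> 1 * 1" using True that n by (intro mult_mono) auto
        then have "n * x * exp (- n * t * x) \<le> n" using n by (simp add: mult.assoc)
        then show ?thesis by (intro mult_right_mono ennreal_leI) auto
      qed (use bz[of x] in auto)
    qed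
    also have "\<dots> = ennreal n" by (simp add: nn_integral_cmult ib)
    finally show ?thesis .
  qed
  have rq: "ennreal (r t) = q t" if "0 < t" for t
    using qn[OF that] that by (auto simp: r_def ennreal_enn2real_if top_unique)
  have r0: "0 \<le> r x" for x by (simp add: r_def)
  have cr: "causal r" by (simp add: causal_def r_def)
  \<comment> \<open>Integrating the exponential density of rate n x up to t gives 1 - e^(-n t x)
    under the mixture.\<close>
  have pr: "nconv ?p ?r t = (\<integral>\<^sup>+x. ennreal (1 - exp (- n * t * x)) * ennreal (b x) \<partial>lborel)" if t: "0 < t" for t
  proof -
    have "nconv ?p ?r t = (\<integral>\<^sup>+s. \<integral>\<^sup>+x. ennreal (n * x * exp (- n * s * x)) * ennreal (b x) * indicator {0<..<t} s \<partial>lborel \<partial>lborel)"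
      unfolding nconv_frac_kernel_1
    proof (rule nn_integral_cong)
      fix s :: real
      show "ennreal (r s) * indicator {..<t} s = (\<integral>\<^sup>+x. ennreal (n * x * exp (- n * s * x)) * ennreal (b x) * indicator {0<..<t} s \<partial>lborel)"
      proof (cases "0 < s \<and> s < t")
        case True then show ?thesis using rq[of s] by (simp add: q_def)
      next
        case False then show ?thesis by (auto simp: r_def indicator_def)
      qed
    qed
    also have "\<dots> = (\<integral>\<^sup>+x. \<integral>\<^sup>+s. ennreal (n * x * exp (- n * s * x)) * ennreal (b x) * indicator {0<..<t} s \<partial>lborel \<partial>lborel)"
      by (rule lborel_pair.Fubini') measurable
    also have "\<dots> = (\<integral>\<^sup>+x. ennreal (1 - exp (- n * t * x)) * ennreal (b x) \<partial>lborel)"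
    proof (rule nn_integral_cong)
      fix x :: real
      show "(\<integral>\<^sup>+s. ennreal (n * x * exp (- n * s * x)) * ennreal (b x) * indicator {0<..<t} s \<partial>lborel)
        = ennreal (1 - exp (- n * t * x)) * ennreal (b x)"
      proof (cases "0 < x")
        case True
        have "(\<integral>\<^sup>+s. ennreal (n * x * exp (- n * s * x)) * indicator {0<..<t} s \<partial>lborel)
          = (\<integral>\<^sup>+s. ennreal (n * x * exp (- n * s * x)) * indicator {0..t} s \<partial>lborel)"
          by (rule nn_integral_cong_AE)
             (use AE_lborel_singleton[of 0] AE_lborel_singleton[of t] in eventually_elim, auto simp: indicator_def)
        also have "\<dots> = ennreal ((- exp (- n * t * x)) - (- exp (- n * 0 * x)))"
          by (rule nn_integral_FTC_Icc)
             (use True n t in \<open>auto intro!: derivative_eq_intros simp: less_imp_le\<close>)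
        finally have "(\<integral>\<^sup>+s. ennreal (n * x * exp (- n * s * x)) * indicator {0<..<t} s \<partial>lborel) = ennreal (1 - exp (- n * t * x))"
          by simp
        moreover have "(\<integral>\<^sup>+s. ennreal (n * x * exp (- n * s * x)) * ennreal (b x) * indicator {0<..<t} s \<partial>lborel)
          = (\<integral>\<^sup>+s. (ennreal (n * x * exp (- n * s * x)) * indicator {0<..<t} s) * ennreal (b x) \<partial>lborel)"
          by (intro nn_integral_cong) (simp add: ac_simps)
        ultimately show ?thesis by (simp add: nn_integral_multc)
      qed (use bz[of x] in auto)
    qed
    finally show ?thesis .
  qed
  \<comment> \<open>The scaling s = t x removes every power of t, since the two kernel exponents add
    up to -1, and leaves the Laplace transform of the same Beta distribution.\<close>
  have ke: "nconv ?k ?e t = (\<integral>\<^sup>+x. ennreal (exp (- n * t * x)) * ennreal (b x) \<partial>lborel)" if t: "0 < t" for t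
  proof -
    have "nconv ?k ?e t = ennreal t * (\<integral>\<^sup>+x. ?k (t - t * x) * ?e (t * x) \<partial>lborel)"
      unfolding nconv_def using t by (subst nn_integral_real_affine[of _ t 0]) simp_all
    also have "\<dots> = (\<integral>\<^sup>+x. ennreal t * (?k (t - t * x) * ?e (t * x)) \<partial>lborel)"
      by (rule nn_integral_cmult[symmetric]) measurable
    also have "\<dots> = (\<integral>\<^sup>+x. ennreal (exp (- n * t * x)) * ennreal (b x) \<partial>lborel)"
    proof (rule nn_integral_cong)
      fix x :: real
      have eq: "t * (frac_kernel (1 - \<alpha>) (t - t * x) * frac_kernel \<alpha> (t * x)) = b x"
      proof (cases "0 < x \<and> x < 1")
        case True
        have "t - t * x = t * (1 - x)" by (simp add: algebra_simps)
        moreover have "t * (t powr (- \<alpha>) * t powr (\<alpha> - 1)) = 1"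
          using t by (subst powr_add[symmetric]) (simp add: powr_neg_one)
        moreover have "t * (t powr (- \<alpha>) * y1 / g1 * (t powr (\<alpha> - 1) * y2 / g2)) = (t * (t powr (- \<alpha>) * t powr (\<alpha> - 1))) * (y1 / g1 * (y2 / g2))"
          for y1 y2 g1 g2 by simp
        ultimately show ?thesis using True t
          by (simp add: b_def frac_kernel_def powr_mult)
      next
        case False
        then have "b x = 0" by (intro bz) auto
        moreover have "frac_kernel (1 - \<alpha>) (t - t * x) * frac_kernel \<alpha> (t * x) = 0"
          using False t by (auto simp: frac_kernel_def zero_less_mult_iff)
        ultimately show ?thesis by simp
      qed
      have "ennreal t * (?k (t - t * x) * ?e (t * x)) = ennreal (t * (frac_kernel (1 - \<alpha>) (t - t * x) * frac_kernel \<alpha> (t * x)) * exp (- n * t * x))"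
        using t k0 by (simp add: e_def ennreal_mult[symmetric] mult_ac)
      also have "\<dots> = ennreal (exp (- n * t * x)) * ennreal (b x)"
        unfolding eq using b0[of x] by (simp add: ennreal_mult[symmetric] mult_ac)
      finally show "ennreal t * (?k (t - t * x) * ?e (t * x)) = ennreal (exp (- n * t * x)) * ennreal (b x)" .
    qed
    finally show ?thesis .
  qed
  \<comment> \<open>The exponentials cancel and the total Beta mass 1 remains. This single relation
    yields both the mass bound on r and the kernel identity.\<close>
  have sum1: "nconv ?p ?r t + nconv ?k ?e t = ?p t" for t
  proof (cases "0 < t")
    case True
    have "nconv ?p ?r t + nconv ?k ?e t = (\<integral>\<^sup>+x. ennreal (1 - exp (- n * t * x)) * ennreal (b x) + ennreal (exp (- n * t * x)) * ennreal (b x) \<partial>lborel)"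
      unfolding pr[OF True] ke[OF True] by (rule nn_integral_add[symmetric]) measurable
    also have "\<dots> = (\<integral>\<^sup>+x. ennreal (b x) \<partial>lborel)"
    proof (rule nn_integral_cong)
      fix x :: real
      show "ennreal (1 - exp (- n * t * x)) * ennreal (b x) + ennreal (exp (- n * t * x)) * ennreal (b x) = ennreal (b x)"
      proof (cases "0 < x")
        case x: True
        then have "ennreal (1 - exp (- n * t * x)) + ennreal (exp (- n * t * x)) = 1"
          using True n by (subst ennreal_plus[symmetric]) auto
        then show ?thesis by (simp only: distrib_right[symmetric] mult_1_left)
      qed (use bz[of x] in auto)
    qed
    finally have "nconv ?p ?r t + nconv ?k ?e t = 1" unfolding ib .
    then show ?thesis using True by (simp only: frac_kernel_1) simp
  next
    case False
    have z: "nconv ?p ?r t = 0" "nconv ?k ?e t = 0"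
    proof -
      have "?p (t - s) * ?r s = 0" "?k (t - s) * ?e s = 0" for s
        using False by (cases "0 < s"; simp add: frac_kernel_def r_def e_def)+
      then show "nconv ?p ?r t = 0" "nconv ?k ?e t = 0"
        unfolding nconv_def by (simp_all only: nn_integral_const mult_zero_left)
    qed
    show ?thesis unfolding z using False by (simp add: frac_kernel_1)
  qed
  \<comment> \<open>Convolution with \<open>frac_kernel 1\<close> integrates over an open half-line,
    hence the shift from t to t + 1.\<close>
  have r1: "(\<integral>\<^sup>+s\<in>{..t}. ennreal (r s) \<partial>lborel) \<le> 1" for t
  proof -
    have "(\<integral>\<^sup>+s\<in>{..t}. ennreal (r s) \<partial>lborel) \<le> (\<integral>\<^sup>+s\<in>{..<t+1}. ennreal (r s) \<partial>lborel)"
      by (intro nn_integral_mono mult_left_mono indicator_leI) auto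
    also have "\<dots> = nconv ?p ?r (t + 1)" by (rule nconv_frac_kernel_1[symmetric])
    also have "\<dots> \<le> nconv ?p ?r (t + 1) + nconv ?k ?e (t + 1)" by simp
    also have "\<dots> = ?p (t + 1)" by (rule sum1)
    also have "\<dots> \<le> 1" by (simp add: frac_kernel_1 indicator_def)
    finally show ?thesis .
  qed
  \<comment> \<open>The relation \<open>sum1\<close> is convolved with the kernel of order \<alpha>,
    whose convolution with the kernel of order 1 - \<alpha> is the Heaviside function. Both sides of
    the kernel identity thus have the same primitive.\<close>
  have mm: "(\<integral>\<^sup>+s\<in>{..<t}. (nconv ?l ?r s + ?e s) \<partial>lborel) = (\<integral>\<^sup>+s\<in>{..<t}. ?l s \<partial>lborel)" for t
  proof -
    have "nconv ?p (\<lambda>s. nconv ?l ?r s + ?e s) t = nconv ?p (nconv ?l ?r) t + nconv ?p ?e t"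
      by (rule nconv_add) measurable
    also have "nconv ?p (nconv ?l ?r) t = nconv (nconv ?l ?p) ?r t"
    proof -
      have "nconv ?p ?l = nconv ?l ?p" by (rule ext, rule nconv_commute) measurable
      moreover have "nconv ?p (nconv ?l ?r) t = nconv (nconv ?p ?l) ?r t" by (rule nconv_assoc) measurable
      ultimately show ?thesis by simp
    qed
    also have "\<dots> = nconv ?l (nconv ?p ?r) t" by (rule nconv_assoc[symmetric]) measurable
    also have "nconv ?p ?e t = nconv (nconv ?l ?k) ?e t"
    proof -
      have "nconv ?l ?k = ?p" by (rule ext) (use \<alpha> in \<open>simp add: nconv_frac_kernel\<close>)
      then show ?thesis by simp
    qed
    also have "\<dots> = nconv ?l (nconv ?k ?e) t" by (rule nconv_assoc[symmetric]) measurable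
    also have "nconv ?l (nconv ?p ?r) t + nconv ?l (nconv ?k ?e) t = nconv ?l (\<lambda>s. nconv ?p ?r s + nconv ?k ?e s) t"
      by (rule nconv_add[symmetric]) measurable
    also have "\<dots> = nconv ?l ?p t" unfolding sum1 ..
    also have "\<dots> = nconv ?p ?l t" by (rule nconv_commute) measurable
    finally show ?thesis unfolding nconv_frac_kernel_1 .
  qed
  have "AE s in lborel. nconv ?l ?r s + ?e s = ?l s"
  proof (rule AE_eq_of_nn_integral_lessThan_eq[OF _ _ mm])
    fix t
    have "(\<integral>\<^sup>+s\<in>{..<t}. ?l s \<partial>lborel) \<le> (\<integral>\<^sup>+s\<in>{..t}. ?l s \<partial>lborel)"
      by (intro nn_integral_mono mult_left_mono indicator_leI) auto
    also have "\<dots> < \<infinity>" using \<alpha> by (simp add: nn_integral_frac_kernel)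
    finally show "(\<integral>\<^sup>+s\<in>{..<t}. (nconv ?l ?r s + ?e s) \<partial>lborel) < \<infinity>" unfolding mm .
  qed measurable
  then have "AE x in lborel. ?l x = nconv ?l ?r x + ennreal (exp (- n * x) * frac_kernel \<alpha> x)"
    by eventually_elim (simp add: e_def)
  from that[OF _ cr r0 r1 this] show ?thesis by measurable
qed

section \<open>Continuity of translations in L1; Gamma densities as approximate identities\<close>

lemma integral_indicator_translation_tendsto:
  fixes A :: "real set"
  assumes A: "A \<in> sets lborel" "emeasure lborel A < \<infinity>" and x: "x \<longlonglongrightarrow> 0"
  shows "(\<lambda>n. LINT t|lborel. \<bar>indicator A (t - x n) - indicator A t\<bar> :: real) \<longlonglongrightarrow> 0"
proof (rule LIMSEQ_I)
  fix e :: real assume e: "0 < e"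
  have Al: "A \<in> lmeasurable" by (rule fmeasurableI) (use A in simp_all)
  \<comment> \<open>Inner regularity gives a closed set at the cost of e/10; intersecting it with a
    large bounded interval makes it compact and costs another e/10.\<close>
  obtain K where K: "compact K" "K \<subseteq> A" "emeasure lebesgue (A - K) < ennreal (e / 5)"
  proof -
    obtain F where F: "closed F" "F \<subseteq> A" "emeasure lebesgue (A - F) < ennreal (e / 10)"
    proof (rule sets_lebesgue_inner_closed[of A "e / 10"])
      show "A \<in> sets lebesgue" by (rule fmeasurableD[OF Al])
    qed (use e in simp_all)
    have [measurable]: "A \<in> sets borel" "F \<in> sets borel" using A(1) F(1) by (auto simp: borel_closed)
    have "(\<lambda>m. emeasure lborel (A - {- real m..real m})) \<longlonglongrightarrow> emeasure lborel (\<Inter>m. A - {- real m..real m})"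
    proof (rule Lim_emeasure_decseq)
      show "emeasure lborel (A - {- real m..real m}) \<noteq> \<infinity>" for m
        using emeasure_mono[of "A - {- real m..real m}" A lborel] A by (auto simp: top_unique)
    qed (auto simp: decseq_def)
    also have "(\<Inter>m. A - {- real m..real m}) = {}"
    proof -
      have "\<exists>m. x \<in> {- real m..real m}" for x :: real
        using real_arch_simple[of "\<bar>x\<bar>"] by (auto simp: abs_le_iff minus_le_iff)
      then show ?thesis by blast
    qed
    finally have "(\<lambda>m. emeasure lborel (A - {- real m..real m})) \<longlonglongrightarrow> 0" by simp
    moreover have "0 < ennreal (e / 10)" using e by simp
    ultimately have "\<forall>\<^sub>F m in sequentially. emeasure lborel (A - {- real m..real m}) < ennreal (e / 10)"
      by (rule order_tendstoD(2))
    then obtain m where m: "emeasure lborel (A - {- real m..real m}) < ennreal (e / 10)"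
      by (auto simp: eventually_sequentially)
    show ?thesis
    proof (rule that[of "F \<inter> {- real m..real m}"])
      show "compact (F \<inter> {- real m..real m})" using F(1) by (intro closed_Int_compact) auto
      show "F \<inter> {- real m..real m} \<subseteq> A" using F by auto
      have "emeasure lborel (A - F \<inter> {- real m..real m}) \<le> emeasure lborel ((A - F) \<union> (A - {- real m..real m}))"
        by (intro emeasure_mono) auto
      also have "\<dots> \<le> emeasure lborel (A - F) + emeasure lborel (A - {- real m..real m})"
        by (rule emeasure_subadditive) auto
      also have "\<dots> < ennreal (e / 10) + ennreal (e / 10)"
        using F(3) m by (intro add_strict_mono) auto
      also have "\<dots> = ennreal (e / 5)" using e by (subst ennreal_plus[symmetric]) auto
      finally show "emeasure lebesgue (A - F \<inter> {- real m..real m}) < ennreal (e / 5)" by simp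
    qed
  qed
  obtain U where U: "open U" "A \<subseteq> U" "emeasure lebesgue (U - A) < ennreal (e / 5)"
  proof (rule sets_lebesgue_outer_open[of A "e / 5"])
    show "A \<in> sets lebesgue" by (rule fmeasurableD[OF Al])
  qed (use e in simp_all)
  \<comment> \<open>For |r| < d below, the translate of K by r stays in U. A point in just one of A
    and its translate therefore lies in \<open>B\<close>, in \<open>C\<close>, or in a translate of
    one of them; these four sets have measure below e/5 each.\<close>
  define B C where "B = A - K" and "C = U - A"
  have [measurable]: "A \<in> sets borel" "B \<in> sets borel" "C \<in> sets borel"
    using A K(1) U(1) by (auto simp: B_def C_def borel_compact)
  have B: "emeasure lborel B < ennreal (e / 5)" and C: "emeasure lborel C < ennreal (e / 5)"
    using K(3) U(3) by (auto simp: B_def[symmetric] C_def[symmetric])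
  have iA: "integrable lborel (indicator A :: real \<Rightarrow> real)" 
    using A by (intro integrable_real_indicator) auto
  have iB: "integrable lborel (indicator B :: real \<Rightarrow> real)" and iC: "integrable lborel (indicator C :: real \<Rightarrow> real)"
    using less_trans[OF B ennreal_less_top] less_trans[OF C ennreal_less_top]
    by (auto intro!: integrable_real_indicator)
  have mB: "measure lborel B < e / 5" and mC: "measure lborel C < e / 5"
    using B C less_trans[OF B ennreal_less_top] less_trans[OF C ennreal_less_top]
    by (simp_all add: emeasure_eq_ennreal_measure ennreal_less_iff)
  have sh: "integrable lborel (\<lambda>t. f (t - r))" "(LINT t|lborel. f (t - r)) = (LINT t|lborel. f t)"
    if "integrable lborel f" for f :: "real \<Rightarrow> real" and r
    using lborel_integrable_real_affine[OF that, of 1 "-r"] lborel_integral_real_affine[of 1 f "-r"] by (auto simp: add.commute)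
  obtain d where d: "0 < d" "\<And>t r. t \<in> K \<Longrightarrow> \<bar>r\<bar> < d \<Longrightarrow> t + r \<in> U"
  proof -
    have "\<exists>d>0. (\<Union>t\<in>K. ball t d) \<subseteq> U"
      by (rule compact_subset_open_imp_ball_epsilon_subset[OF K(1) U(1)]) (use K U in auto)
    then obtain d where d: "0 < d" "(\<Union>t\<in>K. ball t d) \<subseteq> U" by blast
    show ?thesis
    proof (rule that[OF d(1)])
      fix t r :: real assume "t \<in> K" "\<bar>r\<bar> < d"
      moreover have "t + r \<in> ball t d" using \<open>\<bar>r\<bar> < d\<close> by (simp add: dist_real_def)
      ultimately show "t + r \<in> U" using d(2) by blast
    qed
  qed
  have bound: "(LINT t|lborel. \<bar>indicator A (t - r) - indicator A t\<bar> :: real) < e" if r: "\<bar>r\<bar> < d" for r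
  proof -
    have "(LINT t|lborel. \<bar>indicator A (t - r) - indicator A t\<bar> :: real)
      \<le> (LINT t|lborel. (indicator B (t - r) + indicator C (t - r)) + (indicator B t + indicator C t))"
    proof (rule integral_mono)
      fix t
      show "\<bar>indicator A (t - r) - indicator A t\<bar> \<le> (indicator B (t - r) + indicator C (t - r) + (indicator B t + indicator C t) :: real)"
      proof -
        have "t - r \<in> K \<Longrightarrow> t \<in> U" "t \<in> K \<Longrightarrow> t - r \<in> U"
          using d(2)[of "t - r" r] d(2)[of t "-r"] r by auto
        then show ?thesis
          by (cases "t \<in> A"; cases "t - r \<in> A"; cases "t \<in> K"; cases "t - r \<in> K")
             (simp_all add: B_def C_def indicator_def)
      qed
    qed (use iA iB iC sh(1)[OF iA, of r] sh(1)[OF iB, of r] sh(1)[OF iC, of r] in auto)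
    also have "\<dots> = (measure lborel B + measure lborel C) + (measure lborel B + measure lborel C)"
      using iB iC sh[OF iB, of r] sh[OF iC, of r] by simp
    also have "\<dots> < e" using mB mC e by simp
    finally show ?thesis .
  qed
  have "\<forall>\<^sub>F n in sequentially. \<bar>x n\<bar> < d"
    using x d(1) by (auto dest!: tendstoD simp: dist_real_def)
  then obtain N where "\<And>n. n \<ge> N \<Longrightarrow> \<bar>x n\<bar> < d" by (auto simp: eventually_sequentially)
  then show "\<exists>N. \<forall>n\<ge>N. norm ((LINT t|lborel. \<bar>indicator A (t - x n) - indicator A t\<bar> :: real) - 0) < e"
    using bound by (intro exI[of _ N]) auto
qed

lemma lborel_integral_translation:
  fixes f :: "real \<Rightarrow> 'b::{banach, second_countable_topology}"
  shows "integrable lborel f \<Longrightarrow> integrable lborel (\<lambda>t. f (t - r))"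
    and "(LINT t|lborel. f (t - r)) = (LINT t|lborel. f t)"
  using lborel_integrable_real_affine[of f 1 "-r"] lborel_integral_real_affine[of 1 f "-r"] by auto

text \<open>Density argument: indicators are settled above. For a limit of dominated simple
  functions the increment splits into two approximation errors, of equal integral by translation
  invariance, and the increment of the approximant.\<close>

lemma integral_translation_tendsto:
  fixes f :: "real \<Rightarrow> 'b::{banach, second_countable_topology}"
  assumes "integrable lborel f" and x: "x \<longlonglongrightarrow> 0"
  shows "(\<lambda>n. LINT t|lborel. norm (f (t - x n) - f t)) \<longlonglongrightarrow> 0"
  using assms(1)
proof (induct rule: integrable_induct)
  case (base A c)
  have "(\<lambda>n. (LINT t|lborel. \<bar>indicator A (t - x n) - indicator A t\<bar>) * norm c) \<longlonglongrightarrow> 0"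
    by (rule tendsto_mult_left_zero, rule integral_indicator_translation_tendsto) (use base x in auto)
  then show ?case by (simp add: scaleR_diff_left[symmetric])
next
  case (add f g)
  note int = add(1,3) lborel_integral_translation(1)[OF add(1)] lborel_integral_translation(1)[OF add(3)]
  have "(LINT t|lborel. norm (f (t - x n) + g (t - x n) - (f t + g t)))
     \<le> (LINT t|lborel. norm (f (t - x n) - f t)) + (LINT t|lborel. norm (g (t - x n) - g t))" for n
    by (subst Bochner_Integration.integral_add[symmetric])
       (auto intro!: integral_mono Bochner_Integration.integrable_add Bochner_Integration.integrable_diff
          integrable_norm int norm_diff_triangle_ineq)
  then show ?case
    by (intro tendsto_sandwich[OF _ _ tendsto_const tendsto_add_zero[OF add(2,4)]] always_eventually) auto
next
  case (lim f s)
  note int = lim(1,5) lborel_integral_translation(1)[OF lim(1)] lborel_integral_translation(1)[OF lim(5)]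
  have L: "(\<lambda>i. LINT t|lborel. norm (s i t - f t)) \<longlonglongrightarrow> (LINT t|(lborel::real measure). 0)"
  proof (rule integral_dominated_convergence[where w = "\<lambda>t. 3 * norm (f t)"])
    show "AE t in lborel. (\<lambda>i. norm (s i t - f t)) \<longlonglongrightarrow> 0"
      using lim(3) by (intro AE_I2) (auto intro!: tendsto_norm_zero simp: LIM_zero_iff)
    show "AE t in lborel. norm (norm (s i t - f t)) \<le> 3 * norm (f t)" for i
    proof (rule AE_I2)
      fix t
      have "norm (s i t) \<le> 2 * norm (f t)" by (rule lim(4)) simp
      then show "norm (norm (s i t - f t)) \<le> 3 * norm (f t)"
        using norm_triangle_ineq4[of "s i t" "f t"] by simp
    qed
  qed (use int in auto)
  show ?case
  proof (rule LIMSEQ_I)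
    fix e :: real assume e: "0 < e"
    obtain i where i: "(LINT t|lborel. norm (s i t - f t)) < e / 3"
      using LIMSEQ_D[OF L, of "e / 3"] e by auto
    obtain N where N: "\<And>n. n \<ge> N \<Longrightarrow> (LINT t|lborel. norm (s i (t - x n) - s i t)) < e / 3"
      using LIMSEQ_D[OF lim(2)[of i], of "e / 3"] e by auto
    have "(LINT t|lborel. norm (f (t - x n) - f t)) < e" if n: "n \<ge> N" for n
    proof -
      have I: "integrable lborel (\<lambda>t. norm (s i t - f t))" using int by auto
      have "(LINT t|lborel. norm (f (t - x n) - f t))
        \<le> (LINT t|lborel. norm (s i (t - x n) - f (t - x n)) + norm (s i (t - x n) - s i t) + norm (s i t - f t))"
      proof (rule integral_mono)
        fix t
        have "f (t - x n) - f t = - (s i (t - x n) - f (t - x n)) + (s i (t - x n) - s i t) + (s i t - f t)" by simp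
        moreover have "norm (- a + b + c) \<le> norm a + norm b + norm c" for a b c :: 'b
          using norm_triangle_ineq[of "- a + b" c] norm_triangle_ineq[of "- a" b] by simp
        ultimately show "norm (f (t - x n) - f t) \<le> norm (s i (t - x n) - f (t - x n)) + norm (s i (t - x n) - s i t) + norm (s i t - f t)"
          by (simp only:)
      qed (use int in auto)
      also have "\<dots> = (LINT t|lborel. norm (s i t - f t)) + (LINT t|lborel. norm (s i (t - x n) - s i t)) + (LINT t|lborel. norm (s i t - f t))"
        using int I lborel_integral_translation(1)[OF I, of "x n"] lborel_integral_translation(2)[of "\<lambda>t. norm (s i t - f t)" "x n"]
        by (subst Bochner_Integration.integral_add) auto
      also have "\<dots> < e" using i N[OF n] by simp
      finally show ?thesis .
    qed
    then show "\<exists>N. \<forall>n\<ge>N. norm ((LINT t|lborel. norm (f (t - x n) - f t)) - 0) < e"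
      by (intro exI[of _ N]) auto
  qed
qed

lemma nn_integral_translation:
  fixes r :: real
  assumes [measurable]: "f \<in> borel_measurable borel"
  shows "(\<integral>\<^sup>+t. f (t - r) \<partial>lborel) = (\<integral>\<^sup>+t. f t \<partial>lborel)"
  by (subst (2) nn_integral_real_affine[of _ 1 "-r"]) auto

lemma ennreal_tendsto_zeroI:
  fixes f :: "nat \<Rightarrow> ennreal"
  assumes "\<And>e::real. 0 < e \<Longrightarrow> \<forall>\<^sub>F n in sequentially. f n \<le> ennreal e"
  shows "f \<longlonglongrightarrow> 0"
proof (rule order_tendstoI)
  fix a :: ennreal assume "0 < a"
  then obtain e where e: "0 < e" "e < a" using dense by blast
  have "e < top_class.top" using e(2) by (rule less_le_trans) simp
  then have "0 < enn2real e" "ennreal (enn2real e) = e"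
    using e(1) by (auto simp: enn2real_positive_iff)
  then show "\<forall>\<^sub>F n in sequentially. f n < a"
    using assms[of "enn2real e"] e by (auto elim!: eventually_mono intro: le_less_trans)
qed simp

lemma mult_le_weighted_squares:
  fixes a b d :: real
  assumes "0 < d"
  shows "a * b \<le> a\<^sup>2 / d + d * b\<^sup>2"
proof -
  have "0 \<le> (a - d * b)\<^sup>2 + a\<^sup>2 + (d * b)\<^sup>2" by simp
  then have "d * (a * b) \<le> d * (a\<^sup>2 / d + d * b\<^sup>2)"
    using assms by (simp add: power2_eq_square algebra_simps)
  then show ?thesis using assms by simp
qed

text \<open>The truncation \<open>w \<le> M + w * indicator {w > M}\<close> reduces weighted translation continuity
  to translation continuity in \<open>L\<^sup>1\<close>.\<close>

lemma weighted_translation_tendsto: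
  fixes h :: "real \<Rightarrow> 'b::{banach, second_countable_topology}" and w :: "real \<Rightarrow> real"
  assumes h: "integrable lborel h" and h2: "integrable lborel (\<lambda>t. (norm (h t))\<^sup>2)"
    and [measurable]: "w \<in> borel_measurable borel" and w0: "\<And>t. 0 \<le> w t"
    and w2: "integrable lborel (\<lambda>t. (w t)\<^sup>2)" and x: "x \<longlonglongrightarrow> 0"
  shows "(\<lambda>n. \<integral>\<^sup>+t. ennreal (w t * norm (h (t - x n) - h t)) \<partial>lborel) \<longlonglongrightarrow> 0"
proof (rule ennreal_tendsto_zeroI)
  fix e :: real assume e: "0 < e"
  have [measurable]: "h \<in> borel_measurable borel" using h by auto
  define H where "H = (LINT t|lborel. (norm (h t))\<^sup>2)"
  have H0: "0 \<le> H" by (simp add: H_def)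
  have nH: "(\<integral>\<^sup>+t. ennreal ((norm (h t))\<^sup>2) \<partial>lborel) = ennreal H"
    unfolding H_def by (rule nn_integral_eq_integral[OF h2]) simp
  \<comment> \<open>Error budget: e/4 from the bounded part of the weight, e/2 from 2/d times the
    integral of the squared tail \<open>v M\<close>, and 2 d H \<le> e/6 from h and its translate
    together.\<close>
  define d where "d = e / (12 * (H + 1))"
  have d: "0 < d" "12 * d * H \<le> e" using e H0 by (auto simp: d_def field_simps)
  define v where "v M t = (if real M < w t then w t else 0)" for M :: nat and t
  have [measurable]: "v M \<in> borel_measurable borel" for M unfolding v_def[abs_def] by measurable
  have "(\<lambda>M. LINT t|lborel. (v M t)\<^sup>2) \<longlonglongrightarrow> (LINT t|(lborel::real measure). 0)"
  proof (rule integral_dominated_convergence[OF _ _ w2])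
    show "AE t in lborel. (\<lambda>M. (v M t)\<^sup>2) \<longlonglongrightarrow> 0"
    proof (rule AE_I2)
      fix t
      obtain N where "w t < real N" using reals_Archimedean2 by blast
      then have "\<forall>\<^sub>F M in sequentially. (v M t)\<^sup>2 = 0"
        by (intro eventually_mono[OF eventually_ge_at_top[of N]]) (auto simp: v_def)
      then show "(\<lambda>M. (v M t)\<^sup>2) \<longlonglongrightarrow> 0" by (rule tendsto_eventually)
    qed
  qed (auto simp: v_def)
  from LIMSEQ_D[OF this, of "e * d / 4"] e d
  obtain M where M: "(LINT t|lborel. (v M t)\<^sup>2) < e * d / 4" by auto
  have v2: "integrable lborel (\<lambda>t. (v M t)\<^sup>2)"
    by (rule Bochner_Integration.integrable_bound[OF w2]) (auto simp: v_def)
  have nv: "(\<integral>\<^sup>+t. ennreal ((v M t)\<^sup>2) \<partial>lborel) \<le> ennreal (e * d / 4)"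
    using M by (subst nn_integral_eq_integral[OF v2]) (auto intro: ennreal_leI)
  have "\<forall>\<^sub>F n in sequentially. (LINT t|lborel. norm (h (t - x n) - h t)) < e / (4 * (real M + 1))"
    using integral_translation_tendsto[OF h x] e by (intro order_tendstoD(2)) auto
  then show "\<forall>\<^sub>F n in sequentially. (\<integral>\<^sup>+t. ennreal (w t * norm (h (t - x n) - h t)) \<partial>lborel) \<le> ennreal e"
  proof eventually_elim
    case (elim n)
    have ih: "integrable lborel (\<lambda>t. norm (h (t - x n) - h t))"
      using h lborel_integral_translation(1)[OF h] by auto
    have p: "w t * norm (h (t - x n) - h t)
      \<le> real M * norm (h (t - x n) - h t) + (2 / d * (v M t)\<^sup>2 + (d * (norm (h (t - x n)))\<^sup>2 + d * (norm (h t))\<^sup>2))" for t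
    proof -
      have "w t \<le> real M + v M t" by (auto simp: v_def)
      then have "w t * norm (h (t - x n) - h t) \<le> (real M + v M t) * norm (h (t - x n) - h t)"
        by (rule mult_right_mono) simp
      also have "v M t * norm (h (t - x n) - h t) \<le> v M t * (norm (h (t - x n)) + norm (h t))"
        using w0[of t] by (intro mult_left_mono norm_triangle_ineq4) (auto simp: v_def)
      then have "(real M + v M t) * norm (h (t - x n) - h t)
         \<le> real M * norm (h (t - x n) - h t) + (v M t * norm (h (t - x n)) + v M t * norm (h t))"
        by (simp add: algebra_simps)
      also have "v M t * norm (h (t - x n)) + v M t * norm (h t) \<le> 2 / d * (v M t)\<^sup>2 + (d * (norm (h (t - x n)))\<^sup>2 + d * (norm (h t))\<^sup>2)"
        using mult_le_weighted_squares[OF d(1), of "v M t" "norm (h (t - x n))"]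
          mult_le_weighted_squares[OF d(1), of "v M t" "norm (h t)"] by simp
      finally show ?thesis by simp
    qed
    have "(\<integral>\<^sup>+t. ennreal (w t * norm (h (t - x n) - h t)) \<partial>lborel)
      \<le> (\<integral>\<^sup>+t. ennreal (real M) * ennreal (norm (h (t - x n) - h t)) + (ennreal (2 / d) * ennreal ((v M t)\<^sup>2)
          + (ennreal d * ennreal ((norm (h (t - x n)))\<^sup>2) + ennreal d * ennreal ((norm (h t))\<^sup>2))) \<partial>lborel)"
    proof (rule nn_integral_mono)
      fix t
      show "ennreal (w t * norm (h (t - x n) - h t)) \<le> ennreal (real M) * ennreal (norm (h (t - x n) - h t)) + (ennreal (2 / d) * ennreal ((v M t)\<^sup>2)
          + (ennreal d * ennreal ((norm (h (t - x n)))\<^sup>2) + ennreal d * ennreal ((norm (h t))\<^sup>2)))"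
        using ennreal_leI[OF p[of t]] d(1)
        by (simp add: ennreal_mult del: times_divide_eq_left times_divide_eq_right)
    qed
    also have "\<dots> = ennreal (real M) * (\<integral>\<^sup>+t. ennreal (norm (h (t - x n) - h t)) \<partial>lborel)
        + (ennreal (2 / d) * (\<integral>\<^sup>+t. ennreal ((v M t)\<^sup>2) \<partial>lborel)
        + (ennreal d * (\<integral>\<^sup>+t. ennreal ((norm (h (t - x n)))\<^sup>2) \<partial>lborel) + ennreal d * (\<integral>\<^sup>+t. ennreal ((norm (h t))\<^sup>2) \<partial>lborel)))"
      by (simp add: nn_integral_add nn_integral_cmult)
    also have "(\<integral>\<^sup>+t. ennreal ((norm (h (t - x n)))\<^sup>2) \<partial>lborel) = ennreal H"
      using nn_integral_translation[of "\<lambda>t. ennreal ((norm (h t))\<^sup>2)" "x n"] nH by simp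
    also have "ennreal (real M) * (\<integral>\<^sup>+t. ennreal (norm (h (t - x n) - h t)) \<partial>lborel)
        + (ennreal (2 / d) * (\<integral>\<^sup>+t. ennreal ((v M t)\<^sup>2) \<partial>lborel)
        + (ennreal d * ennreal H + ennreal d * (\<integral>\<^sup>+t. ennreal ((norm (h t))\<^sup>2) \<partial>lborel)))
      \<le> ennreal (real M) * ennreal (e / (4 * (real M + 1))) + (ennreal (2 / d) * ennreal (e * d / 4) + (ennreal d * ennreal H + ennreal d * ennreal H))"
    proof (intro add_mono mult_left_mono nv)
      show "(\<integral>\<^sup>+t. ennreal (norm (h (t - x n) - h t)) \<partial>lborel) \<le> ennreal (e / (4 * (real M + 1)))"
        using elim by (subst nn_integral_eq_integral[OF ih]) (auto intro!: ennreal_leI)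
    qed (use nH in auto)
    also have "\<dots> = ennreal (real M * (e / (4 * (real M + 1))) + (2 / d * (e * d / 4) + (d * H + d * H)))"
      using d(1) H0 e by (simp add: ennreal_mult[symmetric] ennreal_plus[symmetric] del: ennreal_plus)
    also have "\<dots> \<le> ennreal e"
    proof (rule ennreal_leI)
      have "real M * (e / (4 * (real M + 1))) \<le> e / 4"
        using e by (simp add: field_simps)
      moreover have "2 / d * (e * d / 4) = e / 2" using d(1) by simp
      moreover have "d * H + d * H \<le> e / 6" using d(2) by (simp add: mult.assoc mult.commute)
      moreover have "A + (B + D) \<le> e" if "A \<le> e / 4" "B = e / 2" "D \<le> e / 6" for A B D
        using that e by linarith
      ultimately show "real M * (e / (4 * (real M + 1))) + (2 / d * (e * d / 4) + (d * H + d * H)) \<le> e"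
        by blast
    qed
    finally show ?case .
  qed
qed

text \<open>As q is a probability density, h(t) is itself the average of the constant h(t), and the
  difference becomes an average of increments.\<close>

lemma norm_conv_diff_le:
  fixes h :: "real \<Rightarrow> 'b::{banach, second_countable_topology}"
  assumes [measurable]: "q \<in> borel_measurable borel" "h \<in> borel_measurable borel"
    and q0: "\<And>x. 0 \<le> q x" and q1: "(\<integral>\<^sup>+x. ennreal (q x) \<partial>lborel) = 1"
  shows "ennreal (norm (conv q h t - h t)) \<le> (\<integral>\<^sup>+x. ennreal (q x) * ennreal (norm (h (t - x) - h t)) \<partial>lborel)"
proof (cases "(\<integral>\<^sup>+x. ennreal (q x) * ennreal (norm (h (t - x) - h t)) \<partial>lborel) < \<infinity>")
  case True
  have "integrable lborel q" by (rule integrableI_nonneg) (use q0 q1 in auto)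
  have I1: "(LINT x|lborel. q x) = 1"
    using q0 q1 by (subst integral_eq_nn_integral) auto
  have i1: "integrable lborel (\<lambda>x. q x *\<^sub>R h t)" using \<open>integrable lborel q\<close> by auto
  have i2: "integrable lborel (\<lambda>x. q x *\<^sub>R (h (t - x) - h t))"
  proof (rule integrableI_bounded)
    show "(\<integral>\<^sup>+ x. ennreal (norm (q x *\<^sub>R (h (t - x) - h t))) \<partial>lborel) < \<infinity>"
      using True q0 by (simp add: ennreal_mult)
    show "(\<lambda>x. q x *\<^sub>R (h (t - x) - h t)) \<in> borel_measurable lborel" by measurable
  qed
  have "conv q h t = (LINT x|lborel. q x *\<^sub>R h (t - x))"
    unfolding conv_def by (subst lborel_integral_real_affine[of "-1" _ t]) simp_all
  also have "\<dots> = (LINT x|lborel. q x *\<^sub>R (h (t - x) - h t) + q x *\<^sub>R h t)"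
    by (simp add: scaleR_diff_right)
  also have "\<dots> = (LINT x|lborel. q x *\<^sub>R (h (t - x) - h t)) + (LINT x|lborel. q x *\<^sub>R h t)"
    by (rule Bochner_Integration.integral_add[OF i2 i1])
  also have "(LINT x|lborel. q x *\<^sub>R h t) = h t"
    using I1 \<open>integrable lborel q\<close> by simp
  finally have "conv q h t - h t = (LINT x|lborel. q x *\<^sub>R (h (t - x) - h t))" by simp
  then have "ennreal (norm (conv q h t - h t)) \<le> (\<integral>\<^sup>+x. ennreal (norm (q x *\<^sub>R (h (t - x) - h t))) \<partial>lborel)"
    using integral_norm_bound_ennreal[OF i2] by simp
  then show ?thesis using q0 by (simp add: ennreal_mult)
qed (simp add: less_top[symmetric])

text \<open>The weight is the density of the Gamma distribution with shape \<alpha> and rate n;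
  scaling by n reduces it to rate 1.\<close>

lemma gamma_density_rescale:
  fixes g :: "real \<Rightarrow> ennreal"
  assumes a: "0 < \<alpha>" and n: "0 < n" and [measurable]: "g \<in> borel_measurable borel"
  shows "(\<integral>\<^sup>+x. ennreal (n powr \<alpha> * (exp (- n * x) * frac_kernel \<alpha> x)) * g x \<partial>lborel)
    = (\<integral>\<^sup>+x. ennreal (exp (- x) * frac_kernel \<alpha> x) * g (x / n) \<partial>lborel)"
proof -
  have "(\<integral>\<^sup>+x. ennreal (n powr \<alpha> * (exp (- n * x) * frac_kernel \<alpha> x)) * g x \<partial>lborel)
    = ennreal (1 / n) * (\<integral>\<^sup>+x. ennreal (n powr \<alpha> * (exp (- n * (x / n)) * frac_kernel \<alpha> (x / n))) * g (x / n) \<partial>lborel)"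
    using n by (subst nn_integral_real_affine[of _ "1 / n" 0]) auto
  also have "\<dots> = (\<integral>\<^sup>+x. ennreal (1 / n) * (ennreal (n powr \<alpha> * (exp (- n * (x / n)) * frac_kernel \<alpha> (x / n))) * g (x / n)) \<partial>lborel)"
    by (rule nn_integral_cmult[symmetric]) measurable
  also have "\<dots> = (\<integral>\<^sup>+x. ennreal (exp (- x) * frac_kernel \<alpha> x) * g (x / n) \<partial>lborel)"
  proof (rule nn_integral_cong)
    fix x
    have "1 / n * (n powr \<alpha> * (exp (- n * (x / n)) * frac_kernel \<alpha> (x / n))) = exp (- x) * frac_kernel \<alpha> x"
    proof (cases "0 < x")
      case True
      then show ?thesis using n
        by (simp add: frac_kernel_def powr_divide powr_diff field_simps)
    next
      case False
      then show ?thesis using n by (simp add: frac_kernel_def zero_less_divide_iff)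
    qed
    then have "ennreal (1 / n) * ennreal (n powr \<alpha> * (exp (- n * (x / n)) * frac_kernel \<alpha> (x / n))) = ennreal (exp (- x) * frac_kernel \<alpha> x)"
      using n a by (subst ennreal_mult[symmetric]) (auto simp: frac_kernel_nonneg)
    then show "ennreal (1 / n) * (ennreal (n powr \<alpha> * (exp (- n * (x / n)) * frac_kernel \<alpha> (x / n))) * g (x / n)) = ennreal (exp (- x) * frac_kernel \<alpha> x) * g (x / n)"
      by (simp add: mult.assoc[symmetric])
  qed
  finally show ?thesis .
qed

lemma gamma_density_integral:
  assumes a: "0 < \<alpha>"
  shows "(\<integral>\<^sup>+x. ennreal (exp (- x) * frac_kernel \<alpha> x) \<partial>lborel) = 1"
proof -
  have G: "0 < Gamma \<alpha>" using a by (rule Gamma_real_pos)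
  have "((\<lambda>x. x powr (\<alpha> - 1) / exp x) has_integral Gamma \<alpha>) {0..}"
    by (rule Gamma_integral_real[OF a])
  then have "((\<lambda>x. x powr (\<alpha> - 1) / exp x / Gamma \<alpha>) has_integral Gamma \<alpha> / Gamma \<alpha>) {0..}"
    by (rule has_integral_divide)
  then have "((\<lambda>x. if x \<in> {0..} then x powr (\<alpha> - 1) / exp x / Gamma \<alpha> else 0) has_integral 1) UNIV"
    using G by (subst has_integral_restrict_UNIV) simp
  moreover have "(if x \<in> {0..} then x powr (\<alpha> - 1) / exp x / Gamma \<alpha> else 0) = exp (- x) * frac_kernel \<alpha> x" for x
    by (auto simp: frac_kernel_def exp_minus divide_inverse mult_ac)
  ultimately have "((\<lambda>x. exp (- x) * frac_kernel \<alpha> x) has_integral 1) UNIV" by simp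
  from nn_integral_has_integral_lborel[OF _ _ this] a show ?thesis by (simp add: frac_kernel_nonneg)
qed

text \<open>After rescaling, the density stays fixed while the argument x / n of g tends to 0 for
  every x, so dominated convergence applies.\<close>

lemma gamma_density_approx_identity:
  fixes g :: "real \<Rightarrow> ennreal"
  assumes a: "0 < \<alpha>" and [measurable]: "g \<in> borel_measurable borel"
    and bound: "\<And>x. g x \<le> ennreal C" and lim: "\<And>x. x \<longlonglongrightarrow> 0 \<Longrightarrow> (\<lambda>n. g (x n)) \<longlonglongrightarrow> 0"
  shows "(\<lambda>n. \<integral>\<^sup>+x. ennreal (real (Suc n) powr \<alpha> * (exp (- real (Suc n) * x) * frac_kernel \<alpha> x)) * g x \<partial>lborel) \<longlonglongrightarrow> 0"
proof -
  have "(\<lambda>n. \<integral>\<^sup>+x. ennreal (exp (- x) * frac_kernel \<alpha> x) * g (x / real (Suc n)) \<partial>lborel) \<longlonglongrightarrow> (\<integral>\<^sup>+x. 0 \<partial>(lborel::real measure))"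
  proof (rule nn_integral_dominated_convergence[where w = "\<lambda>x. ennreal (exp (- x) * frac_kernel \<alpha> x) * ennreal C"])
    show "(\<integral>\<^sup>+x. ennreal (exp (- x) * frac_kernel \<alpha> x) * ennreal C \<partial>lborel) < \<infinity>"
      by (simp add: nn_integral_multc gamma_density_integral[OF a])
    show "AE x in lborel. ennreal (exp (- x) * frac_kernel \<alpha> x) * g (x / real (Suc n)) \<le> ennreal (exp (- x) * frac_kernel \<alpha> x) * ennreal C" for n
      by (intro AE_I2 mult_left_mono bound) simp
    show "AE x in lborel. (\<lambda>n. ennreal (exp (- x) * frac_kernel \<alpha> x) * g (x / real (Suc n))) \<longlonglongrightarrow> 0"
    proof (rule AE_I2)
      fix x :: real
      have "(\<lambda>n. x / real (Suc n)) \<longlonglongrightarrow> 0"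
        by (rule LIMSEQ_Suc[OF lim_const_over_n])
      from lim[OF this] have "(\<lambda>n. ennreal (exp (- x) * frac_kernel \<alpha> x) * g (x / real (Suc n))) \<longlonglongrightarrow> ennreal (exp (- x) * frac_kernel \<alpha> x) * 0"
        by (intro tendsto_mult_ennreal tendsto_const) auto
      then show "(\<lambda>n. ennreal (exp (- x) * frac_kernel \<alpha> x) * g (x / real (Suc n))) \<longlonglongrightarrow> 0" by simp
    qed
  qed measurable
  moreover have "(\<integral>\<^sup>+x. ennreal (real (Suc n) powr \<alpha> * (exp (- real (Suc n) * x) * frac_kernel \<alpha> x)) * g x \<partial>lborel)
      = (\<integral>\<^sup>+x. ennreal (exp (- x) * frac_kernel \<alpha> x) * g (x / real (Suc n)) \<partial>lborel)" for n
    by (rule gamma_density_rescale[OF a]) auto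
  ultimately show ?thesis by (simp only: nn_integral_const mult_zero_left)
qed

section \<open>The chain inequality\<close>

lemma causal_abs [simp]: "causal g \<Longrightarrow> causal (\<lambda>s. ennreal \<bar>g s :: real\<bar>)"
  by (simp add: causal_def)

text \<open>This is n^\<alpha> times the tempered kernel of the regularization. Hence n^\<alpha>
  (\<delta> - r), applied to the fractional integral of h, is the average of h against a probability
  density that concentrates at 0 as n grows.\<close>

abbreviation gamma_density :: "real \<Rightarrow> real \<Rightarrow> real \<Rightarrow> real" where
  "gamma_density \<alpha> n x \<equiv> n powr \<alpha> * (exp (- n * x) * frac_kernel \<alpha> x)"

text \<open>By Tonelli the weighted error is at most the average, over the translation x, of the
  weighted L1 distance between f and its translate. In the chain inequality the weight 1 serves the
  values and the weight \<open>norm (\<xi> t)\<close> serves the derivative h.\<close>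

lemma conv_gamma_density_tendsto:
  fixes f :: "real \<Rightarrow> 'b::{banach, second_countable_topology}" and w :: "real \<Rightarrow> real"
  assumes a: "0 < \<alpha>" and [measurable]: "f \<in> borel_measurable borel" "w \<in> borel_measurable borel"
    and w0: "\<And>t. 0 \<le> w t"
    and bound: "\<And>x. (\<integral>\<^sup>+t. ennreal (w t * norm (f (t - x) - f t)) \<partial>lborel) \<le> ennreal C"
    and lim: "\<And>x. x \<longlonglongrightarrow> 0 \<Longrightarrow> (\<lambda>n. \<integral>\<^sup>+t. ennreal (w t * norm (f (t - x n) - f t)) \<partial>lborel) \<longlonglongrightarrow> 0"
  shows "(\<lambda>n. \<integral>\<^sup>+t. ennreal (w t) * ennreal (norm (conv (gamma_density \<alpha> (real (Suc n))) f t - f t)) \<partial>lborel) \<longlonglongrightarrow> 0"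
    and "\<And>n. (\<integral>\<^sup>+t. ennreal (w t) * ennreal (norm (conv (gamma_density \<alpha> (real (Suc n))) f t - f t)) \<partial>lborel) \<le> ennreal C"
proof -
  define g where "g x = (\<integral>\<^sup>+t. ennreal (w t * norm (f (t - x) - f t)) \<partial>lborel)" for x
  have [measurable]: "g \<in> borel_measurable borel" unfolding g_def[abs_def] by measurable
  have q0: "0 \<le> gamma_density \<alpha> (real (Suc n)) x" for n x
    using a by (intro mult_nonneg_nonneg) (auto simp: frac_kernel_nonneg)
  have q1: "(\<integral>\<^sup>+x. ennreal (gamma_density \<alpha> (real (Suc n)) x) \<partial>lborel) = 1" for n
    using gamma_density_rescale[OF a, of "real (Suc n)" "\<lambda>_. 1"] gamma_density_integral[OF a] by simp
  have le: "(\<integral>\<^sup>+t. ennreal (w t) * ennreal (norm (conv (gamma_density \<alpha> (real (Suc n))) f t - f t)) \<partial>lborel)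
     \<le> (\<integral>\<^sup>+x. ennreal (gamma_density \<alpha> (real (Suc n)) x) * g x \<partial>lborel)" for n
  proof -
    have "(\<integral>\<^sup>+t. ennreal (w t) * ennreal (norm (conv (gamma_density \<alpha> (real (Suc n))) f t - f t)) \<partial>lborel)
       \<le> (\<integral>\<^sup>+t. ennreal (w t) * (\<integral>\<^sup>+x. ennreal (gamma_density \<alpha> (real (Suc n)) x) * ennreal (norm (f (t - x) - f t)) \<partial>lborel) \<partial>lborel)"
      by (intro nn_integral_mono mult_left_mono norm_conv_diff_le q0 q1) auto
    also have "\<dots> = (\<integral>\<^sup>+t. \<integral>\<^sup>+x. ennreal (w t) * (ennreal (gamma_density \<alpha> (real (Suc n)) x) * ennreal (norm (f (t - x) - f t))) \<partial>lborel \<partial>lborel)"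
      by (intro nn_integral_cong nn_integral_cmult[symmetric]) measurable
    also have "\<dots> = (\<integral>\<^sup>+x. \<integral>\<^sup>+t. ennreal (w t) * (ennreal (gamma_density \<alpha> (real (Suc n)) x) * ennreal (norm (f (t - x) - f t))) \<partial>lborel \<partial>lborel)"
      by (rule lborel_pair.Fubini') measurable
    also have "\<dots> = (\<integral>\<^sup>+x. ennreal (gamma_density \<alpha> (real (Suc n)) x) * g x \<partial>lborel)"
    proof (rule nn_integral_cong)
      fix x
      have "(\<integral>\<^sup>+t. ennreal (w t) * (ennreal (gamma_density \<alpha> (real (Suc n)) x) * ennreal (norm (f (t - x) - f t))) \<partial>lborel)
        = (\<integral>\<^sup>+t. ennreal (gamma_density \<alpha> (real (Suc n)) x) * ennreal (w t * norm (f (t - x) - f t)) \<partial>lborel)"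
        by (intro nn_integral_cong) (simp only: ennreal_mult[OF w0 norm_ge_zero] mult.left_commute)
      also have "\<dots> = ennreal (gamma_density \<alpha> (real (Suc n)) x) * g x"
        unfolding g_def by (rule nn_integral_cmult) measurable
      finally show "(\<integral>\<^sup>+t. ennreal (w t) * (ennreal (gamma_density \<alpha> (real (Suc n)) x) * ennreal (norm (f (t - x) - f t))) \<partial>lborel) = \<dots>" .
    qed
    finally show ?thesis .
  qed
  have "(\<lambda>n. \<integral>\<^sup>+x. ennreal (gamma_density \<alpha> (real (Suc n)) x) * g x \<partial>lborel) \<longlonglongrightarrow> 0"
    by (rule gamma_density_approx_identity[OF a]) (use bound lim in \<open>auto simp: g_def\<close>)
  then show "(\<lambda>n. \<integral>\<^sup>+t. ennreal (w t) * ennreal (norm (conv (gamma_density \<alpha> (real (Suc n))) f t - f t)) \<partial>lborel) \<longlonglongrightarrow> 0"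
    by (rule tendsto_sandwich[OF _ _ tendsto_const, rotated 2]) (use le in auto)
  fix n
  have "(\<integral>\<^sup>+x. ennreal (gamma_density \<alpha> (real (Suc n)) x) * g x \<partial>lborel) \<le> (\<integral>\<^sup>+x. ennreal (gamma_density \<alpha> (real (Suc n)) x) * ennreal C \<partial>lborel)"
    by (intro nn_integral_mono mult_left_mono) (use bound in \<open>auto simp: g_def\<close>)
  also have "\<dots> = (\<integral>\<^sup>+x. ennreal (gamma_density \<alpha> (real (Suc n)) x) \<partial>lborel) * ennreal C"
    by (rule nn_integral_multc) measurable
  also have "\<dots> = ennreal C" by (simp only: q1 mult_1)
  finally show "(\<integral>\<^sup>+t. ennreal (w t) * ennreal (norm (conv (gamma_density \<alpha> (real (Suc n))) f t - f t)) \<partial>lborel) \<le> ennreal C"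
    using le[of n] by (rule order_trans[rotated])
qed

lemma integrable_of_square_integrable:
  fixes h :: "real \<Rightarrow> 'b::{banach, second_countable_topology}"
  assumes [measurable]: "h \<in> borel_measurable borel" and z: "\<And>t. t \<notin> {0<..<T} \<Longrightarrow> h t = 0"
    and h2: "integrable lborel (\<lambda>t. (norm (h t))\<^sup>2)"
  shows "integrable lborel h"
proof (rule Bochner_Integration.integrable_bound)
  show "integrable lborel (\<lambda>t. (norm (h t))\<^sup>2 + indicator {0<..<T} t)"
    using h2 emeasure_bounded_finite[of "{0<..<T}"]
    by (intro Bochner_Integration.integrable_add integrable_real_indicator) auto
  show "AE t in lborel. norm (h t) \<le> norm ((norm (h t))\<^sup>2 + indicator {0<..<T} t :: real)"
  proof (rule AE_I2)
    fix t
    show "norm (h t) \<le> norm ((norm (h t))\<^sup>2 + indicator {0<..<T} t :: real)"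
    proof (cases "t \<in> {0<..<T}")
      case True
      then show ?thesis using mult_le_weighted_squares[of 1 1 "norm (h t)"] by simp
    next
      case False
      then show ?thesis by (simp add: z)
    qed
  qed
qed auto

lemma integrable_inner_of_square_integrable:
  fixes g h :: "real \<Rightarrow> 'h::{real_inner, banach, second_countable_topology}"
  assumes [measurable]: "g \<in> borel_measurable borel" "h \<in> borel_measurable borel"
    and "integrable lborel (\<lambda>t. (norm (g t))\<^sup>2)" "integrable lborel (\<lambda>t. (norm (h t))\<^sup>2)"
  shows "integrable lborel (\<lambda>t. inner (g t) (h t))" "integrable lborel (\<lambda>t. norm (g t) * norm (h t))"
proof -
  have i: "integrable lborel (\<lambda>t. (norm (g t))\<^sup>2 + (norm (h t))\<^sup>2)" using assms by auto
  have b: "norm (g t) * norm (h t) \<le> (norm (g t))\<^sup>2 + (norm (h t))\<^sup>2" for t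
    using mult_le_weighted_squares[of 1 "norm (g t)" "norm (h t)"] by simp
  show "integrable lborel (\<lambda>t. inner (g t) (h t))"
    by (rule Bochner_Integration.integrable_bound[OF i])
       (use b Cauchy_Schwarz_ineq2 order_trans in \<open>fastforce+\<close>)
  show "integrable lborel (\<lambda>t. norm (g t) * norm (h t))"
    by (rule Bochner_Integration.integrable_bound[OF i]) (use b in auto)
qed

lemma ennreal_integrable_finite:
  fixes h :: "real \<Rightarrow> 'b::{banach, second_countable_topology}"
  assumes "integrable lborel h"
  shows "(\<integral>\<^sup>+t\<in>A. enorm h t \<partial>lborel) < \<infinity>"
proof -
  have "(\<integral>\<^sup>+t\<in>A. enorm h t \<partial>lborel) \<le> (\<integral>\<^sup>+t. enorm h t \<partial>lborel)"
    by (intro nn_integral_mono) (auto simp: indicator_def)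
  also have "\<dots> < \<infinity>" using assms by (simp add: integrable_iff_bounded)
  finally show ?thesis .
qed

text \<open>The kernel identity l - r * l = e, with * for convolution, is applied to f. The two
  finiteness conditions are those under which r * (l * f) may be reassociated at this t.\<close>

lemma conv_resolvent_identity:
  fixes f :: "real \<Rightarrow> 'b::{banach, second_countable_topology}"
  assumes [measurable]: "r \<in> borel_measurable borel" "e \<in> borel_measurable borel"
      "l \<in> borel_measurable borel" "f \<in> borel_measurable borel"
    and kid: "AE x in lborel. l x = conv r l x + e x"
    and n1: "nconv (enorm l) (enorm f) t < \<infinity>" and n2: "nconv (enorm r) (nconv (enorm l) (enorm f)) t < \<infinity>"
  shows "conv l f t - conv r (conv l f) t = conv e f t"
proof -
  have i1: "integrable lborel (\<lambda>s. l (t - s) *\<^sub>R f s)" by (rule conv_integrable) (use n1 in auto)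
  have "nconv (enorm (conv r l)) (enorm f) t \<le> nconv (nconv (enorm r) (enorm l)) (enorm f) t"
    unfolding nconv_def[of "enorm (conv r l)"] nconv_def[of "nconv (enorm r) (enorm l)"]
    by (intro nn_integral_mono mult_right_mono norm_conv_le) auto
  also have "\<dots> = nconv (enorm r) (nconv (enorm l) (enorm f)) t" by (rule nconv_assoc[symmetric]) measurable
  finally have "nconv (enorm (conv r l)) (enorm f) t < \<infinity>" using n2 by (rule le_less_trans)
  then have i2: "integrable lborel (\<lambda>s. conv r l (t - s) *\<^sub>R f s)" by (intro conv_integrable) auto
  have "conv e f t = conv (\<lambda>x. l x - conv r l x) f t"
    by (rule conv_kernel_cong_AE) (use kid in \<open>auto simp: algebra_simps\<close>)
  also have "\<dots> = conv l f t - conv (conv r l) f t"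
    using i1 i2 unfolding conv_def[of "\<lambda>x. l x - conv r l x"] conv_def[of l f] conv_def[of "conv r l"]
    by (simp add: scaleR_diff_left)
  also have "conv (conv r l) f t = conv r (conv l f) t" by (rule conv_assoc[symmetric]) (use n2 in auto)
  finally show ?thesis ..
qed

text \<open>Applying \<open>\<delta> - r\<close> with \<open>r\<close> a nonnegative kernel of mass at most one preserves the two convexity
  inequalities, and it turns \<open>W - w0 = frac_kernel \<alpha> * h\<close> into a regularization of \<open>h\<close>. Convolving
  with the fractional kernel again and letting \<open>n\<close> tend to infinity gives the claim.\<close>

lemma frac_chain_inequality:
  fixes h \<xi> W :: "real \<Rightarrow> 'h::{real_inner, banach, second_countable_topology}" and y :: "real \<Rightarrow> real"
  assumes \<alpha>: "0 < \<alpha>" "\<alpha> < 1"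
    and [measurable]: "h \<in> borel_measurable borel" "\<xi> \<in> borel_measurable borel" "y \<in> borel_measurable borel"
    and hz: "\<And>t. t \<notin> {0<..<T} \<Longrightarrow> h t = 0" and xz: "\<And>t. t \<notin> {0<..<T} \<Longrightarrow> \<xi> t = 0"
    and h2: "integrable lborel (\<lambda>t. (norm (h t))\<^sup>2)" and x2: "integrable lborel (\<lambda>t. (norm (\<xi> t))\<^sup>2)"
    and yi: "set_integrable lborel {0<..<T} y"
    and W: "AE t in lborel. t \<in> {0<..<T} \<longrightarrow> W t = w0 + conv (frac_kernel \<alpha>) h t"
    and A1: "AE t in lborel. t \<in> {0<..<T} \<longrightarrow> y t - y0 \<le> inner (\<xi> t) (W t - w0)"
    and A2: "AE t in lborel. t \<in> {0<..<T} \<longrightarrow>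
       (AE s in lborel. s \<in> {0<..<T} \<longrightarrow> y t - y s \<le> inner (\<xi> t) (W t - W s))"
  shows "AE t in lborel. t \<in> {0<..<T} \<longrightarrow> y t - y0 \<le> conv (frac_kernel \<alpha>) (\<lambda>s. inner (\<xi> s) (h s)) t"
proof -
  let ?l = "frac_kernel \<alpha>"
  \<comment> \<open>The initial value is subtracted and the result extended by zero. Both Y and the
    v below then vanish for negative times, and convolving with r brings in no initial term.\<close>
  define Y where "Y t = indicator {0<..<T} t * (y t - y0)" for t
  define v where "v = conv ?l h"
  have [measurable]: "Y \<in> borel_measurable borel" unfolding Y_def[abs_def] by measurable
  have [measurable]: "v \<in> borel_measurable borel" unfolding v_def by measurable
  have l0: "0 \<le> ?l x" for x using \<alpha> by (simp add: frac_kernel_nonneg)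
  have ch: "causal h" and cx: "causal \<xi>" and cY: "causal Y" using hz xz by (auto simp: causal_def Y_def)
  have cv: "causal v" unfolding v_def by (intro causal_conv ch) simp
  have hi: "integrable lborel h" by (rule integrable_of_square_integrable[OF _ hz h2]) auto
  have Yi: "integrable lborel Y"
  proof -
    have "integrable lborel (\<lambda>t. indicator {0<..<T} t *\<^sub>R y t - y0 * indicator {0<..<T} t)"
      using yi emeasure_bounded_finite[of "{0<..<T}"] unfolding set_integrable_def
      by (intro Bochner_Integration.integrable_diff integrable_mult_right integrable_real_indicator) auto
    then show ?thesis by (rule Bochner_Integration.integrable_cong[THEN iffD1, rotated 2]) (auto simp: Y_def algebra_simps)
  qed
  have xhi: "integrable lborel (\<lambda>t. inner (\<xi> t) (h t))" and xhn: "integrable lborel (\<lambda>t. norm (\<xi> t) * norm (h t))"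
    using integrable_inner_of_square_integrable[OF _ _ x2 h2] by simp_all
  have fl: "(\<integral>\<^sup>+t\<in>{..T}. enorm ?l t \<partial>lborel) < \<infinity>"
    using nn_integral_frac_kernel[OF \<alpha>(1), of T] l0 by simp
  have fh: "(\<integral>\<^sup>+t\<in>{..T}. enorm h t \<partial>lborel) < \<infinity>" and fY: "(\<integral>\<^sup>+t\<in>{..T}. enorm Y t \<partial>lborel) < \<infinity>"
    using ennreal_integrable_finite[OF hi] ennreal_integrable_finite[OF Yi] by blast+
  have prodfin: "a * b < \<infinity>" if "a < \<infinity>" "b < \<infinity>" for a b :: ennreal
    using that by (simp add: ennreal_mult_less_top)
  have flh: "(\<integral>\<^sup>+t\<in>{..T}. nconv (enorm ?l) (enorm h) t \<partial>lborel) < \<infinity>"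
    by (rule le_less_trans[OF nn_integral_nconv_le prodfin[OF fl fh]]) (use ch in auto)
  have E1: "AE t in lborel. t \<in> {0<..<T} \<longrightarrow> Y t \<le> inner (\<xi> t) (v t)"
    using W A1 by eventually_elim (auto simp: Y_def v_def)
  have E2: "AE t in lborel. t \<in> {0<..<T} \<longrightarrow>
       (AE s in lborel. s \<in> {0<..<T} \<longrightarrow> Y t - Y s \<le> inner (\<xi> t) (v t - v s))"
    using W A2
  proof eventually_elim
    case (elim t)
    show ?case
    proof
      assume t: "t \<in> {0<..<T}"
      from elim(2)[rule_format, OF t] W
      show "AE s in lborel. s \<in> {0<..<T} \<longrightarrow> Y t - Y s \<le> inner (\<xi> t) (v t - v s)"
      proof eventually_elim
        case (elim s)
        then show ?case using t \<open>t \<in> {0<..<T} \<longrightarrow> W t = w0 + conv (frac_kernel \<alpha>) h t\<close>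
          by (auto simp: Y_def v_def)
      qed
    qed
  qed
  let ?q = "\<lambda>n. gamma_density \<alpha> (real (Suc n))"
  have Ybound: "(\<integral>\<^sup>+t. ennreal (1 * norm (Y (t - x) - Y t)) \<partial>lborel) \<le> ennreal (2 * (LINT t|lborel. norm (Y t)))" for x
  proof -
    have "(\<integral>\<^sup>+t. ennreal (1 * norm (Y (t - x) - Y t)) \<partial>lborel) \<le> (\<integral>\<^sup>+t. enorm Y (t - x) + enorm Y t \<partial>lborel)"
    proof (rule nn_integral_mono)
      fix t
      have "ennreal (1 * norm (Y (t - x) - Y t)) \<le> ennreal (norm (Y (t - x)) + norm (Y t))"
        unfolding mult_1 by (rule ennreal_leI, rule norm_triangle_ineq4)
      then show "ennreal (1 * norm (Y (t - x) - Y t)) \<le> enorm Y (t - x) + enorm Y t"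
        by (simp only: ennreal_plus[OF norm_ge_zero norm_ge_zero])
    qed
    also have "\<dots> = (\<integral>\<^sup>+t. enorm Y (t - x) \<partial>lborel) + (\<integral>\<^sup>+t. enorm Y t \<partial>lborel)"
      by (rule nn_integral_add) measurable
    also have "(\<integral>\<^sup>+t. enorm Y (t - x) \<partial>lborel) = (\<integral>\<^sup>+t. enorm Y t \<partial>lborel)"
      by (rule nn_integral_translation) measurable
    also have "(\<integral>\<^sup>+t. enorm Y t \<partial>lborel) = ennreal (LINT t|lborel. norm (Y t))"
      by (rule nn_integral_eq_integral[OF integrable_norm[OF Yi]]) simp
    also have "ennreal (LINT t|lborel. norm (Y t)) + ennreal (LINT t|lborel. norm (Y t)) = ennreal (2 * (LINT t|lborel. norm (Y t)))"
      by (subst ennreal_plus[symmetric]) simp_all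
    finally show ?thesis .
  qed
  have Ylim: "(\<lambda>n. \<integral>\<^sup>+t. ennreal (1 * norm (Y (t - x n) - Y t)) \<partial>lborel) \<longlonglongrightarrow> 0" if x: "x \<longlonglongrightarrow> 0" for x
  proof -
    have i: "integrable lborel (\<lambda>t. norm (Y (t - r) - Y t))" for r
      by (rule integrable_norm, rule Bochner_Integration.integrable_diff[OF lborel_integral_translation(1)[OF Yi] Yi])
    have eq: "(\<integral>\<^sup>+t. ennreal (1 * norm (Y (t - r) - Y t)) \<partial>lborel) = ennreal (LINT t|lborel. norm (Y (t - r) - Y t))" for r
      unfolding mult_1 by (rule nn_integral_eq_integral[OF i]) simp
    show ?thesis
      unfolding eq using tendsto_ennrealI[OF integral_translation_tendsto[OF Yi x]] by (simp only: ennreal_0)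
  qed
  \<comment> \<open>A bound that does not depend on the translation x; it is the dominating constant
    when translations are averaged.\<close>
  define C where "C = 2 * (LINT t|lborel. (norm (\<xi> t))\<^sup>2) + 2 * (LINT t|lborel. (norm (h t))\<^sup>2)"
  have hbound: "(\<integral>\<^sup>+t. ennreal (norm (\<xi> t) * norm (h (t - x) - h t)) \<partial>lborel) \<le> ennreal C" for x
  proof -
    have p: "norm (\<xi> t) * norm (h (t - x) - h t) \<le> 2 * (norm (\<xi> t))\<^sup>2 + ((norm (h (t - x)))\<^sup>2 + (norm (h t))\<^sup>2)" for t
    proof -
      have "norm (\<xi> t) * norm (h (t - x) - h t) \<le> norm (\<xi> t) * norm (h (t - x)) + norm (\<xi> t) * norm (h t)"
        using mult_left_mono[OF norm_triangle_ineq4[of "h (t - x)" "h t"], of "norm (\<xi> t)"]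
        by (simp only: distrib_left norm_ge_zero)
      then show ?thesis
        using mult_le_weighted_squares[of 1 "norm (\<xi> t)" "norm (h (t - x))"] mult_le_weighted_squares[of 1 "norm (\<xi> t)" "norm (h t)"]
        by simp
    qed
    have "(\<integral>\<^sup>+t. ennreal (norm (\<xi> t) * norm (h (t - x) - h t)) \<partial>lborel)
      \<le> (\<integral>\<^sup>+t. 2 * ennreal ((norm (\<xi> t))\<^sup>2) + (ennreal ((norm (h (t - x)))\<^sup>2) + ennreal ((norm (h t))\<^sup>2)) \<partial>lborel)"
    proof (rule nn_integral_mono)
      fix t
      show "ennreal (norm (\<xi> t) * norm (h (t - x) - h t)) \<le> 2 * ennreal ((norm (\<xi> t))\<^sup>2) + (ennreal ((norm (h (t - x)))\<^sup>2) + ennreal ((norm (h t))\<^sup>2))"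
        using ennreal_leI[OF p[of t]] by (simp add: ennreal_mult)
    qed
    also have "\<dots> = 2 * (\<integral>\<^sup>+t. ennreal ((norm (\<xi> t))\<^sup>2) \<partial>lborel)
       + ((\<integral>\<^sup>+t. ennreal ((norm (h (t - x)))\<^sup>2) \<partial>lborel) + (\<integral>\<^sup>+t. ennreal ((norm (h t))\<^sup>2) \<partial>lborel))"
      by (simp add: nn_integral_add nn_integral_cmult)
    also have "(\<integral>\<^sup>+t. ennreal ((norm (h (t - x)))\<^sup>2) \<partial>lborel) = (\<integral>\<^sup>+t. ennreal ((norm (h t))\<^sup>2) \<partial>lborel)"
      by (rule nn_integral_translation) measurable
    also have "(\<integral>\<^sup>+t. ennreal ((norm (h t))\<^sup>2) \<partial>lborel) = ennreal (LINT t|lborel. (norm (h t))\<^sup>2)"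
      by (rule nn_integral_eq_integral[OF h2]) simp
    also have "(\<integral>\<^sup>+t. ennreal ((norm (\<xi> t))\<^sup>2) \<partial>lborel) = ennreal (LINT t|lborel. (norm (\<xi> t))\<^sup>2)"
      by (rule nn_integral_eq_integral[OF x2]) simp
    also have "2 * ennreal (LINT t|lborel. (norm (\<xi> t))\<^sup>2) + (ennreal (LINT t|lborel. (norm (h t))\<^sup>2) + ennreal (LINT t|lborel. (norm (h t))\<^sup>2)) = ennreal C"
    proof -
      have A: "2 * ennreal X = ennreal (2 * X)" if "0 \<le> X" for X
        using that by (subst ennreal_mult) simp_all
      have B: "ennreal Z + ennreal Z = ennreal (2 * Z)" if "0 \<le> Z" for Z
        using that by (subst ennreal_plus[symmetric]) simp_all
      have "2 * ennreal X + (ennreal Z + ennreal Z) = ennreal (2 * X + 2 * Z)" if "0 \<le> X" "0 \<le> Z" for X Z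
        unfolding A[OF that(1)] B[OF that(2)] using that by (subst ennreal_plus) simp_all
      then show ?thesis unfolding C_def by simp
    qed
    finally show ?thesis .
  qed
  have hlim: "(\<lambda>n. \<integral>\<^sup>+t. ennreal (norm (\<xi> t) * norm (h (t - x n) - h t)) \<partial>lborel) \<longlonglongrightarrow> 0" if "x \<longlonglongrightarrow> 0" for x
    by (rule weighted_translation_tendsto[OF hi h2 _ _ x2 that]) auto
  have Alim: "(\<lambda>n. \<integral>\<^sup>+t. ennreal 1 * ennreal (norm (conv (?q n) Y t - Y t)) \<partial>lborel) \<longlonglongrightarrow> 0"
    by (rule conv_gamma_density_tendsto(1)[where w = "\<lambda>_. 1" and f = Y, OF \<alpha>(1) _ _ _ Ybound Ylim]) simp_all
  have Blim: "(\<lambda>n. \<integral>\<^sup>+t. ennreal (norm (\<xi> t)) * ennreal (norm (conv (?q n) h t - h t)) \<partial>lborel) \<longlonglongrightarrow> 0"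
    by (rule conv_gamma_density_tendsto(1)[where w = "\<lambda>t. norm (\<xi> t)" and f = h, OF \<alpha>(1) _ _ _ hbound hlim]) simp_all
  have Bbound: "(\<integral>\<^sup>+t. ennreal (norm (\<xi> t)) * ennreal (norm (conv (?q n) h t - h t)) \<partial>lborel) \<le> ennreal C" for n
    by (rule conv_gamma_density_tendsto(2)[where w = "\<lambda>t. norm (\<xi> t)" and f = h, OF \<alpha>(1) _ _ _ hbound hlim]) simp_all
  \<comment> \<open>The inequality before the limit. The first error comes from averaging Y, the
    second from averaging h inside the inner product; both tend to 0 only after integration over
    t.\<close>
  have main: "AE t in lborel. t \<in> {0<..<T} \<longrightarrow>
      ennreal (Y t - conv ?l (\<lambda>s. inner (\<xi> s) (h s)) t)
      \<le> ennreal (norm (conv (?q n) Y t - Y t)) + nconv (enorm ?l) (\<lambda>s. ennreal (norm (\<xi> s)) * ennreal (norm (conv (?q n) h s - h s))) t" for n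
  proof -
    define N where "N = real (Suc n)"
    have N: "0 < N" by (simp add: N_def)
    define e where "e x = exp (- N * x) * ?l x" for x
    define c where "c = N powr \<alpha>"
    have c: "0 < c" using N by (simp add: c_def)
    have [measurable]: "e \<in> borel_measurable borel" unfolding e_def[abs_def] by measurable
    obtain r where r[measurable]: "r \<in> borel_measurable borel" and cr: "causal r" and r0: "\<And>x. 0 \<le> r x"
      and r1: "\<And>t. (\<integral>\<^sup>+s\<in>{..t}. ennreal (r s) \<partial>lborel) \<le> 1"
      and rl: "AE x in lborel. ennreal (?l x) = nconv (\<lambda>x. ennreal (?l x)) (\<lambda>x. ennreal (r x)) x + ennreal (exp (- N * x) * ?l x)"
      by (rule frac_kernel_regularization[OF \<alpha> N]) blast
    have e0: "0 \<le> e x" for x using l0 by (simp add: e_def)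
    have kid: "AE x in lborel. ?l x = conv r ?l x + e x"
      using rl
    proof eventually_elim
      case (elim x)
      let ?n = "nconv (\<lambda>x. ennreal (?l x)) (\<lambda>x. ennreal (r x)) x"
      have "?n \<le> ennreal (?l x)" unfolding elim by simp
      then have "?n < top_class.top" by (rule le_less_trans) simp
      then have "enn2real (?n + ennreal (e x)) = enn2real ?n + e x"
        using e0[of x] by (subst enn2real_plus) auto
      moreover have "ennreal (?l x) = ?n + ennreal (e x)" using elim by (simp only: e_def)
      ultimately have "?l x = enn2real ?n + e x" using l0[of x] by (metis enn2real_ennreal)
      moreover have "conv r ?l x = enn2real ?n"
        unfolding conv_commute[of r] by (rule conv_eq_nconv) (use r0 l0 in auto)
      ultimately show ?case by simp
    qed
    have qe: "conv (?q n) h t = c *\<^sub>R conv e h t" for t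
    proof -
      have "conv (?q n) h t = (LINT s|lborel. c *\<^sub>R (e (t - s) *\<^sub>R h s))"
        unfolding conv_def by (simp add: c_def e_def N_def mult.assoc)
      then show ?thesis unfolding conv_def by (simp only: integral_scaleR_right)
    qed
    have qeY: "conv (?q n) Y t = c * conv e Y t" for t
    proof -
      have "conv (?q n) Y t = (LINT s|lborel. c *\<^sub>R (e (t - s) *\<^sub>R Y s))"
        unfolding conv_def by (simp add: c_def e_def N_def mult.assoc)
      then show ?thesis unfolding conv_def by simp
    qed
    have fr: "(\<integral>\<^sup>+t\<in>{..T}. enorm r t \<partial>lborel) < \<infinity>"
      using r1[of T] r0 by (simp add: le_less_trans[OF _ ennreal_one_less_top])
    have F1: "AE t in lborel. t \<le> T \<longrightarrow> nconv (enorm ?l) (enorm h) t < \<infinity>"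
      by (rule nconv_finite_AE) (use fl fh ch in auto)
    have F2: "AE t in lborel. t \<le> T \<longrightarrow> nconv (enorm r) (nconv (enorm ?l) (enorm h)) t < \<infinity>"
      by (rule nconv_finite_AE) (use fr flh ch cr in \<open>auto intro!: causal_nconv\<close>)
    have F3: "AE t in lborel. t \<le> T \<longrightarrow> nconv (enorm r) (enorm Y) t < \<infinity>"
      by (rule nconv_finite_AE) (use fr fY cY cr in auto)
    have F4: "AE t in lborel. t \<le> T \<longrightarrow> nconv (enorm ?l) (enorm Y) t < \<infinity>"
      by (rule nconv_finite_AE) (use fl fY cY in auto)
    have frY: "(\<integral>\<^sup>+t\<in>{..T}. nconv (enorm r) (enorm Y) t \<partial>lborel) < \<infinity>"
      by (rule le_less_trans[OF nn_integral_nconv_le prodfin[OF fr fY]]) (use cY cr in auto)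
    have F5: "AE t in lborel. t \<le> T \<longrightarrow> nconv (enorm ?l) (nconv (enorm r) (enorm Y)) t < \<infinity>"
      by (rule nconv_finite_AE) (use fl frY cY cr in \<open>auto intro!: causal_nconv\<close>)
    have S1: "AE t in lborel. t \<in> {0<..<T} \<longrightarrow> c * (Y t - conv r Y t) \<le> inner (\<xi> t) (conv (?q n) h t)"
      using E1 E2 F1 F2 F3
    proof eventually_elim
      case (elim t)
      show ?case
      proof
        assume t: "t \<in> {0<..<T}"
        have n1: "nconv (enorm ?l) (enorm h) t < \<infinity>" and n2: "nconv (enorm r) (nconv (enorm ?l) (enorm h)) t < \<infinity>"
          and n3: "nconv (enorm r) (enorm Y) t < \<infinity>" using elim t by auto
        \<comment> \<open>The first convexity inequality says a \<le> 0, the second says a +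
          \<open>inner (\<xi> t) (v s)\<close> \<le> Y s. The latter is integrated against r(t - s)
          over (0,t); since r has mass at most one and a \<le> 0, a is at most a times that mass.
          This gives Y - r * Y \<le> \<open>inner \<xi> (v - r * v)\<close> at time t, with * for
          convolution with r.\<close>
        define a where "a = Y t - inner (\<xi> t) (v t)"
        have a: "a \<le> 0" using elim(1) t by (simp add: a_def)
        have vr: "v t - conv r v t = conv e h t"
          unfolding v_def by (rule conv_resolvent_identity) (use kid n1 n2 in auto)
        have "nconv (enorm r) (enorm v) t \<le> nconv (enorm r) (nconv (enorm ?l) (enorm h)) t"
          unfolding v_def by (intro nconv_mono norm_conv_le) (use cr in auto)
        then have iv: "integrable lborel (\<lambda>s. r (t - s) *\<^sub>R v s)"
          using n2 by (intro conv_integrable) (auto dest: le_less_trans)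
        have iY: "integrable lborel (\<lambda>s. r (t - s) *\<^sub>R Y s)"
          using n3 by (intro conv_integrable) auto
        have R: "(\<integral>\<^sup>+s. ennreal (r (t - s) * indicator {0<..<t} s) \<partial>lborel) \<le> 1"
        proof -
          have "(\<integral>\<^sup>+s. ennreal (r (t - s) * indicator {0<..<t} s) \<partial>lborel)
            = (\<integral>\<^sup>+s. ennreal (r s * indicator {0<..<t} (t - s)) \<partial>lborel)"
            by (subst nn_integral_real_affine[of _ "-1" t]) auto
          also have "\<dots> \<le> (\<integral>\<^sup>+s\<in>{..t}. ennreal (r s) \<partial>lborel)"
            by (intro nn_integral_mono) (auto simp: indicator_def)
          finally show ?thesis using r1[of t] by (rule order_trans)
        qed
        have iR: "integrable lborel (\<lambda>s. r (t - s) * indicator {0<..<t} s)"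
          by (rule integrableI_nonneg) (use r0 le_less_trans[OF R ennreal_one_less_top] in auto)
        have R1: "(LINT s|lborel. r (t - s) * indicator {0<..<t} s) \<le> 1"
          using R r0 by (subst integral_eq_nn_integral) (auto intro: enn2real_leI)
        have "a + inner (\<xi> t) (conv r v t) \<le> a * (LINT s|lborel. r (t - s) * indicator {0<..<t} s) + inner (\<xi> t) (conv r v t)"
          using mult_left_mono_neg[OF R1 a] by simp
        also have "\<dots> = (LINT s|lborel. a * (r (t - s) * indicator {0<..<t} s) + inner (\<xi> t) (r (t - s) *\<^sub>R v s))"
        proof -
          have "(LINT s|lborel. a * (r (t - s) * indicator {0<..<t} s) + inner (\<xi> t) (r (t - s) *\<^sub>R v s))
            = (LINT s|lborel. a * (r (t - s) * indicator {0<..<t} s)) + (LINT s|lborel. inner (\<xi> t) (r (t - s) *\<^sub>R v s))"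
          proof (rule Bochner_Integration.integral_add)
            show "integrable lborel (\<lambda>s. a * (r (t - s) * indicator {0<..<t} s))" by (rule integrable_mult_right) (rule iR)
            show "integrable lborel (\<lambda>s. inner (\<xi> t) (r (t - s) *\<^sub>R v s))" by (rule integrable_inner_right) (rule iv)
          qed
          also have "(LINT s|lborel. inner (\<xi> t) (r (t - s) *\<^sub>R v s)) = inner (\<xi> t) (conv r v t)"
            unfolding conv_def by (rule integral_inner_right) (rule iv)
          also have "(LINT s|lborel. a * (r (t - s) * indicator {0<..<t} s)) = a * (LINT s|lborel. r (t - s) * indicator {0<..<t} s)"
            by (rule integral_mult_right_zero)
          finally show ?thesis by (rule sym)
        qed
        also have "\<dots> \<le> conv r Y t"
          unfolding conv_def
        proof (rule integral_mono_AE)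
          show "integrable lborel (\<lambda>s. a * (r (t - s) * indicator {0<..<t} s) + inner (\<xi> t) (r (t - s) *\<^sub>R v s))"
            by (rule Bochner_Integration.integrable_add[OF integrable_mult_right integrable_inner_right]; rule iR iv)
          show "AE s in lborel. a * (r (t - s) * indicator {0<..<t} s) + inner (\<xi> t) (r (t - s) *\<^sub>R v s) \<le> r (t - s) *\<^sub>R Y s"
            using elim(2)[rule_format, OF t] AE_lborel_singleton[of 0] AE_lborel_singleton[of t]
          proof eventually_elim
            case (elim s)
            consider "s < 0" | "0 < s" "s < t" | "t < s" using elim by linarith
            then show ?case
            proof cases
              case 1 then show ?thesis using cv cY by (simp add: causal_def)
            next
              case 2
              then have "a + inner (\<xi> t) (v s) \<le> Y s" using elim(1) t by (simp add: a_def inner_diff_right)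
              then have "r (t - s) * (a + inner (\<xi> t) (v s)) \<le> r (t - s) * Y s"
                by (rule mult_left_mono) (rule r0)
              then show ?thesis using 2 by (simp add: algebra_simps)
            next
              case 3 then show ?thesis using cr by (simp add: causal_def)
            qed
          qed
        qed (use iY in auto)
        finally have "Y t - conv r Y t \<le> inner (\<xi> t) (v t - conv r v t)" by (simp add: a_def inner_diff_right)
        then have "c * (Y t - conv r Y t) \<le> c * inner (\<xi> t) (conv e h t)"
          unfolding vr using c by (intro mult_left_mono) auto
        then show "c * (Y t - conv r Y t) \<le> inner (\<xi> t) (conv (?q n) h t)" by (simp only: qe inner_scaleR_right)
      qed
    qed
    \<comment> \<open>The error made by replacing the averaged h by h; it is integrable because the
      weighted averaging error of h is bounded by C.\<close>
    let ?D = "\<lambda>s. inner (\<xi> s) (conv (?q n) h s) - inner (\<xi> s) (h s)"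
    let ?b = "\<lambda>s. ennreal (norm (\<xi> s)) * ennreal (norm (conv (?q n) h s - h s))"
    have Db: "enorm ?D s \<le> ?b s" for s
      using Cauchy_Schwarz_ineq2[of "\<xi> s" "conv (?q n) h s - h s"]
      by (simp only: inner_diff_right[symmetric] ennreal_mult[OF norm_ge_zero norm_ge_zero, symmetric]
          real_norm_def) (rule ennreal_leI)
    have Di: "integrable lborel ?D"
    proof (rule integrableI_bounded)
      have "(\<integral>\<^sup>+s. enorm ?D s \<partial>lborel) \<le> (\<integral>\<^sup>+s. ?b s \<partial>lborel)" by (intro nn_integral_mono Db)
      also have "\<dots> \<le> ennreal C" by (rule Bbound)
      also have "\<dots> < \<infinity>" by simp
      finally show "(\<integral>\<^sup>+s. enorm ?D s \<partial>lborel) < \<infinity>" .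
      show "?D \<in> borel_measurable lborel" by measurable
    qed
    have cD: "causal ?D" and cxh: "causal (\<lambda>s. inner (\<xi> s) (h s))" using cx by (auto simp: causal_def)
    have F6: "AE t in lborel. t \<le> T \<longrightarrow> nconv (enorm ?l) (enorm ?D) t < \<infinity>"
      by (rule nconv_finite_AE[OF _ _ causal_enorm[OF causal_frac_kernel] causal_enorm[OF cD] fl ennreal_integrable_finite[OF Di]]) measurable
    have F7: "AE t in lborel. t \<le> T \<longrightarrow> nconv (enorm ?l) (enorm (\<lambda>s. inner (\<xi> s) (h s))) t < \<infinity>"
      by (rule nconv_finite_AE[OF _ _ causal_enorm[OF causal_frac_kernel] causal_enorm[OF cxh] fl ennreal_integrable_finite[OF xhi]]) measurable
    show ?thesis
      using F4 F5 F6 F7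
    proof eventually_elim
      case (elim t)
      show ?case
      proof
        assume t: "t \<in> {0<..<T}"
        have n4: "nconv (enorm ?l) (enorm Y) t < \<infinity>" and n5: "nconv (enorm ?l) (nconv (enorm r) (enorm Y)) t < \<infinity>"
          and n6: "nconv (enorm ?l) (enorm ?D) t < \<infinity>" and n7: "nconv (enorm ?l) (enorm (\<lambda>s. inner (\<xi> s) (h s))) t < \<infinity>"
          using elim t by auto
        have rl_eq: "nconv (enorm r) (nconv (enorm ?l) (enorm Y)) t = nconv (enorm ?l) (nconv (enorm r) (enorm Y)) t"
        proof -
          have "nconv (enorm r) (enorm ?l) = nconv (enorm ?l) (enorm r)" by (rule ext, rule nconv_commute) measurable
          moreover have "nconv (enorm r) (nconv (enorm ?l) (enorm Y)) t = nconv (nconv (enorm r) (enorm ?l)) (enorm Y) t"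
            by (rule nconv_assoc) measurable
          moreover have "nconv (enorm ?l) (nconv (enorm r) (enorm Y)) t = nconv (nconv (enorm ?l) (enorm r)) (enorm Y) t"
            by (rule nconv_assoc) measurable
          ultimately show ?thesis by simp
        qed
        have id: "conv ?l Y t - conv r (conv ?l Y) t = conv e Y t"
          by (rule conv_resolvent_identity) (use kid n4 n5 rl_eq in auto)
        have swap: "conv r (conv ?l Y) t = conv ?l (conv r Y) t"
        proof -
          have "conv r ?l = conv ?l r" by (rule ext, rule conv_commute)
          moreover have "conv r (conv ?l Y) t = conv (conv r ?l) Y t"
            by (rule conv_assoc) (use n5 rl_eq in auto)
          moreover have "conv ?l (conv r Y) t = conv (conv ?l r) Y t"
            by (rule conv_assoc) (use n5 in auto)
          ultimately show ?thesis by simp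
        qed
        have iY: "integrable lborel (\<lambda>s. ?l (t - s) *\<^sub>R Y s)" by (rule conv_integrable) (use n4 in auto)
        have "nconv (enorm ?l) (enorm (conv r Y)) t \<le> nconv (enorm ?l) (nconv (enorm r) (enorm Y)) t"
          by (intro nconv_mono norm_conv_le) auto
        then have irY: "integrable lborel (\<lambda>s. ?l (t - s) *\<^sub>R conv r Y s)"
          using n5 by (intro conv_integrable) (auto dest: le_less_trans)
        have iD: "integrable lborel (\<lambda>s. ?l (t - s) *\<^sub>R ?D s)" by (rule conv_integrable) (use n6 in auto)
        have ixh: "integrable lborel (\<lambda>s. ?l (t - s) *\<^sub>R inner (\<xi> s) (h s))" by (rule conv_integrable) (use n7 in auto)
        have iq: "integrable lborel (\<lambda>s. ?l (t - s) *\<^sub>R (?D s + inner (\<xi> s) (h s)))"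
          unfolding scaleR_add_right by (rule Bochner_Integration.integrable_add[OF iD ixh])
        \<comment> \<open>\<open>S1\<close> is convolved with the fractional kernel. Its left side
          reassembles into the Gamma average of Y because that kernel commutes with r.\<close>
        have "conv (?q n) Y t = c * (conv ?l Y t - conv ?l (conv r Y) t)"
          by (simp only: qeY id[symmetric] swap)
        also have "\<dots> = c * conv ?l (\<lambda>s. Y s - conv r Y s) t"
          by (simp only: conv_diff[OF iY irY])
        also have "\<dots> = (LINT s|lborel. c * (?l (t - s) * (Y s - conv r Y s)))"
          unfolding conv_def by simp
        also have "\<dots> \<le> (LINT s|lborel. ?l (t - s) *\<^sub>R (?D s + inner (\<xi> s) (h s)))"
        proof (rule integral_mono_AE)
          show "integrable lborel (\<lambda>s. c * (?l (t - s) * (Y s - conv r Y s)))"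
            by (rule integrable_mult_right, unfold right_diff_distrib)
               (rule Bochner_Integration.integrable_diff[OF iY irY, unfolded real_scaleR_def])
          show "AE s in lborel. c * (?l (t - s) * (Y s - conv r Y s)) \<le> ?l (t - s) *\<^sub>R (?D s + inner (\<xi> s) (h s))"
            using S1 AE_lborel_singleton[of 0]
          proof eventually_elim
            case (elim s)
            consider "s < 0" | "t \<le> s" | "0 < s" "s < t" using elim by linarith
            then show ?case
            proof cases
              case 1
              then have "Y s = 0" "conv r Y s = 0" "\<xi> s = 0" using cY causal_conv[OF cr cY] cx by (auto simp: causal_def)
              then show ?thesis by simp
            next
              case 2 then show ?thesis by (simp add: frac_kernel_def)
            next
              case 3
              then have "c * (Y s - conv r Y s) \<le> inner (\<xi> s) (conv (?q n) h s)" using elim t by simp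
              then have "?l (t - s) * (c * (Y s - conv r Y s)) \<le> ?l (t - s) * inner (\<xi> s) (conv (?q n) h s)"
                by (rule mult_left_mono) (rule l0)
              then show ?thesis by (simp add: mult.left_commute)
            qed
          qed
        qed (rule iq)
        also have "\<dots> = conv ?l ?D t + conv ?l (\<lambda>s. inner (\<xi> s) (h s)) t"
          unfolding conv_def[of ?l] scaleR_add_right by (rule Bochner_Integration.integral_add[OF iD ixh])
        finally have "Y t - conv ?l (\<lambda>s. inner (\<xi> s) (h s)) t \<le> norm (conv (?q n) Y t - Y t) + norm (conv ?l ?D t)"
          unfolding real_norm_def by linarith
        then have "ennreal (Y t - conv ?l (\<lambda>s. inner (\<xi> s) (h s)) t) \<le> ennreal (norm (conv (?q n) Y t - Y t)) + ennreal (norm (conv ?l ?D t))"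
          by (simp only: ennreal_plus[OF norm_ge_zero norm_ge_zero, symmetric] ennreal_leI)
        also have "ennreal (norm (conv ?l ?D t)) \<le> nconv (enorm ?l) (enorm ?D) t" by (rule norm_conv_le) measurable
        also have "nconv (enorm ?l) (enorm ?D) t \<le> nconv (enorm ?l) ?b t" by (rule nconv_mono[OF Db]) simp
        finally show "ennreal (Y t - conv ?l (\<lambda>s. inner (\<xi> s) (h s)) t) \<le> ennreal (norm (conv (?q n) Y t - Y t)) + nconv (enorm ?l) ?b t"
          by (simp add: add_left_mono)
      qed
    qed
  qed
  \<comment> \<open>Under \<open>ennreal\<close> only the positive part of the defect survives. Its
    integral over (0,T) does not depend on n and is bounded by quantities that tend to 0.\<close>
  let ?Z = "\<lambda>t. Y t - conv ?l (\<lambda>s. inner (\<xi> s) (h s)) t"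
  let ?A = "\<lambda>n. \<integral>\<^sup>+t. ennreal 1 * ennreal (norm (conv (?q n) Y t - Y t)) \<partial>lborel"
  let ?B = "\<lambda>n. \<integral>\<^sup>+t. ennreal (norm (\<xi> t)) * ennreal (norm (conv (?q n) h t - h t)) \<partial>lborel"
  define K where "K = enn2real (\<integral>\<^sup>+t\<in>{..T}. enorm ?l t \<partial>lborel)"
  have K: "(\<integral>\<^sup>+t\<in>{..T}. enorm ?l t \<partial>lborel) = ennreal K" using fl by (simp add: K_def)
  have "(\<integral>\<^sup>+t\<in>{0<..<T}. ennreal (?Z t) \<partial>lborel) \<le> ?A n + ennreal K * ?B n" for n
  proof -
    let ?b = "\<lambda>s. ennreal (norm (\<xi> s)) * ennreal (norm (conv (?q n) h s - h s))"
    have "(\<integral>\<^sup>+t\<in>{0<..<T}. ennreal (?Z t) \<partial>lborel)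
      \<le> (\<integral>\<^sup>+t. ennreal 1 * ennreal (norm (conv (?q n) Y t - Y t)) + nconv (enorm ?l) ?b t * indicator {..T} t \<partial>lborel)"
      by (rule nn_integral_mono_AE) (use main[of n] in eventually_elim, auto simp: indicator_def)
    also have "\<dots> = ?A n + (\<integral>\<^sup>+t\<in>{..T}. nconv (enorm ?l) ?b t \<partial>lborel)"
      by (rule nn_integral_add) measurable
    also have "(\<integral>\<^sup>+t\<in>{..T}. nconv (enorm ?l) ?b t \<partial>lborel) \<le> ennreal K * (\<integral>\<^sup>+t\<in>{..T}. ?b t \<partial>lborel)"
    proof -
      have cb: "causal ?b" using cx by (auto simp: causal_def)
      show ?thesis unfolding K[symmetric]
        by (rule nn_integral_nconv_le[OF _ _ causal_enorm[OF causal_frac_kernel] cb]) measurable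
    qed
    also have "(\<integral>\<^sup>+t\<in>{..T}. ?b t \<partial>lborel) \<le> ?B n"
      by (intro nn_integral_mono) (auto simp: indicator_def)
    finally show ?thesis by (simp add: add_left_mono mult_left_mono)
  qed
  moreover have "(\<lambda>n. ?A n + ennreal K * ?B n) \<longlonglongrightarrow> 0 + ennreal K * 0"
    by (intro tendsto_add Alim tendsto_mult_ennreal tendsto_const Blim) auto
  ultimately have "(\<integral>\<^sup>+t\<in>{0<..<T}. ennreal (?Z t) \<partial>lborel) \<le> 0 + ennreal K * 0"
    by (intro tendsto_lowerbound[where F = sequentially]) auto
  then have "(\<integral>\<^sup>+t\<in>{0<..<T}. ennreal (?Z t) \<partial>lborel) = 0" by simp
  then have "AE t in lborel. ennreal (?Z t) * indicator {0<..<T} t = 0"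
    by (subst (asm) nn_integral_0_iff_AE) auto
  then show ?thesis
    by eventually_elim (auto simp: Y_def indicator_def ennreal_eq_0_iff split: if_splits)
qed

section \<open>Test functions and distributional derivatives\<close>

text \<open>The functions e^(-1/t) t^(-j), extended by zero. Each derivative is a combination of two
  members of the family, so one argument at t = 0 yields smoothness of every order.\<close>

definition flat_exp :: "nat \<Rightarrow> real \<Rightarrow> real" where
  "flat_exp j t = (if 0 < t then exp (- 1 / t) / t ^ j else 0)"

text \<open>A single term of the exponential series, (1/t)^(j+2) / (j+2)! \<le> e^(1/t), beats the
  negative power. Two spare powers of t make the difference quotient at 0 tend to 0.\<close>

lemma flat_exp_le: "\<bar>flat_exp j t\<bar> \<le> fact (j + 2) * t\<^sup>2"
proof (cases "0 < t")
  case True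
  define F P where "F = (fact (j + 2) :: real)" and "P = t ^ (j + 2)"
  have F: "0 < F" and P: "0 < P" using True by (simp_all add: F_def P_def)
  have "(1 / t) ^ (j + 2) / F \<le> exp (1 / t)"
  proof -
    have "(\<Sum>n\<in>{j + 2}. (1 / t) ^ n /\<^sub>R fact n) \<le> (\<Sum>n. (1 / t) ^ n /\<^sub>R fact n)"
      by (rule sum_le_suminf[OF summable_exp_generic]) (use True in auto)
    then show ?thesis by (simp only: exp_def F_def sum.insert finite.emptyI sum.empty empty_iff
          not_False_eq_True add_0_right real_scaleR_def divide_inverse mult.commute)
  qed
  then have "1 / P / F \<le> exp (1 / t)" by (simp only: P_def power_one_over)
  then have "1 \<le> exp (1 / t) * (F * P)"
    using F P by (simp add: field_simps)
  then have "exp (- 1 / t) * 1 \<le> exp (- 1 / t) * (exp (1 / t) * (F * P))"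
    by (rule mult_left_mono) simp
  also have "\<dots> = F * P"
    by (simp add: mult.assoc[symmetric] exp_add[symmetric])
  finally have "exp (- 1 / t) / t ^ j \<le> F * t\<^sup>2"
    using True by (simp add: P_def pos_divide_le_eq power_add power2_eq_square mult_ac)
  then show ?thesis using True by (simp add: flat_exp_def F_def)
qed (simp add: flat_exp_def)

lemma flat_exp_has_deriv:
  "(flat_exp j has_real_derivative (flat_exp (j + 2) t - real j * flat_exp (j + 1) t)) (at t)"
proof -
  consider "0 < t" | "t < 0" | "t = 0" by linarith
  then show ?thesis
  proof cases
    case 1
    have "((\<lambda>t. - 1 / t) has_real_derivative inverse t ^ 2) (at t)"
      using 1 by (auto intro!: derivative_eq_intros simp: power2_eq_square divide_inverse)
    then have d1: "((\<lambda>t. exp (- 1 / t)) has_real_derivative exp (- 1 / t) * inverse t ^ 2) (at t)"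
      by (rule DERIV_fun_exp)
    have "((\<lambda>t. exp (- 1 / t) * inverse t ^ j) has_real_derivative
       (exp (- 1 / t) * inverse t ^ 2) * inverse t ^ j
       + (real j * (- (inverse t ^ Suc (Suc 0)) * inverse t ^ (j - Suc 0))) * exp (- 1 / t)) (at t)"
      by (rule DERIV_mult[OF d1 DERIV_power[OF DERIV_inverse]]) (use 1 in simp)
    moreover have "(exp (- 1 / t) * inverse t ^ 2) * inverse t ^ j
       + (real j * (- (inverse t ^ Suc (Suc 0)) * inverse t ^ (j - Suc 0))) * exp (- 1 / t)
       = flat_exp (j + 2) t - real j * flat_exp (j + 1) t"
    proof -
      have fe: "flat_exp n t = exp (- 1 / t) * inverse t ^ n" for n
        using 1 by (simp add: flat_exp_def divide_inverse power_inverse)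
      have "(E * i ^ 2) * i ^ j + (real j * (- (i ^ Suc (Suc 0)) * i ^ (j - Suc 0))) * E
        = E * i ^ (j + 2) - real j * (E * i ^ (j + 1))" for E i :: real
        by (cases j) (simp_all add: algebra_simps power_add power2_eq_square)
      then show ?thesis unfolding fe .
    qed
    ultimately have "((\<lambda>t. exp (- 1 / t) * inverse t ^ j) has_real_derivative flat_exp (j + 2) t - real j * flat_exp (j + 1) t) (at t)"
      by simp
    then show ?thesis
      by (rule has_field_derivative_transform_within_open[where S = "{0<..}"])
         (use 1 in \<open>auto simp: flat_exp_def divide_inverse power_inverse\<close>)
  next
    case 2
    have "((\<lambda>t. 0) has_real_derivative 0) (at t)" by simp
    then have "(flat_exp j has_real_derivative 0) (at t)"
      by (rule has_field_derivative_transform_within_open[where S = "{..<0}"])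
         (use 2 in \<open>auto simp: flat_exp_def\<close>)
    then show ?thesis using 2 by (simp add: flat_exp_def)
  next
    case 3
    have "((\<lambda>h. flat_exp j h / h) \<longlongrightarrow> 0) (at 0)"
    proof (rule Lim_null_comparison)
      have "norm (flat_exp j h / h) \<le> fact (j + 2) * \<bar>h\<bar>" if "h \<noteq> 0" for h
        using flat_exp_le[of j h] that
        by (simp add: abs_divide divide_le_eq power2_eq_square mult.assoc abs_mult_self_eq)
      then show "\<forall>\<^sub>F h in at 0. norm (flat_exp j h / h) \<le> fact (j + 2) * \<bar>h\<bar>"
        by (auto simp: eventually_at_filter)
      show "((\<lambda>h. fact (j + 2) * \<bar>h\<bar>) \<longlongrightarrow> (0::real)) (at 0)"
        by (rule tendsto_mult_right_zero) (use tendsto_rabs_zero[OF tendsto_ident_at] in simp)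
    qed
    then have "(flat_exp j has_real_derivative 0) (at 0)"
      by (simp add: DERIV_def flat_exp_def[of j 0])
    then show ?thesis using 3 by (simp add: flat_exp_def)
  qed
qed

text \<open>Outer polynomials are what the product and chain rules produce, and inner polynomials
  admit a bump together with its translates. The set is stable under \<open>deriv\<close>, so its
  members are differentiable to all orders.\<close>

inductive_set flat_span :: "(real \<Rightarrow> real) set" where
  base: "(\<lambda>x. poly p x * flat_exp j (poly q x)) \<in> flat_span"
| add: "f \<in> flat_span \<Longrightarrow> g \<in> flat_span \<Longrightarrow> (\<lambda>x. f x + g x) \<in> flat_span"

lemma flat_span_deriv:
  "f \<in> flat_span \<Longrightarrow> \<exists>g\<in>flat_span. \<forall>x. (f has_real_derivative g x) (at x)"
proof (induction rule: flat_span.induct)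
  case (base p j q)
  let ?g = "\<lambda>x. poly (pderiv p) x * flat_exp j (poly q x)
     + (poly (p * pderiv q) x * flat_exp (j + 2) (poly q x) + poly (Polynomial.smult (- real j) (p * pderiv q)) x * flat_exp (j + 1) (poly q x))"
  have "?g \<in> flat_span" by (intro flat_span.intros)
  moreover have "((\<lambda>x. poly p x * flat_exp j (poly q x)) has_real_derivative ?g x) (at x)" for x
  proof -
    have "((\<lambda>x. flat_exp j (poly q x)) has_real_derivative
        (flat_exp (j + 2) (poly q x) - real j * flat_exp (j + 1) (poly q x)) * poly (pderiv q) x) (at x)"
      by (rule DERIV_chain2[OF flat_exp_has_deriv poly_DERIV])
    then have "((\<lambda>x. poly p x * flat_exp j (poly q x)) has_real_derivative
        poly (pderiv p) x * flat_exp j (poly q x)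
        + (flat_exp (j + 2) (poly q x) - real j * flat_exp (j + 1) (poly q x)) * poly (pderiv q) x * poly p x) (at x)"
      by (rule DERIV_mult[OF poly_DERIV])
    then show ?thesis by (rule DERIV_cong) (simp add: algebra_simps)
  qed
  ultimately show ?case by (intro bexI[of _ ?g] allI)
next
  case (add f1 f2)
  then obtain g1 g2 where "g1 \<in> flat_span" "g2 \<in> flat_span"
    "\<And>x. (f1 has_real_derivative g1 x) (at x)" "\<And>x. (f2 has_real_derivative g2 x) (at x)" by blast
  then show ?case by (intro bexI[of _ "\<lambda>x. g1 x + g2 x"] allI DERIV_add flat_span.add)
qed

lemma flat_span_funpow_deriv: "f \<in> flat_span \<Longrightarrow> (deriv ^^ k) f \<in> flat_span"
proof (induction k)
  case (Suc k)
  then obtain g where g: "g \<in> flat_span" "\<And>x. ((deriv ^^ k) f has_real_derivative g x) (at x)"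
    using flat_span_deriv by blast
  have "deriv ((deriv ^^ k) f) = g" by (rule ext, rule DERIV_imp_deriv, rule g)
  then show ?case using g by simp
qed simp

text \<open>The derivative of the test function is a smooth approximation of the indicator of \<open>(0, b)\<close>
  minus a translate that is supported to the left of \<open>0\<close>.\<close>

lemma test_function_exists:
  fixes m :: nat
  assumes b: "0 < b" "b < T" and m: "0 < m"
  defines "eta \<equiv> \<lambda>x. flat_exp 0 (real m * (x * (b - x)))"
  shows "\<exists>\<phi>\<in>test_functions T. (\<forall>x\<ge>0. deriv \<phi> x = eta x) \<and> (\<forall>x\<in>{0..b}. \<phi> x = - (LINT s:{x..b}|lborel. eta s))
     \<and> (\<forall>x\<ge>b. \<phi> x = 0)"
proof -
  have eta_poly: "eta = (\<lambda>x. poly 1 x * flat_exp 0 (poly [:0, real m * b, - real m:] x))"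
    by (auto simp: eta_def fun_eq_iff algebra_simps)
  have eta_span: "eta \<in> flat_span" unfolding eta_poly by (rule flat_span.base)
  then obtain eta' where "\<And>x. (eta has_real_derivative eta' x) (at x)" using flat_span_deriv by blast
  then have cont: "isCont eta x" for x by (rule DERIV_isCont)
  have eta0: "eta x = 0" if "x \<le> 0 \<or> b \<le> x" for x
  proof -
    have "x * (b - x) \<le> 0" using that b by (auto simp: mult_le_0_iff)
    then have "real m * (x * (b - x)) \<le> 0" by (simp add: mult_nonneg_nonpos)
    then show ?thesis by (simp add: eta_def flat_exp_def)
  qed
  obtain E where E: "\<And>x. (E has_real_derivative eta x) (at x)"
    using einterval_antiderivative[of "-\<infinity>" \<infinity> eta] cont
    by (auto simp: has_real_derivative_iff_has_vector_derivative)
  \<comment> \<open>The shift by b + 1 moves the bump to [-(b + 1), -1]. Subtracting it makes the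
    total integral of the derivative zero, so \<phi> has compact support, while for x \<ge> 0 only
    the original bump is seen.\<close>
  define \<phi> where "\<phi> x = E x - E (x + (b + 1))" for x
  define \<delta> where "\<delta> x = eta x - eta (x + (b + 1))" for x
  have d: "(\<phi> has_real_derivative \<delta> x) (at x)" for x
    unfolding \<phi>_def \<delta>_def by (intro DERIV_diff E DERIV_shift[THEN iffD1])
  have \<delta>_span: "\<delta> \<in> flat_span"
  proof -
    \<comment> \<open>The second inner polynomial is m y (b - y) expanded with y = x + b +
      1.\<close>
    have "(\<lambda>x. poly 1 x * flat_exp 0 (poly [:0, real m * b, - real m:] x)
       + poly (-1) x * flat_exp 0 (poly [:- real m * (b + 1), - real m * (b + 2), - real m:] x)) \<in> flat_span"
      by (intro flat_span.intros)
    also have "(\<lambda>x. poly 1 x * flat_exp 0 (poly [:0, real m * b, - real m:] x)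
       + poly (-1) x * flat_exp 0 (poly [:- real m * (b + 1), - real m * (b + 2), - real m:] x)) = \<delta>"
    proof
      fix x
      have e1: "poly [:0, real m * b, - real m:] x = real m * (x * (b - x))"
        by (simp add: algebra_simps)
      have e2: "poly [:- real m * (b + 1), - real m * (b + 2), - real m:] x = real m * ((x + (b + 1)) * (b - (x + (b + 1))))"
        by (simp add: algebra_simps)
      show "poly 1 x * flat_exp 0 (poly [:0, real m * b, - real m:] x)
       + poly (-1) x * flat_exp 0 (poly [:- real m * (b + 1), - real m * (b + 2), - real m:] x) = \<delta> x"
        unfolding \<delta>_def eta_def e1 e2 by simp
    qed
    finally show ?thesis .
  qed
  have dd: "deriv \<phi> = \<delta>" by (rule ext, rule DERIV_imp_deriv, rule d)
  have const: "E x = E y" if "x \<le> y" "\<And>z. x \<le> z \<Longrightarrow> z \<le> y \<Longrightarrow> eta z = 0" for x y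
  proof (cases "x = y")
    case False
    with that have "x < y" by simp
    show ?thesis
    proof (rule sym, rule DERIV_isconst_end[OF \<open>x < y\<close>])
      show "continuous_on {x..y} E"
        by (intro continuous_at_imp_continuous_on ballI DERIV_isCont[OF E])
      show "(E has_real_derivative 0) (at z)" if "x < z" "z < y" for z
        using E[of z] \<open>\<And>z. x \<le> z \<Longrightarrow> z \<le> y \<Longrightarrow> eta z = 0\<close>[of z] that by simp
    qed
  qed simp
  have E0: "E x = E 0" if "x \<le> 0" for x by (rule const) (use eta0 that in auto)
  have Eb: "E x = E b" if "b \<le> x" for x by (rule const[symmetric]) (use eta0 that in auto)
  have out: "\<phi> x = 0" if "x \<notin> {- (b + 1)..b}" for x
  proof (cases "x < - (b + 1)")
    case True
    have "E x = E 0" by (rule E0) (use True b in simp)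
    moreover have "E (x + (b + 1)) = E 0" by (rule E0) (use True b in simp)
    ultimately show ?thesis by (simp add: \<phi>_def)
  next
    case False
    have "E x = E b" by (rule Eb) (use False that b in simp)
    moreover have "E (x + (b + 1)) = E b" by (rule Eb) (use False that b in simp)
    ultimately show ?thesis by (simp add: \<phi>_def)
  qed
  have smooth: "(deriv ^^ k) \<phi> differentiable (at x)" for k x
  proof (cases k)
    case 0 then show ?thesis using d by (auto simp: real_differentiable_def)
  next
    case (Suc k')
    then have "(deriv ^^ k) \<phi> = (deriv ^^ k') \<delta>" by (simp add: funpow_swap1 dd)
    then show ?thesis using flat_span_deriv[OF flat_span_funpow_deriv[OF \<delta>_span]]
      by (auto simp: real_differentiable_def)
  qed
  have "\<phi> \<in> test_functions T"
  proof -
    have "\<exists>a c. c < T \<and> (\<forall>x. x \<notin> {a..c} \<longrightarrow> \<phi> x = 0)" using out b(2) by blast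
    then show ?thesis using smooth by (simp add: test_functions_def)
  qed
  moreover have "deriv \<phi> x = eta x" if "0 \<le> x" for x
    using that b by (simp add: dd \<delta>_def eta0)
  moreover have "\<phi> x = - (LINT s:{x..b}|lborel. eta s)" if "x \<in> {0..b}" for x
  proof -
    have "(LINT s:{x..b}|lborel. eta s) = E b - E x"
      using that cont E integral_FTC_Icc[of x b E eta]
      by (auto simp: set_lebesgue_integral_def has_real_derivative_iff_has_vector_derivative
          intro: has_vector_derivative_at_within continuous_at_imp_continuous_on)
    moreover have "E (x + (b + 1)) = E b" by (rule Eb) (use that in auto)
    ultimately show ?thesis by (simp add: \<phi>_def)
  qed
  moreover have "\<phi> x = 0" if "b \<le> x" for x
  proof -
    have "E x = E b" by (rule Eb) (use that in simp)
    moreover have "E (x + (b + 1)) = E b" by (rule Eb) (use that b in simp)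
    ultimately show ?thesis by (simp add: \<phi>_def)
  qed
  ultimately show ?thesis by blast
qed

lemma flat_exp_0_tendsto:
  assumes "0 < s"
  shows "(\<lambda>m. flat_exp 0 (real (Suc m) * s)) \<longlonglongrightarrow> 1"
proof -
  have "(\<lambda>m. (- 1 / s) / real (Suc m)) \<longlonglongrightarrow> 0" by (rule LIMSEQ_Suc[OF lim_const_over_n])
  then have "(\<lambda>m. exp ((- 1 / s) / real (Suc m))) \<longlonglongrightarrow> exp 0" by (rule tendsto_exp)
  moreover have "exp ((- 1 / s) / real (Suc m)) = flat_exp 0 (real (Suc m) * s)" for m
    using assms by (simp add: flat_exp_def mult.commute)
  ultimately show ?thesis by simp
qed

text \<open>As m grows, the derivatives \<open>eta m\<close> of the test functions tend to 1 on
  (0,b) and the test functions themselves to -(b - x). The limit says that G and the primitive of g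
  have the same integral up to b. As the test functions do not vanish at 0, no constant of
  integration is left.\<close>

lemma has_distributional_deriv_integral:
  fixes G g :: "real \<Rightarrow> 'b::{banach, second_countable_topology}"
  assumes D: "has_distributional_deriv T G g" and b: "0 < b" "b < T"
    and G0: "\<And>t. t < 0 \<Longrightarrow> G t = 0" and g0: "\<And>t. t < 0 \<Longrightarrow> g t = 0"
  shows "(LINT t:{0..b}|lebesgue. G t) = (LINT t:{0..b}|lebesgue. (b - t) *\<^sub>R g t)"
proof -
  define eta where "eta m x = flat_exp 0 (real (Suc m) * (x * (b - x)))" for m x
  define J where "J m x = (LINT s:{x..b}|lborel. eta m s)" for m x
  have iG: "set_integrable lebesgue {0..b} G" and ig: "set_integrable lebesgue {0..b} g"
    using D b by (auto simp: has_distributional_deriv_def)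
  have e0: "0 \<le> eta m x" and e1: "eta m x \<le> 1" for m x
    by (auto simp: eta_def flat_exp_def)
  have [measurable]: "flat_exp j \<in> borel_measurable borel" for j
    unfolding flat_exp_def[abs_def] by measurable
  have [measurable]: "eta m \<in> borel_measurable borel" for m unfolding eta_def[abs_def] by measurable
  have [measurable]: "J m \<in> borel_measurable borel" for m
  proof -
    have "J m = (\<lambda>x. LINT s|lborel. (if x \<le> s \<and> s \<le> b then eta m s else 0))"
      by (auto simp: J_def set_lebesgue_integral_def indicator_def fun_eq_iff intro!: Bochner_Integration.integral_cong)
    then show ?thesis by simp
  qed
  have elim': "(\<lambda>m. eta m x) \<longlonglongrightarrow> 1" if "0 < x" "x < b" for x
    unfolding eta_def using that by (intro flat_exp_0_tendsto) auto
  have inti: "integrable lborel (indicator {x..b} :: real \<Rightarrow> real)" for x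
    by (rule integrable_real_indicator) (use emeasure_bounded_finite[of "{x..b}"] in auto)
  have Jlim: "(\<lambda>m. J m x) \<longlonglongrightarrow> b - x" if "x \<in> {0..b}" for x
  proof -
    have "(\<lambda>m. LINT s|lborel. indicator {x..b} s *\<^sub>R eta m s) \<longlonglongrightarrow> (LINT s|lborel. indicator {x..b} s)"
    proof (rule integral_dominated_convergence[where w = "indicator {x..b}"])
      show "AE s in lborel. (\<lambda>m. indicator {x..b} s *\<^sub>R eta m s) \<longlonglongrightarrow> (indicator {x..b} s :: real)"
        using AE_lborel_singleton[of 0] AE_lborel_singleton[of b]
      proof eventually_elim
        case (elim s)
        show ?case
        proof (cases "s \<in> {x..b}")
          case True
          then show ?thesis using elim'[of s] elim that by auto
        qed simp
      qed
    qed (use e0 e1 inti in \<open>auto simp: indicator_def\<close>)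
    then show ?thesis using that by (simp add: J_def set_lebesgue_integral_def)
  qed
  have Jb: "\<bar>J m x\<bar> \<le> b" if "x \<in> {0..b}" for m x
  proof -
    have "0 \<le> J m x" unfolding J_def set_lebesgue_integral_def by (rule integral_nonneg_AE) (use e0 in auto)
    moreover have "J m x \<le> (LINT s|lborel. indicator {x..b} s)"
      unfolding J_def set_lebesgue_integral_def
    proof (rule integral_mono)
      show "integrable lborel (\<lambda>s. indicator {x..b} s *\<^sub>R eta m s)"
        by (rule Bochner_Integration.integrable_bound[OF inti[of x]]) (use e0 e1 in \<open>auto simp: indicator_def\<close>)
      show "indicator {x..b} s *\<^sub>R eta m s \<le> indicator {x..b} s" for s
        using e1[of m s] by (cases "s \<in> {x..b}") auto
    qed (rule inti)
    ultimately show ?thesis using that by simp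
  qed
  have eq: "(LINT t|lebesgue. eta m t *\<^sub>R (indicator {0..b} t *\<^sub>R G t)) = (LINT t|lebesgue. J m t *\<^sub>R (indicator {0..b} t *\<^sub>R g t))" for m
  proof -
    obtain \<phi> where \<phi>: "\<phi> \<in> test_functions T" "\<And>x. 0 \<le> x \<Longrightarrow> deriv \<phi> x = eta m x"
      "\<And>x. x \<in> {0..b} \<Longrightarrow> \<phi> x = - J m x" "\<And>x. b \<le> x \<Longrightarrow> \<phi> x = 0"
      using test_function_exists[OF b, of "Suc m"] unfolding eta_def J_def by auto
    have ez: "eta m t = 0" if "b < t" for t
      using that b by (auto simp: eta_def flat_exp_def zero_less_mult_iff)
    have "(LINT t:{..<T}|lebesgue. deriv \<phi> t *\<^sub>R G t) = - (LINT t:{..<T}|lebesgue. \<phi> t *\<^sub>R g t)"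
      using D \<phi>(1) by (auto simp: has_distributional_deriv_def)
    moreover have "(LINT t:{..<T}|lebesgue. deriv \<phi> t *\<^sub>R G t) = (LINT t|lebesgue. eta m t *\<^sub>R (indicator {0..b} t *\<^sub>R G t))"
      unfolding set_lebesgue_integral_def
    proof (rule Bochner_Integration.integral_cong[OF refl])
      fix t
      consider "t < 0" | "0 \<le> t" "t \<le> b" | "b < t" by linarith
      then show "indicator {..<T} t *\<^sub>R deriv \<phi> t *\<^sub>R G t = eta m t *\<^sub>R (indicator {0..b} t *\<^sub>R G t)"
        by cases (use G0[of t] \<phi>(2)[of t] ez[of t] b in \<open>auto simp: indicator_def\<close>)
    qed
    moreover have "(LINT t:{..<T}|lebesgue. \<phi> t *\<^sub>R g t) = (LINT t|lebesgue. - (J m t *\<^sub>R (indicator {0..b} t *\<^sub>R g t)))"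
      unfolding set_lebesgue_integral_def
    proof (rule Bochner_Integration.integral_cong[OF refl])
      fix t
      consider "t < 0" | "0 \<le> t" "t \<le> b" | "b < t" by linarith
      then show "indicator {..<T} t *\<^sub>R \<phi> t *\<^sub>R g t = - (J m t *\<^sub>R (indicator {0..b} t *\<^sub>R g t))"
        by cases (use g0[of t] \<phi>(3)[of t] \<phi>(4)[of t] b in \<open>auto simp: indicator_def\<close>)
    qed
    ultimately show ?thesis by simp
  qed
  have [measurable]: "(\<lambda>t. indicator {0..b} t *\<^sub>R G t) \<in> borel_measurable lebesgue" "(\<lambda>t. indicator {0..b} t *\<^sub>R g t) \<in> borel_measurable lebesgue"
    using iG ig unfolding set_integrable_def by (auto dest: borel_measurable_integrable)
  have me: "eta m \<in> borel_measurable lebesgue" and mJ: "J m \<in> borel_measurable lebesgue" for m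
    by (rule measurable_completion; measurable)+
  have l1: "(\<lambda>m. LINT t|lebesgue. eta m t *\<^sub>R (indicator {0..b} t *\<^sub>R G t)) \<longlonglongrightarrow> (LINT t|lebesgue. indicator {0..b} t *\<^sub>R G t)"
  proof (rule integral_dominated_convergence[where w = "\<lambda>t. norm (indicator {0..b} t *\<^sub>R G t)"])
    have "AE t in lebesgue. t \<noteq> 0 \<and> t \<noteq> b"
      using AE_lborel_singleton[of 0] AE_lborel_singleton[of b] by (intro AE_completion) auto
    then show "AE t in lebesgue. (\<lambda>m. eta m t *\<^sub>R (indicator {0..b} t *\<^sub>R G t)) \<longlonglongrightarrow> indicator {0..b} t *\<^sub>R G t"
    proof eventually_elim
      case (elim t)
      show ?case
      proof (cases "t \<in> {0..b}")
        case True
        then have "(\<lambda>m. eta m t *\<^sub>R G t) \<longlonglongrightarrow> 1 *\<^sub>R G t"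
          using elim by (intro tendsto_scaleR elim' tendsto_const) auto
        then show ?thesis using True by simp
      qed simp
    qed
    show "AE t in lebesgue. norm (eta m t *\<^sub>R (indicator {0..b} t *\<^sub>R G t)) \<le> norm (indicator {0..b} t *\<^sub>R G t)" for m
    proof (rule AE_I2)
      fix t
      have "norm (eta m t *\<^sub>R y) \<le> norm y" for y :: 'b using e0[of m t] e1[of m t] by (simp add: mult_left_le_one_le)
      then show "norm (eta m t *\<^sub>R (indicator {0..b} t *\<^sub>R G t)) \<le> norm (indicator {0..b} t *\<^sub>R G t)" .
    qed
    show "(\<lambda>t. eta m t *\<^sub>R (indicator {0..b} t *\<^sub>R G t)) \<in> borel_measurable lebesgue" for m
      by (rule borel_measurable_scaleR[OF me]) measurable
    show "integrable lebesgue (\<lambda>t. norm (indicator {0..b} t *\<^sub>R G t))"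
      using iG unfolding set_integrable_def by (rule integrable_norm)
  qed measurable
  have l2: "(\<lambda>m. LINT t|lebesgue. J m t *\<^sub>R (indicator {0..b} t *\<^sub>R g t)) \<longlonglongrightarrow> (LINT t|lebesgue. (b - t) *\<^sub>R (indicator {0..b} t *\<^sub>R g t))"
  proof (rule integral_dominated_convergence[where w = "\<lambda>t. b * norm (indicator {0..b} t *\<^sub>R g t)"])
    show "AE t in lebesgue. (\<lambda>m. J m t *\<^sub>R (indicator {0..b} t *\<^sub>R g t)) \<longlonglongrightarrow> (b - t) *\<^sub>R (indicator {0..b} t *\<^sub>R g t)"
    proof (rule AE_I2)
      fix t
      show "(\<lambda>m. J m t *\<^sub>R (indicator {0..b} t *\<^sub>R g t)) \<longlonglongrightarrow> (b - t) *\<^sub>R (indicator {0..b} t *\<^sub>R g t)"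
        by (cases "t \<in> {0..b}") (auto intro!: tendsto_scaleR Jlim)
    qed
    show "AE t in lebesgue. norm (J m t *\<^sub>R (indicator {0..b} t *\<^sub>R g t)) \<le> b * norm (indicator {0..b} t *\<^sub>R g t)" for m
      using Jb[of _ m] by (intro AE_I2) (auto simp: indicator_def intro!: mult_right_mono)
    show "(\<lambda>t. J m t *\<^sub>R (indicator {0..b} t *\<^sub>R g t)) \<in> borel_measurable lebesgue" for m
      by (rule borel_measurable_scaleR[OF mJ]) measurable
    show "(\<lambda>t. (b - t) *\<^sub>R (indicator {0..b} t *\<^sub>R g t)) \<in> borel_measurable lebesgue"
      by (rule borel_measurable_scaleR[OF measurable_completion]) measurable
    show "integrable lebesgue (\<lambda>t. b * norm (indicator {0..b} t *\<^sub>R g t))"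
      using ig unfolding set_integrable_def by (intro integrable_mult_right integrable_norm)
  qed
  have "(LINT t|lebesgue. indicator {0..b} t *\<^sub>R G t) = (LINT t|lebesgue. (b - t) *\<^sub>R (indicator {0..b} t *\<^sub>R g t))"
    by (rule LIMSEQ_unique[OF l1[unfolded eq] l2])
  then show ?thesis
    unfolding set_lebesgue_integral_def by (simp add: mult.commute)
qed

text \<open>Each simple approximant has a Borel modification, and the countably many null sets are
  discarded together. Borel versions are wanted because the convolution arguments use product
  measurability over \<open>lborel\<close>.\<close>

lemma lebesgue_measurable_ex_borel:
  fixes g :: "real \<Rightarrow> 'b::{banach, second_countable_topology}"
  assumes "g \<in> borel_measurable lebesgue"
  shows "\<exists>g'\<in>borel_measurable borel. AE x in lborel. g x = g' x"
proof -
  from borel_measurable_implies_sequence_metric[OF assms, of 0]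
  obtain s where s: "\<forall>i. simple_function lebesgue (s i)" "\<forall>x\<in>space lebesgue. (\<lambda>i. s i x) \<longlonglongrightarrow> g x"
    by blast
  have lim: "(\<lambda>i. s i x) \<longlonglongrightarrow> g x" for x using s(2) by simp
  have "\<forall>i. \<exists>f'. simple_function lborel f' \<and> (AE x in lborel. s i x = f' x)"
    using completion_ex_simple_function s(1) by blast
  then obtain s' where s': "\<And>i. simple_function lborel (s' i)" "\<And>i. AE x in lborel. s i x = s' i x"
    by metis
  have m: "(\<lambda>x. lim (\<lambda>i. s' i x)) \<in> borel_measurable lborel"
    by (rule borel_measurable_lim_metric) (rule borel_measurable_simple_function[OF s'(1)])
  have "AE x in lborel. \<forall>i. s i x = s' i x" using s'(2) by (simp add: AE_all_countable)
  then have "AE x in lborel. g x = lim (\<lambda>i. s' i x)"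
  proof eventually_elim
    case (elim x)
    then show ?case using lim[of x] by (simp add: limI)
  qed
  with m show ?thesis by auto
qed

lemma set_measurable_ex_borel:
  fixes g :: "real \<Rightarrow> 'b::{banach, second_countable_topology}"
  assumes "set_borel_measurable lebesgue {0<..<T} g"
  obtains g' where "g' \<in> borel_measurable borel" "\<And>t. t \<notin> {0<..<T} \<Longrightarrow> g' t = 0"
    "AE t in lborel. t \<in> {0<..<T} \<longrightarrow> g t = g' t"
proof -
  obtain h where h: "h \<in> borel_measurable borel" "AE t in lborel. indicator {0<..<T} t *\<^sub>R g t = h t"
    using lebesgue_measurable_ex_borel[OF assms[unfolded set_borel_measurable_def]] by blast
  show ?thesis
  proof (rule that[of "\<lambda>t. indicator {0<..<T} t *\<^sub>R h t"])
    show "(\<lambda>t. indicator {0<..<T} t *\<^sub>R h t) \<in> borel_measurable borel" using h(1) by measurable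
    show "AE t in lborel. t \<in> {0<..<T} \<longrightarrow> g t = indicator {0<..<T} t *\<^sub>R h t"
      using h(2) by eventually_elim auto
  qed simp
qed

lemma set_integrable_ex_borel:
  fixes g :: "real \<Rightarrow> 'b::{banach, second_countable_topology}"
  assumes i: "set_integrable lebesgue {0..T} g"
  obtains g' where "g' \<in> borel_measurable borel" "\<And>t. t \<notin> {0<..<T} \<Longrightarrow> g' t = 0"
    "AE t in lborel. t \<in> {0<..<T} \<longrightarrow> g t = g' t" "integrable lborel g'"
proof -
  have i2: "set_integrable lebesgue {0<..<T} g" by (rule set_integrable_subset[OF i]) auto
  then have "set_borel_measurable lebesgue {0<..<T} g"
    unfolding set_integrable_def set_borel_measurable_def by (rule borel_measurable_integrable)
  then obtain g' where g': "g' \<in> borel_measurable borel" "\<And>t. t \<notin> {0<..<T} \<Longrightarrow> g' t = 0"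
    "AE t in lborel. t \<in> {0<..<T} \<longrightarrow> g t = g' t" by (rule set_measurable_ex_borel) blast
  have "integrable lebesgue g'"
  proof (rule Bochner_Integration.integrable_cong_AE[THEN iffD1, OF _ _ _ i2[unfolded set_integrable_def]])
    show "AE t in lebesgue. indicator {0<..<T} t *\<^sub>R g t = g' t"
      using AE_completion[OF g'(3)] by eventually_elim (use g'(2) in \<open>auto simp: indicator_def\<close>)
    show "(\<lambda>t. indicator {0<..<T} t *\<^sub>R g t) \<in> borel_measurable lebesgue"
      using i2 unfolding set_integrable_def by (rule borel_measurable_integrable)
    show "g' \<in> borel_measurable lebesgue" using g'(1) by (simp add: measurable_completion)
  qed
  then have "integrable lborel g'" using g'(1) by (simp add: integrable_completion)
  with g' show ?thesis by (rule that)
qed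

section \<open>Fractional integrals and the Caputo derivative as convolutions\<close>

lemma set_integral_frac_kernel:
  fixes w w1 :: "real \<Rightarrow> 'b::{banach, second_countable_topology}"
  assumes a: "0 < a" and w1[measurable]: "w1 \<in> borel_measurable borel" and c: "causal w1"
    and ae: "AE s in lborel. s \<in> {0<..<t} \<longrightarrow> w s = w1 s"
    and w: "(\<lambda>s. indicator {0..t} s *\<^sub>R w s) \<in> borel_measurable lebesgue"
  shows "(1 / Gamma a) *\<^sub>R (LINT s:{0..t}|lebesgue. (t - s) powr (a - 1) *\<^sub>R w s) = conv (frac_kernel a) w1 t"
proof -
  have [measurable]: "(\<lambda>s. (t - s) powr (a - 1)) \<in> borel_measurable lebesgue"
    by (rule measurable_completion) measurable
  have "(LINT s:{0..t}|lebesgue. (t - s) powr (a - 1) *\<^sub>R w s) = (LINT s|lebesgue. Gamma a *\<^sub>R (frac_kernel a (t - s) *\<^sub>R w1 s))"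
    unfolding set_lebesgue_integral_def
  proof (rule Bochner_Integration.integral_cong_AE)
    have "(\<lambda>s. (t - s) powr (a - 1) *\<^sub>R (indicator {0..t} s *\<^sub>R w s)) \<in> borel_measurable lebesgue"
      using w by measurable
    then show "(\<lambda>s. indicator {0..t} s *\<^sub>R (t - s) powr (a - 1) *\<^sub>R w s) \<in> borel_measurable lebesgue"
      by (simp add: mult.commute)
    show "(\<lambda>s. Gamma a *\<^sub>R (frac_kernel a (t - s) *\<^sub>R w1 s)) \<in> borel_measurable lebesgue"
      by (rule measurable_completion) measurable
    have "AE s in lborel. indicator {0..t} s *\<^sub>R (t - s) powr (a - 1) *\<^sub>R w s = Gamma a *\<^sub>R (frac_kernel a (t - s) *\<^sub>R w1 s)"
      using ae AE_lborel_singleton[of 0] AE_lborel_singleton[of t]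
    proof eventually_elim
      case (elim s)
      consider "s < 0" | "0 < s" "s < t" | "t < s" using elim by linarith
      then show ?case
      proof cases
        case 1 then show ?thesis using c by (simp add: causal_def)
      next
        case 2 then show ?thesis using elim Gamma_real_pos[OF a] by (simp add: frac_kernel_def)
      next
        case 3 then show ?thesis by (simp add: frac_kernel_def)
      qed
    qed
    then show "AE s in lebesgue. indicator {0..t} s *\<^sub>R (t - s) powr (a - 1) *\<^sub>R w s = Gamma a *\<^sub>R (frac_kernel a (t - s) *\<^sub>R w1 s)"
      by (rule AE_completion)
  qed
  also have "\<dots> = (LINT s|lborel. Gamma a *\<^sub>R (frac_kernel a (t - s) *\<^sub>R w1 s))"
    by (rule integral_completion) measurable
  also have "\<dots> = Gamma a *\<^sub>R conv (frac_kernel a) w1 t"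
    unfolding conv_def by (rule integral_scaleR_right)
  finally show ?thesis using Gamma_real_pos[OF a] by simp
qed

lemma caputo_primitive_eq_conv:
  fixes w w1 :: "real \<Rightarrow> 'b::{banach, second_countable_topology}"
  assumes \<alpha>: "\<alpha> < 1" and w1: "w1 \<in> borel_measurable borel" "causal w1"
    and ae: "AE s in lborel. s \<in> {0<..<t} \<longrightarrow> w s - w0 = w1 s"
    and w: "set_integrable lebesgue {0..t} w" and t: "0 \<le> t"
  shows "caputo_primitive \<alpha> w w0 t = conv (frac_kernel (1 - \<alpha>)) w1 t"
proof -
  have "(\<lambda>s. indicator {0..t} s *\<^sub>R w s) \<in> borel_measurable lebesgue"
    using w unfolding set_integrable_def by (rule borel_measurable_integrable)
  moreover have "(\<lambda>s. indicator {0..t} s *\<^sub>R w0) \<in> borel_measurable lebesgue"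
    by (rule measurable_completion) measurable
  ultimately have "(\<lambda>s. indicator {0..t} s *\<^sub>R w s - indicator {0..t} s *\<^sub>R w0) \<in> borel_measurable lebesgue"
    by (rule borel_measurable_diff)
  then have "(\<lambda>s. indicator {0..t} s *\<^sub>R (w s - w0)) \<in> borel_measurable lebesgue"
    by (simp add: scaleR_diff_right)
  from set_integral_frac_kernel[OF _ w1 ae this, of "1 - \<alpha>"] show ?thesis
    using \<alpha> t by (simp add: caputo_primitive_def)
qed

lemma conv_finite_AE:
  fixes g :: "real \<Rightarrow> 'b::{banach, second_countable_topology}"
  assumes "0 < a" and [measurable]: "g \<in> borel_measurable borel" and c: "causal g" and i: "integrable lborel g"
  shows "AE t in lborel. nconv (enorm (frac_kernel a)) (enorm g) t < \<infinity>"
    and "\<And>T. (\<integral>\<^sup>+t\<in>{..T}. nconv (enorm (frac_kernel a)) (enorm g) t \<partial>lborel) < \<infinity>"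
    and "\<And>T. set_integrable lborel {..T} (conv (frac_kernel a) g)"
proof -
  let ?l = "frac_kernel a"
  have fl: "(\<integral>\<^sup>+t\<in>{..T}. enorm ?l t \<partial>lborel) < \<infinity>" for T
    using nn_integral_frac_kernel[OF assms(1), of T] assms(1) by (simp add: frac_kernel_nonneg)
  have A: "AE t in lborel. t \<le> T \<longrightarrow> nconv (enorm ?l) (enorm g) t < \<infinity>" for T
    by (rule nconv_finite_AE) (use fl ennreal_integrable_finite[OF i] c in auto)
  have "AE t in lborel. \<forall>n::nat. t \<le> real n \<longrightarrow> nconv (enorm ?l) (enorm g) t < \<infinity>"
    by (subst AE_all_countable) (use A in blast)
  then show "AE t in lborel. nconv (enorm ?l) (enorm g) t < \<infinity>"
    by eventually_elim (use real_arch_simple in blast)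
  show F: "(\<integral>\<^sup>+t\<in>{..T}. nconv (enorm ?l) (enorm g) t \<partial>lborel) < \<infinity>" for T
  proof -
    have "(\<integral>\<^sup>+t\<in>{..T}. nconv (enorm ?l) (enorm g) t \<partial>lborel) \<le> (\<integral>\<^sup>+t\<in>{..T}. enorm ?l t \<partial>lborel) * (\<integral>\<^sup>+t\<in>{..T}. enorm g t \<partial>lborel)"
      by (rule nn_integral_nconv_le) (use c in auto)
    also have "\<dots> < \<infinity>" using fl[of T] ennreal_integrable_finite[OF i, of "{..T}"] by (simp add: ennreal_mult_less_top)
    finally show ?thesis .
  qed
  show "set_integrable lborel {..T} (conv ?l g)" for T
    unfolding set_integrable_def
  proof (rule integrableI_bounded)
    have "(\<integral>\<^sup>+t. ennreal (norm (indicator {..T} t *\<^sub>R conv ?l g t)) \<partial>lborel) \<le> (\<integral>\<^sup>+t\<in>{..T}. nconv (enorm ?l) (enorm g) t \<partial>lborel)"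
    proof (rule nn_integral_mono)
      fix t show "ennreal (norm (indicator {..T} t *\<^sub>R conv ?l g t)) \<le> nconv (enorm ?l) (enorm g) t * indicator {..T} t"
        using norm_conv_le[of ?l g t] by (cases "t \<le> T") auto
    qed
    also have "\<dots> < \<infinity>" by (rule F)
    finally show "(\<integral>\<^sup>+t. ennreal (norm (indicator {..T} t *\<^sub>R conv ?l g t)) \<partial>lborel) < \<infinity>" .
  qed measurable
qed

text \<open>The semigroup law acting on an integrable function, valid wherever the combined
  convolution converges absolutely. For a + b < 1 this can fail at exceptional times.\<close>

lemma conv_frac_kernel_assoc:
  fixes g :: "real \<Rightarrow> 'b::{banach, second_countable_topology}"
  assumes "0 < a" "0 < b" and [measurable]: "g \<in> borel_measurable borel" and c: "causal g" and i: "integrable lborel g"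
  shows "AE t in lborel. conv (frac_kernel a) (conv (frac_kernel b) g) t = conv (frac_kernel (a + b)) g t"
  using conv_finite_AE(1)[OF add_pos_pos[OF assms(1,2)] assms(3) c i]
proof eventually_elim
  case (elim t)
  have k0: "0 \<le> frac_kernel a x" "0 \<le> frac_kernel b x" "0 \<le> frac_kernel (a + b) x" for x
    using assms by (simp_all add: frac_kernel_nonneg)
  have "nconv (enorm (frac_kernel a)) (nconv (enorm (frac_kernel b)) (enorm g)) t
     = nconv (nconv (enorm (frac_kernel a)) (enorm (frac_kernel b))) (enorm g) t"
    by (rule nconv_assoc) measurable
  also have "nconv (enorm (frac_kernel a)) (enorm (frac_kernel b)) = enorm (frac_kernel (a + b))"
    using nconv_frac_kernel[OF assms(1,2)] k0 by (simp add: fun_eq_iff)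
  finally have "conv (frac_kernel a) (conv (frac_kernel b) g) t = conv (conv (frac_kernel a) (frac_kernel b)) g t"
    using elim by (intro conv_assoc) auto
  moreover have "conv (frac_kernel a) (frac_kernel b) = frac_kernel (a + b)"
    using conv_frac_kernel[OF assms(1,2)] by (simp add: fun_eq_iff)
  ultimately show ?case by simp
qed

lemma AE_eq_of_conv_frac_kernel_1_eq:
  fixes f g :: "real \<Rightarrow> 'b::{banach, second_countable_topology}"
  assumes [measurable]: "f \<in> borel_measurable borel" "g \<in> borel_measurable borel"
    and c: "causal f" "causal g"
    and i: "set_integrable lborel {..T} f" "set_integrable lborel {..T} g"
    and eq: "AE t in lborel. t \<in> {0<..<T} \<longrightarrow> conv (frac_kernel 1) f t = conv (frac_kernel 1) g t"
  shows "AE t in lborel. t \<in> {0<..<T} \<longrightarrow> f t = g t"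
proof -
  define z where "z t = indicator {..T} t *\<^sub>R f t - indicator {..T} t *\<^sub>R g t" for t
  have [measurable]: "z \<in> borel_measurable borel" unfolding z_def[abs_def] by measurable
  have "AE s in lborel. s < T \<longrightarrow> z s = 0"
  proof (rule AE_zero_of_conv_frac_kernel_1_zero)
    show "integrable lborel z" unfolding z_def using i by (auto simp: set_integrable_def)
    show "causal z" using c by (simp add: causal_def z_def)
    show "AE t in lborel. t \<in> {0<..<T} \<longrightarrow> conv (frac_kernel 1) z t = 0"
      using eq
    proof eventually_elim
      case (elim t)
      show ?case
      proof
        assume t: "t \<in> {0<..<T}"
        have si: "integrable lborel (\<lambda>s. indicator {..<t} s *\<^sub>R h s)" if "set_integrable lborel {..T} h" for h :: "real \<Rightarrow> 'b"
        proof -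
          have "{..<t} \<subseteq> {..T}" using t by auto
          then show ?thesis using set_integrable_subset[OF that, of "{..<t}"] by (simp add: set_integrable_def)
        qed
        have "conv (frac_kernel 1) z t = (LINT s|lborel. indicator {..<t} s *\<^sub>R f s - indicator {..<t} s *\<^sub>R g s)"
          unfolding conv_frac_kernel_1 set_lebesgue_integral_def z_def
          by (rule Bochner_Integration.integral_cong) (use t in \<open>auto simp: indicator_def\<close>)
        also have "\<dots> = conv (frac_kernel 1) f t - conv (frac_kernel 1) g t"
          unfolding conv_frac_kernel_1 set_lebesgue_integral_def
          by (rule Bochner_Integration.integral_diff[OF si[OF i(1)] si[OF i(2)]])
        finally show "conv (frac_kernel 1) z t = 0" using elim t by simp
      qed
    qed
  qed
  then show ?thesis by eventually_elim (auto simp: z_def)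
qed

text \<open>Write k(a) for the kernel of order a and * for convolution. The distributional equation,
  integrated, reads k(1) * k(1 - \<alpha>) * u1 = k(2) * g1 = k(1) * k(1) * g1, and cancelling k(1)
  gives k(1 - \<alpha>) * u1 = k(1) * g1. Convolving with k(\<alpha>) gives k(1) * u1 = k(1) *
  k(\<alpha>) * g1, and k(1) is cancelled once more. Cancelling k(1) is the uniqueness of
  densities.\<close>

lemma has_caputo_deriv_imp_conv:
  fixes u g u1 g1 :: "real \<Rightarrow> 'b::{banach, second_countable_topology}"
  assumes \<alpha>: "0 < \<alpha>" "\<alpha> < 1" and T: "T' \<le> T"
    and D: "has_caputo_deriv \<alpha> T u u0 g"
    and [measurable]: "u1 \<in> borel_measurable borel" "g1 \<in> borel_measurable borel"
    and z: "\<And>t. t \<notin> {0<..<T'} \<Longrightarrow> u1 t = 0" "\<And>t. t \<notin> {0<..<T'} \<Longrightarrow> g1 t = 0"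
    and i: "integrable lborel u1" "integrable lborel g1"
    and u: "AE t in lborel. t \<in> {0<..<T'} \<longrightarrow> u t - u0 = u1 t"
    and g: "AE t in lborel. t \<in> {0<..<T'} \<longrightarrow> g t = g1 t"
  shows "AE t in lborel. t \<in> {0<..<T'} \<longrightarrow> u1 t = conv (frac_kernel \<alpha>) g1 t"
proof -
  let ?l = "frac_kernel \<alpha>" and ?k = "frac_kernel (1 - \<alpha>)" and ?p = "frac_kernel 1"
  have c: "causal u1" "causal g1" using z by (auto simp: causal_def)
  have a': "0 < 1 - \<alpha>" using \<alpha> by simp
  \<comment> \<open>The weight b - t is the kernel of order 2, as Gamma(2) = 1.\<close>
  have key: "conv ?p (conv ?k u1) b = conv (frac_kernel 2) g1 b" if b: "b \<in> {0<..<T'}" for b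
  proof -
    let ?g = "\<lambda>t. if t < 0 then 0 else g t" and ?G = "caputo_primitive \<alpha> u u0"
    have dd: "has_distributional_deriv T ?G ?g" and su: "\<And>c. c < T \<Longrightarrow> set_integrable lebesgue {0..c} u"
      using D by (auto simp: has_caputo_deriv_def)
    have ig: "set_integrable lebesgue {0..b} ?g" using dd b T by (simp add: has_distributional_deriv_def)
    have "(LINT t:{0..b}|lebesgue. ?G t) = (LINT t:{0..b}|lebesgue. (b - t) *\<^sub>R ?g t)"
      by (rule has_distributional_deriv_integral[OF dd]) (use b T in \<open>auto simp: caputo_primitive_def\<close>)
    moreover have "(LINT t:{0..b}|lebesgue. ?G t) = conv ?p (conv ?k u1) b"
    proof -
      have cG: "?G t = conv ?k u1 t" if "t \<in> {0..b}" for t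
        by (rule caputo_primitive_eq_conv)
          (use \<alpha> c that b T su u in \<open>auto elim: eventually_mono\<close>)
      have "(LINT t:{0..b}|lebesgue. ?G t) = (LINT t:{0..b}|lebesgue. conv ?k u1 t)"
        unfolding set_lebesgue_integral_def
        by (rule Bochner_Integration.integral_cong) (use cG in \<open>auto simp: indicator_def\<close>)
      also have "\<dots> = (LINT t:{0..b}|lborel. conv ?k u1 t)"
        unfolding set_lebesgue_integral_def by (rule integral_completion) measurable
      also have "\<dots> = (LINT t:{..<b}|lborel. conv ?k u1 t)"
        unfolding set_lebesgue_integral_def
      proof (rule Bochner_Integration.integral_cong_AE)
        show "AE t in lborel. indicator {0..b} t *\<^sub>R conv ?k u1 t = indicator {..<b} t *\<^sub>R conv ?k u1 t"
          using AE_lborel_singleton[of b]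
        proof eventually_elim
          case (elim t)
          then show ?case using causal_conv[OF causal_frac_kernel c(1), of "1 - \<alpha>"]
            by (cases "t < 0") (auto simp: causal_def indicator_def)
        qed
      qed measurable
      finally show ?thesis by (simp add: conv_frac_kernel_1)
    qed
    moreover have "(LINT t:{0..b}|lebesgue. (b - t) *\<^sub>R ?g t) = conv (frac_kernel 2) g1 b"
    proof -
      have "(1 / Gamma 2) *\<^sub>R (LINT s:{0..b}|lebesgue. (b - s) powr (2 - 1) *\<^sub>R ?g s) = conv (frac_kernel 2) g1 b"
      proof (rule set_integral_frac_kernel)
        show "(\<lambda>s. indicator {0..b} s *\<^sub>R ?g s) \<in> borel_measurable lebesgue"
          using ig unfolding set_integrable_def by (rule borel_measurable_integrable)
        show "AE s in lborel. s \<in> {0<..<b} \<longrightarrow> ?g s = g1 s"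
          using g by eventually_elim (use b in auto)
      qed (use c in auto)
      moreover have "Gamma (2::real) = 1" using Gamma_fact[of 1, where 'a=real] by simp
      moreover have "(LINT s:{0..b}|lebesgue. (b - s) powr (2 - 1) *\<^sub>R ?g s) = (LINT t:{0..b}|lebesgue. (b - t) *\<^sub>R ?g t)"
        unfolding set_lebesgue_integral_def
        by (rule Bochner_Integration.integral_cong) (auto simp: indicator_def)
      ultimately show ?thesis by simp
    qed
    ultimately show ?thesis by simp
  qed
  have "AE t in lborel. t \<in> {0<..<T'} \<longrightarrow> conv ?p (conv ?k u1) t = conv ?p (conv ?p g1) t"
    using conv_frac_kernel_assoc[OF less_numeral_extra(1) less_numeral_extra(1) assms(6) c(2) i(2)]
  proof eventually_elim
    case (elim t)
    have "(1::real) + 1 = 2" by simp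
    then have E: "conv ?p (conv ?p g1) t = conv (frac_kernel 2) g1 t" using elim by (simp only:)
    show ?case unfolding E using key by blast
  qed
  then have ku: "AE t in lborel. t \<in> {0<..<T'} \<longrightarrow> conv ?k u1 t = conv ?p g1 t"
    by (rule AE_eq_of_conv_frac_kernel_1_eq[OF _ _ causal_conv[OF causal_frac_kernel c(1)] causal_conv[OF causal_frac_kernel c(2)]
        conv_finite_AE(3)[OF a' assms(5) c(1) i(1)] conv_finite_AE(3)[OF less_numeral_extra(1) assms(6) c(2) i(2)], rotated 2]) simp_all
  have e1: "conv ?l (conv ?k u1) t = conv ?l (conv ?p g1) t" if "t \<in> {0<..<T'}" for t
  proof (rule conv_cong_AE)
    show "AE s in lborel. s < t \<longrightarrow> conv ?k u1 s = conv ?p g1 s"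
      using ku AE_lborel_singleton[of 0]
    proof eventually_elim
      case (elim s)
      show ?case
      proof (cases "s < 0")
        case True
        then show ?thesis using causal_conv[OF causal_frac_kernel c(1)] causal_conv[OF causal_frac_kernel c(2)]
          by (simp add: causal_def)
      next
        case False then show ?thesis using elim that by auto
      qed
    qed
  qed auto
  have e2: "AE t in lborel. conv ?l (conv ?k u1) t = conv ?p u1 t"
    using conv_frac_kernel_assoc[OF \<alpha>(1) a' assms(5) c(1) i(1)] by simp
  have e3: "AE t in lborel. conv ?l (conv ?p g1) t = conv (frac_kernel (\<alpha> + 1)) g1 t"
    by (rule conv_frac_kernel_assoc[OF \<alpha>(1) less_numeral_extra(1) assms(6) c(2) i(2)])
  have e4: "AE t in lborel. conv ?p (conv ?l g1) t = conv (frac_kernel (\<alpha> + 1)) g1 t"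
    using conv_frac_kernel_assoc[OF less_numeral_extra(1) \<alpha>(1) assms(6) c(2) i(2)] by (simp add: add.commute)
  have "AE t in lborel. t \<in> {0<..<T'} \<longrightarrow> conv ?p u1 t = conv ?p (conv ?l g1) t"
    using e2 e3 e4
  proof eventually_elim
    case (elim t) then show ?case using e1[of t] by simp
  qed
  then show ?thesis
    by (rule AE_eq_of_conv_frac_kernel_1_eq[OF assms(5) _ c(1) causal_conv[OF causal_frac_kernel c(2)]
        _ conv_finite_AE(3)[OF \<alpha>(1) assms(6) c(2) i(2)], rotated 2])
       (simp_all add: set_integrable_def integrable_mult_indicator[OF _ i(1)])
qed

text \<open>Abel's inversion: convolving with the kernel of order 1 - \<alpha> reduces the claim to
  the Heaviside kernel.\<close>

lemma AE_eq_of_conv_frac_kernel_eq: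
  fixes g h :: "real \<Rightarrow> 'b::{banach, second_countable_topology}"
  assumes \<alpha>: "0 < \<alpha>" "\<alpha> < 1"
    and [measurable]: "g \<in> borel_measurable borel" "h \<in> borel_measurable borel"
    and c: "causal g" "causal h" and i: "integrable lborel g" "integrable lborel h"
    and eq: "AE t in lborel. t \<in> {0<..<T} \<longrightarrow> conv (frac_kernel \<alpha>) g t = conv (frac_kernel \<alpha>) h t"
  shows "AE t in lborel. t \<in> {0<..<T} \<longrightarrow> g t = h t"
proof (rule AE_eq_of_conv_frac_kernel_1_eq)
  let ?l = "frac_kernel \<alpha>" and ?k = "frac_kernel (1 - \<alpha>)"
  have e1: "conv ?k (conv ?l g) t = conv ?k (conv ?l h) t" if "t \<in> {0<..<T}" for t
  proof (rule conv_cong_AE)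
    show "AE s in lborel. s < t \<longrightarrow> conv ?l g s = conv ?l h s"
      using eq AE_lborel_singleton[of 0]
    proof eventually_elim
      case (elim s)
      show ?case
      proof (cases "s < 0")
        case True
        then show ?thesis using causal_conv[OF causal_frac_kernel c(1)] causal_conv[OF causal_frac_kernel c(2)]
          by (simp add: causal_def)
      next
        case False then show ?thesis using elim that by auto
      qed
    qed
  qed auto
  have a': "0 < 1 - \<alpha>" using \<alpha> by simp
  have e2: "AE t in lborel. conv ?k (conv ?l g) t = conv (frac_kernel 1) g t"
    using conv_frac_kernel_assoc[OF a' \<alpha>(1) assms(3) c(1) i(1)] by simp
  have e3: "AE t in lborel. conv ?k (conv ?l h) t = conv (frac_kernel 1) h t"
    using conv_frac_kernel_assoc[OF a' \<alpha>(1) assms(4) c(2) i(2)] by simp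
  show "AE t in lborel. t \<in> {0<..<T} \<longrightarrow> conv (frac_kernel 1) g t = conv (frac_kernel 1) h t"
    using e2 e3
  proof eventually_elim
    case (elim t) then show ?case using e1[of t] by simp
  qed
qed (simp_all add: c set_integrable_def integrable_mult_indicator[OF _ i(1)] integrable_mult_indicator[OF _ i(2)])

text \<open>\<open>caputo_deriv\<close> is picked by \<open>SOME\<close>, so every computation with
  it rests on uniqueness. The definition provides integrability only on [0,c] with c < T, hence the
  exhaustion by T' < T.\<close>

lemma has_caputo_deriv_unique:
  fixes w g h :: "real \<Rightarrow> 'b::{banach, second_countable_topology}"
  assumes \<alpha>: "0 < \<alpha>" "\<alpha> < 1"
    and g: "has_caputo_deriv \<alpha> T w w0 g" and h: "has_caputo_deriv \<alpha> T w w0 h"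
  shows "AE t in lborel. t \<in> {0<..<T} \<longrightarrow> g t = h t"
proof -
  have *: "AE t in lborel. t \<in> {0<..<T'} \<longrightarrow> g t = h t" if T': "T' < T" for T'
  proof -
    have si: "set_integrable lebesgue {0..T'} f" if f: "has_caputo_deriv \<alpha> T w w0 f" for f
    proof -
      have "set_integrable lebesgue {0..T'} (\<lambda>t. if t < 0 then 0 else f t)"
        using f T' by (auto simp: has_caputo_deriv_def has_distributional_deriv_def)
      then show ?thesis by (rule set_integrable_cong[THEN iffD1, rotated 3]) auto
    qed
    obtain g1 where g1: "g1 \<in> borel_measurable borel" "\<And>t. t \<notin> {0<..<T'} \<Longrightarrow> g1 t = 0"
      "AE t in lborel. t \<in> {0<..<T'} \<longrightarrow> g t = g1 t" "integrable lborel g1"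
      using set_integrable_ex_borel[OF si[OF g]] by blast
    obtain h1 where h1: "h1 \<in> borel_measurable borel" "\<And>t. t \<notin> {0<..<T'} \<Longrightarrow> h1 t = 0"
      "AE t in lborel. t \<in> {0<..<T'} \<longrightarrow> h t = h1 t" "integrable lborel h1"
      using set_integrable_ex_borel[OF si[OF h]] by blast
    have "set_integrable lebesgue {0..T'} w" using g T' by (simp add: has_caputo_deriv_def)
    moreover have "set_integrable lebesgue {0..T'} (\<lambda>t. w0)"
      unfolding set_integrable_def using emeasure_bounded_finite[of "{0..T'}"]
      by (subst integrable_completion) (auto intro!: integrable_scaleR_left integrable_real_indicator)
    ultimately have "set_integrable lebesgue {0..T'} (\<lambda>t. w t - w0)" by (rule set_integral_diff)
    then obtain w1 where w1: "w1 \<in> borel_measurable borel" "\<And>t. t \<notin> {0<..<T'} \<Longrightarrow> w1 t = 0"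
      "AE t in lborel. t \<in> {0<..<T'} \<longrightarrow> w t - w0 = w1 t" "integrable lborel w1"
      by (rule set_integrable_ex_borel) blast
    have "AE t in lborel. t \<in> {0<..<T'} \<longrightarrow> w1 t = conv (frac_kernel \<alpha>) g1 t"
      by (rule has_caputo_deriv_imp_conv[OF \<alpha> less_imp_le[OF T'] g w1(1) g1(1) w1(2) g1(2) w1(4) g1(4) w1(3) g1(3)])
    moreover have "AE t in lborel. t \<in> {0<..<T'} \<longrightarrow> w1 t = conv (frac_kernel \<alpha>) h1 t"
      by (rule has_caputo_deriv_imp_conv[OF \<alpha> less_imp_le[OF T'] h w1(1) h1(1) w1(2) h1(2) w1(4) h1(4) w1(3) h1(3)])
    ultimately have "AE t in lborel. t \<in> {0<..<T'} \<longrightarrow> conv (frac_kernel \<alpha>) g1 t = conv (frac_kernel \<alpha>) h1 t"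
      by eventually_elim auto
    then have "AE t in lborel. t \<in> {0<..<T'} \<longrightarrow> g1 t = h1 t"
      by (intro AE_eq_of_conv_frac_kernel_eq[OF \<alpha> g1(1) h1(1)] g1(4) h1(4)) (use g1(2) h1(2) in \<open>auto simp: causal_def\<close>)
    with g1(3) h1(3) show ?thesis by eventually_elim auto
  qed
  have "AE t in lborel. \<forall>n::nat. t \<in> {0<..<T - 1 / real (Suc n)} \<longrightarrow> g t = h t"
    by (subst AE_all_countable, intro allI, rule *) simp
  then show ?thesis
  proof eventually_elim
    case (elim t)
    show ?case
    proof
      assume t: "t \<in> {0<..<T}"
      then obtain n where "1 / real (Suc n) < T - t" using nat_approx_posE[of "T - t"] by auto
      then show "g t = h t" using elim t by (auto simp: algebra_simps)
    qed
  qed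
qed

text \<open>The last item is the fundamental theorem of calculus on (s,\<infinity>), in the form in
  which the inner integral appears after Fubini.\<close>

lemma integral_deriv_test_function:
  assumes "\<phi> \<in> test_functions T"
  obtains a b where "b < T" "\<And>x. x \<notin> {a..b} \<Longrightarrow> \<phi> x = 0" "\<And>x. x \<notin> {a..b} \<Longrightarrow> deriv \<phi> x = 0"
    "\<And>x. isCont (deriv \<phi>) x" "\<And>s. (LINT t:{s<..}|lborel. deriv \<phi> t) = - \<phi> s"
proof -
  obtain a b where ab: "b < T" "\<And>x. x \<notin> {a..b} \<Longrightarrow> \<phi> x = 0" and sm: "\<And>k x. (deriv ^^ k) \<phi> differentiable (at x)"
    using assms unfolding test_functions_def by auto
  have "\<phi> differentiable (at x)" for x using sm[of 0 x] by simp
  then have D: "(\<phi> has_real_derivative deriv \<phi> x) (at x)" for x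
    by (metis DERIV_deriv_iff_real_differentiable)
  have "deriv \<phi> differentiable (at x)" for x using sm[of 1 x] by simp
  then have C: "isCont (deriv \<phi>) x" for x by (rule differentiable_imp_continuous_within)
  have z: "deriv \<phi> x = 0" if "x \<notin> {a..b}" for x
  proof -
    have "((\<lambda>_. 0) has_real_derivative 0) (at x)" by simp
    then have "(\<phi> has_real_derivative 0) (at x)"
      by (rule has_field_derivative_transform_within_open[where S = "- {a..b}"]) (use that ab(2) in auto)
    then show ?thesis by (rule DERIV_imp_deriv)
  qed
  have "(LINT t:{s<..}|lborel. deriv \<phi> t) = - \<phi> s" for s
  proof -
    define c where "c = max s b + 1"
    have c: "s \<le> c" "b < c" by (auto simp: c_def)
    have "(LINT t:{s<..}|lborel. deriv \<phi> t) = (LINT t|lborel. indicator {s..c} t *\<^sub>R deriv \<phi> t)"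
      unfolding set_lebesgue_integral_def
    proof (rule Bochner_Integration.integral_cong_AE)
      have [measurable]: "deriv \<phi> \<in> borel_measurable borel"
        using C by (intro borel_measurable_continuous_onI continuous_at_imp_continuous_on) auto
      show "AE t in lborel. indicator {s<..} t *\<^sub>R deriv \<phi> t = indicator {s..c} t *\<^sub>R deriv \<phi> t"
        using AE_lborel_singleton[of s]
      proof eventually_elim
        case (elim t)
        show ?case using elim z[of t] c by (cases "t \<le> c") (auto simp: indicator_def)
      qed
      show "(\<lambda>t. indicator {s<..} t *\<^sub>R deriv \<phi> t) \<in> borel_measurable lborel"
        "(\<lambda>t. indicator {s..c} t *\<^sub>R deriv \<phi> t) \<in> borel_measurable lborel" by measurable
    qed
    also have "\<dots> = \<phi> c - \<phi> s"
    proof (rule integral_FTC_Icc[OF c(1)])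
      show "(\<phi> has_vector_derivative deriv \<phi> x) (at x within {s..c})" for x
        using D[of x] by (auto simp: has_real_derivative_iff_has_vector_derivative intro: has_vector_derivative_at_within)
      show "continuous_on {s..c} (deriv \<phi>)" using C by (intro continuous_at_imp_continuous_on) auto
    qed
    finally show ?thesis using ab(2)[of c] c by auto
  qed
  from that[OF ab z C this] show thesis by blast
qed

lemma conv_frac_kernel_bounded_finite:
  fixes V :: "real \<Rightarrow> 'b::{banach, second_countable_topology}"
  assumes "0 < a" and [measurable]: "V \<in> borel_measurable borel" and c: "causal V" and M: "\<And>s. norm (V s) \<le> M"
  shows "nconv (enorm (frac_kernel a)) (enorm V) t \<le> ennreal (M * frac_kernel (a + 1) t)"
proof -
  have M0: "0 \<le> M" using M[of 0] by (rule order_trans[OF norm_ge_zero])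
  have k: "enorm (frac_kernel a) = (\<lambda>x. ennreal (frac_kernel a x))"
    using assms(1) by (simp add: fun_eq_iff frac_kernel_nonneg)
  have "nconv (enorm (frac_kernel a)) (enorm V) t \<le> nconv (enorm (frac_kernel a)) (\<lambda>s. ennreal M * ennreal (frac_kernel 1 s)) t"
  proof (rule nconv_mono_AE)
    show "AE s in lborel. s < t \<longrightarrow> enorm V s \<le> ennreal M * ennreal (frac_kernel 1 s)"
      using AE_lborel_singleton[of 0]
    proof eventually_elim
      case (elim s)
      then consider "s < 0" | "0 < s" by linarith
      then show ?case
      proof cases
        case 1 then show ?thesis using c by (simp add: causal_def)
      next
        case 2 then show ?thesis using M[of s] by (simp add: frac_kernel_1 ennreal_leI)
      qed
    qed
  qed (rule causal_enorm, simp)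
  also have "\<dots> = ennreal M * nconv (enorm (frac_kernel a)) (\<lambda>s. ennreal (frac_kernel 1 s)) t"
    by (rule nconv_cmult) measurable
  also have "nconv (enorm (frac_kernel a)) (\<lambda>s. ennreal (frac_kernel 1 s)) t = ennreal (frac_kernel (a + 1) t)"
    unfolding k by (rule nconv_frac_kernel) (use assms in auto)
  also have "ennreal M * ennreal (frac_kernel (a + 1) t) = ennreal (M * frac_kernel (a + 1) t)"
    by (rule ennreal_mult[symmetric]) (use M0 assms in \<open>auto simp: frac_kernel_nonneg\<close>)
  finally show ?thesis .
qed

text \<open>The Caputo primitive of w convolves V1 with the kernels of orders \<alpha> and 1 -
  \<alpha>, hence is the plain primitive of V1; tested with the derivative of \<phi>, Fubini turns
  it into minus the integral of \<phi> V1. This identifies a Caputo derivative of the discrete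
  interpolant.\<close>

lemma has_caputo_deriv_conv:
  fixes w V V1 :: "real \<Rightarrow> 'b::{banach, second_countable_topology}"
  assumes \<alpha>: "0 < \<alpha>" "\<alpha> < 1" and [measurable]: "V1 \<in> borel_measurable borel" and c: "causal V1"
    and M: "\<And>s. norm (V1 s) \<le> M"
    and w: "\<And>t. t \<in> {0..T} \<Longrightarrow> w t = w0 + conv (frac_kernel \<alpha>) V1 t"
    and V: "\<And>t. t \<in> {0<..<T} \<Longrightarrow> V t = V1 t"
  shows "has_caputo_deriv \<alpha> T w w0 V"
proof -
  let ?l = "frac_kernel \<alpha>" and ?k = "frac_kernel (1 - \<alpha>)" and ?p = "frac_kernel 1"
  let ?V = "\<lambda>t. if t < 0 then 0 else V t"
  have a': "0 < 1 - \<alpha>" using \<alpha> by simp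
  have lm: "f \<in> borel_measurable borel \<Longrightarrow> f \<in> borel_measurable lebesgue" for f :: "real \<Rightarrow> 'b"
    by (rule measurable_completion) simp
  have bi: "set_integrable lebesgue {a..b} f"
    if f: "f \<in> borel_measurable borel" and bd: "\<And>t. t \<in> {a..b} \<Longrightarrow> norm (f t) \<le> B" for f :: "real \<Rightarrow> 'b" and a b B
  proof -
    have "integrable lborel (\<lambda>t. indicator {a..b} t *\<^sub>R f t)"
    proof (rule Bochner_Integration.integrable_bound)
      show "integrable lborel (\<lambda>t. B * indicator {a..b} t)"
        by (intro integrable_mult_right integrable_real_indicator) (use emeasure_bounded_finite[of "{a..b}"] in auto)
      show "(\<lambda>t. indicator {a..b} t *\<^sub>R f t) \<in> borel_measurable lborel" using f by measurable
      show "AE t in lborel. norm (indicator {a..b} t *\<^sub>R f t) \<le> norm (B * indicator {a..b} t)"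
      proof (rule AE_I2)
        fix t show "norm (indicator {a..b} t *\<^sub>R f t) \<le> norm (B * indicator {a..b} t)"
          using bd[of t] by (cases "t \<in> {a..b}") auto
      qed
    qed
    moreover have "(\<lambda>t. indicator {a..b} t *\<^sub>R f t) \<in> borel_measurable lborel" using f by measurable
    ultimately show ?thesis unfolding set_integrable_def by (simp only: integrable_completion)
  qed
  have cb: "norm (conv (frac_kernel a) V1 t) \<le> M * (max 0 (frac_kernel (a + 1) b))" if "0 < a" "t \<le> b" "0 \<le> b" for a t b
  proof -
    have M0: "0 \<le> M" using M[of 0] by (rule order_trans[OF norm_ge_zero])
    have "ennreal (norm (conv (frac_kernel a) V1 t)) \<le> ennreal (M * frac_kernel (a + 1) t)"
      by (rule order_trans[OF norm_conv_le conv_frac_kernel_bounded_finite]) (use that c M in auto)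
    then have "norm (conv (frac_kernel a) V1 t) \<le> M * frac_kernel (a + 1) t"
      by (subst (asm) ennreal_le_iff) (use M0 that in \<open>auto simp: frac_kernel_nonneg\<close>)
    also have "frac_kernel (a + 1) t \<le> max 0 (frac_kernel (a + 1) b)"
      using that Gamma_real_pos[of "a + 1"]
      by (cases "0 < t") (auto simp: frac_kernel_def max_def intro!: divide_right_mono powr_mono2)
    finally show ?thesis using M0 by (simp add: mult_left_mono)
  qed
  have cl: "causal (conv ?l V1)" by (intro causal_conv c) simp
  have siw: "set_integrable lebesgue {0..b} w" if "b < T" for b
  proof -
    have "set_integrable lebesgue {0..b} (\<lambda>t. w0 + conv ?l V1 t)"
    proof (rule bi)
      show "norm (w0 + conv ?l V1 t) \<le> norm w0 + M * (max 0 (frac_kernel (\<alpha> + 1) b))" if "t \<in> {0..b}" for t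
        using cb[OF \<alpha>(1), of t b] that norm_triangle_ineq[of w0 "conv ?l V1 t"] by auto
    qed measurable
    then show ?thesis by (rule set_integrable_cong[THEN iffD1, rotated 3]) (use w that in auto)
  qed
  have prim: "caputo_primitive \<alpha> w w0 t = conv ?p V1 t" if "t < T" for t
  proof (cases "t < 0")
    case True
    then show ?thesis using causal_conv[OF causal_frac_kernel c, of 1] by (simp add: caputo_primitive_def causal_def)
  next
    case False
    have "caputo_primitive \<alpha> w w0 t = conv ?k (conv ?l V1) t"
    proof (rule caputo_primitive_eq_conv)
      show "AE s in lborel. s \<in> {0<..<t} \<longrightarrow> w s - w0 = conv ?l V1 s"
        by (rule AE_I2) (use w that in auto)
    qed (use \<alpha> cl siw that False in auto)
    also have "\<dots> = conv (conv ?k ?l) V1 t"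
    proof (rule conv_assoc)
      have "nconv (enorm ?k) (nconv (enorm ?l) (enorm V1)) t = nconv (nconv (enorm ?k) (enorm ?l)) (enorm V1) t"
        by (rule nconv_assoc) measurable
      also have "nconv (enorm ?k) (enorm ?l) = enorm ?p"
        using nconv_frac_kernel[OF a' \<alpha>(1)] frac_kernel_nonneg[OF a'] frac_kernel_nonneg[OF \<alpha>(1)] by (simp add: fun_eq_iff frac_kernel_1)
      also have "nconv (enorm ?p) (enorm V1) t < \<infinity>"
        using conv_frac_kernel_bounded_finite[OF less_numeral_extra(1) _ c M, of t] by (auto intro: le_less_trans)
      finally show "nconv (enorm ?k) (nconv (enorm ?l) (enorm V1)) t < \<infinity>" .
    qed auto
    also have "conv ?k ?l = ?p" using conv_frac_kernel[OF a' \<alpha>(1)] by (simp add: fun_eq_iff)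
    finally show ?thesis .
  qed
  have "has_distributional_deriv T (caputo_primitive \<alpha> w w0) ?V"
    unfolding has_distributional_deriv_def
  proof (intro conjI allI impI ballI)
    fix a b :: real assume b: "b < T"
    have "set_integrable lebesgue {a..b} (conv ?p V1)"
    proof (rule bi)
      show "norm (conv ?p V1 t) \<le> M * (max 0 (frac_kernel (1 + 1) (max 0 b)))" if "t \<in> {a..b}" for t
        by (rule cb) (use that in auto)
    qed measurable
    then show "set_integrable lebesgue {a..b} (caputo_primitive \<alpha> w w0)"
      by (rule set_integrable_cong[THEN iffD1, rotated 3]) (use prim b in auto)
    have V1i: "set_integrable lebesgue {a..b} V1" by (rule bi) (use M in auto)
    have z: "AE t in lebesgue. t \<noteq> 0" using AE_lborel_singleton[of 0] by (rule AE_completion)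
    have e: "AE t in lebesgue. indicator {a..b} t *\<^sub>R ?V t = indicator {a..b} t *\<^sub>R V1 t"
      using z by eventually_elim (use V b c in \<open>auto simp: indicator_def causal_def\<close>)
    have "(\<lambda>t. indicator {a..b} t *\<^sub>R V1 t) \<in> borel_measurable lebesgue"
      using V1i unfolding set_integrable_def by (rule borel_measurable_integrable)
    \<comment> \<open>V agrees with V1 on (0,T) only; writing its value at 0 as a one-point
      correction exhibits measurability.\<close>
    moreover have "(\<lambda>t. indicator {a..b} t *\<^sub>R ?V t) = (\<lambda>t. indicator {a..b} t *\<^sub>R (V1 t + indicator {0} t *\<^sub>R (V 0 - V1 0)))"
      using V b c by (auto simp: indicator_def causal_def fun_eq_iff)
    moreover have "(\<lambda>t. indicator {a..b} t *\<^sub>R (V1 t + indicator {0} t *\<^sub>R (V 0 - V1 0))) \<in> borel_measurable lebesgue"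
      by (rule lm) measurable
    ultimately show "set_integrable lebesgue {a..b} ?V"
      using V1i e unfolding set_integrable_def by (subst Bochner_Integration.integrable_cong_AE[OF _ _ e]) auto
  next
    fix \<phi> assume "\<phi> \<in> test_functions T"
    then obtain a b where ab: "b < T" "\<And>x. x \<notin> {a..b} \<Longrightarrow> \<phi> x = 0" "\<And>x. x \<notin> {a..b} \<Longrightarrow> deriv \<phi> x = 0"
      "\<And>x. isCont (deriv \<phi>) x" "\<And>s. (LINT t:{s<..}|lborel. deriv \<phi> t) = - \<phi> s"
      by (rule integral_deriv_test_function) blast
    let ?d = "deriv \<phi>"
    have [measurable]: "?d \<in> borel_measurable borel"
      using ab(4) by (intro borel_measurable_continuous_onI continuous_at_imp_continuous_on) auto
    have [measurable]: "\<phi> \<in> borel_measurable borel"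
    proof -
      have "\<phi> = (\<lambda>s. - (LINT t|lborel. (if s < t then ?d t else 0)))"
      proof
        fix s
        have "(LINT t:{s<..}|lborel. ?d t) = (LINT t|lborel. (if s < t then ?d t else 0))"
          unfolding set_lebesgue_integral_def by (rule Bochner_Integration.integral_cong) (auto simp: indicator_def)
        then show "\<phi> s = - (LINT t|lborel. (if s < t then ?d t else 0))" using ab(5)[of s] by simp
      qed
      moreover have "(\<lambda>s. - (LINT t|lborel. (if s < t then ?d t else 0))) \<in> borel_measurable borel" by measurable
      ultimately show ?thesis by simp
    qed
    have di: "integrable lborel ?d"
    proof -
      have "integrable lborel (\<lambda>t. indicator {a..b} t *\<^sub>R ?d t)"
        using borel_integrable_atLeastAtMost'[of a b ?d] ab(4)
        by (simp add: set_integrable_def continuous_at_imp_continuous_on)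
      moreover have "(\<lambda>t. indicator {a..b} t *\<^sub>R ?d t) = ?d" using ab(3) by (auto simp: indicator_def fun_eq_iff)
      ultimately show ?thesis by simp
    qed
    \<comment> \<open>V1 is bounded but need not be integrable on the line. Past b the test function
      vanishes, so V1 may be cut there without changing either side.\<close>
    define V2 where "V2 s = indicator {..b} s *\<^sub>R V1 s" for s
    have [measurable]: "V2 \<in> borel_measurable borel" unfolding V2_def[abs_def] by measurable
    have V2i: "integrable lborel V2"
    proof -
      have "set_integrable lebesgue {0..b} V1" by (rule bi) (use M in auto)
      then have "integrable lborel (\<lambda>t. indicator {0..b} t *\<^sub>R V1 t)"
        unfolding set_integrable_def by (subst (asm) integrable_completion) auto
      moreover have "(\<lambda>t. indicator {0..b} t *\<^sub>R V1 t) = V2"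
      proof
        fix t show "indicator {0..b} t *\<^sub>R V1 t = V2 t"
          using c by (cases "t < 0") (auto simp: V2_def indicator_def causal_def)
      qed
      ultimately show ?thesis by simp
    qed
    have pi: "integrable (lborel \<Otimes>\<^sub>M lborel) (\<lambda>(t, s). ?d t *\<^sub>R (?p (t - s) *\<^sub>R V2 s))"
    proof (rule integrableI_bounded)
      have "(\<integral>\<^sup>+x. ennreal (norm (case x of (t, s) \<Rightarrow> ?d t *\<^sub>R (?p (t - s) *\<^sub>R V2 s))) \<partial>(lborel \<Otimes>\<^sub>M lborel))
        = (\<integral>\<^sup>+t. \<integral>\<^sup>+s. ennreal (norm (?d t *\<^sub>R (?p (t - s) *\<^sub>R V2 s))) \<partial>lborel \<partial>lborel)"
        by (subst lborel.nn_integral_fst[symmetric]) (auto simp: split_beta')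
      also have "\<dots> \<le> (\<integral>\<^sup>+t. \<integral>\<^sup>+s. enorm ?d t * enorm V2 s \<partial>lborel \<partial>lborel)"
      proof (intro nn_integral_mono)
        fix t s show "ennreal (norm (?d t *\<^sub>R (?p (t - s) *\<^sub>R V2 s))) \<le> enorm ?d t * enorm V2 s"
          by (cases "s < t") (simp_all add: frac_kernel_1 ennreal_mult)
      qed
      also have "\<dots> = (\<integral>\<^sup>+t. enorm ?d t \<partial>lborel) * (\<integral>\<^sup>+s. enorm V2 s \<partial>lborel)"
        by (simp add: nn_integral_cmult nn_integral_multc)
      also have "\<dots> < \<infinity>" using di V2i by (simp add: integrable_iff_bounded ennreal_mult_less_top)
      finally show "(\<integral>\<^sup>+x. ennreal (norm (case x of (t, s) \<Rightarrow> ?d t *\<^sub>R (?p (t - s) *\<^sub>R V2 s))) \<partial>(lborel \<Otimes>\<^sub>M lborel)) < \<infinity>" .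
    qed measurable
    have "(LINT t:{..<T}|lebesgue. ?d t *\<^sub>R caputo_primitive \<alpha> w w0 t) = (LINT t|lebesgue. ?d t *\<^sub>R conv ?p V2 t)"
      unfolding set_lebesgue_integral_def
    proof (rule Bochner_Integration.integral_cong[OF refl])
      fix t
      show "indicator {..<T} t *\<^sub>R ?d t *\<^sub>R caputo_primitive \<alpha> w w0 t = ?d t *\<^sub>R conv ?p V2 t"
      proof (cases "t \<le> b")
        case True
        have "conv ?p V1 t = conv ?p V2 t"
          unfolding conv_def by (rule Bochner_Integration.integral_cong) (use True in \<open>auto simp: V2_def indicator_def frac_kernel_1\<close>)
        then show ?thesis using True ab(1) prim[of t] by simp
      next
        case False then show ?thesis using ab(3)[of t] by simp
      qed
    qed
    also have "\<dots> = (LINT t|lborel. ?d t *\<^sub>R conv ?p V2 t)" by (rule integral_completion) measurable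
    also have "\<dots> = (LINT t|lborel. LINT s|lborel. ?d t *\<^sub>R (?p (t - s) *\<^sub>R V2 s))"
      unfolding conv_def by (simp only: integral_scaleR_right)
    also have "\<dots> = (LINT s|lborel. LINT t|lborel. ?d t *\<^sub>R (?p (t - s) *\<^sub>R V2 s))"
      by (rule lborel_pair.Fubini_integral[symmetric]) (rule pi)
    also have "\<dots> = (LINT s|lborel. - (\<phi> s *\<^sub>R V2 s))"
    proof (rule Bochner_Integration.integral_cong[OF refl])
      fix s
      have "integrable lborel (\<lambda>t. indicator {s<..} t *\<^sub>R ?d t)" by (rule integrable_mult_indicator[OF _ di]) simp
      then have "(LINT t|lborel. (indicator {s<..} t *\<^sub>R ?d t) *\<^sub>R V2 s) = (LINT t|lborel. indicator {s<..} t *\<^sub>R ?d t) *\<^sub>R V2 s"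
        by (rule integral_scaleR_left)
      moreover have "(LINT t|lborel. ?d t *\<^sub>R (?p (t - s) *\<^sub>R V2 s)) = (LINT t|lborel. (indicator {s<..} t *\<^sub>R ?d t) *\<^sub>R V2 s)"
        by (rule Bochner_Integration.integral_cong) (auto simp: frac_kernel_1 indicator_def)
      ultimately show "(LINT t|lborel. ?d t *\<^sub>R (?p (t - s) *\<^sub>R V2 s)) = - (\<phi> s *\<^sub>R V2 s)"
        using ab(5)[of s] by (simp add: set_lebesgue_integral_def)
    qed
    also have "\<dots> = (LINT s|lebesgue. - (\<phi> s *\<^sub>R V2 s))" by (rule integral_completion[symmetric]) measurable
    also have "\<dots> = - (LINT t|lebesgue. \<phi> t *\<^sub>R V2 t)" by simp
    also have "(LINT t|lebesgue. \<phi> t *\<^sub>R V2 t) = (LINT t:{..<T}|lebesgue. \<phi> t *\<^sub>R ?V t)"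
      unfolding set_lebesgue_integral_def
    proof (rule Bochner_Integration.integral_cong_AE)
      have z: "AE t in lebesgue. t \<noteq> 0" using AE_lborel_singleton[of 0] by (rule AE_completion)
      show "AE t in lebesgue. \<phi> t *\<^sub>R V2 t = indicator {..<T} t *\<^sub>R \<phi> t *\<^sub>R ?V t"
        using z
      proof eventually_elim
        case (elim t)
        consider "t < 0" | "0 < t" "t \<le> b" | "b < t" using elim by linarith
        then show ?case
        proof cases
          case 1 then show ?thesis using c by (simp add: causal_def V2_def)
        next
          case 2 then show ?thesis using V[of t] ab(1) by (simp add: V2_def)
        next
          case 3 then show ?thesis using ab(2)[of t] by simp
        qed
      qed
      show "(\<lambda>t. \<phi> t *\<^sub>R V2 t) \<in> borel_measurable lebesgue" by (rule lm) measurable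
      have "(\<lambda>t. indicator {..<T} t *\<^sub>R \<phi> t *\<^sub>R ?V t) = (\<lambda>t. \<phi> t *\<^sub>R (V2 t + indicator {0} t *\<^sub>R (indicator {..<T} t *\<^sub>R V 0 - V2 0)))"
      proof
        fix t
        consider "t < 0" | "t = 0" | "0 < t" "t \<le> b" | "0 < t" "b < t" by linarith
        then show "indicator {..<T} t *\<^sub>R \<phi> t *\<^sub>R ?V t = \<phi> t *\<^sub>R (V2 t + indicator {0} t *\<^sub>R (indicator {..<T} t *\<^sub>R V 0 - V2 0))"
        proof cases
          case 1 then show ?thesis using c by (simp add: causal_def V2_def)
        next
          case 3 then show ?thesis using V[of t] ab(1) by (simp add: V2_def)
        next
          case 4 then show ?thesis using ab(2)[of t] by simp
        qed (simp add: mult.commute)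
      qed
      moreover have "(\<lambda>t. \<phi> t *\<^sub>R (V2 t + indicator {0} t *\<^sub>R (indicator {..<T} t *\<^sub>R V 0 - V2 0))) \<in> borel_measurable lebesgue"
        by (rule lm) measurable
      ultimately show "(\<lambda>t. indicator {..<T} t *\<^sub>R \<phi> t *\<^sub>R ?V t) \<in> borel_measurable lebesgue" by simp
    qed
    finally show "(LINT t:{..<T}|lebesgue. ?d t *\<^sub>R caputo_primitive \<alpha> w w0 t) = - (LINT t:{..<T}|lebesgue. \<phi> t *\<^sub>R ?V t)" .
  qed
  then show ?thesis using siw by (simp add: has_caputo_deriv_def)
qed

section \<open>Energy estimates\<close>

text \<open>Setting \<open>a\<close> to 0 where the inequality fails alters it only on a null set of
  (0,T), leaves its fractional integral unchanged at every time in [0,T], and makes the inequality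
  hold everywhere.\<close>

lemma frac_gronwall_AE:
  fixes a :: "real \<Rightarrow> ennreal"
  assumes [measurable]: "a \<in> borel_measurable borel" and ca: "causal a"
    and al: "0 < \<alpha>" and c: "0 \<le> c"
    and fin: "(\<integral>\<^sup>+s\<in>{..T}. a s \<partial>lborel) < \<infinity>"
    and le: "AE t in lborel. t \<in> {0<..<T} \<longrightarrow> a t \<le> b + ennreal c * nconv (\<lambda>x. ennreal (frac_kernel \<alpha> x)) a t"
  shows "AE t in lborel. t \<in> {0<..<T} \<longrightarrow> a t \<le> b * ennreal (mittag_leffler \<alpha> (c * T powr \<alpha>))"
proof -
  let ?l = "\<lambda>x. ennreal (frac_kernel \<alpha> x)"
  have cl: "causal ?l" by (simp add: causal_def frac_kernel_def)
  define a' where "a' t = (if t \<in> {0<..<T} \<and> a t \<le> b + ennreal c * nconv ?l a t then a t else 0)" for t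
  have [measurable]: "a' \<in> borel_measurable borel" unfolding a'_def[abs_def] by measurable
  have ae: "AE t in lborel. t \<in> {0<..<T} \<longrightarrow> a' t = a t"
    using le by eventually_elim (simp add: a'_def)
  have nc: "nconv ?l a' t = nconv ?l a t" if "t \<in> {0..T}" for t
  proof (rule nconv_cong_AE[OF _ cl])
    show "AE s in lborel. s < t \<longrightarrow> a' s = a s"
      using ae AE_lborel_singleton[of 0]
    proof eventually_elim
      case (elim s)
      show ?case
      proof (cases "s < 0")
        case True then show ?thesis using ca by (simp add: a'_def causal_def)
      next
        case False then show ?thesis using elim that by auto
      qed
    qed
  qed
  have bd: "a' t \<le> b * ennreal (\<Sum>k. (c * t powr \<alpha>) ^ k / Gamma (\<alpha> * real k + 1))" if t: "t \<in> {0..T}" for t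
  proof (rule frac_gronwall[OF _ _ al c _ _ t])
    show "causal a'" by (simp add: causal_def a'_def)
    have "(\<integral>\<^sup>+s\<in>{..T}. a' s \<partial>lborel) \<le> (\<integral>\<^sup>+s\<in>{..T}. a s \<partial>lborel)"
      by (intro nn_integral_mono mult_right_mono) (simp_all add: a'_def)
    then show "(\<integral>\<^sup>+s\<in>{..T}. a' s \<partial>lborel) < \<infinity>" using fin by (rule le_less_trans)
    show "a' t \<le> b + ennreal c * nconv ?l a' t" if "t \<in> {0..T}" for t
      unfolding nc[OF that] by (simp add: a'_def)
  qed measurable
  show ?thesis
    using ae
  proof eventually_elim
    case (elim t)
    show ?case
    proof
      assume t: "t \<in> {0<..<T}"
      have "a t = a' t" using elim t by simp
      also have "\<dots> \<le> b * ennreal (\<Sum>k. (c * t powr \<alpha>) ^ k / Gamma (\<alpha> * real k + 1))"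
        by (rule bd) (use t in simp)
      also have "\<dots> \<le> b * ennreal (mittag_leffler \<alpha> (c * T powr \<alpha>))"
        unfolding mittag_leffler_def
      proof (intro mult_left_mono ennreal_leI suminf_le summable_mittag_leffler al)
        fix k
        have "0 < Gamma (\<alpha> * real k + 1)" using al by (intro Gamma_real_pos) (simp add: add_nonneg_pos)
        then show "(c * t powr \<alpha>) ^ k / Gamma (\<alpha> * real k + 1) \<le> (c * T powr \<alpha>) ^ k / Gamma (\<alpha> * real k + 1)"
          using t c al by (intro divide_right_mono power_mono mult_left_mono powr_mono2) auto
      qed simp
      finally show "a t \<le> b * ennreal (mittag_leffler \<alpha> (c * T powr \<alpha>))" .
    qed
  qed
qed

text \<open>Cauchy-Schwarz for the measure with density \<open>frac_kernel \<alpha> (t - s)\<close>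
  on (0,t), whose mass is at most k. It is derived from |g| \<le> 1/d + d |g|^2 with a suitable d,
  which costs the factor 4.\<close>

lemma norm_conv_frac_kernel_square_le:
  fixes g :: "real \<Rightarrow> 'b::{banach, second_countable_topology}"
  assumes a: "0 < \<alpha>" and [measurable]: "g \<in> borel_measurable borel" and c: "causal g"
    and k: "0 < k" "frac_kernel (\<alpha> + 1) t \<le> k"
  shows "ennreal ((norm (conv (frac_kernel \<alpha>) g t))\<^sup>2) \<le> ennreal (4 * k) * nconv (\<lambda>x. ennreal (frac_kernel \<alpha> x)) (\<lambda>s. ennreal ((norm (g s))\<^sup>2)) t"
proof -
  let ?l = "\<lambda>x. ennreal (frac_kernel \<alpha> x)"
  define X where "X = norm (conv (frac_kernel \<alpha>) g t)"
  define a where "a = nconv ?l (\<lambda>s. ennreal ((norm (g s))\<^sup>2)) t"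
  have el: "enorm (frac_kernel \<alpha>) = ?l" using a by (simp add: fun_eq_iff frac_kernel_nonneg)
  have cl: "causal ?l" by (simp add: causal_def frac_kernel_def)
  have bd: "ennreal X \<le> ennreal (1 / d) * ennreal k + ennreal d * a" if d: "0 < d" for d
  proof -
    have "ennreal X \<le> nconv ?l (enorm g) t" unfolding X_def el[symmetric] by (rule norm_conv_le) measurable
    also have "\<dots> \<le> nconv ?l (\<lambda>s. ennreal (1 / d) * ennreal (frac_kernel 1 s) + ennreal d * ennreal ((norm (g s))\<^sup>2)) t"
    proof (rule nconv_mono_AE[OF _ cl])
      show "AE s in lborel. s < t \<longrightarrow> enorm g s \<le> ennreal (1 / d) * ennreal (frac_kernel 1 s) + ennreal d * ennreal ((norm (g s))\<^sup>2)"
        using AE_lborel_singleton[of 0]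
      proof eventually_elim
        case (elim s)
        then consider "s < 0" | "0 < s" by linarith
        then show ?case
        proof cases
          case 1 then show ?thesis using c by (simp add: causal_def)
        next
          case 2
          have "norm (g s) \<le> 1 / d + d * (norm (g s))\<^sup>2"
            using mult_le_weighted_squares[OF d, of 1 "norm (g s)"] by simp
          then have "enorm g s \<le> ennreal (1 / d + d * (norm (g s))\<^sup>2)" by (rule ennreal_leI)
          also have "\<dots> = ennreal (1 / d) + ennreal (d * (norm (g s))\<^sup>2)" by (rule ennreal_plus) (use d in auto)
          also have "ennreal (d * (norm (g s))\<^sup>2) = ennreal d * ennreal ((norm (g s))\<^sup>2)" by (rule ennreal_mult) (use d in auto)
          finally show ?thesis using 2 by (simp add: frac_kernel_1)
        qed
      qed
    qed
    also have "\<dots> = ennreal (1 / d) * nconv ?l (\<lambda>s. ennreal (frac_kernel 1 s)) t + ennreal d * a"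
      unfolding a_def by (subst nconv_add; measurable?) (simp add: nconv_cmult)
    also have "nconv ?l (\<lambda>s. ennreal (frac_kernel 1 s)) t = ennreal (frac_kernel (\<alpha> + 1) t)"
      by (rule nconv_frac_kernel) (use a in auto)
    also have "ennreal (1 / d) * ennreal (frac_kernel (\<alpha> + 1) t) + ennreal d * a \<le> ennreal (1 / d) * ennreal k + ennreal d * a"
      by (intro add_right_mono mult_left_mono ennreal_leI k) simp
    finally show ?thesis .
  qed
  have "ennreal (X\<^sup>2) \<le> ennreal (4 * k) * a"
  proof (cases "a = top_class.top \<or> X = 0")
    case True
    then show ?thesis using k by (auto simp: ennreal_mult_top)
  next
    case False
    then obtain A where A: "a = ennreal A" "0 \<le> A" by (cases a) auto
    have X: "0 < X" using False by (simp add: X_def)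
    \<comment> \<open>Then k/d = X/2, which is absorbed into the left side.\<close>
    define d where "d = 2 * k / X"
    have d: "0 < d" using X k by (simp add: d_def)
    have "ennreal X \<le> ennreal (1 / d * k + d * A)"
      using bd[OF d] d k A by (simp add: ennreal_plus ennreal_mult[symmetric])
    then have "X \<le> 1 / d * k + d * A"
      by (subst (asm) ennreal_le_iff) (use d k A in auto)
    also have "1 / d * k = X / 2" using k X by (simp add: d_def)
    finally have "X * X \<le> X * (X / 2 + d * A)" using X by (intro mult_left_mono) auto
    also have "\<dots> = X * X / 2 + 2 * k * A" using X by (simp add: d_def field_simps)
    finally have "X\<^sup>2 \<le> 4 * k * A" by (simp add: power2_eq_square)
    then have "ennreal (X\<^sup>2) \<le> ennreal (4 * k * A)" by (rule ennreal_leI)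
    also have "\<dots> = ennreal (4 * k) * a" unfolding A(1) by (rule ennreal_mult) (use k A in auto)
    finally show ?thesis .
  qed
  then show ?thesis by (simp add: X_def a_def)
qed

lemma nconv_frac_kernel_finite_AE:
  fixes h :: "real \<Rightarrow> 'b::{banach, second_countable_topology}"
  assumes "0 < \<alpha>" and i: "integrable lborel h" and c: "causal h"
  shows "AE t in lborel. t \<le> T \<longrightarrow> nconv (\<lambda>x. ennreal (frac_kernel \<alpha> x)) (enorm h) t < \<infinity>"
    and "(\<integral>\<^sup>+t\<in>{..T}. nconv (\<lambda>x. ennreal (frac_kernel \<alpha> x)) (enorm h) t \<partial>lborel) < \<infinity>"
proof -
  have el: "enorm (frac_kernel \<alpha>) = (\<lambda>x. ennreal (frac_kernel \<alpha> x))" using assms(1) by (simp add: fun_eq_iff frac_kernel_nonneg)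
  have m: "h \<in> borel_measurable borel" using i by auto
  show "(\<integral>\<^sup>+t\<in>{..T}. nconv (\<lambda>x. ennreal (frac_kernel \<alpha> x)) (enorm h) t \<partial>lborel) < \<infinity>"
    using conv_finite_AE(2)[OF assms(1) m c i] unfolding el .
  show "AE t in lborel. t \<le> T \<longrightarrow> nconv (\<lambda>x. ennreal (frac_kernel \<alpha> x)) (enorm h) t < \<infinity>"
    using conv_finite_AE(1)[OF assms(1) m c i] unfolding el by eventually_elim simp
qed

text \<open>As \<open>inner (F - g) g\<close> \<le> |F|^2/2 - |g|^2/2, the lower bound
  \<open>E\<close> controls the fractional integral of |g|^2 by that of |F|^2. The nonlocal part of
  F is bounded by L times the fractional integral of g, whose square is in turn at most a multiple
  of the fractional integral of |g|^2, so a Gronwall inequality closes. Semicontinuity carries the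
  bound to every time, as the continuity argument requires.\<close>

lemma frac_energy_estimate:
  fixes g F :: "real \<Rightarrow> 'h::{real_inner, banach, second_countable_topology}" and G :: "real \<Rightarrow> real"
  assumes \<alpha>: "0 < \<alpha>" and T: "0 < T" and L: "0 \<le> L" and K: "0 \<le> K" and C0: "0 \<le> C0"
    and [measurable]: "g \<in> borel_measurable borel" "F \<in> borel_measurable borel" "G \<in> borel_measurable borel"
    and c: "causal g" "causal F"
    and Fz: "\<And>t. t \<notin> {0<..<T} \<Longrightarrow> F t = 0" and G0: "\<And>t. 0 \<le> G t"
    and g2: "integrable lborel (\<lambda>t. (norm (g t))\<^sup>2)" and F2: "integrable lborel (\<lambda>t. (norm (F t))\<^sup>2)"
    and E: "AE t in lborel. t \<in> {0<..<T} \<longrightarrow> - K \<le> conv (frac_kernel \<alpha>) (\<lambda>s. inner (F s - g s) (g s)) t"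
    and FG: "AE s in lborel. s \<in> {0<..<T} \<longrightarrow> norm (F s) \<le> G s + L * norm (conv (frac_kernel \<alpha>) g s)"
    and CG: "\<And>t. t \<in> {0..T} \<Longrightarrow> nconv (\<lambda>x. ennreal (frac_kernel \<alpha> x)) (\<lambda>s. ennreal ((G s)\<^sup>2)) t \<le> ennreal C0"
  shows "\<exists>C\<ge>0. \<forall>t\<in>{0..T}. nconv (\<lambda>x. ennreal (frac_kernel \<alpha> x)) (\<lambda>s. ennreal ((norm (g s))\<^sup>2)) t \<le> ennreal C"
proof -
  let ?l = "\<lambda>x. ennreal (frac_kernel \<alpha> x)"
  have cl: "causal ?l" by (simp add: causal_def frac_kernel_def)
  have k0: "0 \<le> frac_kernel \<alpha> x" for x using \<alpha> by (simp add: frac_kernel_nonneg)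
  have el: "enorm (frac_kernel \<alpha>) = ?l" using k0 by (simp add: fun_eq_iff)
  let ?g2 = "\<lambda>s. ennreal ((norm (g s))\<^sup>2)" and ?F2 = "\<lambda>s. ennreal ((norm (F s))\<^sup>2)"
  define a where "a = nconv ?l ?g2"
  have [measurable]: "a \<in> borel_measurable borel" unfolding a_def by measurable
  have cg2: "causal (\<lambda>s. (norm (g s))\<^sup>2)" and cF2: "causal (\<lambda>s. (norm (F s))\<^sup>2)" using c by (auto simp: causal_def)
  have eg2: "enorm (\<lambda>s. (norm (g s))\<^sup>2) = ?g2" and eF2: "enorm (\<lambda>s. (norm (F s))\<^sup>2) = ?F2" by simp_all
  have ca: "causal a" unfolding a_def by (rule causal_nconv[OF cl]) (use c in \<open>simp add: causal_def\<close>)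
  have ii: "integrable lborel (\<lambda>s. inner (F s - g s) (g s))"
    using integrable_inner_of_square_integrable(1)[OF _ _ F2 g2] integrable_inner_of_square_integrable(1)[OF _ _ g2 g2]
    by (simp add: inner_diff_left)
  have ci: "causal (\<lambda>s. inner (F s - g s) (g s))" using c by (simp add: causal_def)
  define k where "k = frac_kernel (\<alpha> + 1) T"
  have k: "0 < k" using \<alpha> T by (auto simp: k_def frac_kernel_def intro!: divide_pos_pos Gamma_real_pos)
  have kt: "frac_kernel (\<alpha> + 1) t \<le> k" if "t \<le> T" for t
    using that \<alpha> T Gamma_real_pos[of "\<alpha> + 1"] unfolding k_def
    by (cases "0 < t") (auto simp: frac_kernel_def intro!: divide_right_mono powr_mono2)
  have ineq: "AE t in lborel. t \<in> {0<..<T} \<longrightarrow> a t \<le> ennreal (2 * K + 2 * C0) + ennreal (8 * L\<^sup>2 * k) * nconv ?l a t"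
    using E nconv_frac_kernel_finite_AE(1)[OF \<alpha> ii ci, of T] nconv_frac_kernel_finite_AE(1)[OF \<alpha> g2 cg2, of T]
      nconv_frac_kernel_finite_AE(1)[OF \<alpha> F2 cF2, of T]
  proof eventually_elim
    case (elim t)
    show ?case
    proof
      assume t: "t \<in> {0<..<T}"
      let ?li = "\<lambda>s. frac_kernel \<alpha> (t - s) *\<^sub>R inner (F s - g s) (g s)"
        and ?lg = "\<lambda>s. frac_kernel \<alpha> (t - s) *\<^sub>R (norm (g s))\<^sup>2" and ?lF = "\<lambda>s. frac_kernel \<alpha> (t - s) *\<^sub>R (norm (F s))\<^sup>2"
      have i1: "integrable lborel ?li" by (rule conv_integrable) (use elim(2) t in \<open>simp_all add: el[symmetric]\<close>)
      have i2: "integrable lborel ?lg" by (rule conv_integrable) (use elim(3) t in \<open>simp_all add: el[symmetric]\<close>)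
      have i3: "integrable lborel ?lF" by (rule conv_integrable) (use elim(4) t in \<open>simp_all add: el[symmetric]\<close>)
      have "- K \<le> (LINT s|lborel. ?li s)" using elim(1) t by (simp add: conv_def)
      also have "\<dots> \<le> (LINT s|lborel. ?lF s / 2 - ?lg s / 2)"
      proof (rule integral_mono[OF i1])
        show "integrable lborel (\<lambda>s. ?lF s / 2 - ?lg s / 2)"
          by (intro Bochner_Integration.integrable_diff integrable_divide i2 i3)
        fix s
        have "inner (F s) (g s) \<le> norm (F s) * norm (g s)" by (rule norm_cauchy_schwarz)
        moreover have "2 * (norm (F s) * norm (g s)) \<le> (norm (F s))\<^sup>2 + (norm (g s))\<^sup>2"
          using sum_squares_bound[of "norm (F s)" "norm (g s)"] by simp
        ultimately have "inner (F s - g s) (g s) \<le> (norm (F s))\<^sup>2 / 2 - (norm (g s))\<^sup>2 / 2"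
          by (simp add: inner_diff_left power2_norm_eq_inner)
        from mult_left_mono[OF this k0[of "t - s"]] show "?li s \<le> ?lF s / 2 - ?lg s / 2"
          by (simp add: right_diff_distrib)
      qed
      also have "\<dots> = (LINT s|lborel. ?lF s) / 2 - (LINT s|lborel. ?lg s) / 2"
        using i2 i3 by simp
      finally have r: "(LINT s|lborel. ?lg s) \<le> 2 * K + (LINT s|lborel. ?lF s)" by simp
      have toreal: "ennreal (LINT s|lborel. frac_kernel \<alpha> (t - s) *\<^sub>R (norm (h s))\<^sup>2) = nconv ?l (\<lambda>s. ennreal ((norm (h s))\<^sup>2)) t"
        if "integrable lborel (\<lambda>s. frac_kernel \<alpha> (t - s) *\<^sub>R (norm (h s))\<^sup>2)" for h :: "real \<Rightarrow> 'h"
      proof -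
        have "(\<integral>\<^sup>+s. ennreal (frac_kernel \<alpha> (t - s) *\<^sub>R (norm (h s))\<^sup>2) \<partial>lborel) = ennreal (LINT s|lborel. frac_kernel \<alpha> (t - s) *\<^sub>R (norm (h s))\<^sup>2)"
          by (rule nn_integral_eq_integral[OF that]) (use k0 in simp)
        then show ?thesis using k0 by (simp add: nconv_def ennreal_mult)
      qed
      have "a t = ennreal (LINT s|lborel. ?lg s)" unfolding a_def by (rule toreal[OF i2, symmetric])
      also have "\<dots> \<le> ennreal (2 * K + (LINT s|lborel. ?lF s))" by (rule ennreal_leI[OF r])
      also have "\<dots> = ennreal (2 * K) + ennreal (LINT s|lborel. ?lF s)"
        by (rule ennreal_plus) (use K k0 in \<open>auto intro!: integral_nonneg_AE\<close>)
      also have "ennreal (LINT s|lborel. ?lF s) = nconv ?l ?F2 t" by (rule toreal[OF i3])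
      also have "nconv ?l ?F2 t \<le> nconv ?l (\<lambda>s. ennreal 2 * ennreal ((G s)\<^sup>2) + ennreal (8 * L\<^sup>2 * k) * a s) t"
      proof (rule nconv_mono_AE[OF _ cl])
        show "AE s in lborel. s < t \<longrightarrow> ?F2 s \<le> ennreal 2 * ennreal ((G s)\<^sup>2) + ennreal (8 * L\<^sup>2 * k) * a s"
          using FG
        proof eventually_elim
          case (elim s)
          show ?case
          proof (cases "s \<in> {0<..<T}")
            case False then show ?thesis by (simp add: Fz)
          next
            case True
            let ?Y = "norm (conv (frac_kernel \<alpha>) g s)"
            have "norm (F s) \<le> G s + L * ?Y" using elim True by simp
            then have "(norm (F s))\<^sup>2 \<le> (G s + L * ?Y)\<^sup>2" by (rule power_mono) simp
            also have "\<dots> \<le> 2 * (G s)\<^sup>2 + 2 * L\<^sup>2 * ?Y\<^sup>2"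
              using sum_squares_bound[of "G s" "L * ?Y"] by (simp add: power2_eq_square algebra_simps)
            finally have "?F2 s \<le> ennreal (2 * (G s)\<^sup>2 + 2 * L\<^sup>2 * ?Y\<^sup>2)" by (rule ennreal_leI)
            also have "\<dots> = ennreal (2 * (G s)\<^sup>2) + ennreal (2 * L\<^sup>2 * ?Y\<^sup>2)" by (rule ennreal_plus) auto
            also have "ennreal (2 * (G s)\<^sup>2) = ennreal 2 * ennreal ((G s)\<^sup>2)" by (rule ennreal_mult) auto
            also have "ennreal (2 * L\<^sup>2 * ?Y\<^sup>2) = ennreal (2 * L\<^sup>2) * ennreal (?Y\<^sup>2)" by (rule ennreal_mult) auto
            also have "\<dots> \<le> ennreal (2 * L\<^sup>2) * (ennreal (4 * k) * a s)"
              unfolding a_def by (intro mult_left_mono norm_conv_frac_kernel_square_le) (use \<alpha> c k kt[of s] True in auto)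
            also have "\<dots> = ennreal (8 * L\<^sup>2 * k) * a s"
              using k by (simp only: mult.assoc[symmetric] ennreal_mult[symmetric] zero_le_power2 mult_nonneg_nonneg
                  zero_le_numeral less_imp_le) (simp add: mult_ac)
            finally show ?thesis by (simp add: add_left_mono)
          qed
        qed
      qed
      also have "\<dots> = ennreal 2 * nconv ?l (\<lambda>s. ennreal ((G s)\<^sup>2)) t + ennreal (8 * L\<^sup>2 * k) * nconv ?l a t"
        by (subst nconv_add; measurable?) (simp add: nconv_cmult)
      also have "\<dots> \<le> ennreal 2 * ennreal C0 + ennreal (8 * L\<^sup>2 * k) * nconv ?l a t"
        by (intro add_right_mono mult_left_mono CG) (use t in auto)
      also have "ennreal 2 * ennreal C0 = ennreal (2 * C0)" by (rule ennreal_mult[symmetric]) (use C0 in auto)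
      finally have "a t \<le> ennreal (2 * K) + (ennreal (2 * C0) + ennreal (8 * L\<^sup>2 * k) * nconv ?l a t)"
        by (simp add: add_left_mono)
      also have "\<dots> = ennreal (2 * K + 2 * C0) + ennreal (8 * L\<^sup>2 * k) * nconv ?l a t"
        using K C0 by (simp add: ennreal_plus add.assoc)
      finally show "a t \<le> ennreal (2 * K + 2 * C0) + ennreal (8 * L\<^sup>2 * k) * nconv ?l a t" .
    qed
  qed
  have fa: "(\<integral>\<^sup>+s\<in>{..T}. a s \<partial>lborel) < \<infinity>"
    using nconv_frac_kernel_finite_AE(2)[OF \<alpha> g2 cg2, of T] by (simp add: a_def)
  define M where "M = mittag_leffler \<alpha> (8 * L\<^sup>2 * k * T powr \<alpha>)"
  have "AE t in lborel. t \<in> {0<..<T} \<longrightarrow> a t \<le> ennreal (2 * K + 2 * C0) * ennreal M"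
    unfolding M_def by (rule frac_gronwall_AE[OF _ ca \<alpha> _ fa ineq]) (use k in auto)
  then have "AE t in lborel. t \<in> {0<..<T} \<longrightarrow> a t \<le> ennreal ((2 * K + 2 * C0) * max 0 M)"
    using K C0 by (auto simp: ennreal_mult ennreal_max_0 elim!: eventually_mono)
  from nconv_frac_kernel_bound_everywhere[OF _ T this[unfolded a_def]]
  have "\<forall>t\<in>{0..T}. nconv ?l ?g2 t \<le> ennreal ((2 * K + 2 * C0) * max 0 M)" by auto
  then show ?thesis using K C0 by (intro exI[of _ "(2 * K + 2 * C0) * max 0 M"]) auto
qed

section \<open>A Gronwall inequality with a linear and a quadratic term\<close>

lemma le_of_square_le_affine:
  fixes s B d :: real
  assumes "0 \<le> B" "0 \<le> d" "0 \<le> s" "s\<^sup>2 \<le> B + d * s"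
  shows "s \<le> sqrt B + d"
proof (rule ccontr)
  assume "\<not> ?thesis"
  then have s: "sqrt B + d < s" by simp
  have "0 \<le> sqrt B" using assms by simp
  then have "sqrt B * sqrt B \<le> s * sqrt B" using s assms by (intro mult_right_mono) auto
  also have "\<dots> < s * (s - d)" if "0 < s" using s that by simp
  finally have "B < s * (s - d)" using s \<open>0 \<le> sqrt B\<close> assms by simp
  then show False using assms(4) by (simp add: power2_eq_square algebra_simps)
qed

text \<open>The term A |w| is linearized by e, the maximum of |w| over [0,T], which exists by
  continuity. Gronwall bounds the whole left side by b M with b affine in e, and e^2 \<le> b M makes
  this a quadratic inequality for sqrt(b M). Its solution is the root plus the linear term. Since
  the q part is carried through Gronwall together with the square, it costs no further
  constant.\<close>

lemma frac_quadratic_gronwall: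
  fixes w :: "real \<Rightarrow> 'h::real_normed_vector" and A ep x q :: "real \<Rightarrow> real"
  assumes \<alpha>: "0 < \<alpha>" and T: "0 < T" and L: "0 \<le> L" and W0: "0 \<le> W0" and E1: "0 \<le> E1" and A1: "0 \<le> A1"
    and [measurable]: "(\<lambda>t. norm (w t)) \<in> borel_measurable borel" "A \<in> borel_measurable borel" "ep \<in> borel_measurable borel"
      "x \<in> borel_measurable borel" "q \<in> borel_measurable borel"
    and cont: "continuous_on {0..T} w"
    and A0: "\<And>s. 0 \<le> A s" and ep0: "\<And>s. 0 \<le> ep s" and q0: "\<And>s. 0 \<le> q s"
    and z: "\<And>s. s \<notin> {0<..<T} \<Longrightarrow> x s = 0" "\<And>s. s \<notin> {0<..<T} \<Longrightarrow> q s = 0"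
    and qx: "AE s in lborel. s \<in> {0<..<T} \<longrightarrow> q s + x s = A s * norm (w s) + L * (norm (w s))\<^sup>2 + ep s"
    and NE: "\<And>t. t \<in> {0..T} \<Longrightarrow> nconv (\<lambda>x. ennreal (frac_kernel \<alpha> x)) (\<lambda>s. ennreal (ep s)) t \<le> ennreal E1"
    and NA: "\<And>t. t \<in> {0..T} \<Longrightarrow> nconv (\<lambda>x. ennreal (frac_kernel \<alpha> x)) (\<lambda>s. ennreal (A s)) t \<le> ennreal A1"
    and nx: "\<And>t. t \<in> {0..T} \<Longrightarrow> nconv (\<lambda>x. ennreal (frac_kernel \<alpha> x)) (enorm x) t < \<infinity>"
    and H: "\<And>t. t \<in> {0..T} \<Longrightarrow> (norm (w t))\<^sup>2 \<le> W0 + 2 * conv (frac_kernel \<alpha>) x t"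
    and t: "t \<in> {0..T}"
  defines "M \<equiv> mittag_leffler \<alpha> (2 * L * T powr \<alpha>)"
  shows "ennreal ((norm (w t))\<^sup>2) + ennreal 2 * nconv (\<lambda>x. ennreal (frac_kernel \<alpha> x)) (\<lambda>s. ennreal (q s)) t
     \<le> ennreal ((sqrt ((W0 + 2 * E1) * M) + 2 * A1 * M)\<^sup>2)"
proof -
  let ?l = "\<lambda>x. ennreal (frac_kernel \<alpha> x)"
  have cl: "causal ?l" by (simp add: causal_def frac_kernel_def)
  have k0: "0 \<le> frac_kernel \<alpha> x" for x using \<alpha> by (simp add: frac_kernel_nonneg)
  have "continuous_on {0..T} (\<lambda>t. norm (w t))" using cont by (rule continuous_on_norm)
  then obtain t0 where t0: "t0 \<in> {0..T}" "\<And>t. t \<in> {0..T} \<Longrightarrow> norm (w t) \<le> norm (w t0)"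
    using continuous_attains_sup[of "{0..T}" "\<lambda>t. norm (w t)"] T by auto
  define e where "e = norm (w t0)"
  have e0: "0 \<le> e" and we: "\<And>t. t \<in> {0..T} \<Longrightarrow> norm (w t) \<le> e" using t0 by (auto simp: e_def)
  define w2 where "w2 s = (if s \<in> {0<..<T} then (norm (w s))\<^sup>2 else 0)" for s
  have [measurable]: "w2 \<in> borel_measurable borel" unfolding w2_def[abs_def] by measurable
  have w20: "0 \<le> w2 s" for s by (simp add: w2_def)
  define X where "X t = ennreal ((norm (w t))\<^sup>2) + ennreal 2 * nconv ?l (\<lambda>s. ennreal (q s)) t" for t
  have [measurable]: "X \<in> borel_measurable borel" unfolding X_def[abs_def] by measurable
  define b where "b = W0 + 2 * E1 + 2 * e * A1"
  have b0: "0 \<le> b" using W0 E1 A1 e0 by (simp add: b_def)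
  have step: "X t \<le> ennreal b + ennreal (2 * L) * nconv ?l (\<lambda>s. ennreal (w2 s)) t" if t: "t \<in> {0..T}" for t
  proof -
    \<comment> \<open>x has no sign, so its convolution is split into positive and negative parts.
      The extended values are compared by additions only, and P, being finite, is cancelled at the
      end.\<close>
    define P N where "P = nconv ?l (\<lambda>s. ennreal (x s)) t" and "N = nconv ?l (\<lambda>s. ennreal (- x s)) t"
    have Pf: "P < \<infinity>" and Nf: "N < \<infinity>"
    proof -
      have "P \<le> nconv ?l (enorm x) t" unfolding P_def by (rule nconv_mono[OF _ cl]) (simp add: ennreal_leI)
      then show "P < \<infinity>" using nx[OF t] by (rule le_less_trans)
      have "N \<le> nconv ?l (enorm x) t" unfolding N_def by (rule nconv_mono[OF _ cl]) (simp add: ennreal_leI)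
      then show "N < \<infinity>" using nx[OF t] by (rule le_less_trans)
    qed
    obtain p n where p: "P = ennreal p" "0 \<le> p" and n: "N = ennreal n" "0 \<le> n"
      using Pf Nf by (cases P; cases N) auto
    have cx: "conv (frac_kernel \<alpha>) x t = p - n"
    proof -
      have i: "integrable lborel (\<lambda>s. frac_kernel \<alpha> (t - s) *\<^sub>R x s)"
        by (rule conv_integrable) (use nx[OF t] k0 in simp_all)
      have e1: "ennreal (frac_kernel \<alpha> (t - s) *\<^sub>R x s) = ?l (t - s) * ennreal (x s)"
        and e2: "ennreal (- (frac_kernel \<alpha> (t - s) *\<^sub>R x s)) = ?l (t - s) * ennreal (- x s)" for s
        using ennreal_mult'[OF k0[of "t - s"], of "x s"] ennreal_mult'[OF k0[of "t - s"], of "- x s"] by simp_all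
      have "conv (frac_kernel \<alpha>) x t = enn2real P - enn2real N"
        unfolding conv_def real_lebesgue_integral_def[OF i] e1 e2 P_def N_def nconv_def ..
      then show ?thesis using p n by simp
    qed
    have H': "ennreal ((norm (w t))\<^sup>2) + ennreal 2 * N \<le> ennreal W0 + ennreal 2 * P"
    proof -
      have "ennreal ((norm (w t))\<^sup>2 + 2 * n) \<le> ennreal (W0 + 2 * p)"
        using H[OF t] cx by (intro ennreal_leI) simp
      then show ?thesis unfolding p(1) n(1) using p n W0 by (simp add: ennreal_plus ennreal_mult)
    qed
    define R where "R = nconv ?l (\<lambda>s. ennreal (q s + x s)) t"
    have qR: "nconv ?l (\<lambda>s. ennreal (q s)) t + P = N + R"
    proof -
      have "nconv ?l (\<lambda>s. ennreal (q s)) t + P = nconv ?l (\<lambda>s. ennreal (q s) + ennreal (x s)) t"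
        unfolding P_def by (rule nconv_add[symmetric]) measurable
      also have "\<dots> = nconv ?l (\<lambda>s. ennreal (- x s) + ennreal (q s + x s)) t"
      proof (rule nconv_cong_AE[OF _ cl])
        show "AE s in lborel. s < t \<longrightarrow> ennreal (q s) + ennreal (x s) = ennreal (- x s) + ennreal (q s + x s)"
          using qx
        proof eventually_elim
          case (elim s)
          have r0: "0 \<le> q s + x s"
          proof (cases "s \<in> {0<..<T}")
            case True
            then have "q s + x s = A s * norm (w s) + L * (norm (w s))\<^sup>2 + ep s" using elim by simp
            then show ?thesis using A0[of s] ep0[of s] L by simp
          qed (simp add: z)
          show ?case
          proof (cases "0 \<le> x s")
            case True
            then have "ennreal (- x s) = 0" by (simp add: ennreal_neg)
            then show ?thesis using True q0[of s] by (simp add: ennreal_plus)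
          next
            case False
            then have "ennreal (x s) = 0" "ennreal (- x s) + ennreal (q s + x s) = ennreal (- x s + (q s + x s))"
              using r0 by (simp_all add: ennreal_neg ennreal_plus[symmetric] del: ennreal_plus)
            then show ?thesis by simp
          qed
        qed
      qed
      also have "\<dots> = N + R" unfolding N_def R_def by (rule nconv_add) measurable
      finally show ?thesis .
    qed
    have RR: "R \<le> ennreal (E1 + e * A1) + ennreal L * nconv ?l (\<lambda>s. ennreal (w2 s)) t"
    proof -
      have "R \<le> nconv ?l (\<lambda>s. (ennreal (ep s) + ennreal e * ennreal (A s)) + ennreal L * ennreal (w2 s)) t"
        unfolding R_def
      proof (rule nconv_mono_AE[OF _ cl])
        show "AE s in lborel. s < t \<longrightarrow> ennreal (q s + x s) \<le> ennreal (ep s) + ennreal e * ennreal (A s) + ennreal L * ennreal (w2 s)"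
          using qx
        proof eventually_elim
          case (elim s)
          show ?case
          proof (cases "s \<in> {0<..<T}")
            case True
            have "q s + x s \<le> ep s + e * A s + L * w2 s"
              using elim True we[of s] A0[of s] mult_left_mono[of "norm (w s)" e "A s"] by (simp add: w2_def mult.commute)
            then have "ennreal (q s + x s) \<le> ennreal (ep s + e * A s + L * w2 s)" by (rule ennreal_leI)
            then show ?thesis using ep0[of s] A0[of s] w20[of s] e0 L by (simp add: ennreal_plus ennreal_mult)
          qed (simp add: z)
        qed
      qed
      also have "\<dots> = (nconv ?l (\<lambda>s. ennreal (ep s)) t + ennreal e * nconv ?l (\<lambda>s. ennreal (A s)) t) + ennreal L * nconv ?l (\<lambda>s. ennreal (w2 s)) t"
        by (subst nconv_add; measurable?) (simp add: nconv_add nconv_cmult)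
      also have "\<dots> \<le> (ennreal E1 + ennreal e * ennreal A1) + ennreal L * nconv ?l (\<lambda>s. ennreal (w2 s)) t"
        by (intro add_mono mult_left_mono NE NA t order_refl) auto
      also have "ennreal E1 + ennreal e * ennreal A1 = ennreal (E1 + e * A1)"
        using E1 e0 A1 by (simp add: ennreal_plus ennreal_mult)
      finally show ?thesis .
    qed
    have "ennreal 2 * P + X t = ennreal ((norm (w t))\<^sup>2) + ennreal 2 * (nconv ?l (\<lambda>s. ennreal (q s)) t + P)"
      by (simp only: X_def distrib_left distrib_right ac_simps)
    also have "\<dots> = (ennreal ((norm (w t))\<^sup>2) + ennreal 2 * N) + ennreal 2 * R"
      unfolding qR by (simp only: distrib_left distrib_right ac_simps)
    also have "\<dots> \<le> (ennreal W0 + ennreal 2 * P) + ennreal 2 * R" by (rule add_right_mono[OF H'])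
    finally have "ennreal 2 * P + X t \<le> ennreal 2 * P + (ennreal W0 + ennreal 2 * R)" by (simp only: ac_simps)
    moreover have "ennreal 2 * P \<noteq> top_class.top" unfolding p(1) by (simp add: ennreal_mult_eq_top_iff)
    ultimately have "X t \<le> ennreal W0 + ennreal 2 * R" by (simp add: ennreal_add_left_cancel_le)
    also have "\<dots> \<le> ennreal W0 + ennreal 2 * (ennreal (E1 + e * A1) + ennreal L * nconv ?l (\<lambda>s. ennreal (w2 s)) t)"
      by (intro add_left_mono mult_left_mono RR) simp
    also have "\<dots> = (ennreal W0 + ennreal 2 * ennreal (E1 + e * A1)) + (ennreal 2 * ennreal L) * nconv ?l (\<lambda>s. ennreal (w2 s)) t"
      by (simp only: distrib_left add.assoc mult.assoc)
    also have "ennreal 2 * ennreal L = ennreal (2 * L)" by (rule ennreal_mult[symmetric]) (use L in auto)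
    also have "ennreal W0 + ennreal 2 * ennreal (E1 + e * A1) = ennreal b"
    proof -
      have "ennreal 2 * ennreal (E1 + e * A1) = ennreal (2 * (E1 + e * A1))" by (rule ennreal_mult[symmetric]) (use E1 e0 A1 in auto)
      moreover have "ennreal W0 + ennreal (2 * (E1 + e * A1)) = ennreal (W0 + 2 * (E1 + e * A1))"
        by (rule ennreal_plus[symmetric]) (use W0 E1 e0 A1 in auto)
      ultimately show ?thesis by (simp add: b_def algebra_simps)
    qed
    finally show ?thesis .
  qed
  define X' where "X' t = (if t \<in> {0..T} then X t else 0)" for t
  have [measurable]: "X' \<in> borel_measurable borel" unfolding X'_def[abs_def] by measurable
  \<comment> \<open>A crude bound used for finiteness only: Gronwall asks for an integrable
    X.\<close>
  define Bd where "Bd = ennreal b + ennreal (2 * L) * (ennreal (e\<^sup>2) * ennreal (frac_kernel (\<alpha> + 1) T))"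
  have Bd: "Bd < \<infinity>" by (simp add: Bd_def ennreal_mult_less_top)
  have XB: "X t \<le> Bd" if t: "t \<in> {0..T}" for t
  proof -
    have "nconv ?l (\<lambda>s. ennreal (w2 s)) t \<le> nconv ?l (\<lambda>s. ennreal (e\<^sup>2) * ennreal (frac_kernel 1 s)) t"
    proof (rule nconv_mono[OF _ cl])
      fix s
      show "ennreal (w2 s) \<le> ennreal (e\<^sup>2) * ennreal (frac_kernel 1 s)"
        using we[of s] by (auto simp: w2_def frac_kernel_1 intro!: ennreal_leI power_mono)
    qed
    also have "\<dots> = ennreal (e\<^sup>2) * ennreal (frac_kernel (\<alpha> + 1) t)"
      using \<alpha> by (subst nconv_cmult; measurable?) (simp add: nconv_frac_kernel)
    also have "\<dots> \<le> ennreal (e\<^sup>2) * ennreal (frac_kernel (\<alpha> + 1) T)"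
    proof (intro mult_left_mono ennreal_leI)
      show "frac_kernel (\<alpha> + 1) t \<le> frac_kernel (\<alpha> + 1) T"
        using t T \<alpha> Gamma_real_pos[of "\<alpha> + 1"] by (auto simp: frac_kernel_def intro!: divide_right_mono powr_mono2)
    qed simp
    finally show ?thesis unfolding Bd_def by (intro order_trans[OF step[OF t]] add_left_mono mult_left_mono) auto
  qed
  have XM: "X t \<le> ennreal (b * M)" if t: "t \<in> {0..T}" for t
  proof -
    have "X' t \<le> ennreal b * ennreal (\<Sum>k. (2 * L * t powr \<alpha>) ^ k / Gamma (\<alpha> * real k + 1))"
    proof (rule frac_gronwall[OF _ _ \<alpha> _ _ _ t])
      show "causal X'" by (simp add: causal_def X'_def)
      have "(\<integral>\<^sup>+s\<in>{..T}. X' s \<partial>lborel) \<le> (\<integral>\<^sup>+s. Bd * indicator {0..T} s \<partial>lborel)"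
        by (rule nn_integral_mono) (use XB in \<open>auto simp: X'_def indicator_def\<close>)
      also have "\<dots> = Bd * emeasure lborel {0..T}" by (rule nn_integral_cmult_indicator) simp
      also have "\<dots> < \<infinity>" using Bd T by (simp add: ennreal_mult_less_top)
      finally show "(\<integral>\<^sup>+s\<in>{..T}. X' s \<partial>lborel) < \<infinity>" .
      show "X' t \<le> ennreal b + ennreal (2 * L) * nconv ?l X' t" if t: "t \<in> {0..T}" for t
      proof -
        have "nconv ?l (\<lambda>s. ennreal (w2 s)) t \<le> nconv ?l X' t"
          by (rule nconv_mono[OF _ cl]) (simp add: X'_def X_def w2_def)
        then have "ennreal b + ennreal (2 * L) * nconv ?l (\<lambda>s. ennreal (w2 s)) t \<le> ennreal b + ennreal (2 * L) * nconv ?l X' t"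
          by (intro add_left_mono mult_left_mono) auto
        with step[OF t] have "X t \<le> ennreal b + ennreal (2 * L) * nconv ?l X' t" by (rule order_trans)
        then show ?thesis using t by (simp add: X'_def)
      qed
    qed (use L in \<open>simp_all\<close>)
    also have "\<dots> \<le> ennreal b * ennreal M"
      unfolding M_def mittag_leffler_def
    proof (intro mult_left_mono ennreal_leI suminf_le summable_mittag_leffler \<alpha>)
      fix k
      have "0 < Gamma (\<alpha> * real k + 1)" using \<alpha> by (intro Gamma_real_pos) (simp add: add_nonneg_pos)
      then show "(2 * L * t powr \<alpha>) ^ k / Gamma (\<alpha> * real k + 1) \<le> (2 * L * T powr \<alpha>) ^ k / Gamma (\<alpha> * real k + 1)"
        using t L \<alpha> by (intro divide_right_mono power_mono mult_left_mono powr_mono2) auto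
    qed simp
    also have "\<dots> = ennreal (b * M)" using b0 by (simp add: ennreal_mult')
    finally show ?thesis using t by (simp add: X'_def)
  qed
  have M0: "0 \<le> M"
    unfolding M_def mittag_leffler_def
  proof (rule suminf_nonneg[OF summable_mittag_leffler[OF \<alpha>]])
    fix k
    have "0 < Gamma (\<alpha> * real k + 1)" using \<alpha> by (intro Gamma_real_pos) (simp add: add_nonneg_pos)
    then show "0 \<le> (2 * L * T powr \<alpha>) ^ k / Gamma (\<alpha> * real k + 1)" using L by simp
  qed
  have bM: "0 \<le> b * M" using b0 M0 by simp
  \<comment> \<open>b contains e, and evaluating X at the maximizer shows e \<le> s. Hence s^2 \<le>
    (W0 + 2 E1) M + 2 A1 M s, which is solved for s.\<close>
  define s where "s = sqrt (b * M)"
  have s0: "0 \<le> s" and s2: "s\<^sup>2 = b * M" using bM by (simp_all add: s_def)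
  have "ennreal (e\<^sup>2) \<le> X t0" by (simp add: X_def e_def)
  also have "\<dots> \<le> ennreal (s\<^sup>2)" unfolding s2 by (rule XM[OF t0(1)])
  finally have "e\<^sup>2 \<le> s\<^sup>2" by (subst (asm) ennreal_le_iff) auto
  then have es: "e \<le> s" using s0 by (rule power2_le_imp_le)
  have "s\<^sup>2 \<le> (W0 + 2 * E1) * M + (2 * A1 * M) * s"
  proof -
    have "2 * e * A1 * M \<le> 2 * s * A1 * M" using es A1 M0 by (intro mult_right_mono mult_left_mono) auto
    then show ?thesis unfolding s2 b_def by (simp add: algebra_simps)
  qed
  then have "s \<le> sqrt ((W0 + 2 * E1) * M) + 2 * A1 * M"
    by (intro le_of_square_le_affine) (use W0 E1 A1 M0 s0 in auto)
  then have "s\<^sup>2 \<le> (sqrt ((W0 + 2 * E1) * M) + 2 * A1 * M)\<^sup>2" using s0 by (rule power_mono)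
  then have "ennreal (b * M) \<le> ennreal ((sqrt ((W0 + 2 * E1) * M) + 2 * A1 * M)\<^sup>2)" unfolding s2 by (rule ennreal_leI)
  then show ?thesis using XM[OF t] unfolding X_def by (rule order_trans[rotated])
qed

section \<open>Subgradients and coercivity moduli\<close>

lemma lower_semicontinuous_borel:
  fixes \<Phi> :: "'h::topological_space \<Rightarrow> ereal"
  assumes "lower_semicontinuous \<Phi>"
  shows "\<Phi> \<in> borel_measurable borel"
proof (rule borel_measurableI_greater)
  fix c
  have "open {x. c < \<Phi> x}"
  proof (subst open_subopen, intro ballI)
    fix x assume "x \<in> {x. c < \<Phi> x}"
    then have x: "c < \<Phi> x" by simp
    then have "c < Liminf (at x) \<Phi>" using assms by (auto simp: lower_semicontinuous_def intro: less_le_trans)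
    then have "\<forall>\<^sub>F y in at x. c < \<Phi> y" by (rule less_LiminfD)
    then have "\<forall>\<^sub>F y in nhds x. c < \<Phi> y"
      using x by (auto simp: eventually_at_filter elim!: eventually_mono)
    then show "\<exists>T. open T \<and> x \<in> T \<and> T \<subseteq> {x. c < \<Phi> x}"
      by (auto simp: eventually_nhds)
  qed
  then show "{x \<in> space borel. c < \<Phi> x} \<in> sets borel" by simp
qed

text \<open>A subgradient at w excludes the value \<infinity>: tested at a point of the effective
  domain, the right side of the subgradient inequality would be -\<infinity>.\<close>

lemma subdiff_finite:
  assumes "eff_dom \<Phi> \<noteq> {}" "bounded_from_below \<Phi>" "\<xi> \<in> subdiff \<Phi> w"
  obtains r where "\<Phi> w = ereal r"
proof (cases "\<Phi> w")
  case PInf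
  obtain v where "\<Phi> v < \<infinity>" using assms(1) by (auto simp: eff_dom_def)
  moreover have "ereal (inner \<xi> (v - w)) \<le> \<Phi> v - \<Phi> w" using assms(3) by (simp add: subdiff_def)
  ultimately show ?thesis using PInf by (cases "\<Phi> v") auto
next
  case MInf
  obtain c where "ereal c \<le> \<Phi> w" using assms(2) by (auto simp: bounded_from_below_def)
  then show ?thesis using MInf by simp
qed (rule that)

lemma subdiff_le:
  assumes "\<xi> \<in> subdiff \<Phi> w" "\<Phi> w = ereal a" "\<Phi> v = ereal b"
  shows "a - b \<le> inner \<xi> (w - v)"
proof -
  have "ereal (inner \<xi> (v - w)) \<le> \<Phi> v - \<Phi> w" using assms(1) by (simp add: subdiff_def)
  then show ?thesis using assms by (simp add: inner_diff_right)
qed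

text \<open>The supremum is subtracted, so any single subgradient gives an upper bound; the equation
  will supply the one to use.\<close>

lemma coercivity_modulus_le:
  assumes "\<xi> \<in> subdiff \<Phi> w" "\<Phi> w = ereal a" "\<Phi> v = ereal b"
  shows "coercivity_modulus \<Phi> w v \<le> ereal (b - a - inner \<xi> (v - w))"
proof -
  have "ereal (inner \<xi> (v - w)) \<le> (SUP \<xi>\<in>subdiff \<Phi> w. ereal (inner \<xi> (v - w)))"
    by (rule SUP_upper[OF assms(1)])
  then have "\<Phi> v - \<Phi> w - (SUP \<xi>\<in>subdiff \<Phi> w. ereal (inner \<xi> (v - w))) \<le> \<Phi> v - \<Phi> w - ereal (inner \<xi> (v - w))"
    by (intro ereal_minus_mono) auto
  then show ?thesis using assms by (simp add: coercivity_modulus_def)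
qed

text \<open>With the subgradients from the two inclusions, \<Phi> v cancels in the sum of the
  moduli. What is left is the residual plus the inner product of v - uh with the difference of the
  two subgradients, and the equations express that difference by f - fb, a difference of values of
  \<Psi>, and g - V. The Lipschitz bound passes through |v - ub| \<le> |v - uh| + |ub - uh|, so the
  perturbation enters both the linear and the quadratic term.\<close>

lemma coercivity_moduli_le:
  fixes f fb g V v uh ub :: "'h::real_inner"
  assumes \<xi>: "\<xi> \<in> subdiff \<Phi> v" and \<zeta>: "fb - V - \<Psi> ub \<in> subdiff \<Phi> ub"
    and \<Phi>: "\<Phi> v = ereal a" "\<Phi> uh = ereal b" "\<Phi> ub = ereal c"
    and eq: "g + \<xi> + \<Psi> v = f" and lip: "L-lipschitz_on UNIV \<Psi>"
  defines "Q \<equiv> (norm (f - fb) + L * norm (ub - uh)) * norm (v - uh) + L * (norm (v - uh))\<^sup>2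
      + \<bar>inner (V + \<Psi> ub - fb) (uh - ub) + b - c\<bar> - inner (v - uh) (g - V)"
  shows "e2ennreal (coercivity_modulus \<Phi> v uh + coercivity_modulus \<Phi> ub v) \<le> ennreal Q" and "0 \<le> Q"
proof -
  let ?\<zeta> = "fb - V - \<Psi> ub"
  define s1 s2 where "s1 = b - a - inner \<xi> (uh - v)" and "s2 = a - c - inner ?\<zeta> (v - ub)"
  have s0: "0 \<le> s1" "0 \<le> s2"
    using subdiff_le[OF \<xi> \<Phi>(1,2)] subdiff_le[OF \<zeta> \<Phi>(3,1)] by (simp_all add: s1_def s2_def inner_diff_right)
  have "g - V = (f - fb) - (\<Psi> v - \<Psi> ub) - (\<xi> - ?\<zeta>)" using eq by (auto simp: algebra_simps)
  then have id: "inner (v - uh) (g - V) = inner (v - uh) (f - fb) - inner (v - uh) (\<Psi> v - \<Psi> ub) - inner (v - uh) \<xi> + inner (v - uh) ?\<zeta>"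
    by (simp add: inner_diff_right)
  have c1: "inner (v - uh) (f - fb) \<le> norm (f - fb) * norm (v - uh)"
    using norm_cauchy_schwarz[of "v - uh" "f - fb"] by (simp add: mult.commute)
  have L: "0 \<le> L" using lip by (rule lipschitz_on_nonneg)
  have c2: "- inner (v - uh) (\<Psi> v - \<Psi> ub) \<le> L * norm (ub - uh) * norm (v - uh) + L * (norm (v - uh))\<^sup>2"
  proof -
    have "- inner (v - uh) (\<Psi> v - \<Psi> ub) \<le> norm (v - uh) * norm (\<Psi> v - \<Psi> ub)"
      using Cauchy_Schwarz_ineq2[of "v - uh" "\<Psi> v - \<Psi> ub"] by linarith
    also have "norm (\<Psi> v - \<Psi> ub) \<le> L * norm (v - ub)"
      using lipschitz_onD[OF lip, of v ub] by (simp add: dist_norm)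
    also have "norm (v - ub) \<le> norm (v - uh) + norm (ub - uh)"
      using norm_triangle_ineq4[of "v - uh" "ub - uh"] by simp
    finally have "- inner (v - uh) (\<Psi> v - \<Psi> ub) \<le> norm (v - uh) * (L * (norm (v - uh) + norm (ub - uh)))"
      using L by (simp add: mult_left_mono)
    then show ?thesis by (simp add: power2_eq_square algebra_simps)
  qed
  have "s1 + s2 = b - c + inner (v - uh) \<xi> - inner (v - uh) ?\<zeta> + inner (V + \<Psi> ub - fb) (uh - ub)"
    unfolding s1_def s2_def by (simp add: inner_diff_left inner_diff_right inner_add_left inner_add_right inner_commute)
  moreover have "inner (V + \<Psi> ub - fb) (uh - ub) + b - c \<le> \<bar>inner (V + \<Psi> ub - fb) (uh - ub) + b - c\<bar>" by (rule abs_ge_self)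
  ultimately have sQ: "s1 + s2 \<le> Q" unfolding Q_def distrib_right using id c1 c2 by linarith
  then show "0 \<le> Q" using s0 by linarith
  have "coercivity_modulus \<Phi> v uh + coercivity_modulus \<Phi> ub v \<le> ereal s1 + ereal s2"
    unfolding s1_def s2_def by (intro add_mono coercivity_modulus_le \<xi> \<zeta> \<Phi>)
  also have "\<dots> \<le> ereal Q" using sQ by simp
  finally have "e2ennreal (coercivity_modulus \<Phi> v uh + coercivity_modulus \<Phi> ub v) \<le> e2ennreal (ereal Q)" by (rule e2ennreal_mono)
  then show "e2ennreal (coercivity_modulus \<Phi> v uh + coercivity_modulus \<Phi> ub v) \<le> ennreal Q" by simp
qed

section \<open>The weighted norms of the statement in terms of convolutions\<close>

lemma ennpowr_1 [simp]: "ennpowr x 1 = x"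
  by (cases x) (auto simp: ennpowr_def)

lemma ennpowr_half: "0 \<le> r \<Longrightarrow> ennpowr (ennreal r) (1 / 2) = ennreal (sqrt r)"
  by (simp add: ennpowr_def powr_half_sqrt)

lemma ennpowr_half_square: "(ennpowr x (1 / 2))\<^sup>2 = x"
proof (cases x)
  case (real r)
  then show ?thesis by (simp add: ennpowr_half ennreal_power)
qed (simp add: ennpowr_def power2_eq_square ennreal_top_mult)

lemma ennpowr_mono: "x \<le> y \<Longrightarrow> 0 \<le> p \<Longrightarrow> ennpowr x p \<le> ennpowr y p"
  by (cases x; cases y) (auto simp: ennpowr_def top_unique intro!: ennreal_leI powr_mono2)

text \<open>m is arbitrary: only its majorant n has to be measurable. The bound therefore applies to
  the coercivity moduli without any discussion of their measurability.\<close>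

lemma nn_set_integral_frac_kernel_le:
  assumes \<alpha>: "0 < \<alpha>" and [measurable]: "n \<in> borel_measurable borel"
    and le: "AE s in lborel. s \<in> {0<..<t} \<longrightarrow> m s \<le> n s"
  shows "(\<integral>\<^sup>+s\<in>{0..t}. (ennreal ((t - s) powr (\<alpha> - 1)) * m s) \<partial>lebesgue)
     \<le> ennreal (Gamma \<alpha>) * nconv (\<lambda>x. ennreal (frac_kernel \<alpha> x)) n t"
proof -
  have G: "0 < Gamma \<alpha>" using \<alpha> by (rule Gamma_real_pos)
  have "(\<integral>\<^sup>+s\<in>{0..t}. (ennreal ((t - s) powr (\<alpha> - 1)) * m s) \<partial>lborel)
     \<le> (\<integral>\<^sup>+s. ennreal (Gamma \<alpha>) * (ennreal (frac_kernel \<alpha> (t - s)) * n s) \<partial>lborel)"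
  proof (rule nn_integral_mono_AE)
    show "AE s in lborel. ennreal ((t - s) powr (\<alpha> - 1)) * m s * indicator {0..t} s \<le> ennreal (Gamma \<alpha>) * (ennreal (frac_kernel \<alpha> (t - s)) * n s)"
      using le AE_lborel_singleton[of 0] AE_lborel_singleton[of t]
    proof eventually_elim
      case (elim s)
      show ?case
      proof (cases "s \<in> {0<..<t}")
        case True
        then have "(t - s) powr (\<alpha> - 1) = Gamma \<alpha> * frac_kernel \<alpha> (t - s)" using G by (simp add: frac_kernel_def)
        then have "ennreal ((t - s) powr (\<alpha> - 1)) = ennreal (Gamma \<alpha>) * ennreal (frac_kernel \<alpha> (t - s))"
          using G \<alpha> by (simp add: ennreal_mult frac_kernel_nonneg)
        then show ?thesis using True elim by (simp add: mult.assoc mult_left_mono)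
      next
        case False
        then have "s \<notin> {0..t}" using elim by auto
        then show ?thesis by simp
      qed
    qed
  qed
  also have "\<dots> = ennreal (Gamma \<alpha>) * nconv (\<lambda>x. ennreal (frac_kernel \<alpha> x)) n t"
    unfolding nconv_def by (rule nn_integral_cmult) measurable
  finally show ?thesis by (simp only: nn_integral_completion)
qed

text \<open>The opposite direction, by which finite weighted norms yield bounds on convolutions of
  Borel minorants.\<close>

lemma nn_set_integral_frac_kernel_ge:
  assumes \<alpha>: "0 < \<alpha>" and [measurable]: "n \<in> borel_measurable borel" and c: "causal n"
    and le: "AE s in lborel. s \<in> {0<..<t} \<longrightarrow> n s \<le> m s"
  shows "ennreal (Gamma \<alpha>) * nconv (\<lambda>x. ennreal (frac_kernel \<alpha> x)) n t
     \<le> (\<integral>\<^sup>+s\<in>{0..t}. (ennreal ((t - s) powr (\<alpha> - 1)) * m s) \<partial>lebesgue)"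
proof -
  have G: "0 < Gamma \<alpha>" using \<alpha> by (rule Gamma_real_pos)
  have "ennreal (Gamma \<alpha>) * nconv (\<lambda>x. ennreal (frac_kernel \<alpha> x)) n t = (\<integral>\<^sup>+s. ennreal (Gamma \<alpha>) * (ennreal (frac_kernel \<alpha> (t - s)) * n s) \<partial>lborel)"
    unfolding nconv_def by (rule nn_integral_cmult[symmetric]) measurable
  also have "\<dots> \<le> (\<integral>\<^sup>+s\<in>{0..t}. (ennreal ((t - s) powr (\<alpha> - 1)) * m s) \<partial>lborel)"
  proof (rule nn_integral_mono_AE)
    show "AE s in lborel. ennreal (Gamma \<alpha>) * (ennreal (frac_kernel \<alpha> (t - s)) * n s) \<le> ennreal ((t - s) powr (\<alpha> - 1)) * m s * indicator {0..t} s"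
      using le AE_lborel_singleton[of 0] AE_lborel_singleton[of t]
    proof eventually_elim
      case (elim s)
      show ?case
      proof (cases "s \<in> {0<..<t}")
        case True
        then have "(t - s) powr (\<alpha> - 1) = Gamma \<alpha> * frac_kernel \<alpha> (t - s)" using G by (simp add: frac_kernel_def)
        then have "ennreal ((t - s) powr (\<alpha> - 1)) = ennreal (Gamma \<alpha>) * ennreal (frac_kernel \<alpha> (t - s))"
          using G \<alpha> by (simp add: ennreal_mult frac_kernel_nonneg)
        then show ?thesis using True elim by (simp add: mult.assoc mult_left_mono)
      next
        case False
        then have "s < 0 \<or> t < s" using elim by auto
        then have "ennreal (frac_kernel \<alpha> (t - s)) * n s = 0" using c by (auto simp: causal_def frac_kernel_def)
        then show ?thesis by (simp only: mult_zero_right) simp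
      qed
    qed
  qed
  finally show ?thesis by (simp only: nn_integral_completion)
qed

lemma ennreal_le_divideI:
  assumes "0 < G" "ennreal G * x \<le> ennreal y"
  shows "x \<le> ennreal (y / G)"
proof -
  have "x = ennreal (1 / G) * (ennreal G * x)"
    using assms(1) by (simp add: mult.assoc[symmetric] ennreal_mult[symmetric])
  also have "\<dots> \<le> ennreal (1 / G) * ennreal y" by (intro mult_left_mono assms) simp
  also have "\<dots> = ennreal (y / G)" using assms(1) by (simp add: ennreal_mult'[symmetric])
  finally show ?thesis .
qed

lemma square_integrable_diff:
  fixes f g :: "real \<Rightarrow> 'b::{banach, second_countable_topology}"
  assumes [measurable]: "f \<in> borel_measurable borel" "g \<in> borel_measurable borel"
    and "integrable lborel (\<lambda>t. (norm (f t))\<^sup>2)" "integrable lborel (\<lambda>t. (norm (g t))\<^sup>2)"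
  shows "integrable lborel (\<lambda>t. (norm (f t - g t))\<^sup>2)"
proof (rule Bochner_Integration.integrable_bound)
  show "integrable lborel (\<lambda>t. 2 * (norm (f t))\<^sup>2 + 2 * (norm (g t))\<^sup>2)" using assms(3,4) by simp
  show "AE t in lborel. norm ((norm (f t - g t))\<^sup>2) \<le> norm (2 * (norm (f t))\<^sup>2 + 2 * (norm (g t))\<^sup>2)"
  proof (rule AE_I2)
    fix t
    have "(norm (f t - g t))\<^sup>2 \<le> (norm (f t) + norm (g t))\<^sup>2" by (intro power_mono norm_triangle_ineq4) simp
    also have "\<dots> \<le> 2 * (norm (f t))\<^sup>2 + 2 * (norm (g t))\<^sup>2"
      using sum_squares_bound[of "norm (f t)" "norm (g t)"] by (simp add: power2_sum)
    finally show "norm ((norm (f t - g t))\<^sup>2) \<le> norm (2 * (norm (f t))\<^sup>2 + 2 * (norm (g t))\<^sup>2)" by simp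
  qed
qed measurable

lemma square_integrable_bounded:
  fixes f :: "real \<Rightarrow> 'b::{banach, second_countable_topology}"
  assumes [measurable]: "f \<in> borel_measurable borel"
    and z: "\<And>t. t \<notin> {0<..<T} \<Longrightarrow> f t = 0" and B: "\<And>t. t \<in> {0<..<T} \<Longrightarrow> norm (f t) \<le> B"
  shows "integrable lborel (\<lambda>t. (norm (f t))\<^sup>2)"
proof (rule Bochner_Integration.integrable_bound)
  show "integrable lborel (\<lambda>t. B\<^sup>2 * indicator {0<..<T} t)"
    by (intro integrable_mult_right integrable_real_indicator) (use emeasure_bounded_finite[of "{0<..<T}"] in auto)
  show "AE t in lborel. norm ((norm (f t))\<^sup>2) \<le> norm (B\<^sup>2 * indicator {0<..<T} t)"
  proof (rule AE_I2)
    fix t show "norm ((norm (f t))\<^sup>2) \<le> norm (B\<^sup>2 * indicator {0<..<T} t)"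
      using z[of t] B[of t] by (cases "t \<in> {0<..<T}") (simp_all add: power_mono)
  qed
qed measurable

lemma L2_Bochner_ex_borel:
  fixes w :: "real \<Rightarrow> 'b::{banach, second_countable_topology}"
  assumes "w \<in> L2_Bochner T"
  obtains w' where "w' \<in> borel_measurable borel" "\<And>t. t \<notin> {0<..<T} \<Longrightarrow> w' t = 0"
    "AE t in lborel. t \<in> {0<..<T} \<longrightarrow> w t = w' t" "integrable lborel (\<lambda>t. (norm (w' t))\<^sup>2)"
proof -
  have m: "set_borel_measurable lebesgue {0<..<T} w" and i: "set_integrable lebesgue {0<..<T} (\<lambda>t. (norm (w t))\<^sup>2)"
    using assms by (auto simp: L2_Bochner_def)
  obtain w' where w': "w' \<in> borel_measurable borel" "\<And>t. t \<notin> {0<..<T} \<Longrightarrow> w' t = 0"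
    "AE t in lborel. t \<in> {0<..<T} \<longrightarrow> w t = w' t" by (rule set_measurable_ex_borel[OF m]) blast
  have [measurable]: "w' \<in> borel_measurable borel" by (rule w'(1))
  have b: "(\<lambda>t. (norm (w' t))\<^sup>2) \<in> borel_measurable lborel" by measurable
  have "integrable lebesgue (\<lambda>t. (norm (w' t))\<^sup>2)"
  proof (rule Bochner_Integration.integrable_cong_AE[THEN iffD1, OF _ _ _ i[unfolded set_integrable_def]])
    show "AE t in lebesgue. indicator {0<..<T} t *\<^sub>R (norm (w t))\<^sup>2 = (norm (w' t))\<^sup>2"
      using AE_completion[OF w'(3)] by eventually_elim (use w'(2) in \<open>auto simp: indicator_def\<close>)
    show "(\<lambda>t. indicator {0<..<T} t *\<^sub>R (norm (w t))\<^sup>2) \<in> borel_measurable lebesgue"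
      using i unfolding set_integrable_def by (rule borel_measurable_integrable)
    show "(\<lambda>t. (norm (w' t))\<^sup>2) \<in> borel_measurable lebesgue" by (rule measurable_completion[OF b])
  qed
  then have "integrable lborel (\<lambda>t. (norm (w' t))\<^sup>2)" by (subst (asm) integrable_completion[OF b])
  with w' show ?thesis by (rule that)
qed

text \<open>At t = T the weight (T - s)^(\<alpha> - 1) is at least T^(\<alpha> - 1), so the weighted
  space embeds into L2. The bound for each t is kept as well, since the energy estimate needs
  it.\<close>

lemma Lp_frac_2_ex_borel:
  fixes f :: "real \<Rightarrow> 'b::{banach, second_countable_topology}"
  assumes \<alpha>: "0 < \<alpha>" "\<alpha> < 1" and T: "0 < T" and f: "f \<in> Lp_frac \<alpha> T 2"
  obtains f' C where "f' \<in> borel_measurable borel" "\<And>t. t \<notin> {0<..<T} \<Longrightarrow> f' t = 0"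
    "AE t in lborel. t \<in> {0<..<T} \<longrightarrow> f t = f' t" "integrable lborel (\<lambda>t. (norm (f' t))\<^sup>2)" "0 \<le> C"
    "\<And>t. t \<in> {0..T} \<Longrightarrow> nconv (\<lambda>x. ennreal (frac_kernel \<alpha> x)) (\<lambda>s. ennreal ((norm (f' s))\<^sup>2)) t \<le> ennreal C"
proof -
  let ?l = "\<lambda>x. ennreal (frac_kernel \<alpha> x)"
  have G: "0 < Gamma \<alpha>" using \<alpha>(1) by (rule Gamma_real_pos)
  have m: "set_borel_measurable lebesgue {0<..<T} f" and fin: "Lp_frac_norm \<alpha> T 2 f < \<infinity>"
    using f by (auto simp: Lp_frac_def)
  obtain f' where f': "f' \<in> borel_measurable borel" "\<And>t. t \<notin> {0<..<T} \<Longrightarrow> f' t = 0"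
    "AE t in lborel. t \<in> {0<..<T} \<longrightarrow> f t = f' t" by (rule set_measurable_ex_borel[OF m]) blast
  have [measurable]: "f' \<in> borel_measurable borel" by (rule f'(1))
  obtain S where S: "Lp_frac_norm \<alpha> T 2 f = ennreal S" "0 \<le> S" using fin by (cases "Lp_frac_norm \<alpha> T 2 f") auto
  have p2: "ennpowr (ennreal (norm x)) 2 = ennreal ((norm x)\<^sup>2)" for x :: 'b
    by (cases "x = 0") (simp_all add: ennpowr_def)
  have C: "nconv ?l (\<lambda>s. ennreal ((norm (f' s))\<^sup>2)) t \<le> ennreal (S\<^sup>2 / Gamma \<alpha>)" if t: "t \<in> {0..T}" for t
  proof -
    define X where "X = (\<integral>\<^sup>+ s\<in>{0..t}. (ennreal ((t - s) powr (\<alpha> - 1)) * ennpowr (ennreal (norm (f s))) 2) \<partial>lebesgue)"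
    have "ennpowr X (1 / 2) \<le> Lp_frac_norm \<alpha> T 2 f"
      unfolding Lp_frac_norm_def Lp_frac_enorm_def X_def using t by (rule SUP_upper)
    then have "(ennpowr X (1 / 2))\<^sup>2 \<le> (ennreal S)\<^sup>2" unfolding S(1) by (rule power_mono) simp
    then have XS: "X \<le> ennreal (S\<^sup>2)" unfolding ennpowr_half_square using S(2) by (simp add: ennreal_power)
    have "ennreal (Gamma \<alpha>) * nconv ?l (\<lambda>s. ennreal ((norm (f' s))\<^sup>2)) t \<le> X"
      unfolding X_def
    proof (rule nn_set_integral_frac_kernel_ge[OF \<alpha>(1)])
      show "causal (\<lambda>s. ennreal ((norm (f' s))\<^sup>2))" using f'(2) by (simp add: causal_def)
      show "AE s in lborel. s \<in> {0<..<t} \<longrightarrow> ennreal ((norm (f' s))\<^sup>2) \<le> ennpowr (ennreal (norm (f s))) 2"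
        using f'(3) by eventually_elim (use t in \<open>auto simp: p2\<close>)
    qed measurable
    then have "ennreal (Gamma \<alpha>) * nconv ?l (\<lambda>s. ennreal ((norm (f' s))\<^sup>2)) t \<le> ennreal (S\<^sup>2)" using XS by (rule order_trans)
    then show ?thesis by (rule ennreal_le_divideI[OF G])
  qed
  have k: "0 < frac_kernel \<alpha> T" using T G by (simp add: frac_kernel_def)
  have "integrable lborel (\<lambda>t. (norm (f' t))\<^sup>2)"
  proof (rule integrableI_bounded)
    have "ennreal (frac_kernel \<alpha> T) * (\<integral>\<^sup>+t. ennreal ((norm (f' t))\<^sup>2) \<partial>lborel) = (\<integral>\<^sup>+t. ennreal (frac_kernel \<alpha> T) * ennreal ((norm (f' t))\<^sup>2) \<partial>lborel)"
      by (rule nn_integral_cmult[symmetric]) measurable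
    also have "\<dots> \<le> nconv ?l (\<lambda>s. ennreal ((norm (f' s))\<^sup>2)) T"
      unfolding nconv_def
    proof (rule nn_integral_mono)
      fix s
      show "ennreal (frac_kernel \<alpha> T) * ennreal ((norm (f' s))\<^sup>2) \<le> ennreal (frac_kernel \<alpha> (T - s)) * ennreal ((norm (f' s))\<^sup>2)"
      proof (cases "s \<in> {0<..<T}")
        case True
        then have "frac_kernel \<alpha> T \<le> frac_kernel \<alpha> (T - s)"
          using \<alpha> T G by (auto simp: frac_kernel_def intro!: divide_right_mono powr_mono2')
        then show ?thesis by (intro mult_right_mono ennreal_leI) auto
      qed (simp add: f'(2))
    qed
    also have "\<dots> \<le> ennreal (S\<^sup>2 / Gamma \<alpha>)" by (rule C) (use T in simp)
    finally have "(\<integral>\<^sup>+t. ennreal ((norm (f' t))\<^sup>2) \<partial>lborel) \<le> ennreal (S\<^sup>2 / Gamma \<alpha> / frac_kernel \<alpha> T)"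
      by (rule ennreal_le_divideI[OF k])
    also have "\<dots> < \<infinity>" by simp
    finally show "(\<integral>\<^sup>+t. ennreal (norm ((norm (f' t))\<^sup>2)) \<partial>lborel) < \<infinity>" by simp
  qed measurable
  from that[OF f' this _ C] show thesis using G by simp
qed

text \<open>Along a Borel version W of u the function F - g, with F = f - \<Psi>(W), is a
  subgradient almost everywhere. The chain inequality for the values of \<Phi> along W bounds their
  increase from u0 by the fractional integral of \<open>inner (F - g) g\<close>. Since \<Phi> is
  bounded from below, this is a lower bound for that integral, which is what the energy estimate
  takes as input.\<close>

lemma energy_solution_regularity:
  fixes \<Phi> :: "'h::{real_inner, banach, second_countable_topology} \<Rightarrow> ereal" and \<Psi> :: "'h \<Rightarrow> 'h"
  assumes T: "0 < T" and \<alpha>: "0 < \<alpha>" "\<alpha> < 1"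
    and lsc: "lower_semicontinuous \<Phi>" and dom: "eff_dom \<Phi> \<noteq> {}" and bdd: "bounded_from_below \<Phi>"
    and lip: "L-lipschitz_on UNIV \<Psi>" and u0: "u0 \<in> eff_dom \<Phi>" and f: "f \<in> Lp_frac \<alpha> T 2"
    and sol: "energy_solution \<alpha> T \<Phi> \<Psi> f u0 u"
  obtains g C where "g \<in> borel_measurable borel" "\<And>t. t \<notin> {0<..<T} \<Longrightarrow> g t = 0"
    "integrable lborel (\<lambda>t. (norm (g t))\<^sup>2)" "0 \<le> C"
    "\<And>t. t \<in> {0..T} \<Longrightarrow> nconv (\<lambda>x. ennreal (frac_kernel \<alpha> x)) (\<lambda>s. ennreal ((norm (g s))\<^sup>2)) t \<le> ennreal C"
    "AE t in lborel. t \<in> {0<..<T} \<longrightarrow> u0 + conv (frac_kernel \<alpha>) g t = u t"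
    "AE t in lborel. t \<in> {0<..<T} \<longrightarrow> (\<exists>\<xi>\<in>subdiff \<Phi> (u0 + conv (frac_kernel \<alpha>) g t).
        g t + \<xi> + \<Psi> (u0 + conv (frac_kernel \<alpha>) g t) = f t)"
proof -
  let ?k = "frac_kernel \<alpha>" and ?l = "\<lambda>x. ennreal (frac_kernel \<alpha> x)"
  have cl: "causal ?l" by (simp add: causal_def frac_kernel_def)
  have L: "0 \<le> L" using lip by (rule lipschitz_on_nonneg)
  have [measurable]: "\<Phi> \<in> borel_measurable borel" using lsc by (rule lower_semicontinuous_borel)
  have [measurable]: "\<Psi> \<in> borel_measurable borel"
    using lip by (intro borel_measurable_continuous_onI lipschitz_on_continuous_on)
  obtain c0 where c0: "\<And>w. ereal c0 \<le> \<Phi> w" using bdd by (auto simp: bounded_from_below_def)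
  obtain g0 where uL: "u \<in> L2_Bochner T" and D: "has_caputo_deriv \<alpha> T u u0 g0" and gL: "g0 \<in> L2_Bochner T"
    and inc0: "AE t in lebesgue. t \<in> {0<..<T} \<longrightarrow> (\<exists>\<xi>\<in>subdiff \<Phi> (u t). g0 t + \<xi> + \<Psi> (u t) = f t)"
    using sol unfolding energy_solution_def by blast
  obtain ub where ub: "ub \<in> borel_measurable borel" "\<And>t. t \<notin> {0<..<T} \<Longrightarrow> ub t = 0"
    "AE t in lborel. t \<in> {0<..<T} \<longrightarrow> u t = ub t" "integrable lborel (\<lambda>t. (norm (ub t))\<^sup>2)"
    by (rule L2_Bochner_ex_borel[OF uL]) blast
  obtain g where g: "g \<in> borel_measurable borel" "\<And>t. t \<notin> {0<..<T} \<Longrightarrow> g t = 0"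
    "AE t in lborel. t \<in> {0<..<T} \<longrightarrow> g0 t = g t" "integrable lborel (\<lambda>t. (norm (g t))\<^sup>2)"
    by (rule L2_Bochner_ex_borel[OF gL]) blast
  obtain fb Cf where fb: "fb \<in> borel_measurable borel" "\<And>t. t \<notin> {0<..<T} \<Longrightarrow> fb t = 0"
    "AE t in lborel. t \<in> {0<..<T} \<longrightarrow> f t = fb t" "integrable lborel (\<lambda>t. (norm (fb t))\<^sup>2)" "0 \<le> Cf"
    "\<And>t. t \<in> {0..T} \<Longrightarrow> nconv ?l (\<lambda>s. ennreal ((norm (fb s))\<^sup>2)) t \<le> ennreal Cf"
    by (rule Lp_frac_2_ex_borel[OF \<alpha> T f]) blast
  note [measurable] = ub(1) g(1) fb(1)
  define u1 where "u1 t = ub t - indicator {0<..<T} t *\<^sub>R u0" for t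
  have [measurable]: "u1 \<in> borel_measurable borel" unfolding u1_def[abs_def] by measurable
  have u1z: "u1 t = 0" if "t \<notin> {0<..<T}" for t using that ub(2) by (simp add: u1_def)
  have const2: "integrable lborel (\<lambda>t. (norm (indicator {0<..<T} t *\<^sub>R (x::'h)))\<^sup>2)" for x
    by (rule square_integrable_bounded[where B = "norm x" and T = T]) (auto simp: indicator_def)
  have u12: "integrable lborel (\<lambda>t. (norm (u1 t))\<^sup>2)"
    unfolding u1_def by (rule square_integrable_diff[OF ub(1) _ ub(4) const2]) measurable
  have cg: "causal g" using g(2) by (simp add: causal_def)
  have rep: "AE t in lborel. t \<in> {0<..<T} \<longrightarrow> u1 t = conv ?k g t"
  proof (rule has_caputo_deriv_imp_conv[OF \<alpha> order_refl D _ g(1) u1z g(2)])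
    show "integrable lborel u1" by (rule integrable_of_square_integrable[OF _ u1z u12]) measurable
    show "integrable lborel g" by (rule integrable_of_square_integrable[OF _ g(2) g(4)]) measurable
    show "AE t in lborel. t \<in> {0<..<T} \<longrightarrow> u t - u0 = u1 t"
      using ub(3) by eventually_elim (simp add: u1_def)
  qed (use g(3) in \<open>simp_all\<close>)
  define W where "W t = u0 + u1 t" for t
  have [measurable]: "W \<in> borel_measurable borel" unfolding W_def[abs_def] by measurable
  have uW: "AE t in lborel. t \<in> {0<..<T} \<longrightarrow> u t = W t"
    using ub(3) by eventually_elim (simp add: u1_def W_def)
  define F where "F t = fb t - indicator {0<..<T} t *\<^sub>R \<Psi> (W t)" for t
  have [measurable]: "F \<in> borel_measurable borel" unfolding F_def[abs_def] by measurable
  have Fz: "F t = 0" if "t \<notin> {0<..<T}" for t using that fb(2) by (simp add: F_def)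
  have PsiW: "norm (\<Psi> (W t)) \<le> norm (\<Psi> u0) + L * norm (u1 t)" for t
  proof -
    have "norm (\<Psi> (W t) - \<Psi> u0) \<le> L * norm (u1 t)"
      using lipschitz_onD[OF lip, of "W t" u0] by (simp add: dist_norm W_def)
    then show ?thesis using norm_triangle_sub[of "\<Psi> (W t)" "\<Psi> u0"] by linarith
  qed
  have F2: "integrable lborel (\<lambda>t. (norm (F t))\<^sup>2)"
    unfolding F_def
  proof (rule square_integrable_diff[OF fb(1) _ fb(4)])
    show "integrable lborel (\<lambda>t. (norm (indicator {0<..<T} t *\<^sub>R \<Psi> (W t)))\<^sup>2)"
    proof (rule Bochner_Integration.integrable_bound)
      show "integrable lborel (\<lambda>t. 2 * (norm (indicator {0<..<T} t *\<^sub>R \<Psi> u0))\<^sup>2 + 2 * L\<^sup>2 * (norm (u1 t))\<^sup>2)"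
        by (intro Bochner_Integration.integrable_add integrable_mult_right const2 u12)
      show "AE t in lborel. norm ((norm (indicator {0<..<T} t *\<^sub>R \<Psi> (W t)))\<^sup>2) \<le> norm (2 * (norm (indicator {0<..<T} t *\<^sub>R \<Psi> u0))\<^sup>2 + 2 * L\<^sup>2 * (norm (u1 t))\<^sup>2)"
      proof (rule AE_I2)
        fix t
        show "norm ((norm (indicator {0<..<T} t *\<^sub>R \<Psi> (W t)))\<^sup>2) \<le> norm (2 * (norm (indicator {0<..<T} t *\<^sub>R \<Psi> u0))\<^sup>2 + 2 * L\<^sup>2 * (norm (u1 t))\<^sup>2)"
        proof (cases "t \<in> {0<..<T}")
          case True
          have "(norm (\<Psi> (W t)))\<^sup>2 \<le> (norm (\<Psi> u0) + L * norm (u1 t))\<^sup>2" by (rule power_mono[OF PsiW]) simp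
          also have "\<dots> \<le> 2 * (norm (\<Psi> u0))\<^sup>2 + 2 * L\<^sup>2 * (norm (u1 t))\<^sup>2"
            using sum_squares_bound[of "norm (\<Psi> u0)" "L * norm (u1 t)"] by (simp add: power2_eq_square algebra_simps)
          finally show ?thesis using True by simp
        qed simp
      qed
    qed measurable
  qed measurable
  define xi where "xi t = F t - g t" for t
  have [measurable]: "xi \<in> borel_measurable borel" unfolding xi_def[abs_def] by measurable
  have xiz: "xi t = 0" if "t \<notin> {0<..<T}" for t using that Fz g(2) by (simp add: xi_def)
  have xi2: "integrable lborel (\<lambda>t. (norm (xi t))\<^sup>2)"
    unfolding xi_def by (rule square_integrable_diff[OF _ _ F2 g(4)]) measurable
  have inc1: "AE t in lborel. t \<in> {0<..<T} \<longrightarrow> xi t \<in> subdiff \<Phi> (W t)"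
    using inc0[unfolded AE_completion_iff] uW fb(3) g(3)
  proof eventually_elim
    case (elim t)
    show ?case
    proof
      assume t: "t \<in> {0<..<T}"
      then obtain x where x: "x \<in> subdiff \<Phi> (W t)" "g t + x + \<Psi> (W t) = fb t" using elim by auto
      then have "x = xi t" using t by (auto simp: xi_def F_def algebra_simps)
      with x show "xi t \<in> subdiff \<Phi> (W t)" by simp
    qed
  qed
  \<comment> \<open>The inclusion makes \<Phi> (W t) finite for almost every t in (0,T); on the
    exceptional null set the default value of \<open>real_of_ereal\<close> does no harm.\<close>
  define y where "y t = real_of_ereal (\<Phi> (W t))" for t
  have [measurable]: "y \<in> borel_measurable borel" unfolding y_def[abs_def] by measurable
  have Phiy: "\<Phi> (W t) = ereal (y t)" if "xi t \<in> subdiff \<Phi> (W t)" for t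
    using subdiff_finite[OF dom bdd that] unfolding y_def by fastforce
  obtain y0 where y0: "\<Phi> u0 = ereal y0"
    using u0 c0[of u0] by (cases "\<Phi> u0") (auto simp: eff_dom_def)
  have A1: "AE t in lborel. t \<in> {0<..<T} \<longrightarrow> y t - y0 \<le> inner (xi t) (W t - u0)"
    using inc1 by eventually_elim (use subdiff_le Phiy y0 in blast)
  have A2: "AE t in lborel. t \<in> {0<..<T} \<longrightarrow> (AE s in lborel. s \<in> {0<..<T} \<longrightarrow> y t - y s \<le> inner (xi t) (W t - W s))"
    using inc1
  proof eventually_elim
    case (elim t)
    show ?case
    proof
      assume t: "t \<in> {0<..<T}"
      show "AE s in lborel. s \<in> {0<..<T} \<longrightarrow> y t - y s \<le> inner (xi t) (W t - W s)"
        using inc1 by eventually_elim (use subdiff_le Phiy elim t in blast)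
    qed
  qed
  have yc: "c0 \<le> y t" if "xi t \<in> subdiff \<Phi> (W t)" for t using c0[of "W t"] Phiy[OF that] by simp
  \<comment> \<open>y lies between c0 and y0 + \<open>inner (xi t) (u1 t)\<close>, and a product of
    two L2 functions is integrable.\<close>
  have yi: "set_integrable lborel {0<..<T} y"
    unfolding set_integrable_def
  proof (rule Bochner_Integration.integrable_bound)
    show "integrable lborel (\<lambda>t. (\<bar>c0\<bar> + \<bar>y0\<bar>) * indicator {0<..<T} t + norm (inner (xi t) (u1 t)))"
      by (intro Bochner_Integration.integrable_add integrable_mult_right integrable_real_indicator integrable_norm
          integrable_inner_of_square_integrable(1)[OF _ _ xi2 u12])
         (use emeasure_bounded_finite[of "{0<..<T}"] in auto)
    show "AE t in lborel. norm (indicator {0<..<T} t *\<^sub>R y t) \<le> norm ((\<bar>c0\<bar> + \<bar>y0\<bar>) * indicator {0<..<T} t + norm (inner (xi t) (u1 t)))"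
      using inc1 A1
    proof eventually_elim
      case (elim t)
      show ?case
      proof (cases "t \<in> {0<..<T}")
        case True
        then have "c0 \<le> y t" "y t - y0 \<le> inner (xi t) (u1 t)" using elim yc by (auto simp: W_def)
        then have "\<bar>y t\<bar> \<le> \<bar>c0\<bar> + \<bar>y0\<bar> + \<bar>inner (xi t) (u1 t)\<bar>" by linarith
        then show ?thesis using True by simp
      qed simp
    qed
  qed measurable
  have Wv: "AE t in lborel. t \<in> {0<..<T} \<longrightarrow> W t = u0 + conv ?k g t"
    using rep by eventually_elim (simp add: W_def)
  have chain: "AE t in lborel. t \<in> {0<..<T} \<longrightarrow> y t - y0 \<le> conv ?k (\<lambda>s. inner (xi s) (g s)) t"
    by (rule frac_chain_inequality[OF \<alpha> g(1) _ _ g(2) xiz g(4) xi2 yi Wv A1 A2]) measurable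
  \<comment> \<open>The Lipschitz bound is taken at u0: |\<Psi> (W t)| \<le> |\<Psi> u0| + L |u1 t|.
    The factor \<open>frac_kernel 1\<close> confines the constant to positive times, where its
    fractional integral up to t is finite.\<close>
  define G where "G t = norm (fb t) + norm (\<Psi> u0) * frac_kernel 1 t" for t
  have [measurable]: "G \<in> borel_measurable borel" unfolding G_def[abs_def] by measurable
  define C0 where "C0 = 2 * Cf + 2 * (norm (\<Psi> u0))\<^sup>2 * frac_kernel (\<alpha> + 1) T"
  have C00: "0 \<le> C0" using fb(5) \<alpha> by (simp add: C0_def frac_kernel_nonneg)
  have "\<exists>C\<ge>0. \<forall>t\<in>{0..T}. nconv ?l (\<lambda>s. ennreal ((norm (g s))\<^sup>2)) t \<le> ennreal C"
  proof (rule frac_energy_estimate[OF \<alpha>(1) T L _ C00 g(1) _ _ cg _ Fz _ g(4) F2])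
    show "0 \<le> max 0 (y0 - c0)" by simp
    show "causal F" using Fz by (simp add: causal_def)
    show "0 \<le> G t" for t by (simp add: G_def frac_kernel_1)
    show "AE t in lborel. t \<in> {0<..<T} \<longrightarrow> - max 0 (y0 - c0) \<le> conv ?k (\<lambda>s. inner (F s - g s) (g s)) t"
      using chain inc1 unfolding xi_def[symmetric]
    proof eventually_elim
      case (elim t)
      show ?case using elim yc[of t] by auto
    qed
    show "AE s in lborel. s \<in> {0<..<T} \<longrightarrow> norm (F s) \<le> G s + L * norm (conv ?k g s)"
      using rep
    proof eventually_elim
      case (elim s)
      show ?case
      proof
        assume s: "s \<in> {0<..<T}"
        have "norm (F s) \<le> norm (fb s) + norm (\<Psi> (W s))"
          using s norm_triangle_ineq4[of "fb s" "\<Psi> (W s)"] by (simp add: F_def)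
        then show "norm (F s) \<le> G s + L * norm (conv ?k g s)"
          using PsiW[of s] elim s by (simp add: G_def frac_kernel_1)
      qed
    qed
    show "nconv ?l (\<lambda>s. ennreal ((G s)\<^sup>2)) t \<le> ennreal C0" if t: "t \<in> {0..T}" for t
    proof -
      have "nconv ?l (\<lambda>s. ennreal ((G s)\<^sup>2)) t
        \<le> nconv ?l (\<lambda>s. ennreal 2 * ennreal ((norm (fb s))\<^sup>2) + ennreal (2 * (norm (\<Psi> u0))\<^sup>2) * ennreal (frac_kernel 1 s)) t"
      proof (rule nconv_mono[OF _ cl])
        fix s
        have "(G s)\<^sup>2 \<le> 2 * (norm (fb s))\<^sup>2 + 2 * (norm (\<Psi> u0))\<^sup>2 * frac_kernel 1 s"
          using sum_squares_bound[of "norm (fb s)" "norm (\<Psi> u0)"]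
          by (cases "0 < s") (simp_all add: G_def frac_kernel_1 power2_sum)
        then have "ennreal ((G s)\<^sup>2) \<le> ennreal (2 * (norm (fb s))\<^sup>2 + 2 * (norm (\<Psi> u0))\<^sup>2 * frac_kernel 1 s)" by (rule ennreal_leI)
        also have "\<dots> = ennreal (2 * (norm (fb s))\<^sup>2) + ennreal (2 * (norm (\<Psi> u0))\<^sup>2 * frac_kernel 1 s)"
          by (rule ennreal_plus) (simp_all add: frac_kernel_nonneg)
        also have "ennreal (2 * (norm (fb s))\<^sup>2) = ennreal 2 * ennreal ((norm (fb s))\<^sup>2)" by (rule ennreal_mult) auto
        also have "ennreal (2 * (norm (\<Psi> u0))\<^sup>2 * frac_kernel 1 s) = ennreal (2 * (norm (\<Psi> u0))\<^sup>2) * ennreal (frac_kernel 1 s)"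
          by (rule ennreal_mult) (simp_all add: frac_kernel_nonneg)
        finally show "ennreal ((G s)\<^sup>2) \<le> ennreal 2 * ennreal ((norm (fb s))\<^sup>2) + ennreal (2 * (norm (\<Psi> u0))\<^sup>2) * ennreal (frac_kernel 1 s)" .
      qed
      also have "\<dots> = ennreal 2 * nconv ?l (\<lambda>s. ennreal ((norm (fb s))\<^sup>2)) t + ennreal (2 * (norm (\<Psi> u0))\<^sup>2) * nconv ?l (\<lambda>s. ennreal (frac_kernel 1 s)) t"
        by (subst nconv_add; measurable?) (simp only: nconv_cmult[OF _ measurable_compose[OF _ measurable_ennreal]] nconv_cmult frac_kernel_measurable measurable_compose[OF frac_kernel_measurable measurable_ennreal] | simp add: nconv_cmult)+
      also have "nconv ?l (\<lambda>s. ennreal (frac_kernel 1 s)) t = ennreal (frac_kernel (\<alpha> + 1) t)"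
        by (rule nconv_frac_kernel) (use \<alpha> in auto)
      also have "ennreal 2 * nconv ?l (\<lambda>s. ennreal ((norm (fb s))\<^sup>2)) t + ennreal (2 * (norm (\<Psi> u0))\<^sup>2) * ennreal (frac_kernel (\<alpha> + 1) t)
        \<le> ennreal 2 * ennreal Cf + ennreal (2 * (norm (\<Psi> u0))\<^sup>2) * ennreal (frac_kernel (\<alpha> + 1) T)"
      proof (intro add_mono mult_left_mono fb(6) t ennreal_leI)
        show "frac_kernel (\<alpha> + 1) t \<le> frac_kernel (\<alpha> + 1) T"
          using t T \<alpha> Gamma_real_pos[of "\<alpha> + 1"] by (auto simp: frac_kernel_def intro!: divide_right_mono powr_mono2)
      qed auto
      also have "\<dots> = ennreal C0"
      proof -
        have "ennreal 2 * ennreal Cf = ennreal (2 * Cf)" by (rule ennreal_mult[symmetric]) (use fb(5) in auto)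
        moreover have "ennreal (2 * (norm (\<Psi> u0))\<^sup>2) * ennreal (frac_kernel (\<alpha> + 1) T) = ennreal (2 * (norm (\<Psi> u0))\<^sup>2 * frac_kernel (\<alpha> + 1) T)"
          by (rule ennreal_mult[symmetric]) (use \<alpha> in \<open>auto simp: frac_kernel_nonneg\<close>)
        moreover have "ennreal (2 * Cf) + ennreal (2 * (norm (\<Psi> u0))\<^sup>2 * frac_kernel (\<alpha> + 1) T) = ennreal C0"
          unfolding C0_def by (rule ennreal_plus[symmetric]) (use fb(5) \<alpha> in \<open>auto simp: frac_kernel_nonneg\<close>)
        ultimately show ?thesis by simp
      qed
      finally show ?thesis .
    qed
  qed measurable
  then obtain C where C: "0 \<le> C" "\<And>t. t \<in> {0..T} \<Longrightarrow> nconv ?l (\<lambda>s. ennreal ((norm (g s))\<^sup>2)) t \<le> ennreal C" by blast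
  have R1: "AE t in lborel. t \<in> {0<..<T} \<longrightarrow> u0 + conv ?k g t = u t"
    using uW Wv by eventually_elim simp
  have R2: "AE t in lborel. t \<in> {0<..<T} \<longrightarrow> (\<exists>\<xi>\<in>subdiff \<Phi> (u0 + conv ?k g t). g t + \<xi> + \<Psi> (u0 + conv ?k g t) = f t)"
    using inc0[unfolded AE_completion_iff] R1 g(3) by eventually_elim auto
  from that[OF g(1) g(2) g(4) C R1 R2] show thesis by blast
qed

section \<open>The error estimate\<close>

text \<open>A form of \<open>pc_interpolant\<close> without description operator: measurable by
  construction, and for a partition equal to zero off (0,T], where \<open>part_index\<close> is
  unspecified.\<close>

definition step_function :: "nat \<Rightarrow> (nat \<Rightarrow> real) \<Rightarrow> (nat \<Rightarrow> 'b::real_vector) \<Rightarrow> real \<Rightarrow> 'b" where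
  "step_function N P W t = (\<Sum>n\<in>{1..N}. indicator {P (n - 1)<..P n} t *\<^sub>R W n)"

lemma step_function_measurable [measurable]:
  fixes W :: "nat \<Rightarrow> 'b::{second_countable_topology, real_normed_vector}"
  shows "step_function N P W \<in> borel_measurable borel"
  unfolding step_function_def[abs_def] by measurable

lemma norm_step_function_le:
  fixes W :: "nat \<Rightarrow> 'b::real_normed_vector"
  shows "norm (step_function N P W t) \<le> (\<Sum>n\<in>{1..N}. norm (W n))"
proof -
  have "norm (step_function N P W t) \<le> (\<Sum>n\<in>{1..N}. norm (indicator {P (n - 1)<..P n} t *\<^sub>R W n))"
    unfolding step_function_def by (rule norm_sum)
  also have "\<dots> \<le> (\<Sum>n\<in>{1..N}. norm (W n))"
    by (rule sum_mono) (simp add: indicator_def)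
  finally show ?thesis .
qed

lemma partition_mono:
  assumes "is_partition T N P" "i \<le> j" "j \<le> N"
  shows "P i \<le> P j"
  using assms(2,3)
proof (induction rule: dec_induct)
  case (step n)
  then have "n < N" "P i \<le> P n" by simp_all
  moreover have "P n < P (Suc n)" using assms(1) \<open>n < N\<close> by (simp add: is_partition_def)
  ultimately show ?case by linarith
qed simp

lemma pc_interpolant_eq:
  fixes W :: "nat \<Rightarrow> 'b::real_vector"
  assumes P: "is_partition T N P" and t: "0 < t" "t \<le> T"
  shows "part_index N P t \<in> {1..N}" and "pc_interpolant N P W t = step_function N P W t"
proof -
  \<comment> \<open>The index is that of the first node not before t: minimality puts the preceding
    node strictly before t, and monotonicity of the nodes gives uniqueness.\<close>
  define n where "n = (LEAST n. t \<le> P n)"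
  have PN: "t \<le> P N" and P0: "P 0 = 0" using P t by (simp_all add: is_partition_def)
  have n1: "t \<le> P n" unfolding n_def by (rule LeastI[of _ N]) (rule PN)
  have nN: "n \<le> N" unfolding n_def by (rule Least_le) (rule PN)
  have n0: "0 < n" using n1 P0 t by (cases n) auto
  have "n - 1 < (LEAST n. t \<le> P n)" using n0 by (simp only: n_def)
  then have "\<not> t \<le> P (n - 1)" by (rule not_less_Least)
  then have n2: "P (n - 1) < t" by simp
  have uniq: "m = n" if m: "m \<in> {1..N}" "P (m - 1) < t" "t \<le> P m" for m
  proof (rule ccontr)
    assume "m \<noteq> n"
    then consider "m \<le> n - 1" | "n \<le> m - 1" by linarith
    then show False
    proof cases
      case 1
      then have "P m \<le> P (n - 1)" by (rule partition_mono[OF P]) (use nN in simp)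
      then show False using m n2 by simp
    next
      case 2
      then have "P n \<le> P (m - 1)" by (rule partition_mono[OF P]) (use m(1) in \<open>simp, linarith\<close>)
      then show False using m n1 by simp
    qed
  qed
  have idx: "part_index N P t = n"
    unfolding part_index_def
  proof (rule the_equality)
    show "n \<in> {1..N} \<and> P (n - 1) < t \<and> t \<le> P n" using n0 nN n1 n2 by simp
  next
    fix m assume "m \<in> {1..N} \<and> P (m - 1) < t \<and> t \<le> P m"
    then show "m = n" by (elim conjE) (rule uniq)
  qed
  show "part_index N P t \<in> {1..N}" unfolding idx using n0 nN by simp
  have "step_function N P W t = (\<Sum>m\<in>{1..N}. if m = n then W n else 0)"
    unfolding step_function_def
  proof (rule sum.cong[OF refl])
    fix m assume m: "m \<in> {1..N}"
    show "indicator {P (m - 1)<..P m} t *\<^sub>R W m = (if m = n then W n else 0)"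
    proof (cases "m = n")
      case True
      have "t \<in> {P (n - 1)<..P n}" using n1 n2 by (simp only: greaterThanAtMost_iff)
      then show ?thesis unfolding True by simp
    next
      case False
      then have "t \<notin> {P (m - 1)<..P m}" using uniq[OF m] by (metis greaterThanAtMost_iff)
      then show ?thesis using False by simp
    qed
  qed
  also have "\<dots> = W n" using n0 nN by (simp only: sum.delta[OF finite_atLeastAtMost]) simp
  finally show "pc_interpolant N P W t = step_function N P W t" by (simp only: pc_interpolant_def idx)
qed

lemma step_function_outside:
  assumes P: "is_partition T N P" and t: "t \<notin> {0<..T}"
  shows "step_function N P W t = 0"
  unfolding step_function_def
proof (rule sum.neutral, rule ballI)
  fix n assume n: "n \<in> {1..N}"
  have "P 0 \<le> P (n - 1)" by (rule partition_mono[OF P]) (use n in \<open>simp_all, linarith\<close>)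
  moreover have "P n \<le> P N" by (rule partition_mono[OF P]) (use n in simp_all)
  moreover have "P 0 = 0" "P N = T" using P by (simp_all add: is_partition_def)
  ultimately have "t \<notin> {P (n - 1)<..P n}" using t by auto
  then show "indicator {P (n - 1)<..P n} t *\<^sub>R W n = 0" by simp
qed

lemma mittag_leffler_ge_1:
  assumes "0 < \<alpha>" "0 \<le> z"
  shows "1 \<le> mittag_leffler \<alpha> z"
proof -
  have "(\<Sum>k\<in>{0}. z ^ k / Gamma (\<alpha> * real k + 1)) \<le> mittag_leffler \<alpha> z"
    unfolding mittag_leffler_def
  proof (rule sum_le_suminf[OF summable_mittag_leffler[OF assms(1)]])
    fix k :: nat
    have "0 < Gamma (\<alpha> * real k + 1)" using assms(1) by (intro Gamma_real_pos) (simp add: add_nonneg_pos)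
    then show "0 \<le> z ^ k / Gamma (\<alpha> * real k + 1)" using assms(2) by simp
  qed simp
  then show ?thesis by simp
qed

lemma conv_frac_kernel_0:
  assumes "\<And>t. t \<le> 0 \<Longrightarrow> g t = 0"
  shows "conv (frac_kernel a) g 0 = 0"
proof -
  have "frac_kernel a (0 - s) *\<^sub>R g s = 0" for s using assms[of s] by (simp add: frac_kernel_def)
  then show ?thesis unfolding conv_def by (simp only: integral_zero)
qed

text \<open>Convexity of half the squared norm, whose gradient at a is a itself; it brings the
  squared error within the scope of the chain inequality.\<close>

lemma half_norm_square_diff_le:
  fixes a b :: "'h::real_inner"
  shows "(norm a)\<^sup>2 / 2 - (norm b)\<^sup>2 / 2 \<le> inner a (a - b)"
proof -
  have "0 \<le> (norm (a - b))\<^sup>2" by simp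
  then have "0 \<le> inner (a - b) (a - b)" by (simp add: power2_norm_eq_inner)
  then show ?thesis by (simp add: power2_norm_eq_inner inner_diff_left inner_diff_right inner_commute)
qed

lemma nn_set_integral_le_Lp_frac_enorm:
  assumes "t \<in> {0..T}"
  shows "(\<integral>\<^sup>+s\<in>{0..t}. (ennreal ((t - s) powr (\<alpha> - 1)) * m s) \<partial>lebesgue) \<le> Lp_frac_enorm \<alpha> T 1 m"
proof -
  have "ennpowr (\<integral>\<^sup>+s\<in>{0..t}. (ennreal ((t - s) powr (\<alpha> - 1)) * ennpowr (m s) 1) \<partial>lebesgue) (1 / 1) \<le> Lp_frac_enorm \<alpha> T 1 m"
    unfolding Lp_frac_enorm_def using assms by (rule SUP_upper)
  then show ?thesis by simp
qed

theorem theorem6p3: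
  fixes \<Phi> :: "'h::{real_inner, banach, second_countable_topology} \<Rightarrow> ereal"
    and \<Psi> :: "'h \<Rightarrow> 'h" and f u :: "real \<Rightarrow> 'h" and u0 U0 :: 'h
    and \<alpha> T L :: real and N :: nat and P :: "nat \<Rightarrow> real" and U :: "nat \<Rightarrow> 'h"
  assumes "0 < T" and "0 < \<alpha>" and "\<alpha> < 1"
    and "convex_ereal \<Phi>" and "lower_semicontinuous \<Phi>" and "eff_dom \<Phi> \<noteq> {}"
    and "bounded_from_below \<Phi>"
    and "0 < L" and "L-lipschitz_on UNIV \<Psi>"
    and "u0 \<in> eff_dom \<Phi>" and "f \<in> Lp_frac \<alpha> T 2"
    and "energy_solution \<alpha> T \<Phi> \<Psi> f u0 u"
    and "is_partition T N P" and "L * max_step N P powr \<alpha> < Gamma (\<alpha> + 1)"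
    and "U0 \<in> eff_dom \<Phi>" and "discrete_solution \<alpha> N P \<Phi> \<Psi> f U0 U"
  shows "\<exists>v. continuous_on {0..T} v \<and> v 0 = u0 \<and>
    (AE t in lebesgue. t \<in> {0<..<T} \<longrightarrow> v t = u t) \<and>
    total_error \<alpha> T N P \<Phi> U v \<le>
      ennpowr (ennreal ((norm (u0 - U0))\<^sup>2) + ennreal (2 / Gamma \<alpha>) *
          Lp_frac_enorm \<alpha> T 1 (\<lambda>t. e2ennreal \<bar>estimator \<alpha> T N P \<Phi> \<Psi> f U t\<bar>)) (1 / 2)
        * ennpowr (ennreal (mittag_leffler \<alpha> (2 * L * T powr \<alpha>))) (1 / 2)
      + ennreal (2 / Gamma \<alpha>) *
        (Lp_frac_norm \<alpha> T 1 (\<lambda>t. f t - pc_interpolant N P (cell_average P f) t)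
         + ennreal L * Lp_frac_norm \<alpha> T 1
             (\<lambda>t. pc_interpolant N P U t - frac_interpolant \<alpha> N P U t))
        * ennreal (mittag_leffler \<alpha> (2 * L * T powr \<alpha>))"
proof -
  let ?k = "frac_kernel \<alpha>" and ?l = "\<lambda>x. ennreal (frac_kernel \<alpha> x)"
  note T = assms(1) and \<alpha> = assms(2,3) and P = assms(13)
  have L: "0 \<le> L" using assms(8) by simp
  have \<alpha>1: "\<alpha> \<le> 1" using \<alpha> by simp
  have G: "0 < Gamma \<alpha>" using \<alpha>(1) by (rule Gamma_real_pos)
  have cl: "causal ?l" by (simp add: causal_def frac_kernel_def)
  have k0: "0 \<le> ?k x" for x using \<alpha> by (simp add: frac_kernel_nonneg)
  have el: "enorm ?k = ?l" using k0 by (simp add: fun_eq_iff)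
  have [measurable]: "\<Phi> \<in> borel_measurable borel" using assms(5) by (rule lower_semicontinuous_borel)
  have [measurable]: "\<Psi> \<in> borel_measurable borel"
    using assms(9) by (intro borel_measurable_continuous_onI lipschitz_on_continuous_on)
  obtain c0 where c0: "\<And>w. ereal c0 \<le> \<Phi> w" using assms(7) by (auto simp: bounded_from_below_def)
  obtain g Cg where g: "g \<in> borel_measurable borel" "\<And>t. t \<notin> {0<..<T} \<Longrightarrow> g t = 0"
    "integrable lborel (\<lambda>t. (norm (g t))\<^sup>2)" "0 \<le> Cg"
    "\<And>t. t \<in> {0..T} \<Longrightarrow> nconv ?l (\<lambda>s. ennreal ((norm (g s))\<^sup>2)) t \<le> ennreal Cg"
    and vu: "AE t in lborel. t \<in> {0<..<T} \<longrightarrow> u0 + conv ?k g t = u t"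
    and inc: "AE t in lborel. t \<in> {0<..<T} \<longrightarrow> (\<exists>\<xi>\<in>subdiff \<Phi> (u0 + conv ?k g t).
        g t + \<xi> + \<Psi> (u0 + conv ?k g t) = f t)"
    by (rule energy_solution_regularity[OF T \<alpha> assms(5,6,7,9,10,11,12)]) blast
  obtain fb where fb: "fb \<in> borel_measurable borel" "AE t in lborel. t \<in> {0<..<T} \<longrightarrow> f t = fb t"
    by (rule Lp_frac_2_ex_borel[OF \<alpha> T assms(11)]) blast
  note [measurable] = g(1) fb(1)
  have cg: "causal g" using g(2) by (simp add: causal_def)
  \<comment> \<open>The continuous representative of u, defined at every time; it is the witness for
    which the pointwise error is estimated.\<close>
  define v where "v t = u0 + conv ?k g t" for t
  have [measurable]: "v \<in> borel_measurable borel" unfolding v_def[abs_def] by measurable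
  note vcont = continuous_on_conv_frac_kernel[OF g(1) cg \<alpha>(1) \<alpha>1 g(5)]
  have contv: "continuous_on {0..T} v" unfolding v_def[abs_def] by (intro continuous_on_add continuous_on_const vcont(1))
  have v0: "v 0 = u0" using conv_frac_kernel_0[of g] g(2) by (simp add: v_def)
  define Vd where "Vd = pc_interpolant N P (discrete_caputo \<alpha> N P U)"
  define Vs where "Vs = step_function N P (discrete_caputo \<alpha> N P U)"
  define Us where "Us = step_function N P U"
  define Fs where "Fs = step_function N P (cell_average P f)"
  have [measurable]: "Vs \<in> borel_measurable borel" "Us \<in> borel_measurable borel" "Fs \<in> borel_measurable borel"
    unfolding Vs_def Us_def Fs_def by measurable
  have Vd: "Vd t = Vs t" and Ud: "pc_interpolant N P U t = Us t" and Fd: "pc_interpolant N P (cell_average P f) t = Fs t"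
    if "0 < t" "t \<le> T" for t
    unfolding Vd_def Vs_def Us_def Fs_def by (rule pc_interpolant_eq(2)[OF P that])+
  \<comment> \<open>The discrete derivative is cut to the open interval. The value at T that is lost
    affects no fractional integral.\<close>
  define V1 where "V1 t = indicator {0<..<T} t *\<^sub>R Vs t" for t
  have [measurable]: "V1 \<in> borel_measurable borel" unfolding V1_def[abs_def] by measurable
  have V1z: "V1 t = 0" if "t \<notin> {0<..<T}" for t using that by (simp add: V1_def)
  have cV: "causal V1" using V1z by (simp add: causal_def)
  define MV where "MV = (\<Sum>n\<in>{1..N}. norm (discrete_caputo \<alpha> N P U n))"
  have MV: "norm (V1 t) \<le> MV" for t
  proof -
    have "norm (Vs t) \<le> MV" unfolding Vs_def MV_def by (rule norm_step_function_le)
    moreover have "norm (V1 t) \<le> norm (Vs t)" by (simp add: V1_def indicator_def)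
    ultimately show ?thesis by simp
  qed
  have U0: "U 0 = U0" using assms(16) by (simp add: discrete_solution_def)
  define Uh where "Uh t = U0 + conv ?k V1 t" for t
  have [measurable]: "Uh \<in> borel_measurable borel" unfolding Uh_def[abs_def] by measurable
  have Uhat: "frac_interpolant \<alpha> N P U t = Uh t" if t: "t \<in> {0..T}" for t
  proof -
    have Vs0: "Vs 0 = 0" unfolding Vs_def by (rule step_function_outside[OF P]) simp
    have "(1 / Gamma \<alpha>) *\<^sub>R (LINT s:{0..t}|lebesgue. (t - s) powr (\<alpha> - 1) *\<^sub>R Vd s) = conv ?k V1 t"
    proof (rule set_integral_frac_kernel[OF \<alpha>(1) _ cV])
      show "AE s in lborel. s \<in> {0<..<t} \<longrightarrow> Vd s = V1 s"
        by (rule AE_I2) (use Vd t in \<open>simp add: V1_def\<close>)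
      \<comment> \<open>At 0 the partition index is unspecified, so \<open>Vd 0\<close> is an
        unknown vector; measurability is seen by treating it as a one-point correction.\<close>
      have "(\<lambda>s. indicator {0..t} s *\<^sub>R Vd s) = (\<lambda>s. indicator {0..t} s *\<^sub>R (Vs s + indicator {0} s *\<^sub>R Vd 0))"
      proof
        fix s
        consider "s \<notin> {0..t}" | "s = 0" | "0 < s" "s \<le> t" by force
        then show "indicator {0..t} s *\<^sub>R Vd s = indicator {0..t} s *\<^sub>R (Vs s + indicator {0} s *\<^sub>R Vd 0)"
          by cases (use Vd[of s] Vs0 t in auto)
      qed
      moreover have "(\<lambda>s. indicator {0..t} s *\<^sub>R (Vs s + indicator {0} s *\<^sub>R Vd 0)) \<in> borel_measurable lebesgue"
        by (rule measurable_completion) measurable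
      ultimately show "(\<lambda>s. indicator {0..t} s *\<^sub>R Vd s) \<in> borel_measurable lebesgue" by simp
    qed measurable
    then show ?thesis by (simp add: frac_interpolant_def Uh_def U0 Vd_def)
  qed
  define Uf where "Uf = frac_interpolant \<alpha> N P U"
  have Uf: "Uf t = Uh t" if "t \<in> {0..T}" for t using Uhat[OF that] by (simp add: Uf_def)
  have Uf0: "Uf 0 = U0"
    using Uf[of 0] T conv_frac_kernel_0[of V1] V1z by (simp add: Uh_def)
  have hc: "has_caputo_deriv \<alpha> T Uf (Uf 0) Vd"
  proof (rule has_caputo_deriv_conv[OF \<alpha> _ cV MV])
    show "Uf t = Uf 0 + conv ?k V1 t" if "t \<in> {0..T}" for t
      using that Uf[of t] by (simp add: Uf0 Uh_def)
    show "Vd t = V1 t" if "t \<in> {0<..<T}" for t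
      using that Vd[of t] by (simp add: V1_def)
  qed simp_all
  \<comment> \<open>Existence makes the choice operator return some Caputo derivative, and
    uniqueness identifies it with \<open>Vd\<close> almost everywhere.\<close>
  have "has_caputo_deriv \<alpha> T Uf (Uf 0) (caputo_deriv \<alpha> T Uf (Uf 0))"
    unfolding caputo_deriv_def by (rule someI[of _ Vd]) (rule hc)
  then have cd: "AE t in lborel. t \<in> {0<..<T} \<longrightarrow> caputo_deriv \<alpha> T Uf (Uf 0) t = Vd t"
    by (rule has_caputo_deriv_unique[OF \<alpha> _ hc])
  have zeta: "Fs t - V1 t - \<Psi> (Us t) \<in> subdiff \<Phi> (Us t)" if t: "t \<in> {0<..<T}" for t
  proof -
    have i: "part_index N P t \<in> {1..N}" by (rule pc_interpolant_eq(1)[OF P]) (use t in auto)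
    have t': "0 < t" "t \<le> T" using t by auto
    have "V1 t = Vd t" using t Vd[OF t'] by (simp add: V1_def)
    then show ?thesis unfolding Fd[OF t', symmetric] Ud[OF t', symmetric]
      using assms(16) i by (simp add: discrete_solution_def pc_interpolant_def Vd_def)
  qed
  define h where "h t = g t - V1 t" for t
  have [measurable]: "h \<in> borel_measurable borel" unfolding h_def[abs_def] by measurable
  have hz: "h t = 0" if "t \<notin> {0<..<T}" for t using that g(2) V1z by (simp add: h_def)
  have ch: "causal h" using hz by (simp add: causal_def)
  have h2: "integrable lborel (\<lambda>t. (norm (h t))\<^sup>2)"
    unfolding h_def by (rule square_integrable_diff[OF _ _ g(3) square_integrable_bounded[OF _ V1z MV]]) measurable
  \<comment> \<open>Here g contributes 2 Cg, and the step function, bounded by \<open>MV\<close>,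
    contributes 2 MV^2 times the integrated kernel.\<close>
  define Ch where "Ch = 2 * Cg + 2 * MV\<^sup>2 * frac_kernel (\<alpha> + 1) T"
  have Ch0: "0 \<le> Ch" using g(4) \<alpha> by (simp add: Ch_def frac_kernel_nonneg)
  have Ch: "nconv ?l (\<lambda>s. ennreal ((norm (h s))\<^sup>2)) t \<le> ennreal Ch" if t: "t \<in> {0..T}" for t
  proof -
    have "nconv ?l (\<lambda>s. ennreal ((norm (h s))\<^sup>2)) t
      \<le> nconv ?l (\<lambda>s. ennreal 2 * ennreal ((norm (g s))\<^sup>2) + ennreal (2 * MV\<^sup>2) * ennreal (frac_kernel 1 s)) t"
    proof (rule nconv_mono[OF _ cl])
      fix s
      have "(norm (h s))\<^sup>2 \<le> 2 * (norm (g s))\<^sup>2 + 2 * MV\<^sup>2 * frac_kernel 1 s"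
      proof (cases "0 < s")
        case True
        have "norm (h s) \<le> norm (g s) + MV"
          using norm_triangle_ineq4[of "g s" "V1 s"] MV[of s] by (simp add: h_def)
        then have "(norm (h s))\<^sup>2 \<le> (norm (g s) + MV)\<^sup>2" by (rule power_mono) simp
        also have "\<dots> \<le> 2 * (norm (g s))\<^sup>2 + 2 * MV\<^sup>2"
          using sum_squares_bound[of "norm (g s)" MV] by (simp add: power2_sum)
        finally show ?thesis using True by (simp add: frac_kernel_1)
      qed (simp add: hz frac_kernel_1)
      then have "ennreal ((norm (h s))\<^sup>2) \<le> ennreal (2 * (norm (g s))\<^sup>2 + 2 * MV\<^sup>2 * frac_kernel 1 s)" by (rule ennreal_leI)
      also have "\<dots> = ennreal (2 * (norm (g s))\<^sup>2) + ennreal (2 * MV\<^sup>2 * frac_kernel 1 s)"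
        by (rule ennreal_plus) (simp_all add: frac_kernel_nonneg)
      also have "ennreal (2 * (norm (g s))\<^sup>2) = ennreal 2 * ennreal ((norm (g s))\<^sup>2)" by (rule ennreal_mult) auto
      also have "ennreal (2 * MV\<^sup>2 * frac_kernel 1 s) = ennreal (2 * MV\<^sup>2) * ennreal (frac_kernel 1 s)"
        by (rule ennreal_mult) (simp_all add: frac_kernel_nonneg)
      finally show "ennreal ((norm (h s))\<^sup>2) \<le> ennreal 2 * ennreal ((norm (g s))\<^sup>2) + ennreal (2 * MV\<^sup>2) * ennreal (frac_kernel 1 s)" .
    qed
    also have "\<dots> = nconv ?l (\<lambda>s. ennreal 2 * ennreal ((norm (g s))\<^sup>2)) t + nconv ?l (\<lambda>s. ennreal (2 * MV\<^sup>2) * ennreal (frac_kernel 1 s)) t"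
      by (rule nconv_add) measurable
    also have "nconv ?l (\<lambda>s. ennreal 2 * ennreal ((norm (g s))\<^sup>2)) t = ennreal 2 * nconv ?l (\<lambda>s. ennreal ((norm (g s))\<^sup>2)) t"
      by (rule nconv_cmult) measurable
    also have "nconv ?l (\<lambda>s. ennreal (2 * MV\<^sup>2) * ennreal (frac_kernel 1 s)) t = ennreal (2 * MV\<^sup>2) * nconv ?l (\<lambda>s. ennreal (frac_kernel 1 s)) t"
      by (rule nconv_cmult) measurable
    also have "nconv ?l (\<lambda>s. ennreal (frac_kernel 1 s)) t = ennreal (frac_kernel (\<alpha> + 1) t)"
      by (rule nconv_frac_kernel) (use \<alpha> in auto)
    also have "ennreal 2 * nconv ?l (\<lambda>s. ennreal ((norm (g s))\<^sup>2)) t + ennreal (2 * MV\<^sup>2) * ennreal (frac_kernel (\<alpha> + 1) t)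
      \<le> ennreal 2 * ennreal Cg + ennreal (2 * MV\<^sup>2) * ennreal (frac_kernel (\<alpha> + 1) T)"
    proof (intro add_mono mult_left_mono g(5) t ennreal_leI)
      show "frac_kernel (\<alpha> + 1) t \<le> frac_kernel (\<alpha> + 1) T"
        using t T \<alpha> Gamma_real_pos[of "\<alpha> + 1"] by (auto simp: frac_kernel_def intro!: divide_right_mono powr_mono2)
    qed auto
    also have "ennreal 2 * ennreal Cg = ennreal (2 * Cg)" by (rule ennreal_mult[symmetric]) (use g(4) in auto)
    also have "ennreal (2 * MV\<^sup>2) * ennreal (frac_kernel (\<alpha> + 1) T) = ennreal (2 * MV\<^sup>2 * frac_kernel (\<alpha> + 1) T)"
      by (rule ennreal_mult[symmetric]) (use \<alpha> in \<open>auto simp: frac_kernel_nonneg\<close>)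
    also have "ennreal (2 * Cg) + ennreal (2 * MV\<^sup>2 * frac_kernel (\<alpha> + 1) T) = ennreal Ch"
      unfolding Ch_def by (rule ennreal_plus[symmetric]) (use g(4) \<alpha> in \<open>auto simp: frac_kernel_nonneg\<close>)
    finally show ?thesis .
  qed
  \<comment> \<open>The error as a fractional integral of h; the weighted bound on h makes it
    continuous.\<close>
  define w where "w t = (u0 - U0) + conv ?k h t" for t
  have [measurable]: "w \<in> borel_measurable borel" unfolding w_def[abs_def] by measurable
  have wv: "w t = v t - Uh t" if t: "t \<in> {0..T}" for t
  proof -
    have i1: "integrable lborel (\<lambda>s. ?k (t - s) *\<^sub>R g s)"
      by (rule conv_integrable) (use vcont(2)[OF _ t] k0 in simp_all)
    have "nconv (enorm ?k) (enorm V1) t < \<infinity>"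
      using conv_frac_kernel_bounded_finite[OF \<alpha>(1) _ cV MV, of t] by (auto intro: le_less_trans)
    then have i2: "integrable lborel (\<lambda>s. ?k (t - s) *\<^sub>R V1 s)" by (intro conv_integrable) simp_all
    have "conv ?k h t = conv ?k g t - conv ?k V1 t" unfolding h_def[abs_def] by (rule conv_diff[OF i1 i2])
    then show ?thesis by (simp add: w_def v_def Uh_def)
  qed
  have contw: "continuous_on {0..T} w"
    unfolding w_def[abs_def]
    by (intro continuous_on_add continuous_on_const continuous_on_conv_frac_kernel(1)[OF _ ch \<alpha>(1) \<alpha>1 Ch]) simp_all
  have "bounded (w ` {0..T})" by (intro compact_imp_bounded compact_continuous_image contw) simp
  then obtain e where "\<forall>y\<in>w ` {0..T}. norm y \<le> e" unfolding bounded_iff by blast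
  then have e: "norm (w t) \<le> e" if "t \<in> {0..T}" for t using that by blast
  have e0: "0 \<le> e" using e[of 0] T by (auto intro: order_trans[OF norm_ge_zero])
  \<comment> \<open>The gradient of half the squared norm along w, cut to (0,T) as the chain
    inequality requires.\<close>
  define xi where "xi t = indicator {0<..<T} t *\<^sub>R w t" for t
  have [measurable]: "xi \<in> borel_measurable borel" unfolding xi_def[abs_def] by measurable
  have xiz: "xi t = 0" if "t \<notin> {0<..<T}" for t using that by (simp add: xi_def)
  have xib: "norm (xi t) \<le> e" for t using e[of t] e0 by (cases "t \<in> {0<..<T}") (auto simp: xi_def)
  have xi2: "integrable lborel (\<lambda>t. (norm (xi t))\<^sup>2)"
    by (rule square_integrable_bounded[OF _ xiz xib]) simp_all
  define x where "x s = inner (xi s) (h s)" for s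
  have [measurable]: "x \<in> borel_measurable borel" unfolding x_def[abs_def] by measurable
  have xz: "x t = 0" if "t \<notin> {0<..<T}" for t using that by (simp add: x_def xiz)
  have cx: "causal x" using xz by (simp add: causal_def)
  \<comment> \<open>Boundedness of w transfers the weighted bound from h to the inner product. Its
    fractional integral is thus continuous, and the chain inequality may be evaluated at every
    t.\<close>
  have Cx: "nconv ?l (\<lambda>s. ennreal ((norm (x s))\<^sup>2)) t \<le> ennreal (e\<^sup>2 * Ch)" if t: "t \<in> {0..T}" for t
  proof -
    have "nconv ?l (\<lambda>s. ennreal ((norm (x s))\<^sup>2)) t \<le> nconv ?l (\<lambda>s. ennreal (e\<^sup>2) * ennreal ((norm (h s))\<^sup>2)) t"
    proof (rule nconv_mono[OF _ cl])
      fix s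
      have "norm (x s) \<le> norm (xi s) * norm (h s)" unfolding x_def real_norm_def by (rule Cauchy_Schwarz_ineq2)
      also have "\<dots> \<le> e * norm (h s)" by (rule mult_right_mono[OF xib]) simp
      finally have "(norm (x s))\<^sup>2 \<le> (e * norm (h s))\<^sup>2" by (rule power_mono) simp
      then have "ennreal ((norm (x s))\<^sup>2) \<le> ennreal (e\<^sup>2 * (norm (h s))\<^sup>2)" by (simp only: power_mult_distrib ennreal_leI)
      also have "\<dots> = ennreal (e\<^sup>2) * ennreal ((norm (h s))\<^sup>2)" by (rule ennreal_mult) auto
      finally show "ennreal ((norm (x s))\<^sup>2) \<le> ennreal (e\<^sup>2) * ennreal ((norm (h s))\<^sup>2)" .
    qed
    also have "\<dots> = ennreal (e\<^sup>2) * nconv ?l (\<lambda>s. ennreal ((norm (h s))\<^sup>2)) t" by (rule nconv_cmult) measurable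
    also have "\<dots> \<le> ennreal (e\<^sup>2) * ennreal Ch" by (intro mult_left_mono Ch t) simp
    also have "\<dots> = ennreal (e\<^sup>2 * Ch)" by (rule ennreal_mult[symmetric]) (use Ch0 in auto)
    finally show ?thesis .
  qed
  note xcont = continuous_on_conv_frac_kernel[OF _ cx \<alpha>(1) \<alpha>1 Cx]
  have hw: "(norm (w t))\<^sup>2 / 2 - (norm b)\<^sup>2 / 2 \<le> inner (xi t) (w t - b)" if t: "t \<in> {0<..<T}" for t b
  proof -
    have "xi t = w t" using t by (simp add: xi_def)
    then show ?thesis by (simp only: half_norm_square_diff_le)
  qed
  have chain: "AE t in lborel. t \<in> {0<..<T} \<longrightarrow> (norm (w t))\<^sup>2 / 2 - (norm (u0 - U0))\<^sup>2 / 2 \<le> conv ?k (\<lambda>s. inner (xi s) (h s)) t"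
  proof (rule frac_chain_inequality[where W = w and ?w0.0 = "u0 - U0", OF \<alpha> _ _ _ hz xiz h2 xi2])
    have "integrable lborel (\<lambda>t. (norm (xi t))\<^sup>2 / 2)" using xi2 by simp
    moreover have "(\<lambda>t. (norm (xi t))\<^sup>2 / 2) = (\<lambda>t. indicator {0<..<T} t *\<^sub>R ((norm (w t))\<^sup>2 / 2))"
      by (auto simp: xi_def indicator_def fun_eq_iff)
    ultimately show "set_integrable lborel {0<..<T} (\<lambda>t. (norm (w t))\<^sup>2 / 2)" by (simp add: set_integrable_def)
    show "AE t in lborel. t \<in> {0<..<T} \<longrightarrow> w t = u0 - U0 + conv ?k h t" by (simp add: w_def)
    show "AE t in lborel. t \<in> {0<..<T} \<longrightarrow> (norm (w t))\<^sup>2 / 2 - (norm (u0 - U0))\<^sup>2 / 2 \<le> inner (xi t) (w t - (u0 - U0))"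
      by (rule AE_I2, rule impI) (rule hw)
    show "AE t in lborel. t \<in> {0<..<T} \<longrightarrow> (AE s in lborel. s \<in> {0<..<T} \<longrightarrow> (norm (w t))\<^sup>2 / 2 - (norm (w s))\<^sup>2 / 2 \<le> inner (xi t) (w t - w s))"
      by (rule AE_I2, rule impI, rule AE_I2, rule impI) (rule hw)
  qed measurable
  have H: "(norm (w t))\<^sup>2 \<le> (norm (u0 - U0))\<^sup>2 + 2 * conv ?k x t" if t: "t \<in> {0..T}" for t
  proof -
    have "(norm (w t))\<^sup>2 / 2 - (norm (u0 - U0))\<^sup>2 / 2 \<le> conv ?k x t"
    proof (rule AE_le_imp_le_on[OF _ T t])
      show "AE t in lborel. t \<in> {0<..<T} \<longrightarrow> (norm (w t))\<^sup>2 / 2 - (norm (u0 - U0))\<^sup>2 / 2 \<le> conv ?k x t"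
        using chain by (simp only: x_def[abs_def])
      show "continuous_on {0..T} (\<lambda>t. (norm (w t))\<^sup>2 / 2 - (norm (u0 - U0))\<^sup>2 / 2)"
        by (intro continuous_intros contw) simp
      show "continuous_on {0..T} (conv ?k x)" by (rule xcont(1)) simp_all
    qed
    then show ?thesis by simp
  qed
  define M where "M = mittag_leffler \<alpha> (2 * L * T powr \<alpha>)"
  have M1: "1 \<le> M" unfolding M_def by (rule mittag_leffler_ge_1[OF \<alpha>(1)]) (use L in simp)
  define NE where "NE = Lp_frac_enorm \<alpha> T 1 (\<lambda>t. e2ennreal \<bar>estimator \<alpha> T N P \<Phi> \<Psi> f U t\<bar>)"
  define NF where "NF = Lp_frac_norm \<alpha> T 1 (\<lambda>t. f t - pc_interpolant N P (cell_average P f) t)"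
  define NU where "NU = Lp_frac_norm \<alpha> T 1 (\<lambda>t. pc_interpolant N P U t - frac_interpolant \<alpha> N P U t)"
  have main: "total_error \<alpha> T N P \<Phi> U v \<le>
      ennpowr (ennreal ((norm (u0 - U0))\<^sup>2) + ennreal (2 / Gamma \<alpha>) * NE) (1 / 2) * ennpowr (ennreal M) (1 / 2)
      + ennreal (2 / Gamma \<alpha>) * (NF + ennreal L * NU) * ennreal M"
  proof (cases "NE = \<infinity> \<or> NF = \<infinity> \<or> NU = \<infinity>")
    case True
    \<comment> \<open>In extended arithmetic 0 * \<infinity> = 0, so the coefficients, among them L,
      are checked to be nonzero before an infinite norm makes the right side infinite.\<close>
    have nz: "ennpowr (ennreal M) (1 / 2) \<noteq> 0" "ennreal M \<noteq> 0" "ennreal (2 / Gamma \<alpha>) \<noteq> 0" "ennreal L \<noteq> 0"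
      using M1 G assms(8) by (simp_all add: ennpowr_half ennreal_eq_0_iff)
    have "ennpowr \<infinity> (1 / 2) = \<infinity>" by (simp add: ennpowr_def)
    with True nz have inf: "ennpowr (ennreal ((norm (u0 - U0))\<^sup>2) + ennreal (2 / Gamma \<alpha>) * NE) (1 / 2) * ennpowr (ennreal M) (1 / 2)
      + ennreal (2 / Gamma \<alpha>) * (NF + ennreal L * NU) * ennreal M = \<infinity>"
      by (auto simp: ennreal_mult_top ennreal_top_mult)
    show ?thesis unfolding inf by simp
  next
    case False
    then obtain E' F' U' where fin: "NE = ennreal E'" "0 \<le> E'" "NF = ennreal F'" "0 \<le> F'" "NU = ennreal U'" "0 \<le> U'"
      by (cases NE; cases NF; cases NU) auto
    \<comment> \<open>A Borel version of the estimator, whose Caputo derivative is known only almost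
      everywhere.\<close>
    define est where "est t = ereal (inner (V1 t + \<Psi> (Us t) - Fs t) (Uh t - Us t)) + \<Phi> (Uh t) - \<Phi> (Us t)" for t
    have [measurable]: "est \<in> borel_measurable borel" unfolding est_def[abs_def] by measurable
    have estAE: "AE t in lborel. t \<in> {0<..<T} \<longrightarrow> estimator \<alpha> T N P \<Phi> \<Psi> f U t = est t"
      using cd
    proof eventually_elim
      case (elim t)
      show ?case
      proof
        assume t: "t \<in> {0<..<T}"
        then have t': "0 < t" "t \<le> T" "t \<in> {0..T}" by auto
        have "caputo_deriv \<alpha> T Uf (Uf 0) t = V1 t" using elim t Vd[OF t'(1,2)] by (simp add: V1_def)
        then show "estimator \<alpha> T N P \<Phi> \<Psi> f U t = est t"
          unfolding estimator_def Let_def est_def Uf_def[symmetric] Ud[OF t'(1,2)] Fd[OF t'(1,2)] Uf[OF t'(3)] by simp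
      qed
    qed
    define n where "n s = (if s \<in> {0<..<T} then e2ennreal \<bar>est s\<bar> else 0)" for s
    have [measurable]: "n \<in> borel_measurable borel" unfolding n_def[abs_def] by measurable
    have cn: "causal n" by (simp add: causal_def n_def)
    have nle: "ennreal (Gamma \<alpha>) * nconv ?l n t \<le> ennreal E'" if t: "t \<in> {0..T}" for t
    proof -
      have "ennreal (Gamma \<alpha>) * nconv ?l n t \<le> (\<integral>\<^sup>+s\<in>{0..t}. (ennreal ((t - s) powr (\<alpha> - 1)) * e2ennreal \<bar>estimator \<alpha> T N P \<Phi> \<Psi> f U s\<bar>) \<partial>lebesgue)"
        by (rule nn_set_integral_frac_kernel_ge[OF \<alpha>(1) _ cn])
           (use estAE t in \<open>auto simp: n_def elim!: eventually_mono\<close>)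
      also have "\<dots> \<le> NE" unfolding NE_def by (rule nn_set_integral_le_Lp_frac_enorm[OF t])
      finally show ?thesis by (simp add: fin)
    qed
    \<comment> \<open>Nothing so far places the interpolant \<open>Uh\<close> in the effective
      domain. The residual norm is finite and, at t = T, the kernel is positive on all of (0,T);
      hence the residual, and with it \<Phi> (Uh s), is finite for almost every s.\<close>
    have nfin: "AE s in lborel. s \<in> {0<..<T} \<longrightarrow> \<bar>est s\<bar> \<noteq> \<infinity>"
    proof -
      have "nconv ?l n T \<le> ennreal (E' / Gamma \<alpha>)" by (rule ennreal_le_divideI[OF G nle]) (use T in simp)
      then have "(\<integral>\<^sup>+s. ?l (T - s) * n s \<partial>lborel) \<noteq> \<infinity>" unfolding nconv_def by (auto simp: top_unique)
      then have "AE s in lborel. ?l (T - s) * n s \<noteq> \<infinity>" by (intro nn_integral_noteq_infinite) simp_all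
      then show ?thesis
      proof eventually_elim
        case (elim s)
        show ?case
        proof (intro impI notI)
          assume s: "s \<in> {0<..<T}" and i: "\<bar>est s\<bar> = \<infinity>"
          have "0 < ?k (T - s)" using s G by (simp add: frac_kernel_def)
          then have "?l (T - s) * n s = \<infinity>" using s i by (simp add: n_def ennreal_mult_top ennreal_eq_0_iff)
          then show False using elim by simp
        qed
      qed
    qed
    define ep where "ep s = enn2real (n s)" for s
    have [measurable]: "ep \<in> borel_measurable borel" unfolding ep_def[abs_def] by measurable
    have epn: "ennreal (ep s) \<le> n s" for s by (cases "n s") (simp_all add: ep_def)
    define A where "A s = (if s \<in> {0<..<T} then norm (fb s - Fs s) + L * norm (Us s - Uh s) else 0)" for s
    have [measurable]: "A \<in> borel_measurable borel" unfolding A_def[abs_def] by measurable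
    have A0: "0 \<le> A s" for s using L by (simp add: A_def)
    \<comment> \<open>The weighted norms lack the factor 1 / Gamma(\<alpha>) that the kernel
      carries, so these quotients are the bounds for the convolutions.\<close>
    define E1 where "E1 = E' / Gamma \<alpha>"
    define A1 where "A1 = (F' + L * U') / Gamma \<alpha>"
    have E10: "0 \<le> E1" and A10: "0 \<le> A1" using fin L G by (simp_all add: E1_def A1_def)
    have NEle: "nconv ?l (\<lambda>s. ennreal (ep s)) t \<le> ennreal E1" if t: "t \<in> {0..T}" for t
    proof -
      have "nconv ?l (\<lambda>s. ennreal (ep s)) t \<le> nconv ?l n t" by (rule nconv_mono[OF epn cl])
      also have "\<dots> \<le> ennreal E1" unfolding E1_def by (rule ennreal_le_divideI[OF G nle[OF t]])
      finally show ?thesis .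
    qed
    have NAle: "nconv ?l (\<lambda>s. ennreal (A s)) t \<le> ennreal A1" if t: "t \<in> {0..T}" for t
    proof -
      define n1 where "n1 s = (if s \<in> {0<..<T} then ennreal (norm (fb s - Fs s)) else 0)" for s
      define n2 where "n2 s = (if s \<in> {0<..<T} then ennreal (norm (Us s - Uh s)) else 0)" for s
      have [measurable]: "n1 \<in> borel_measurable borel" "n2 \<in> borel_measurable borel"
        unfolding n1_def[abs_def] n2_def[abs_def] by measurable
      have "ennreal (Gamma \<alpha>) * nconv ?l n1 t \<le> (\<integral>\<^sup>+s\<in>{0..t}. (ennreal ((t - s) powr (\<alpha> - 1)) * ennreal (norm (f s - pc_interpolant N P (cell_average P f) s))) \<partial>lebesgue)"
      proof (rule nn_set_integral_frac_kernel_ge[OF \<alpha>(1)])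
        show "causal n1" by (simp add: causal_def n1_def)
        show "AE s in lborel. s \<in> {0<..<t} \<longrightarrow> n1 s \<le> ennreal (norm (f s - pc_interpolant N P (cell_average P f) s))"
          using fb(2) by eventually_elim (use t Fd in \<open>auto simp: n1_def\<close>)
      qed simp
      also have "\<dots> \<le> NF" unfolding NF_def Lp_frac_norm_def by (rule nn_set_integral_le_Lp_frac_enorm[OF t])
      finally have b1: "ennreal (Gamma \<alpha>) * nconv ?l n1 t \<le> ennreal F'" by (simp add: fin)
      have "ennreal (Gamma \<alpha>) * nconv ?l n2 t \<le> (\<integral>\<^sup>+s\<in>{0..t}. (ennreal ((t - s) powr (\<alpha> - 1)) * ennreal (norm (pc_interpolant N P U s - frac_interpolant \<alpha> N P U s))) \<partial>lebesgue)"
      proof (rule nn_set_integral_frac_kernel_ge[OF \<alpha>(1)])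
        show "causal n2" by (simp add: causal_def n2_def)
        show "AE s in lborel. s \<in> {0<..<t} \<longrightarrow> n2 s \<le> ennreal (norm (pc_interpolant N P U s - frac_interpolant \<alpha> N P U s))"
          by (rule AE_I2) (use t Ud Uhat in \<open>auto simp: n2_def\<close>)
      qed simp
      also have "\<dots> \<le> NU" unfolding NU_def Lp_frac_norm_def by (rule nn_set_integral_le_Lp_frac_enorm[OF t])
      finally have b2: "ennreal (Gamma \<alpha>) * nconv ?l n2 t \<le> ennreal U'" by (simp add: fin)
      have An: "ennreal (A s) = n1 s + ennreal L * n2 s" for s
        using L by (simp add: A_def n1_def n2_def ennreal_plus ennreal_mult)
      have "nconv ?l (\<lambda>s. ennreal (A s)) t = nconv ?l n1 t + nconv ?l (\<lambda>s. ennreal L * n2 s) t"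
        unfolding An by (rule nconv_add) measurable
      also have "nconv ?l (\<lambda>s. ennreal L * n2 s) t = ennreal L * nconv ?l n2 t" by (rule nconv_cmult) measurable
      also have "nconv ?l n1 t + ennreal L * nconv ?l n2 t \<le> ennreal (F' / Gamma \<alpha>) + ennreal L * ennreal (U' / Gamma \<alpha>)"
        by (intro add_mono mult_left_mono ennreal_le_divideI[OF G b1] ennreal_le_divideI[OF G b2]) simp
      also have "ennreal L * ennreal (U' / Gamma \<alpha>) = ennreal (L * (U' / Gamma \<alpha>))"
        by (rule ennreal_mult[symmetric]) (use L fin G in auto)
      also have "ennreal (F' / Gamma \<alpha>) + ennreal (L * (U' / Gamma \<alpha>)) = ennreal (F' / Gamma \<alpha> + L * (U' / Gamma \<alpha>))"
        by (rule ennreal_plus[symmetric]) (use L fin G in auto)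
      finally show ?thesis by (simp add: A1_def add_divide_distrib)
    qed
    \<comment> \<open>Wherever the pointwise estimate holds the bracket is nonnegative and the
      maximum changes nothing; it keeps q nonnegative on the exceptional null set.\<close>
    define q where "q s = (if s \<in> {0<..<T} then max 0 (A s * norm (w s) + L * (norm (w s))\<^sup>2 + ep s - x s) else 0)" for s
    have [measurable]: "q \<in> borel_measurable borel" unfolding q_def[abs_def] by measurable
    have q0: "0 \<le> q s" for s by (simp add: q_def)
    have qz: "q s = 0" if "s \<notin> {0<..<T}" for s unfolding q_def using that by (rule if_not_P)
    have point: "AE s in lborel. s \<in> {0<..<T} \<longrightarrow>
        e2ennreal (coercivity_modulus \<Phi> (v s) (Uf s) + coercivity_modulus \<Phi> (pc_interpolant N P U s) (v s)) \<le> ennreal (q s)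
        \<and> q s + x s = A s * norm (w s) + L * (norm (w s))\<^sup>2 + ep s"
      using inc nfin fb(2)
    proof eventually_elim
      case (elim s)
      show ?case
      proof
        assume s: "s \<in> {0<..<T}"
        then have s': "0 < s" "s \<le> T" "s \<in> {0..T}" by auto
        obtain \<xi> where \<xi>: "\<xi> \<in> subdiff \<Phi> (v s)" "g s + \<xi> + \<Psi> (v s) = fb s"
          using elim s by (auto simp: v_def)
        obtain a where a: "\<Phi> (v s) = ereal a" by (rule subdiff_finite[OF assms(6,7) \<xi>(1)])
        obtain c where c: "\<Phi> (Us s) = ereal c" by (rule subdiff_finite[OF assms(6,7) zeta[OF s]])
        have ef: "\<bar>est s\<bar> \<noteq> \<infinity>" using elim s by simp
        obtain b where b: "\<Phi> (Uh s) = ereal b"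
          using ef c c0[of "Uh s"] by (cases "\<Phi> (Uh s)") (simp_all add: est_def)
        let ?r = "inner (V1 s + \<Psi> (Us s) - Fs s) (Uh s - Us s) + b - c"
        have es: "est s = ereal ?r" by (simp add: est_def b c)
        have eps: "ep s = \<bar>?r\<bar>" using s by (simp add: ep_def n_def es)
        have ws: "w s = v s - Uh s" by (rule wv[OF s'(3)])
        have xs: "x s = inner (v s - Uh s) (g s - V1 s)" using s by (simp add: x_def xi_def ws h_def)
        let ?Q = "(norm (fb s - Fs s) + L * norm (Us s - Uh s)) * norm (v s - Uh s) + L * (norm (v s - Uh s))\<^sup>2 + \<bar>?r\<bar> - inner (v s - Uh s) (g s - V1 s)"
        have Q: "e2ennreal (coercivity_modulus \<Phi> (v s) (Uh s) + coercivity_modulus \<Phi> (Us s) (v s)) \<le> ennreal ?Q" "0 \<le> ?Q"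
          by (rule coercivity_moduli_le[OF \<xi>(1) zeta[OF s] a b c \<xi>(2) assms(9)])+
        have AQ: "A s * norm (w s) + L * (norm (w s))\<^sup>2 + ep s - x s = ?Q"
          using s by (simp add: A_def ws eps xs)
        have qQ: "q s = ?Q" unfolding q_def AQ using s Q(2) by (simp only: if_True max_absorb2)
        show "e2ennreal (coercivity_modulus \<Phi> (v s) (Uf s) + coercivity_modulus \<Phi> (pc_interpolant N P U s) (v s)) \<le> ennreal (q s)
          \<and> q s + x s = A s * norm (w s) + L * (norm (w s))\<^sup>2 + ep s"
          unfolding Uf[OF s'(3)] Ud[OF s'(1,2)] qQ using Q(1) AQ by simp
      qed
    qed
    \<comment> \<open>Pulling sqrt(M) out of the root gives the first summand of the claimed bound,
      and 2 A1 M is the second.\<close>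
    define R where "R = sqrt (((norm (u0 - U0))\<^sup>2 + 2 * E1) * M) + 2 * A1 * M"
    have R0: "0 \<le> R" using E10 A10 M1 by (simp add: R_def)
    have bound: "ennreal ((norm (w t))\<^sup>2) + ennreal 2 * nconv ?l (\<lambda>s. ennreal (q s)) t \<le> ennreal (R\<^sup>2)" if t: "t \<in> {0..T}" for t
      unfolding R_def M_def
    proof (rule frac_quadratic_gronwall[OF \<alpha>(1) T L _ E10 A10 _ _ _ _ _ contw A0 _ q0 xz qz _ NEle NAle _ H t])
      show "0 \<le> ep s" for s by (simp add: ep_def)
      show "AE s in lborel. s \<in> {0<..<T} \<longrightarrow> q s + x s = A s * norm (w s) + L * (norm (w s))\<^sup>2 + ep s"
        using point by eventually_elim simp
      show "nconv ?l (enorm x) t < \<infinity>" if "t \<in> {0..T}" for t by (rule xcont(2)[OF _ _ that]) simp_all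
    qed simp_all
    have err: "(error_H \<alpha> N P U v t)\<^sup>2 + (error_sigma \<alpha> N P \<Phi> U v t)\<^sup>2 \<le> ennreal (R\<^sup>2)" if t: "t \<in> {0..T}" for t
    proof -
      have "(error_H \<alpha> N P U v t)\<^sup>2 = ennreal ((norm (w t))\<^sup>2)"
        unfolding error_H_def Uhat[OF t] wv[OF t] by (simp add: ennreal_power)
      moreover have "(error_sigma \<alpha> N P \<Phi> U v t)\<^sup>2 \<le> ennreal 2 * nconv ?l (\<lambda>s. ennreal (q s)) t"
      proof -
        have "(\<integral>\<^sup>+ s\<in>{0..t}. (ennreal ((t - s) powr (\<alpha> - 1)) * e2ennreal (coercivity_modulus \<Phi> (v s) (frac_interpolant \<alpha> N P U s)
            + coercivity_modulus \<Phi> (pc_interpolant N P U s) (v s))) \<partial>lebesgue) \<le> ennreal (Gamma \<alpha>) * nconv ?l (\<lambda>s. ennreal (q s)) t"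
          unfolding Uf_def[symmetric]
        proof (rule nn_set_integral_frac_kernel_le[OF \<alpha>(1)])
          show "AE s in lborel. s \<in> {0<..<t} \<longrightarrow> e2ennreal (coercivity_modulus \<Phi> (v s) (Uf s)
              + coercivity_modulus \<Phi> (pc_interpolant N P U s) (v s)) \<le> ennreal (q s)"
            using point by eventually_elim (use t in auto)
        qed simp
        then have "(error_sigma \<alpha> N P \<Phi> U v t)\<^sup>2 \<le> ennreal (2 / Gamma \<alpha>) * (ennreal (Gamma \<alpha>) * nconv ?l (\<lambda>s. ennreal (q s)) t)"
          unfolding error_sigma_def ennpowr_half_square by (intro mult_left_mono) simp_all
        also have "\<dots> = ennreal 2 * nconv ?l (\<lambda>s. ennreal (q s)) t"
        proof -
          have "ennreal (2 / Gamma \<alpha>) * ennreal (Gamma \<alpha>) = ennreal (2 / Gamma \<alpha> * Gamma \<alpha>)"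
            by (rule ennreal_mult[symmetric]) (use G in auto)
          then show ?thesis using G by (simp add: mult.assoc[symmetric])
        qed
        finally show ?thesis .
      qed
      ultimately show ?thesis using bound[OF t] by (metis add_left_mono order_trans)
    qed
    have "total_error \<alpha> T N P \<Phi> U v \<le> ennpowr (ennreal (R\<^sup>2)) (1 / 2)"
      unfolding total_error_def by (intro ennpowr_mono SUP_least err) simp_all
    also have "\<dots> = ennreal R" using R0 by (simp add: ennpowr_half)
    also have "\<dots> = ennpowr (ennreal ((norm (u0 - U0))\<^sup>2) + ennreal (2 / Gamma \<alpha>) * NE) (1 / 2) * ennpowr (ennreal M) (1 / 2)
      + ennreal (2 / Gamma \<alpha>) * (NF + ennreal L * NU) * ennreal M"
    proof -
      have m1: "ennreal (2 / Gamma \<alpha>) * ennreal E' = ennreal (2 * E1)"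
        using G fin by (simp add: ennreal_mult[symmetric] E1_def)
      have "ennreal ((norm (u0 - U0))\<^sup>2) + ennreal (2 * E1) = ennreal ((norm (u0 - U0))\<^sup>2 + 2 * E1)"
        by (rule ennreal_plus[symmetric]) (use E10 in auto)
      then have p1: "ennpowr (ennreal ((norm (u0 - U0))\<^sup>2) + ennreal (2 / Gamma \<alpha>) * NE) (1 / 2) = ennreal (sqrt ((norm (u0 - U0))\<^sup>2 + 2 * E1))"
        unfolding fin(1) m1 using E10 by (simp only:) (rule ennpowr_half, simp)
      have p2: "ennpowr (ennreal M) (1 / 2) = ennreal (sqrt M)" using M1 by (simp add: ennpowr_half)
      have "ennreal L * ennreal U' = ennreal (L * U')" by (rule ennreal_mult[symmetric]) (use L fin in auto)
      moreover have "ennreal F' + ennreal (L * U') = ennreal (F' + L * U')" by (rule ennreal_plus[symmetric]) (use L fin in auto)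
      ultimately have p3: "NF + ennreal L * NU = ennreal (F' + L * U')" by (simp only: fin)
      have "ennreal (2 / Gamma \<alpha>) * ennreal (F' + L * U') = ennreal (2 / Gamma \<alpha> * (F' + L * U'))"
        by (rule ennreal_mult[symmetric]) (use G L fin in auto)
      moreover have "ennreal (2 / Gamma \<alpha> * (F' + L * U')) * ennreal M = ennreal (2 / Gamma \<alpha> * (F' + L * U') * M)"
        by (rule ennreal_mult[symmetric]) (use G L fin M1 in auto)
      ultimately have p4: "ennreal (2 / Gamma \<alpha>) * (NF + ennreal L * NU) * ennreal M = ennreal (2 * A1 * M)"
        unfolding p3 by (simp add: A1_def)
      have "ennreal (sqrt ((norm (u0 - U0))\<^sup>2 + 2 * E1)) * ennreal (sqrt M) = ennreal (sqrt ((norm (u0 - U0))\<^sup>2 + 2 * E1) * sqrt M)"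
        by (rule ennreal_mult[symmetric]) (use E10 M1 in auto)
      also have "sqrt ((norm (u0 - U0))\<^sup>2 + 2 * E1) * sqrt M = sqrt (((norm (u0 - U0))\<^sup>2 + 2 * E1) * M)"
        by (rule real_sqrt_mult[symmetric])
      finally have p5: "ennreal (sqrt ((norm (u0 - U0))\<^sup>2 + 2 * E1)) * ennreal (sqrt M) = ennreal (sqrt (((norm (u0 - U0))\<^sup>2 + 2 * E1) * M))" .
      show ?thesis unfolding p1 p2 p4 p5 R_def by (rule ennreal_plus) (use E10 A10 M1 in auto)
    qed
    finally show ?thesis .
  qed
  have vu': "AE t in lebesgue. t \<in> {0<..<T} \<longrightarrow> v t = u t"
    using vu unfolding v_def by (rule AE_completion)
  show ?thesis
    using contv v0 vu' main unfolding NE_def NF_def NU_def M_def by blast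
qed

end
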